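(* The eigenvalue counting function of the problem $$-i\varepsilon y''=(x-\lambda)y,\qquad x\in(-1,1),\qquad y(-1)=y(1)=0,$$ has, as $\varepsilon\to0+$, the form $$N(\lambda,\varepsilon)=\pm\frac{\varepsilon^{-1/2}}{\pi}\int_{\lambda}^{\pm1}e^{-i\pi/4}\sqrt{x-\lambda}\,dx+O(1)$$ for $\lambda$ on the segments $[\pm1,-\frac{i}{\sqrt3})$ (upper sign for the segment starting at $1$, lower sign for the segment starting at $-1$), and $$N(\lambda,\varepsilon)=\frac{\varepsilon^{-1/2}}{\pi}\int_{-1}^{1}e^{-i\pi/4}\sqrt{x-\lambda}\,dx+O(1)$$ for $\lambda$ on the ray $(-\frac{i}{\sqrt3},-i\infty)$.
   Context: $\lambda\in\mathbb C$ is the spectral parameter, $\varepsilon>0$ a small parameter. Let $$T=\left[-1,-\tfrac{i}{\sqrt3}\right)\cup\left[1,-\tfrac{i}{\sqrt3}\right)\cup\left(-\tfrac{i}{\sqrt3},-i\infty\right),$$ where $[a,b)$ denotes the straight segment in $\mathbb C$ from $a$ (included) to $b$ (excluded). A function $N(\lambda,\varepsilon)$ defined for $\lambda\in T$ is called the eigenvalue counting (distribution) function if for all $\lambda_1,\lambda_2$ belonging to the same connected component of $T$ (the node $-\frac{i}{\sqrt3}$ is excluded) the number of eigenvalues on the segment $[\lambda_1,\lambda_2]$ (or in a thin rectangle around it, two opposite sides of which pass through $\lambda_1$ and $\lambda_2$) equals $|N(\lambda_2,\varepsilon)-N(\lambda_1,\varepsilon)|$; it is thus determined up to an additive constant on each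 component. The square root is the principal branch; in the first formula the integral is taken along the straight segment from $\lambda$ to $\pm1$. With this branch $\pm\int_\lambda^{\pm1}e^{-i\pi/4}\sqrt{x-\lambda}\,dx=\frac23|\pm1-\lambda|^{3/2}$ on the segments, and the second integral is positive on the ray. *)

theory Defs
  imports "HOL-Complex_Analysis.Complex_Analysis"
begin

text \<open>
  The spectral problem \<open>- \<i> \<epsilon> y'' = (x - \<lambda>) y\<close> on \<open>(-1, 1)\<close> with \<open>y (-1) = y 1 = 0\<close>,
  for classical complex-valued solutions.  The spectral parameter is written \<open>z\<close>, since
  \<open>\<lambda>\<close> is reserved.
\<close>

definition is_eigenvalue :: "real \<Rightarrow> complex \<Rightarrow> bool" where
  "is_eigenvalue \<epsilon> z \<longleftrightarrow>
     (\<exists>y y' y'' :: real \<Rightarrow> complex.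
        continuous_on {-1..1} y \<and>
        (\<forall>x\<in>{-1<..<1}.
           (y has_vector_derivative y' x) (at x) \<and>
           (y' has_vector_derivative y'' x) (at x) \<and>
           - \<i> * complex_of_real \<epsilon> * y'' x = (complex_of_real x - z) * y x) \<and>
        y (-1) = 0 \<and> y 1 = 0 \<and>
        (\<exists>x\<in>{-1<..<1}. y x \<noteq> 0))"

definition node :: complex where
  "node = - \<i> / complex_of_real (sqrt 3)"

definition half_open_segment :: "complex \<Rightarrow> complex \<Rightarrow> complex set" where
  "half_open_segment a b = closed_segment a b - {b}"

definition node_ray :: "complex set" where
  "node_ray = {node - \<i> * complex_of_real t | t. t > 0}"

definition T_set :: "complex set" where
  "T_set = half_open_segment (-1) node \<union> half_open_segment 1 node \<union> node_ray"

text \<open>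
  The rectangle of half-width \<open>\<delta>\<close> around \<open>[z1, z2]\<close> having two opposite sides through \<open>z1\<close>
  and \<open>z2\<close>.  The side through \<open>z1\<close> is left out: with both sides included, an eigenvalue on
  a side shared by two adjacent rectangles would be counted twice, and no function could
  have the counts as its increments.
\<close>

definition thin_rectangle :: "real \<Rightarrow> complex \<Rightarrow> complex \<Rightarrow> complex set" where
  "thin_rectangle \<delta> z1 z2 =
     {z1 + complex_of_real t * (z2 - z1) + complex_of_real s * \<i> * sgn (z2 - z1) | t s.
        0 < t \<and> t \<le> 1 \<and> \<bar>s\<bar> \<le> \<delta>}"

text \<open>
  The imaginary part decreases strictly along each component of \<^term>\<open>T_set\<close>, from \<open>1\<close> or
  \<open>-1\<close> towards the node and from the node towards \<open>- \<i> \<infinity>\<close>.  Hence \<open>Im z2 < Im z1\<close> only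
  orders two distinct points of a component, so as to fix which side is left out.
\<close>

definition is_counting_function :: "real \<Rightarrow> real \<Rightarrow> (complex \<Rightarrow> real) \<Rightarrow> bool" where
  "is_counting_function \<epsilon> \<delta> N \<longleftrightarrow>
     (\<forall>z1 z2. connected_component T_set z1 z2 \<and> Im z2 < Im z1 \<longrightarrow>
        finite {z \<in> thin_rectangle \<delta> z1 z2. is_eigenvalue \<epsilon> z} \<and>
        real (card {z \<in> thin_rectangle \<delta> z1 z2. is_eigenvalue \<epsilon> z}) = \<bar>N z2 - N z1\<bar>)"

end

theory Submission
  imports Defs "HOL-Real_Asymp.Real_Asymp"
begin

text \<open>
  With \<open>p = \<i> \<lambda>\<close> and \<open>\<epsilon> = k\<^sup>-\<^sup>6\<close>, an Airy function \<open>A\<close> given by a contour integral and its rotation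
  \<open>A (\<omega> \<cdot>)\<close>, \<open>\<omega> = exp (2 \<pi> \<i> / 3)\<close>, form a fundamental system, so the eigenvalues are the zeros of the
  entire Evans function \<open>U (p - \<i>) V (p + \<i>) - U (p + \<i>) V (p - \<i>)\<close> of \<open>U z = A (k\<^sup>2 z)\<close> and
  \<open>V z = A (\<omega> k\<^sup>2 z)\<close>, all of them in the half-strip \<open>Re p > 0\<close>, \<open>\<bar>Im p\<bar> < 1\<close>.  Away from \<open>\<plusminus> \<i>\<close>
  the Airy asymptotics turn it into a sum of three exponentials of \<open>k\<^sup>3\<close> times combinations of \<open>2 / 3 (p \<plusminus> \<i>)\<^sup>3\<^sup>/\<^sup>2\<close>, with amplitudes close to \<open>1\<close>.  Zeros occur only where two of
  these balance: on the images of the ray and of the two segments, where the equation reads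
  \<open>exp (2 \<i> X) = c (1 + \<eta>)\<close> with small \<open>\<eta>\<close> and has exactly one solution near each root of the
  unperturbed equation.  Counting those roots gives the integrals.  Near the node and near the ends
  \<open>\<plusminus> \<i>\<close> the asymptotics are not uniform, but a Jensen-type estimate bounds the number of zeros there
  by a constant.  Eigenvalues with \<open>Im p < 0\<close> are obtained by the symmetry \<open>p \<mapsto> cnj p\<close>.
\<close>

subsection \<open>Airy functions\<close>

text \<open>With \<open>1 / k ^ 6\<close> for the small parameter the Airy scale is
  \<open>k ^ 2\<close> and the exponentials have the large parameter \<open>k ^ 3\<close>, its power
  -1/2. The obstacle is uniformity: an error O(1) has to hold on the whole unbounded ray and on the
  segments up to the node and the ends, so limits at a fixed spectral parameter do not help and
  every estimate carries explicit constants. Two scales govern them: a root of the unperturbed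
  equation is isolated in a disc whose radius is the reciprocal of the slope of the phase, and
  distances from the node are measured in units of \<open>1 / k ^ 3\<close>. Counting works in both
  directions, from a root to a zero and from a zero to a root; the second direction starts with
  wider margins, so that the root it produces satisfies the assumptions of the first. One constant
  serves all widths \<delta>. Beyond a distance \<open>20 / k ^ 3\<close> from the node, uniqueness
  and the symmetry force the zeros to lie exactly on the ray, and the zeros constructed along a
  segment are within \<open>1 / k ^ 2\<close> of it; \<delta> thus enters only through a threshold
  for k.\<close>

definition airy_kernel :: "complex \<Rightarrow> complex \<Rightarrow> complex" where
  "airy_kernel z w = exp (\<i> * (w ^ 3 / 3 + z * w))"

text \<open>On the line of imaginary part 1 the kernel decays like a Gaussian, whereas on the real
  axis it has modulus 1 for real z. The limit of these integrals is 2 pi times the classical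
  function Ai.\<close>

definition airy_trunc :: "nat \<Rightarrow> complex \<Rightarrow> complex" where
  "airy_trunc n z = integral {- real n..real n} (\<lambda>t. airy_kernel z (of_real t + \<i>))"

definition airy :: "complex \<Rightarrow> complex" where
  "airy z = lim (\<lambda>n. airy_trunc n z)"

lemma continuous_on_airy_kernel [continuous_intros]:
  assumes "continuous_on S f" "continuous_on S g"
  shows "continuous_on S (\<lambda>x. airy_kernel (f x) (g x))"
  unfolding airy_kernel_def using assms by (intro continuous_intros) auto

lemma norm_airy_kernel_le:
  assumes "norm z \<le> B"
  shows "norm (airy_kernel z (of_real t + \<i>)) \<le> exp (1/3 + B + (B + 1)\<^sup>2 / 4) * exp (- \<bar>t\<bar>)"
proof -
  have w3: "(complex_of_real t + \<i>) ^ 3 = Complex (t ^ 3 - 3 * t) (3 * t\<^sup>2 - 1)"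
    by (simp add: complex_eq_iff power3_eq_cube power2_eq_square algebra_simps)
  have "Re (\<i> * ((of_real t + \<i>) ^ 3 / 3 + z * (of_real t + \<i>))) =
        1/3 - t\<^sup>2 - (Im z * t + Re z)"
    unfolding w3 by (simp add: field_simps)
  also have "\<dots> \<le> 1/3 + B + (B + 1)\<^sup>2 / 4 - \<bar>t\<bar>"
  proof -
    have "- (Im z * t) \<le> B * \<bar>t\<bar>"
    proof -
      have "- (Im z * t) \<le> \<bar>Im z\<bar> * \<bar>t\<bar>" by (metis abs_ge_minus_self abs_mult)
      also have "\<dots> \<le> B * \<bar>t\<bar>"
        using abs_Im_le_cmod[of z] assms by (intro mult_right_mono) linarith+
      finally show ?thesis .
    qed
    moreover have "- Re z \<le> B" using abs_Re_le_cmod[of z] assms by linarith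
    \<comment> \<open>Completing the square weakens the Gaussian to
      \<open>exp (- \<bar>t\<bar>)\<close>, which makes the increments of \<open>airy_trunc\<close>
      a geometric series.\<close>
    moreover have "(B + 1) * \<bar>t\<bar> - t\<^sup>2 \<le> (B + 1)\<^sup>2 / 4"
    proof -
      have "0 \<le> (\<bar>t\<bar> - (B + 1) / 2)\<^sup>2" by simp
      also have "\<dots> = t\<^sup>2 - (B + 1) * \<bar>t\<bar> + (B + 1)\<^sup>2 / 4"
        by (simp add: power2_diff power_divide)
      finally show ?thesis by linarith
    qed
    ultimately show ?thesis by (simp add: ring_distribs)
  qed
  finally show ?thesis
    unfolding airy_kernel_def norm_exp_eq_Re by (simp only: mult_exp_exp exp_le_cancel_iff add_uminus_conv_diff)
qed

lemma airy_trunc_Suc_bound: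
  assumes "norm z \<le> B"
  shows "norm (airy_trunc (Suc n) z - airy_trunc n z)
           \<le> 2 * exp (1/3 + B + (B + 1)\<^sup>2 / 4) * exp (- 1) ^ n"
proof -
  let ?K = "\<lambda>t::real. airy_kernel z (of_real t + \<i>)"
  let ?M = "exp (1/3 + B + (B + 1)\<^sup>2 / 4)"
  have int: "?K integrable_on {a..b}" for a b
    by (intro integrable_continuous_real continuous_intros)
  have "airy_trunc (Suc n) z =
      integral {-real (Suc n)..-real n} ?K + integral {-real n..real n} ?K
        + integral {real n..real (Suc n)} ?K"
    unfolding airy_trunc_def
    using Henstock_Kurzweil_Integration.integral_combine[of "- real (Suc n)" "- real n" "real n" ?K]
      Henstock_Kurzweil_Integration.integral_combine[of "- real (Suc n)" "real n" "real (Suc n)" ?K] int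
    by simp
  hence "airy_trunc (Suc n) z - airy_trunc n z =
      integral {-real (Suc n)..-real n} ?K + integral {real n..real (Suc n)} ?K"
    by (simp add: airy_trunc_def)
  also have "norm \<dots> \<le> ?M * exp (- real n) + ?M * exp (- real n)"
  proof (rule order.trans[OF norm_triangle_ineq add_mono])
    have *: "norm (?K t) \<le> ?M * exp (- real n)" if "real n \<le> \<bar>t\<bar>" for t
      using norm_airy_kernel_le[OF assms, of t] that by (smt (verit) exp_less_cancel_iff exp_gt_zero mult_le_cancel_left_pos)
    show "norm (integral {-real (Suc n)..-real n} ?K) \<le> ?M * exp (- real n)"
      using integral_bound[of "- real (Suc n)" "- real n" ?K "?M * exp (- real n)"]
      by (force intro!: * continuous_intros)
    show "norm (integral {real n..real (Suc n)} ?K) \<le> ?M * exp (- real n)"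
      using integral_bound[of "real n" "real (Suc n)" ?K "?M * exp (- real n)"]
      by (force intro!: * continuous_intros)
  qed
  also have "exp (- real n) = exp (- 1) ^ n"
    using exp_of_nat_mult[of n "- 1::real"] by (simp add: mult.commute)
  finally show ?thesis by (simp add: mult_ac)
qed

lemma airy_uniform_limit: "uniform_limit (cball 0 B) airy_trunc airy sequentially"
proof -
  let ?M = "2 * exp (1/3 + B + (B + 1)\<^sup>2 / 4)"
  have "uniform_limit (cball 0 B) (\<lambda>n z. \<Sum>i<n. airy_trunc (Suc i) z - airy_trunc i z)
          (\<lambda>z. \<Sum>i. airy_trunc (Suc i) z - airy_trunc i z) sequentially"
  proof (rule Weierstrass_m_test)
    show "summable (\<lambda>n. ?M * exp (- 1) ^ n)"
      by (intro summable_mult summable_geometric) simp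
  qed (use airy_trunc_Suc_bound in auto)
  moreover have "(\<Sum>i<n. airy_trunc (Suc i) z - airy_trunc i z) = airy_trunc n z" for n z
    by (subst sum_lessThan_telescope) (simp add: airy_trunc_def)
  ultimately have ul: "uniform_limit (cball 0 B) airy_trunc
      (\<lambda>z. \<Sum>i. airy_trunc (Suc i) z - airy_trunc i z) sequentially"
    by simp
  show ?thesis
  proof (rule uniform_limit_cong'[THEN iffD1, OF _ _ ul])
    fix z :: complex assume "z \<in> cball 0 B"
    from tendsto_uniform_limitI[OF ul this] 
    show "(\<Sum>i. airy_trunc (Suc i) z - airy_trunc i z) = airy z"
      unfolding airy_def by (simp add: limI)
  qed auto
qed

lemma airy_trunc_tendsto: "(\<lambda>n. airy_trunc n z) \<longlonglongrightarrow> airy z"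
  using tendsto_uniform_limitI[OF airy_uniform_limit[of "norm z"]] by simp

section \<open>Holomorphy, the Airy equation and uniqueness of its entire solutions\<close>

lemma airy_kernel_deriv [derivative_intros]:
  "((\<lambda>z. airy_kernel z w) has_field_derivative \<i> * w * airy_kernel z w) (at z within S)"
  "(airy_kernel z has_field_derivative \<i> * (w\<^sup>2 + z) * airy_kernel z w) (at w within S)"
  unfolding airy_kernel_def by (auto intro!: derivative_eq_intros simp: power2_eq_square)

text \<open>The weight c is carried along so that the lemma can be applied twice, the second time
  with the factor brought down by the first differentiation.\<close>

lemma integral_airy_kernel_deriv:
  fixes c :: "real \<Rightarrow> complex"
  assumes "continuous_on UNIV c"
  shows "((\<lambda>z. integral {a..b} (\<lambda>t. c t * airy_kernel z (of_real t + \<i>))) has_field_derivative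
     integral {a..b} (\<lambda>t. c t * (\<i> * (of_real t + \<i>)) * airy_kernel z (of_real t + \<i>))) (at z)"
proof -
  have c: "continuous_on S (\<lambda>x. c (f x))" if "continuous_on S f" for S :: "'a::topological_space set" and f
    using continuous_on_compose2[OF assms that] by auto
  note [continuous_intros] = c
  have "((\<lambda>z. integral (cbox a b) (\<lambda>t. c t * airy_kernel z (of_real t + \<i>))) has_field_derivative
     integral (cbox a b) (\<lambda>t. c t * (\<i> * (of_real t + \<i>)) * airy_kernel z (of_real t + \<i>))) (at z within UNIV)"
    by (rule leibniz_rule_field_derivative[where U=UNIV and
       fx="\<lambda>z t. c t * (\<i> * (of_real t + \<i>)) * airy_kernel z (of_real t + \<i>)"])
      (auto intro!: derivative_eq_intros integrable_continuous_real continuous_intros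
         continuous_on_subset[OF assms] simp: split_beta)
  thus ?thesis by simp
qed

lemma airy_trunc_deriv:
  "(airy_trunc n has_field_derivative
     integral {-real n..real n} (\<lambda>t. \<i> * (of_real t + \<i>) * airy_kernel z (of_real t + \<i>))) (at z)"
  using integral_airy_kernel_deriv[of "\<lambda>_. 1" "-real n" "real n" z]
  by (simp add: airy_trunc_def[abs_def])

lemma airy_trunc_deriv2:
  "(deriv ^^ 2) (airy_trunc n) z = 
     integral {-real n..real n} (\<lambda>t. - (of_real t + \<i>)\<^sup>2 * airy_kernel z (of_real t + \<i>))"
proof -
  have "deriv (airy_trunc n) =
     (\<lambda>z. integral {-real n..real n} (\<lambda>t. \<i> * (of_real t + \<i>) * airy_kernel z (of_real t + \<i>)))"
    by (rule ext, rule DERIV_imp_deriv, rule airy_trunc_deriv)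
  moreover have "deriv \<dots> z = integral {-real n..real n}
     (\<lambda>t. (\<i> * (of_real t + \<i>)) * (\<i> * (of_real t + \<i>)) * airy_kernel z (of_real t + \<i>))"
    by (rule DERIV_imp_deriv, rule integral_airy_kernel_deriv) (intro continuous_intros)
  moreover have "(\<i> * (of_real t + \<i>)) * (\<i> * (of_real t + \<i>)) = - (of_real t + \<i>)\<^sup>2" for t
    by (simp add: power2_eq_square algebra_simps)
  ultimately show ?thesis by (simp add: numeral_2_eq_2)
qed

lemma airy_trunc_holomorphic: "airy_trunc n holomorphic_on S"
proof -
  have "airy_trunc n holomorphic_on UNIV"
    using airy_trunc_deriv by (subst holomorphic_on_open) auto
  thus ?thesis by (rule holomorphic_on_subset) simp
qed

lemma airy_holomorphic: "airy holomorphic_on S"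
proof -
  have "airy holomorphic_on UNIV"
  proof (rule holomorphic_uniform_sequence[OF _ airy_trunc_holomorphic])
    fix x :: complex
    have "cball x 1 \<subseteq> cball 0 (norm x + 1)"
      by (simp add: cball_subset_cball_iff)
    thus "\<exists>d>0. cball x d \<subseteq> UNIV \<and> uniform_limit (cball x d) airy_trunc airy sequentially"
      using uniform_limit_on_subset[OF airy_uniform_limit] by (metis top_greatest zero_less_one)
  qed auto
  thus ?thesis using holomorphic_on_subset by blast
qed

text \<open>With \<open>w = t + \<i>\<close>, two differentiations bring down minus the square of w,
  and \<open>- (w ^ 2 + z)\<close> times the kernel is the w-derivative of \<open>\<i>\<close> times
  the kernel. The truncated integrals therefore satisfy the equation up to two boundary terms that
  decay exponentially, and locally uniform convergence carries second derivatives to the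
  limit.\<close>

lemma airy_ode: "(deriv ^^ 2) airy z = z * airy z"
proof -
  have "(\<lambda>n. (deriv ^^ 2) (airy_trunc n) z) \<longlonglongrightarrow> (deriv ^^ 2) airy z"
  proof (rule higher_deriv_complex_uniform_limit)
    show "uniform_limit (ball 0 (norm z + 1)) airy_trunc airy sequentially"
      using uniform_limit_on_subset[OF airy_uniform_limit ball_subset_cball] .
  qed (auto intro: airy_trunc_holomorphic always_eventually)
  hence "(\<lambda>n. (deriv ^^ 2) (airy_trunc n) z - z * airy_trunc n z) \<longlonglongrightarrow> (deriv ^^ 2) airy z - z * airy z"
    by (intro tendsto_intros airy_trunc_tendsto)
  moreover have "(\<lambda>n. (deriv ^^ 2) (airy_trunc n) z - z * airy_trunc n z) \<longlonglongrightarrow> 0"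
  proof (rule Lim_null_comparison)
    let ?K = "\<lambda>t::real. airy_kernel z (of_real t + \<i>)"
    let ?M = "exp (1/3 + norm z + (norm z + 1)\<^sup>2 / 4)"
    have eq: "(deriv ^^ 2) (airy_trunc n) z - z * airy_trunc n z = \<i> * ?K (real n) - \<i> * ?K (- real n)" for n
    proof -
      have "((\<lambda>t. - ((of_real t + \<i>)\<^sup>2 + z) * ?K t) has_integral (\<i> * ?K (real n) - \<i> * ?K (- real n))) {-real n..real n}"
      proof (rule fundamental_theorem_of_calculus)
        fix t assume "t \<in> {-real n..real n}"
        have "((\<lambda>w. \<i> * airy_kernel z (w + \<i>)) has_field_derivative
                 (- (((of_real t + \<i>)\<^sup>2 + z) * ?K t))) (at (of_real t))"
        proof -
          have "((\<lambda>w. airy_kernel z (w + \<i>)) has_field_derivative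
                 (\<i> * ((of_real t + \<i>)\<^sup>2 + z) * ?K t)) (at (of_real t))"
            using DERIV_shift[THEN iffD1, OF airy_kernel_deriv(2)[of z "of_real t + \<i>" UNIV]] by simp
          from DERIV_cmult[OF this, of \<i>] show ?thesis by (simp add: algebra_simps)
        qed
        from has_vector_derivative_real_field[OF this]
        show "((\<lambda>x. \<i> * ?K x) has_vector_derivative - ((of_real t + \<i>)\<^sup>2 + z) * ?K t) (at t within {-real n..real n})"
          by (simp only: minus_mult_left)
      qed simp
      hence "integral {-real n..real n} (\<lambda>t. - ((of_real t + \<i>)\<^sup>2 + z) * ?K t) = \<i> * ?K (real n) - \<i> * ?K (- real n)"
        by blast
      moreover have "integral {-real n..real n} (\<lambda>t. - ((of_real t + \<i>)\<^sup>2 + z) * ?K t) =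
         (deriv ^^ 2) (airy_trunc n) z - z * airy_trunc n z"
        unfolding airy_trunc_deriv2 airy_trunc_def integral_mult_right[symmetric]
        by (subst Henstock_Kurzweil_Integration.integral_diff[symmetric])
           (auto intro!: integrable_continuous_real continuous_intros arg_cong[where f="integral _"] simp: algebra_simps)
      ultimately show ?thesis by simp
    qed
    have "norm (?K t) \<le> ?M * exp (-\<bar>t\<bar>)" for t
      by (rule norm_airy_kernel_le) simp
    hence "norm (\<i> * ?K (real n)) + norm (\<i> * ?K (- real n)) \<le> ?M * exp (- real n) + ?M * exp (- real n)" for n
      unfolding norm_mult by (intro add_mono) (metis abs_of_nat abs_minus_cancel norm_ii mult_1)+
    thus "\<forall>\<^sub>F n in sequentially. norm ((deriv ^^ 2) (airy_trunc n) z - z * airy_trunc n z) \<le> 2 * ?M * exp (- real n)"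
      unfolding eq
      by (intro always_eventually allI order.trans[OF norm_triangle_ineq4]) (simp add: mult_ac)
    show "(\<lambda>n. 2 * ?M * exp (- real n)) \<longlonglongrightarrow> 0"
      by real_asymp
  qed
  ultimately show ?thesis using LIMSEQ_unique by force
qed

text \<open>The equation is a recursion for the Taylor coefficients at 0: by the Leibniz rule the
  derivative of order m + 2 is a combination of derivatives of order at most m.\<close>

lemma higher_deriv_eq_0_airy_ode:
  assumes g: "g holomorphic_on UNIV" and ode: "\<And>z. (deriv ^^ 2) g z = z * g z"
    and init: "g 0 = 0" "deriv g 0 = 0"
  shows "(deriv ^^ n) g 0 = 0"
proof (induction n rule: less_induct)
  case (less n)
  consider "n = 0" | "n = 1" | m where "n = m + 2"
    by (metis One_nat_def Suc_1 add_2_eq_Suc' not0_implies_Suc)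
  thus ?case
  proof cases
    case 3
    have "(deriv ^^ n) g 0 = (deriv ^^ m) ((deriv ^^ 2) g) 0"
      unfolding 3 funpow_add by simp
    also have "(deriv ^^ 2) g = (\<lambda>z. z * g z)" using ode by blast
    also have "(deriv ^^ m) \<dots> 0 = (\<Sum>i = 0..m. of_nat (m choose i) * (deriv ^^ i) (\<lambda>z. z) 0 * (deriv ^^ (m - i)) g 0)"
      by (rule higher_deriv_mult[OF _ g]) auto
    also have "\<dots> = 0"
      by (intro sum.neutral ballI) (simp add: less 3)
    finally show ?thesis .
  qed (use init in auto)
qed

lemma airy_ode_unique:
  assumes "g holomorphic_on UNIV" "\<And>z. (deriv ^^ 2) g z = z * g z" "g 0 = 0" "deriv g 0 = 0"
  shows "g z = 0"
  using holomorphic_fun_eq_0_on_connected[of g UNIV 0 z] assms higher_deriv_eq_0_airy_ode[OF assms] by auto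

section \<open>Rotated solutions and the connection formula\<close>

definition airy' :: "complex \<Rightarrow> complex" where "airy' = deriv airy"

lemma airy_deriv: "(airy has_field_derivative airy' z) (at z within S)"
  unfolding airy'_def
  using holomorphic_derivI[OF airy_holomorphic open_UNIV UNIV_I] by (rule has_field_derivative_at_within)

lemma airy'_deriv: "(airy' has_field_derivative z * airy z) (at z within S)"
proof -
  have "airy' holomorphic_on UNIV"
    unfolding airy'_def by (intro holomorphic_deriv airy_holomorphic) auto
  hence "(airy' has_field_derivative deriv airy' z) (at z)"
    by (simp add: holomorphic_derivI)
  moreover have "deriv airy' z = z * airy z"
    using airy_ode[of z] by (simp add: airy'_def numeral_2_eq_2)
  ultimately show ?thesis by (simp add: has_field_derivative_at_within)
qed

definition cbrt_unity :: complex where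
  "cbrt_unity = Complex (-1/2) (sqrt 3 / 2)"

lemma cbrt_unity_sum: "1 + cbrt_unity + cbrt_unity\<^sup>2 = 0"
  by (simp add: cbrt_unity_def complex_eq_iff power2_eq_square)

lemma cbrt_unity_cube: "cbrt_unity ^ 3 = 1"
  by (simp add: cbrt_unity_def complex_eq_iff power3_eq_cube)

lemma airy_scale_deriv:
  "((\<lambda>z. airy (c * z)) has_field_derivative c * airy' (c * z)) (at z within S)"
  "((\<lambda>z. airy' (c * z)) has_field_derivative c * (c * z * airy (c * z))) (at z within S)"
  using DERIV_chain2[OF airy_deriv DERIV_cmult_Id, of c z S] DERIV_chain2[OF airy'_deriv DERIV_cmult_Id, of c z S]
  by (simp_all only: mult.commute)

text \<open>The left side solves the Airy equation because \<open>cbrt_unity\<close> has cube 1, and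
  its value and derivative at 0 are multiples of \<open>1 + cbrt_unity + cbrt_unity ^ 2\<close>,
  which vanishes. The formula later replaces one rotated solution by the other where the first
  leaves its sector of asymptotics.\<close>

lemma airy_connection:
  "airy z + cbrt_unity * airy (cbrt_unity * z) + cbrt_unity\<^sup>2 * airy (cbrt_unity\<^sup>2 * z) = 0"
proof -
  let ?w = cbrt_unity
  define g where "g = (\<lambda>z. airy z + ?w * airy (?w * z) + ?w\<^sup>2 * airy (?w\<^sup>2 * z))"
  define g' where "g' = (\<lambda>z. airy' z + ?w * (?w * airy' (?w * z)) + ?w\<^sup>2 * (?w\<^sup>2 * airy' (?w\<^sup>2 * z)))"
  have w3: "?w * (?w * (?w * x)) = x" for x
  proof -
    have "?w * (?w * (?w * x)) = ?w ^ 3 * x" by (simp only: power3_eq_cube mult.assoc)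
    thus ?thesis by (simp only: cbrt_unity_cube mult_1)
  qed
  have dg: "(g has_field_derivative g' z) (at z)" for z
    unfolding g_def g'_def by (intro DERIV_add DERIV_cmult airy_deriv airy_scale_deriv)
  have dg': "(g' has_field_derivative z * g z) (at z)" for z
  proof -
    have "(g' has_field_derivative z * airy z + ?w * (?w * (?w * (?w * z * airy (?w * z)))) +
        ?w\<^sup>2 * (?w\<^sup>2 * (?w\<^sup>2 * (?w\<^sup>2 * z * airy (?w\<^sup>2 * z))))) (at z)"
      unfolding g'_def by (intro DERIV_add DERIV_cmult airy'_deriv airy_scale_deriv)
    moreover have "?w * (?w * (?w * (?w * z * airy (?w * z)))) = z * (?w * airy (?w * z))"
      by (subst w3) simp
    moreover have "?w\<^sup>2 * (?w\<^sup>2 * (?w\<^sup>2 * (?w\<^sup>2 * z * airy (?w\<^sup>2 * z)))) =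
       ?w * (?w * (?w * (?w * (?w * (?w * (?w\<^sup>2 * z * airy (?w\<^sup>2 * z)))))))"
      by (simp only: power2_eq_square mult.assoc)
    moreover have "\<dots> = z * (?w\<^sup>2 * airy (?w\<^sup>2 * z))"
      unfolding w3 by simp
    ultimately show ?thesis unfolding g_def by (simp only: distrib_left)
  qed
  have "deriv g = g'" by (rule ext) (rule DERIV_imp_deriv[OF dg])
  hence "(deriv ^^ 2) g z = z * g z" for z
    using DERIV_imp_deriv[OF dg'] by (simp add: numeral_2_eq_2)
  moreover have "g holomorphic_on UNIV"
    using dg holomorphic_on_open by blast
  moreover have "g 0 = airy 0 * (1 + ?w + ?w\<^sup>2)"
    by (simp add: g_def algebra_simps)
  hence "g 0 = 0" using cbrt_unity_sum by simp
  moreover have "g' 0 = airy' 0 * (1 + ?w + ?w\<^sup>2)"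
    using w3[of "?w * airy' 0"] by (simp add: g'_def power2_eq_square algebra_simps)
  hence "deriv g 0 = 0" using cbrt_unity_sum \<open>deriv g = g'\<close> by simp
  ultimately have "g z = 0" using airy_ode_unique[of g z] by simp
  thus ?thesis by (simp add: g_def)
qed

section \<open>Contour shifts and saddle point asymptotics\<close>

lemma entire_primitive:
  assumes "f holomorphic_on UNIV"
  obtains F where "\<And>w. (F has_field_derivative f w) (at w)"
proof (rule holomorphic_convex_primitive'[OF convex_UNIV open_UNIV assms])
  fix g assume "\<And>x. x \<in> UNIV \<Longrightarrow> (g has_field_derivative f x) (at x)"
  thus thesis by (intro that[of g]) simp
qed

lemma integral_line_primitive:
  fixes F f :: "complex \<Rightarrow> complex"
  assumes F: "\<And>w. (F has_field_derivative f w) (at w)" and "a \<le> b"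
  shows "d * integral {a..b} (\<lambda>t. f (d * of_real t + c)) = F (d * of_real b + c) - F (d * of_real a + c)"
proof -
  have "((\<lambda>t. d * f (d * of_real t + c)) has_integral
          (F (d * of_real b + c) - F (d * of_real a + c))) {a..b}"
  proof (rule fundamental_theorem_of_calculus[OF \<open>a \<le> b\<close>])
    fix t
    have "((\<lambda>w. F (d * w + c)) has_field_derivative (f (d * of_real t + c) * d)) (at (of_real t))"
      by (rule DERIV_chain2[OF F]) (auto intro!: derivative_eq_intros)
    from has_vector_derivative_real_field[OF this]
    show "((\<lambda>t. F (d * of_real t + c)) has_vector_derivative d * f (d * of_real t + c)) (at t within {a..b})"
      by (simp only: mult.commute)
  qed
  thus ?thesis unfolding integral_mult_right[symmetric] by (rule integral_unique)
qed

lemma primitive_segment_bound: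
  fixes F f :: "complex \<Rightarrow> complex"
  assumes F: "\<And>w. (F has_field_derivative f w) (at w)"
    and B: "\<And>w. w \<in> closed_segment a b \<Longrightarrow> norm (f w) \<le> B"
  shows "norm (F b - F a) \<le> B * norm (b - a)"
  by (rule field_differentiable_bound[OF convex_closed_segment has_field_derivative_at_within[OF F] B]) auto

text \<open>The contour is moved from the line through \<open>\<i>\<close> to the parallel line
  through the saddle point \<open>\<i> * s\<close>, where the linear term of the exponent disappears
  and the quadratic and cubic terms remain. Primitives of the entire kernel replace Cauchy's
  theorem, so only the two connecting end segments have to be estimated.\<close>

lemma airy_shift:
  assumes "Re s > 0"
  shows "(\<lambda>n. integral {-real n..real n} (\<lambda>t. exp (- s * of_real t ^ 2 + \<i> * of_real t ^ 3 / 3)))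
           \<longlonglongrightarrow> exp (2 * s ^ 3 / 3) * airy (s\<^sup>2)"
proof -
  have "airy_kernel (s\<^sup>2) holomorphic_on UNIV"
    using airy_kernel_deriv(2) holomorphic_on_def field_differentiable_def by blast
  then obtain P where P: "\<And>w. (P has_field_derivative airy_kernel (s\<^sup>2) w) (at w)"
    using entire_primitive by blast
  have int: "integral {-real n..real n} (\<lambda>t. airy_kernel (s\<^sup>2) (of_real t + c)) =
      P (of_real (real n) + c) - P (of_real (- real n) + c)" for n c
    using integral_line_primitive[OF P, of "- real n" "real n" 1 c] by simp
  define c where "c = min 1 (Re s)"
  define V where "V = 1 + norm s"
  have c: "c > 0" and V: "V \<ge> 0" using assms by (auto simp: c_def V_def)
  define b where "b = (\<lambda>n. exp (- c * real n ^ 2 + real n * V ^ 2 + V ^ 3 / 3 + norm (s\<^sup>2) * (real n + V)))"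
  have bnd: "norm (P (of_real x + \<i> * s) - P (of_real x + \<i>)) \<le> b n * norm (\<i> * s - \<i>)"
    if x: "\<bar>x\<bar> = real n" for x n
  proof -
    have "norm (airy_kernel (s\<^sup>2) w) \<le> b n" if seg: "w \<in> closed_segment (of_real x + \<i>) (of_real x + \<i> * s)" for w
    proof -
      obtain u where u: "0 \<le> u" "u \<le> 1" and w: "w = (1 - u) *\<^sub>R (of_real x + \<i>) + u *\<^sub>R (of_real x + \<i> * s)"
        using seg by (auto simp: in_segment)
      \<comment> \<open>On the end segment \<open>w = x + \<i> * v\<close> with v between 1 and s.
        The exponent is led by \<open>- x ^ 2 * v\<close>, and the real part of v stays above
        \<open>min 1 (Re s)\<close>.\<close>
      define v where "v = of_real (1 - u) + of_real u * s"
      have w: "w = of_real x + \<i> * v"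
        unfolding w v_def by (simp add: scaleR_conv_of_real algebra_simps)
      have "c \<le> (1 - u) * 1 + u * Re s"
      proof -
        have "(1 - u) * c + u * c \<le> (1 - u) * 1 + u * Re s"
          using u by (intro add_mono mult_left_mono) (auto simp: c_def)
        thus ?thesis by (simp add: algebra_simps)
      qed
      hence Rev: "c \<le> Re v" by (simp add: v_def)
      have "norm v \<le> (1 - u) + u * norm s"
        unfolding v_def by (rule order.trans[OF norm_triangle_ineq]) (use u in \<open>simp add: norm_mult del: of_real_diff\<close>)
      also have "\<dots> \<le> V" using u mult_left_le_one_le[of "norm s" u] by (simp add: V_def)
      finally have nv: "norm v \<le> V" .
      have "\<i> * (w ^ 3 / 3 + s\<^sup>2 * w) =
         \<i> * of_real (x ^ 3) / 3 - of_real (x\<^sup>2) * v + (- \<i> * of_real x * v\<^sup>2) + v ^ 3 / 3 + \<i> * s\<^sup>2 * w"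
      proof -
        have "w ^ 3 = of_real (x ^ 3) + 3 * \<i> * of_real (x\<^sup>2) * v - 3 * of_real x * v\<^sup>2 - \<i> * v ^ 3"
          unfolding w by (simp add: power3_eq_cube power2_eq_square algebra_simps)
        hence "\<i> * (w ^ 3 / 3) = \<i> * ((of_real (x ^ 3) + 3 * \<i> * of_real (x\<^sup>2) * v - 3 * of_real x * v\<^sup>2 - \<i> * v ^ 3) / 3)"
          by (rule arg_cong)
        also have "\<dots> = (\<i> * of_real (x ^ 3) + 3 * (\<i> * \<i>) * of_real (x\<^sup>2) * v -
            3 * \<i> * of_real x * v\<^sup>2 - \<i> * \<i> * v ^ 3) / 3"
          by (simp add: algebra_simps)
        finally show ?thesis
          by (simp only: i_squared distrib_left add_divide_distrib diff_divide_distrib) simp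
      qed
      hence "Re (\<i> * (w ^ 3 / 3 + s\<^sup>2 * w)) =
          - x\<^sup>2 * Re v + Re (- \<i> * of_real x * v\<^sup>2) + Re (v ^ 3) / 3 + Re (\<i> * s\<^sup>2 * w)"
        by simp
      also have "\<dots> \<le> - x\<^sup>2 * c + \<bar>x\<bar> * V ^ 2 + V ^ 3 / 3 + norm (s\<^sup>2) * (\<bar>x\<bar> + V)"
      proof (intro add_mono)
        show "- x\<^sup>2 * Re v \<le> - x\<^sup>2 * c" using Rev by (simp add: mult_left_mono)
        have "Re (- \<i> * of_real x * v\<^sup>2) \<le> norm (- \<i> * of_real x * v\<^sup>2)" by (rule complex_Re_le_cmod)
        also have "\<dots> = \<bar>x\<bar> * norm v ^ 2" by (simp add: norm_mult norm_power)
        also have "\<dots> \<le> \<bar>x\<bar> * V ^ 2" using nv by (intro mult_left_mono power_mono) auto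
        finally show "Re (- \<i> * of_real x * v\<^sup>2) \<le> \<bar>x\<bar> * V ^ 2" .
        have "Re (v ^ 3) \<le> norm (v ^ 3)" by (rule complex_Re_le_cmod)
        also have "\<dots> \<le> V ^ 3" unfolding norm_power using nv by (intro power_mono) auto
        finally show "Re (v ^ 3) / 3 \<le> V ^ 3 / 3" by simp
        have "norm w \<le> \<bar>x\<bar> + V"
          unfolding w by (rule order.trans[OF norm_triangle_ineq]) (use nv in \<open>simp add: norm_mult\<close>)
        hence "norm (s\<^sup>2) * norm w \<le> norm (s\<^sup>2) * (\<bar>x\<bar> + V)" by (intro mult_left_mono) auto
        moreover have "Re (\<i> * s\<^sup>2 * w) \<le> norm (\<i> * s\<^sup>2 * w)" by (rule complex_Re_le_cmod)
        moreover have "norm (\<i> * s\<^sup>2 * w) = norm (s\<^sup>2) * norm w" by (simp only: norm_mult norm_ii mult_1)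
        ultimately show "Re (\<i> * s\<^sup>2 * w) \<le> norm (s\<^sup>2) * (\<bar>x\<bar> + V)"
          by linarith
      qed
      also have "\<dots> = - c * real n ^ 2 + real n * V ^ 2 + V ^ 3 / 3 + norm (s\<^sup>2) * (real n + V)"
        using x by (simp add: mult.commute flip: x)
      finally show ?thesis unfolding airy_kernel_def b_def norm_exp_eq_Re by simp
    qed
    from primitive_segment_bound[where a="of_real x + \<i>" and b="of_real x + \<i> * s", OF P this]
    show ?thesis by simp
  qed
  have b0: "b \<longlonglongrightarrow> 0"
  proof -
    have "(\<lambda>n. exp (- c * real n ^ 2 + real n * A + B)) \<longlonglongrightarrow> 0" for A B
      using c by real_asymp
    from this[of "V ^ 2 + norm (s\<^sup>2)" "V ^ 3 / 3 + norm (s\<^sup>2) * V"]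
    show ?thesis unfolding b_def by (simp add: algebra_simps)
  qed
  have "(\<lambda>n. integral {-real n..real n} (\<lambda>t. airy_kernel (s\<^sup>2) (of_real t + \<i> * s)) - airy_trunc n (s\<^sup>2)) \<longlonglongrightarrow> 0"
  proof (rule Lim_null_comparison)
    show "\<forall>\<^sub>F n in sequentially. norm (integral {-real n..real n} (\<lambda>t. airy_kernel (s\<^sup>2) (of_real t + \<i> * s)) - airy_trunc n (s\<^sup>2))
        \<le> 2 * b n * norm (\<i> * s - \<i>)"
    proof (intro always_eventually allI)
      fix n
      have "integral {-real n..real n} (\<lambda>t. airy_kernel (s\<^sup>2) (of_real t + \<i> * s)) - airy_trunc n (s\<^sup>2) =
        (P (of_real (real n) + \<i> * s) - P (of_real (real n) + \<i>)) -
        (P (of_real (- real n) + \<i> * s) - P (of_real (- real n) + \<i>))"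
        unfolding int airy_trunc_def by simp
      also have "norm \<dots> \<le> b n * norm (\<i> * s - \<i>) + b n * norm (\<i> * s - \<i>)"
        by (intro order.trans[OF norm_triangle_ineq4] add_mono bnd) auto
      finally show "norm (integral {-real n..real n} (\<lambda>t. airy_kernel (s\<^sup>2) (of_real t + \<i> * s)) - airy_trunc n (s\<^sup>2))
        \<le> 2 * b n * norm (\<i> * s - \<i>)" by (simp add: mult.assoc)
    qed
    show "(\<lambda>n. 2 * b n * norm (\<i> * s - \<i>)) \<longlonglongrightarrow> 0"
      using tendsto_mult_left[OF tendsto_mult_right[OF b0], of 2 "norm (\<i> * s - \<i>)"] by (simp add: mult.assoc)
  qed
  from tendsto_add[OF this airy_trunc_tendsto[of "s\<^sup>2"]]
  have lim: "(\<lambda>n. integral {-real n..real n} (\<lambda>t. airy_kernel (s\<^sup>2) (of_real t + \<i> * s))) \<longlonglongrightarrow> airy (s\<^sup>2)"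
    by simp
  have "airy_kernel (s\<^sup>2) (of_real t + \<i> * s) = exp (- 2 * s ^ 3 / 3) * exp (- s * of_real t ^ 2 + \<i> * of_real t ^ 3 / 3)" for t
  proof -
    have "(of_real t + \<i> * s) ^ 3 = of_real t ^ 3 + 3 * \<i> * of_real t ^ 2 * s - 3 * of_real t * s\<^sup>2 - \<i> * s ^ 3"
      by (simp add: power3_eq_cube power2_eq_square algebra_simps)
    hence "\<i> * ((of_real t + \<i> * s) ^ 3 / 3) = \<i> * ((of_real t ^ 3 + 3 * \<i> * of_real t ^ 2 * s - 3 * of_real t * s\<^sup>2 - \<i> * s ^ 3) / 3)"
      by (rule arg_cong)
    also have "\<dots> = (\<i> * of_real t ^ 3 + 3 * (\<i> * \<i>) * of_real t ^ 2 * s -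
            3 * \<i> * of_real t * s\<^sup>2 - \<i> * \<i> * s ^ 3) / 3"
      by (simp add: algebra_simps)
    finally have "\<i> * ((of_real t + \<i> * s) ^ 3 / 3) = (\<i> * of_real t ^ 3 + 3 * (\<i> * \<i>) * of_real t ^ 2 * s -
            3 * \<i> * of_real t * s\<^sup>2 - \<i> * \<i> * s ^ 3) / 3" .
    moreover have "\<i> * (s\<^sup>2 * (of_real t + \<i> * s)) = \<i> * of_real t * s\<^sup>2 - s ^ 3"
      by (simp add: power3_eq_cube power2_eq_square algebra_simps)
    ultimately have "\<i> * ((of_real t + \<i> * s) ^ 3 / 3 + s\<^sup>2 * (of_real t + \<i> * s)) =
        - 2 * s ^ 3 / 3 + (- s * of_real t ^ 2 + \<i> * of_real t ^ 3 / 3)"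
      by (simp only: i_squared distrib_left add_divide_distrib diff_divide_distrib) simp
    thus ?thesis unfolding airy_kernel_def mult_exp_exp by (rule arg_cong)
  qed
  hence "(\<lambda>n. exp (2 * s ^ 3 / 3) * (exp (- 2 * s ^ 3 / 3) * integral {-real n..real n} (\<lambda>t. exp (- s * of_real t ^ 2 + \<i> * of_real t ^ 3 / 3))))
      \<longlonglongrightarrow> exp (2 * s ^ 3 / 3) * airy (s\<^sup>2)"
    using lim by (intro tendsto_mult_left) simp
  moreover have "exp (2 * s ^ 3 / 3) * (exp (- 2 * s ^ 3 / 3) * X) = X" for X
  proof -
    have "exp (2 * s ^ 3 / 3) * exp (- 2 * s ^ 3 / 3) = (1::complex)"
      unfolding mult_exp_exp by simp
    thus ?thesis by (metis mult.assoc mult_1)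
  qed
  ultimately show ?thesis by (simp only:)
qed

text \<open>Monotone in the bound and majorised through \<open>1 / (1 + t ^ 2)\<close>, whose
  primitive is the arctangent. The limit, sqrt pi, is kept as an anonymous positive
  constant.\<close>

lemma gauss_integral_tendsto:
  obtains C :: real where "C > 0" "((\<lambda>x. integral {-x..x} (\<lambda>t. exp (- t\<^sup>2))) \<longlongrightarrow> C) at_top"
proof -
  define I :: "real \<Rightarrow> real" where "I = (\<lambda>x. integral {-x..x} (\<lambda>t. exp (- t\<^sup>2)))"
  have int: "(\<lambda>t::real. exp (- t\<^sup>2)) integrable_on {a..b}" for a b
    by (intro integrable_continuous_real continuous_intros)
  have mono: "mono I"
    unfolding I_def by (intro monoI integral_subset_le int) auto
  have bd: "I x \<le> pi" for x
  proof (cases "x \<ge> 0")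
    case True
    have "((\<lambda>t::real. 1 / (1 + t\<^sup>2)) has_integral (arctan x - arctan (- x))) {-x..x}"
      by (rule fundamental_theorem_of_calculus)
         (use True in \<open>auto intro!: derivative_eq_intros simp: has_real_derivative_iff_has_vector_derivative[symmetric] divide_inverse\<close>)
    hence "I x \<le> arctan x - arctan (- x)"
      unfolding I_def
    proof (rule has_integral_le[OF integrable_integral[OF int]])
      fix t :: real
      have "1 + t\<^sup>2 \<le> exp (t\<^sup>2)" by (rule exp_ge_add_one_self)
      hence "inverse (exp (t\<^sup>2)) \<le> inverse (1 + t\<^sup>2)" by (intro le_imp_inverse_le) (auto intro: add_pos_nonneg)
      thus "exp (- t\<^sup>2) \<le> 1 / (1 + t\<^sup>2)" by (simp add: exp_minus inverse_eq_divide)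
    qed
    also have "\<dots> \<le> pi" using arctan_bounded[of x] by (simp add: arctan_minus)
    finally show ?thesis .
  qed (simp add: I_def)
  have "incseq (\<lambda>n. I (real n))" using mono by (simp add: mono_def)
  then obtain C where C: "(\<lambda>n. I (real n)) \<longlonglongrightarrow> C" "\<forall>i. I (real i) \<le> C"
    using incseq_convergent[of "\<lambda>n. I (real n)" pi] bd by blast
  have "0 < 2 * exp (-1::real)" by simp
  also have "2 * exp (-1) = integral {-1..1} (\<lambda>t::real. exp (-1::real))"
    by (subst integral_const_real) simp
  also have "\<dots> \<le> I 1"
    unfolding I_def
  proof (rule integral_le)
    fix x :: real assume "x \<in> {-1..1}"
    hence "x\<^sup>2 \<le> 1" by (simp add: abs_square_le_1 abs_le_iff)
    thus "exp (- 1) \<le> exp (- x\<^sup>2)" by simp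
  qed (auto intro: int)
  also have "\<dots> \<le> C" using C(2)[rule_format, of 1] by simp
  finally have "C > 0" .
  moreover have "(I \<longlongrightarrow> C) at_top"
    by (rule tendsto_at_topI_sequentially_real[OF mono C(1)])
  ultimately show ?thesis using that by (simp add: I_def)
qed

text \<open>A rotation of the contour: the ends \<open>r * n\<close> are moved vertically to
  \<open>Re r * n\<close>. On these segments the real part of the square is at least
  \<open>Re (r ^ 2) * n ^ 2\<close>, so the change of the integral tends to 0 and a real Gauss
  integral is left.\<close>

lemma complex_gauss_tendsto:
  obtains C :: real where "C > 0"
    "\<And>r. Re r > 0 \<Longrightarrow> Re (r\<^sup>2) > 0 \<Longrightarrow>
      (\<lambda>n. r * integral {-real n..real n} (\<lambda>t. exp (- (r\<^sup>2 * of_real t ^ 2)))) \<longlonglongrightarrow> of_real C"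
proof -
  obtain C where C: "C > 0" "((\<lambda>x::real. integral {-x..x} (\<lambda>t. exp (- t\<^sup>2))) \<longlongrightarrow> C) at_top"
    using gauss_integral_tendsto by blast
  have "(\<lambda>w::complex. exp (- w\<^sup>2)) holomorphic_on UNIV" by (intro holomorphic_intros)
  then obtain E where E: "\<And>w::complex. (E has_field_derivative exp (- w\<^sup>2)) (at w)"
    using entire_primitive by blast
  have "(\<lambda>n. r * integral {-real n..real n} (\<lambda>t. exp (- (r\<^sup>2 * of_real t ^ 2)))) \<longlonglongrightarrow> of_real C"
    if r: "Re r > 0" "Re (r\<^sup>2) > 0" for r
  proof -
    have eq: "r * integral {-real n..real n} (\<lambda>t. exp (- (r\<^sup>2 * of_real t ^ 2))) =
        E (r * real n) - E (- (r * real n))" for n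
      using integral_line_primitive[OF E, of "- real n" "real n" r 0] by (simp add: power_mult_distrib)
    have eq': "of_real (integral {-x..x} (\<lambda>t. exp (- t\<^sup>2))) = E (of_real x) - E (- of_real x)" if "x \<ge> 0" for x
    proof -
      have "of_real (integral {-x..x} (\<lambda>t. exp (- t\<^sup>2))) = integral {-x..x} (\<lambda>t. complex_of_real (exp (- t\<^sup>2)))"
        by (rule integral_unique[symmetric], rule has_integral_of_real, rule integrable_integral)
           (intro integrable_continuous_real continuous_intros)
      thus ?thesis
        using integral_line_primitive[OF E, of "- x" x 1 0] that by (simp flip: exp_of_real)
    qed
    have bnd: "norm (E (of_real e * (r * real n)) - E (of_real e * of_real (Re r * real n))) \<le> exp (- (Re (r\<^sup>2) * real n ^ 2)) * (\<bar>Im r\<bar> * real n)"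
      if e: "e\<^sup>2 = 1" for e n
    proof -
      have "norm (exp (- w\<^sup>2)) \<le> exp (- (Re (r\<^sup>2) * real n ^ 2))"
        if w: "w \<in> closed_segment (of_real e * of_real (Re r * real n)) (of_real e * (r * real n))" for w
      proof -
        obtain u where u: "0 \<le> u" "u \<le> 1" 
          and w: "w = (1 - u) *\<^sub>R (of_real e * of_real (Re r * real n)) + u *\<^sub>R (of_real e * (r * real n))"
          using w by (auto simp: in_segment)
        have "w = of_real (e * real n) * Complex (Re r) (u * Im r)"
          unfolding w by (simp add: complex_eq_iff algebra_simps)
        hence "w\<^sup>2 = of_real (e\<^sup>2 * real n ^ 2) * (Complex (Re r) (u * Im r))\<^sup>2"
          by (simp only: power_mult_distrib of_real_mult of_real_power)
        hence "w\<^sup>2 = of_real (real n ^ 2) * (Complex (Re r) (u * Im r))\<^sup>2"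
          by (simp only: e mult_1)
        hence "Re (w\<^sup>2) = real n ^ 2 * ((Re r)\<^sup>2 - (u * Im r)\<^sup>2)"
          using e by (simp add: power2_eq_square)
        moreover have "(u * Im r)\<^sup>2 \<le> (Im r)\<^sup>2"
          using u by (simp add: power_mult_distrib mult_left_le_one_le power_le_one)
        hence "real n ^ 2 * Re (r\<^sup>2) \<le> real n ^ 2 * ((Re r)\<^sup>2 - (u * Im r)\<^sup>2)"
          by (intro mult_left_mono) (auto simp: power2_eq_square)
        ultimately show ?thesis by (simp add: mult.commute)
      qed
      from primitive_segment_bound[OF E this]
      have "norm (E (of_real e * (r * real n)) - E (of_real e * of_real (Re r * real n))) \<le> exp (- (Re (r\<^sup>2) * real n ^ 2)) *
          norm (of_real e * (r * real n) - of_real e * of_real (Re r * real n))" .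
      also have "of_real e * (r * real n) - of_real e * of_real (Re r * real n) = of_real e * (\<i> * of_real (Im r * real n))"
        by (simp add: complex_eq_iff algebra_simps)
      also have "norm \<dots> = \<bar>Im r\<bar> * real n"
        using e by (simp add: norm_mult abs_mult power2_eq_1_iff) auto
      finally show ?thesis .
    qed
    have b0: "(\<lambda>n. exp (- (Re (r\<^sup>2) * real n ^ 2)) * (\<bar>Im r\<bar> * real n)) \<longlonglongrightarrow> 0"
    proof -
      have "(\<lambda>n. exp (- (a * real n ^ 2)) * (b * real n)) \<longlonglongrightarrow> 0" if "a > 0" for a b
        using that by real_asymp
      thus ?thesis using r by blast
    qed
    have d: "(\<lambda>n. E (of_real e * (r * real n)) - E (of_real e * of_real (Re r * real n))) \<longlonglongrightarrow> 0" if "e\<^sup>2 = 1" for e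
      by (rule Lim_null_comparison[OF _ b0]) (use bnd[OF that] in auto)
    have "filterlim (\<lambda>n. Re r * real n) at_top sequentially"
      using r(1) by real_asymp
    from filterlim_compose[OF C(2) this]
    have "(\<lambda>n. complex_of_real (integral {- (Re r * real n)..Re r * real n} (\<lambda>t. exp (- t\<^sup>2)))) \<longlonglongrightarrow> of_real C"
      by (intro tendsto_of_real)
    hence "(\<lambda>n. E (of_real (Re r * real n)) - E (- of_real (Re r * real n))) \<longlonglongrightarrow> of_real C"
      using r(1) by (subst (asm) eq') auto
    from tendsto_add[OF this tendsto_diff[OF d[of 1] d[of "-1"]]]
    show ?thesis unfolding eq by (simp add: algebra_simps)
  qed
  thus thesis by (rule that[OF C(1)])
qed

text \<open>The primitive is elementary; the value stays below the reciprocal square of \<sigma> for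
  every n.\<close>

lemma cubic_gauss_bound:
  assumes "\<sigma> > 0" "n \<ge> 0"
  shows "((\<lambda>t::real. exp (- \<sigma> * t\<^sup>2) * \<bar>t\<bar> ^ 3) has_integral (1 - (\<sigma> * n\<^sup>2 + 1) * exp (- \<sigma> * n\<^sup>2)) / \<sigma>\<^sup>2) {-n..n}"
proof -
  define F where "F = (\<lambda>t::real. - ((\<sigma> * t\<^sup>2 + 1) * exp (- \<sigma> * t\<^sup>2)) / (2 * \<sigma>\<^sup>2))"
  have F: "(F has_real_derivative exp (- \<sigma> * t\<^sup>2) * t ^ 3) (at t within S)" for t S
    unfolding F_def using assms(1)
    by (auto intro!: derivative_eq_intros simp: field_simps power2_eq_square power3_eq_cube)
  have "((\<lambda>t::real. exp (- \<sigma> * t\<^sup>2) * t ^ 3) has_integral (F n - F 0)) {0..n}"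
    by (rule fundamental_theorem_of_calculus) (use assms F in \<open>auto simp: has_real_derivative_iff_has_vector_derivative[symmetric]\<close>)
  hence 1: "((\<lambda>t::real. exp (- \<sigma> * t\<^sup>2) * \<bar>t\<bar> ^ 3) has_integral (F n - F 0)) {0..n}"
    by (rule has_integral_eq[rotated]) auto
  have "((\<lambda>t::real. exp (- \<sigma> * t\<^sup>2) * t ^ 3) has_integral (F 0 - F (-n))) {-n..0}"
    by (rule fundamental_theorem_of_calculus) (use assms F in \<open>auto simp: has_real_derivative_iff_has_vector_derivative[symmetric]\<close>)
  hence "((\<lambda>t::real. - (exp (- \<sigma> * t\<^sup>2) * t ^ 3)) has_integral - (F 0 - F (-n))) {-n..0}"
    by (rule has_integral_neg)
  hence 2: "((\<lambda>t::real. exp (- \<sigma> * t\<^sup>2) * \<bar>t\<bar> ^ 3) has_integral - (F 0 - F (-n))) {-n..0}"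
    by (rule has_integral_eq[rotated]) auto
  have "- (F 0 - F (-n)) + (F n - F 0) = (1 - (\<sigma> * n\<^sup>2 + 1) * exp (- \<sigma> * n\<^sup>2)) / \<sigma>\<^sup>2"
    using assms(1) by (simp add: F_def field_simps)
  with has_integral_combine[OF _ _ 2 1] assms show ?thesis by simp
qed

text \<open>After the shift to the saddle, dropping the cubic term costs at most the integral of
  \<open>exp (- \<sigma> * t ^ 2) * \<bar>t\<bar> ^ 3 / 3\<close> with
  \<open>\<sigma> = Re s\<close>, that is \<open>1 / (3 * \<sigma> ^ 2)\<close>;
  \<open>\<sigma> \<ge> norm s / 4\<close> gives 16/3, rounded up to 6. The sector, of half-angle
  about 75 degrees, is wide enough to contain the direction pi / 3 of \<open>sixth_root\<close> with
  a margin, as the rotated solutions will require.\<close>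

lemma airy_asymptotics:
  obtains C :: real where "C > 0"
    "\<And>s. s \<noteq> 0 \<Longrightarrow> Re s \<ge> norm s / 4 \<Longrightarrow>
       norm (csqrt s * (exp (2 * s ^ 3 / 3) * airy (s\<^sup>2)) - of_real C) \<le> 6 * sqrt (norm s) / (norm s)\<^sup>2"
proof (rule complex_gauss_tendsto)
  fix C :: real
  assume C: "C > 0"
    "\<And>r. Re r > 0 \<Longrightarrow> Re (r\<^sup>2) > 0 \<Longrightarrow>
      (\<lambda>n. r * integral {-real n..real n} (\<lambda>t. exp (- (r\<^sup>2 * of_real t ^ 2)))) \<longlonglongrightarrow> of_real C"
  have "norm (csqrt s * (exp (2 * s ^ 3 / 3) * airy (s\<^sup>2)) - of_real C) \<le> 6 * sqrt (norm s) / (norm s)\<^sup>2"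
    if s: "s \<noteq> 0" "Re s \<ge> norm s / 4" for s
  proof -
    define r where "r = csqrt s"
    define \<sigma> where "\<sigma> = Re s"
    have "norm s > 0" using s by simp
    with s(2) have \<sigma>: "\<sigma> > 0" "\<sigma> \<ge> norm s / 4" unfolding \<sigma>_def by linarith+
    have r2: "r\<^sup>2 = s" by (simp add: r_def)
    have "Re r \<ge> 0" using csqrt_principal[of s] unfolding r_def by linarith
    moreover have "Re r \<noteq> 0"
    proof
      assume "Re r = 0"
      hence "Re (r\<^sup>2) = - (Im r)\<^sup>2" by (simp add: power2_eq_square)
      thus False using \<sigma>(1) zero_le_power2[of "Im r"] unfolding r2 \<sigma>_def by linarith
    qed
    ultimately have r: "Re r > 0" "Re (r\<^sup>2) > 0" using \<sigma> by (auto simp: r2 \<sigma>_def)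
    let ?m = "\<lambda>n::nat. integral {-real n..real n} (\<lambda>t. exp (- s * of_real t ^ 2 + \<i> * of_real t ^ 3 / 3))"
    let ?J = "\<lambda>n::nat. integral {-real n..real n} (\<lambda>t. exp (- (s * of_real t ^ 2)))"
    have "(\<lambda>n. r * ?m n - r * ?J n) \<longlonglongrightarrow> r * (exp (2 * s ^ 3 / 3) * airy (s\<^sup>2)) - of_real C"
      using C(2)[OF r] airy_shift[of s] \<sigma> unfolding r2 \<sigma>_def by (intro tendsto_diff tendsto_mult_left) auto
    hence lim: "(\<lambda>n. norm (r * ?m n - r * ?J n)) \<longlonglongrightarrow> norm (r * (exp (2 * s ^ 3 / 3) * airy (s\<^sup>2)) - of_real C)"
      by (rule tendsto_norm)
    have "norm (?m n - ?J n) \<le> 1 / (3 * \<sigma>\<^sup>2)" for n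
    proof -
      have "?m n - ?J n = integral {-real n..real n}
         (\<lambda>t. exp (- s * of_real t ^ 2 + \<i> * of_real t ^ 3 / 3) - exp (- (s * of_real t ^ 2)))"
        by (rule Henstock_Kurzweil_Integration.integral_diff[symmetric])
           (auto intro!: integrable_continuous_real continuous_intros)
      also have "norm \<dots> \<le> integral {-real n..real n} (\<lambda>t. exp (- \<sigma> * t\<^sup>2) * \<bar>t\<bar> ^ 3 / 3)"
      proof (rule integral_norm_bound_integral)
        fix t :: real
        have "exp (- s * of_real t ^ 2 + \<i> * of_real t ^ 3 / 3) - exp (- (s * of_real t ^ 2)) =
          exp (- (s * of_real (t ^ 2))) * (exp (\<i> * of_real (t ^ 3 / 3)) - 1)"
          by (simp add: right_diff_distrib mult_exp_exp)
        also have "norm \<dots> = exp (- \<sigma> * t\<^sup>2) * (2 * \<bar>sin (t ^ 3 / 3 / 2)\<bar>)"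
          by (simp only: norm_mult dist_exp_i_1 norm_exp_eq_Re) (simp add: \<sigma>_def)
        also have "\<dots> \<le> exp (- \<sigma> * t\<^sup>2) * \<bar>t ^ 3 / 3\<bar>"
          using abs_sin_x_le_abs_x[of "t ^ 3 / 3 / 2"] by (intro mult_left_mono) auto
        finally show "norm (exp (- s * of_real t ^ 2 + \<i> * of_real t ^ 3 / 3) - exp (- (s * of_real t ^ 2)))
            \<le> exp (- \<sigma> * t\<^sup>2) * \<bar>t\<bar> ^ 3 / 3" by (simp add: power_abs)
      qed (intro integrable_continuous_real continuous_intros; simp)+
      also have "\<dots> = (1 - (\<sigma> * real n ^ 2 + 1) * exp (- \<sigma> * real n ^ 2)) / \<sigma>\<^sup>2 / 3"
        using integral_unique[OF has_integral_divide[OF cubic_gauss_bound[OF \<sigma>(1), of "real n"], of 3]]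
        by (simp only: of_nat_0_le_iff)
      also have "\<dots> \<le> 1 / \<sigma>\<^sup>2 / 3"
        using \<sigma> by (intro divide_right_mono) auto
      finally show ?thesis by (simp add: mult.commute)
    qed
    hence "norm (r * ?m n - r * ?J n) \<le> norm r * (1 / (3 * \<sigma>\<^sup>2))" for n
      unfolding right_diff_distrib[symmetric] norm_mult by (intro mult_left_mono) auto
    hence "norm (r * (exp (2 * s ^ 3 / 3) * airy (s\<^sup>2)) - of_real C) \<le> norm r * (1 / (3 * \<sigma>\<^sup>2))"
      using LIMSEQ_le_const2[OF lim] by blast
    also have "\<dots> \<le> norm r * (1 / (3 * (norm s / 4)\<^sup>2))"
      using \<sigma> \<open>norm s > 0\<close> by (intro mult_left_mono divide_left_mono mult_left_mono power_mono mult_pos_pos) auto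
    also have "norm r = sqrt (norm s)"
      unfolding r2[symmetric] by (simp add: norm_power)
    also have "\<dots> * (1 / (3 * (norm s / 4)\<^sup>2)) \<le> 6 * sqrt (norm s) / (norm s)\<^sup>2"
      using \<open>norm s > 0\<close> by (simp add: field_simps)
    finally show ?thesis by (simp add: r_def)
  qed
  thus thesis by (rule that[OF C(1)])
qed

subsection \<open>The Evans function\<close>

definition sixth_root :: complex where
  "sixth_root = Complex (1/2) (sqrt 3 / 2)"

lemma sixth_root_square: "sixth_root\<^sup>2 = cbrt_unity"
  by (simp add: sixth_root_def cbrt_unity_def complex_eq_iff power2_eq_square)

lemma sixth_root_cube: "sixth_root ^ 3 = - 1"
  by (simp add: sixth_root_def complex_eq_iff power3_eq_cube)

lemma norm_sixth_root: "norm sixth_root = 1"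
  by (simp add: sixth_root_def cmod_def power_divide)

text \<open>Along the positive axis \<open>z = s ^ 2\<close> the function decays like
  \<open>exp (- 2 * s ^ 3 / 3)\<close>. Its rotation grows with the opposite exponent, because
  \<open>sixth_root * s\<close> is a root of the rotated argument and has cube
  \<open>- s ^ 3\<close>.\<close>

lemma airy_ratio_neq:
  "\<exists>z. norm (airy (cbrt_unity * z)) > norm (airy z)"
proof -
  obtain C :: real where C: "C > 0"
    "\<And>s. s \<noteq> 0 \<Longrightarrow> Re s \<ge> norm s / 4 \<Longrightarrow>
       norm (csqrt s * (exp (2 * s ^ 3 / 3) * airy (s\<^sup>2)) - of_real C) \<le> 6 * sqrt (norm s) / (norm s)\<^sup>2"
    using airy_asymptotics by blast
  have "eventually (\<lambda>x::real. 6 * sqrt x / x\<^sup>2 < C / 4) at_top"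
    by (rule order_tendstoD(2)[of _ 0]) (real_asymp, use C(1) in simp)
  moreover have "eventually (\<lambda>x::real. x \<ge> 2) at_top" by (rule eventually_ge_at_top)
  ultimately have "eventually (\<lambda>x::real. 6 * sqrt x / x\<^sup>2 < C / 4 \<and> x \<ge> 2) at_top" by (rule eventually_conj)
  then obtain x :: real where x: "6 * sqrt x / x\<^sup>2 < C / 4" "x \<ge> 2"
    using eventually_happens[of _ "at_top :: real filter"] by auto
  define s where "s = complex_of_real x"
  define s' where "s' = sixth_root * s"
  have s'n: "norm s' = x" using x(2) by (simp add: s'_def s_def norm_mult norm_sixth_root)
  have s'2: "s'\<^sup>2 = cbrt_unity * s\<^sup>2"
    by (simp add: s'_def power_mult_distrib sixth_root_square)
  have s'3: "s' ^ 3 = - (s ^ 3)"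
    by (simp add: s'_def power_mult_distrib sixth_root_cube)
  have 1: "norm (csqrt s * (exp (2 * s ^ 3 / 3) * airy (s\<^sup>2)) - of_real C) < C / 4"
    using C(2)[of s] x by (simp add: s_def)
  have 2: "norm (csqrt s' * (exp (2 * s' ^ 3 / 3) * airy (s'\<^sup>2)) - of_real C) < C / 4"
  proof -
    have "Re s' \<ge> norm s' / 4" unfolding s'n using x(2) by (simp add: s'_def s_def sixth_root_def)
    thus ?thesis using C(2)[of s'] x s'n by fastforce
  qed
  have "norm (csqrt s * (exp (2 * s ^ 3 / 3) * airy (s\<^sup>2))) \<le> C + C / 4"
    using norm_triangle_sub[of "csqrt s * (exp (2 * s ^ 3 / 3) * airy (s\<^sup>2))" "of_real C"] 1 C(1) by simp
  hence A: "sqrt x * (exp (2 * x ^ 3 / 3) * norm (airy (s\<^sup>2))) \<le> C + C / 4"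
    using x(2) by (simp add: norm_mult s_def norm_exp_eq_Re flip: of_real_power)
  have "norm (csqrt s' * (exp (2 * s' ^ 3 / 3) * airy (s'\<^sup>2))) \<ge> C - C / 4"
    using norm_triangle_sub[of "of_real C" "csqrt s' * (exp (2 * s' ^ 3 / 3) * airy (s'\<^sup>2))"] 2 C(1)
    by (simp add: norm_minus_commute)
  hence B: "sqrt x * (exp (- (2 * x ^ 3 / 3)) * norm (airy (cbrt_unity * s\<^sup>2))) \<ge> C - C / 4"
    using x(2) unfolding s'3 s'2 by (simp add: norm_mult s'n s_def norm_exp_eq_Re flip: of_real_power)
  have e: "exp (2 * x ^ 3 / 3) \<ge> 2" "exp (2 * x ^ 3 / 3) > 1"
  proof -
    have "2 ^ 3 \<le> x ^ 3" using x(2) by (intro power_mono) auto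
    hence "1 \<le> 2 * x ^ 3 / 3" by simp
    hence "exp 1 \<le> exp (2 * x ^ 3 / 3)" by simp
    moreover have "exp 1 \<ge> (2::real)" using exp_ge_add_one_self[of 1] by simp
    ultimately show "exp (2 * x ^ 3 / 3) \<ge> 2" "exp (2 * x ^ 3 / 3) > 1" by linarith+
  qed
  have "norm (airy (cbrt_unity * s\<^sup>2)) > norm (airy (s\<^sup>2))"
  proof (rule ccontr)
    assume "\<not> ?thesis"
    hence le: "norm (airy (cbrt_unity * s\<^sup>2)) \<le> norm (airy (s\<^sup>2))" by simp
    define a where "a = sqrt x * norm (airy (s\<^sup>2))"
    have a0: "a \<ge> 0" using x(2) by (simp add: a_def)
    have "exp (2 * x ^ 3 / 3) * a \<le> C + C / 4" using A by (simp add: a_def mult_ac)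
    moreover have "2 * a \<le> exp (2 * x ^ 3 / 3) * a" using e a0 by (intro mult_right_mono)
    ultimately have "2 * a \<le> C + C / 4" by linarith
    have "C - C / 4 \<le> exp (- (2 * x ^ 3 / 3)) * a"
    proof -
      have "sqrt x * (exp (- (2 * x ^ 3 / 3)) * norm (airy (cbrt_unity * s\<^sup>2)))
          \<le> sqrt x * (exp (- (2 * x ^ 3 / 3)) * norm (airy (s\<^sup>2)))"
        using le x(2) by (intro mult_left_mono) auto
      thus ?thesis using B by (simp add: a_def mult_ac)
    qed
    also have "\<dots> \<le> 1 * a"
      using e a0 x(2) by (intro mult_right_mono) auto
    finally show False using \<open>2 * a \<le> C + C / 4\<close> C(1) by linarith
  qed
  thus ?thesis by blast
qed

lemma norm_cbrt_unity: "norm cbrt_unity = 1"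
  by (simp add: cbrt_unity_def cmod_def power_divide)

lemma airy_rotate_unique:
  assumes "airy 0 = c * airy 0" "cbrt_unity * airy' 0 = c * airy' 0"
  shows "airy (cbrt_unity * z) = c * airy z"
proof -
  let ?w = cbrt_unity
  define g where "g = (\<lambda>z. airy (?w * z) - c * airy z)"
  define g' where "g' = (\<lambda>z. ?w * airy' (?w * z) - c * airy' z)"
  have w3: "?w * (?w * (?w * x)) = x" for x
  proof -
    have "?w * (?w * (?w * x)) = ?w ^ 3 * x" by (simp only: power3_eq_cube mult.assoc)
    thus ?thesis by (simp only: cbrt_unity_cube mult_1)
  qed
  have dg: "(g has_field_derivative g' z) (at z)" for z
    unfolding g_def g'_def by (intro DERIV_diff DERIV_cmult airy_deriv airy_scale_deriv)
  have dg': "(g' has_field_derivative z * g z) (at z)" for z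
  proof -
    have "(g' has_field_derivative ?w * (?w * (?w * z * airy (?w * z))) - c * (z * airy z)) (at z)"
      unfolding g'_def by (intro DERIV_diff DERIV_cmult airy'_deriv airy_scale_deriv)
    moreover have "?w * (?w * (?w * z * airy (?w * z))) - c * (z * airy z) = z * g z"
      using w3[of "z * airy (?w * z)"] by (simp add: g_def mult.assoc right_diff_distrib mult.left_commute)
    ultimately show ?thesis by (simp only:)
  qed
  have "deriv g = g'" by (rule ext) (rule DERIV_imp_deriv[OF dg])
  hence "(deriv ^^ 2) g z = z * g z" for z
    using DERIV_imp_deriv[OF dg'] by (simp add: numeral_2_eq_2)
  moreover have "g holomorphic_on UNIV"
    using dg by (subst holomorphic_on_open) auto
  ultimately have "g z = 0"
    using airy_ode_unique[of g z] assms \<open>deriv g = g'\<close> by (simp add: g_def g'_def)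
  thus ?thesis by (simp add: g_def)
qed

text \<open>If one of the two initial values vanished, uniqueness would make the rotated function a
  multiple of the original one by a factor of modulus 1, against \<open>airy_ratio_neq\<close>. No
  Gamma values are evaluated.\<close>

lemma airy_0_neq: "airy 0 \<noteq> 0" "airy' 0 \<noteq> 0"
proof -
  obtain z where z: "norm (airy (cbrt_unity * z)) > norm (airy z)"
    using airy_ratio_neq by blast
  show "airy 0 \<noteq> 0"
  proof
    assume "airy 0 = 0"
    hence "airy (cbrt_unity * z) = cbrt_unity * airy z" by (intro airy_rotate_unique) auto
    thus False using z by (simp add: norm_mult norm_cbrt_unity)
  qed
  show "airy' 0 \<noteq> 0"
  proof
    assume "airy' 0 = 0"
    hence "airy (cbrt_unity * z) = 1 * airy z" by (intro airy_rotate_unique) auto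
    thus False using z by simp
  qed
qed

lemma airy_wronskian:
  obtains w where "w \<noteq> 0"
    "\<And>z. airy z * (cbrt_unity * airy' (cbrt_unity * z)) - airy' z * airy (cbrt_unity * z) = w"
proof -
  let ?w = cbrt_unity
  define W where "W = (\<lambda>z. airy z * (?w * airy' (?w * z)) - airy' z * airy (?w * z))"
  have w3: "?w * (?w * (?w * x)) = x" for x
  proof -
    have "?w * (?w * (?w * x)) = ?w ^ 3 * x" by (simp only: power3_eq_cube mult.assoc)
    thus ?thesis by (simp only: cbrt_unity_cube mult_1)
  qed
  have "(W has_field_derivative 0) (at z)" for z
  proof -
    have "(W has_field_derivative
       (airy' z * (?w * airy' (?w * z)) + ?w * (?w * (?w * z * airy (?w * z))) * airy z) -
       (z * airy z * airy (?w * z) + ?w * airy' (?w * z) * airy' z)) (at z)"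
      unfolding W_def by (intro DERIV_diff DERIV_mult DERIV_cmult airy_deriv airy'_deriv airy_scale_deriv)
    moreover have "?w * (?w * (?w * z * airy (?w * z))) = z * airy (?w * z)"
      using w3[of "z * airy (?w * z)"] by (simp add: mult.assoc)
    ultimately have "(W has_field_derivative
       (airy' z * (?w * airy' (?w * z)) + z * airy (?w * z) * airy z) -
       (z * airy z * airy (?w * z) + ?w * airy' (?w * z) * airy' z)) (at z)"
      by (simp only:)
    thus ?thesis by (simp only: mult_ac diff_self add.commute)
  qed
  hence "\<exists>c. \<forall>z\<in>UNIV. W z = c"
    by (intro has_field_derivative_zero_constant) auto
  hence "W z = W 0" for z by (metis UNIV_I)
  moreover have "W 0 = (?w - 1) * (airy 0 * airy' 0)" by (simp add: W_def algebra_simps)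
  moreover have "?w \<noteq> 1" by (simp add: cbrt_unity_def complex_eq_iff)
  ultimately show ?thesis using airy_0_neq that[of "W 0"] by (simp add: W_def)
qed

section \<open>The fundamental system, eigenvalues as zeros, energy identities\<close>

definition mode :: "real \<Rightarrow> complex \<Rightarrow> complex \<Rightarrow> complex" where
  "mode k c z = airy (c * (of_real (k\<^sup>2) * z))"

definition mode' :: "real \<Rightarrow> complex \<Rightarrow> complex \<Rightarrow> complex" where
  "mode' k c z = c * of_real (k\<^sup>2) * airy' (c * (of_real (k\<^sup>2) * z))"

lemma mode_deriv:
  "(mode k c has_field_derivative mode' k c z) (at z within S)"
  unfolding mode_def[abs_def] mode'_def
  using airy_scale_deriv(1)[of "c * of_real (k\<^sup>2)"] by (simp only: mult.assoc)

lemma mode'_deriv: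
  assumes "c ^ 3 = 1"
  shows "(mode' k c has_field_derivative of_real (k ^ 6) * z * mode k c z) (at z within S)"
proof -
  have "(mode' k c has_field_derivative c * of_real (k\<^sup>2) *
      (c * of_real (k\<^sup>2) * (c * of_real (k\<^sup>2) * z * airy (c * of_real (k\<^sup>2) * z)))) (at z within S)"
    unfolding mode'_def[abs_def]
    using DERIV_cmult[OF airy_scale_deriv(2)[of "c * of_real (k\<^sup>2)"], of "c * of_real (k\<^sup>2)"]
    by (simp only: mult.assoc)
  moreover have "c * of_real (k\<^sup>2) * (c * of_real (k\<^sup>2) * (c * of_real (k\<^sup>2) * z * airy (c * of_real (k\<^sup>2) * z))) =
     c ^ 3 * (of_real (k ^ 6) * z * mode k c z)"
    by (simp add: mode_def power3_eq_cube power2_eq_square eval_nat_numeral mult_ac)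
  ultimately show ?thesis by (simp only: assms mult_1)
qed

lemma mode_holomorphic: "mode k c holomorphic_on S"
  unfolding holomorphic_on_def field_differentiable_def using mode_deriv by blast

text \<open>The determinant of the two boundary conditions: the end x = 1 is the point
  \<open>p - \<i>\<close>, the end x = -1 is the point \<open>p + \<i>\<close>.\<close>

definition evans :: "real \<Rightarrow> complex \<Rightarrow> complex" where
  "evans k p = mode k 1 (p - \<i>) * mode k cbrt_unity (p + \<i>) - mode k 1 (p + \<i>) * mode k cbrt_unity (p - \<i>)"

text \<open>
  With \<open>p = \<i> \<lambda>\<close> and \<open>\<epsilon> = k\<^sup>-\<^sup>6\<close> the equation on \<open>(-1, 1)\<close> becomes \<open>u'' = k\<^sup>6 z u\<close> on
  the segment \<open>z = p - \<i> x\<close>.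
\<close>

definition sol :: "real \<Rightarrow> complex \<Rightarrow> complex \<Rightarrow> complex \<Rightarrow> complex \<Rightarrow> complex" where
  "sol k a b p x = a * mode k 1 (p - \<i> * x) + b * mode k cbrt_unity (p - \<i> * x)"

definition sol' :: "real \<Rightarrow> complex \<Rightarrow> complex \<Rightarrow> complex \<Rightarrow> complex \<Rightarrow> complex" where
  "sol' k a b p x = - \<i> * (a * mode' k 1 (p - \<i> * x) + b * mode' k cbrt_unity (p - \<i> * x))"

lemma sol_deriv: "(sol k a b p has_field_derivative sol' k a b p x) (at x within S)"
proof -
  have "((\<lambda>x. p - \<i> * x) has_field_derivative - \<i>) (at x within S)"
    by (auto intro!: derivative_eq_intros)
  from DERIV_add[OF DERIV_cmult[OF DERIV_chain2[OF mode_deriv this]] DERIV_cmult[OF DERIV_chain2[OF mode_deriv this]]]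
  have "(sol k a b p has_field_derivative (a * (mode' k 1 (p - \<i> * x) * - \<i>) + b * (mode' k cbrt_unity (p - \<i> * x) * - \<i>))) (at x within S)"
    unfolding sol_def[abs_def] .
  thus ?thesis by (simp add: sol'_def algebra_simps)
qed

lemma sol'_deriv:
  "(sol' k a b (\<i> * l) has_field_derivative \<i> * of_real (k ^ 6) * (x - l) * sol k a b (\<i> * l) x) (at x within S)"
proof -
  have "((\<lambda>x. \<i> * l - \<i> * x) has_field_derivative - \<i>) (at x within S)"
    by (auto intro!: derivative_eq_intros)
  note d = DERIV_cmult[OF DERIV_chain2[OF mode'_deriv this]]
  have "(sol' k a b (\<i> * l) has_field_derivative - \<i> *
      (a * (of_real (k ^ 6) * (\<i> * l - \<i> * x) * mode k 1 (\<i> * l - \<i> * x) * - \<i>) +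
       b * (of_real (k ^ 6) * (\<i> * l - \<i> * x) * mode k cbrt_unity (\<i> * l - \<i> * x) * - \<i>))) (at x within S)"
    unfolding sol'_def[abs_def] by (intro DERIV_cmult DERIV_add d) (simp_all add: cbrt_unity_cube)
  moreover have "- \<i> *
      (a * (of_real (k ^ 6) * (\<i> * l - \<i> * x) * mode k 1 (\<i> * l - \<i> * x) * - \<i>) +
       b * (of_real (k ^ 6) * (\<i> * l - \<i> * x) * mode k cbrt_unity (\<i> * l - \<i> * x) * - \<i>)) =
     (\<i> * \<i>) * (\<i> * of_real (k ^ 6) * (l - x) * sol k a b (\<i> * l) x)"
    unfolding sol_def by (simp add: algebra_simps)
  moreover have "(\<i> * \<i>) * (\<i> * of_real (k ^ 6) * (l - x) * sol k a b (\<i> * l) x) =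
      \<i> * of_real (k ^ 6) * (x - l) * sol k a b (\<i> * l) x"
    by (simp add: algebra_simps)
  ultimately show ?thesis by (simp only:)
qed

lemma sol_wronskian:
  assumes "k > 0"
  shows "\<exists>w. w \<noteq> 0 \<and> (\<forall>x. sol k 1 0 p x * sol' k 0 1 p x - sol' k 1 0 p x * sol k 0 1 p x = w)"
proof (rule airy_wronskian)
  fix w assume w: "w \<noteq> 0"
    "\<And>z. airy z * (cbrt_unity * airy' (cbrt_unity * z)) - airy' z * airy (cbrt_unity * z) = w"
  have "sol k 1 0 p x * sol' k 0 1 p x - sol' k 1 0 p x * sol k 0 1 p x = - \<i> * of_real (k\<^sup>2) * w" for x
    unfolding w(2)[of "of_real (k\<^sup>2) * (p - \<i> * x)", symmetric]
    by (simp add: sol_def sol'_def mode_def mode'_def algebra_simps)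
  thus ?thesis using w(1) assms by auto
qed

lemma sol_linear: "sol k a b p x = a * sol k 1 0 p x + b * sol k 0 1 p x"
  "sol' k a b p x = a * sol' k 1 0 p x + b * sol' k 0 1 p x"
  by (simp_all add: sol_def sol'_def algebra_simps)

lemma sol_nontrivial:
  assumes "k > 0" "a \<noteq> 0 \<or> b \<noteq> 0"
  shows "\<exists>x\<in>{-1<..<1::real}. sol k a b p (of_real x) \<noteq> 0"
proof (rule ccontr)
  assume "\<not> ?thesis"
  hence z: "sol k a b p (of_real x) = 0" if "x \<in> {-1<..<1}" for x using that by blast
  obtain w where w: "w \<noteq> 0"
    "\<And>x. sol k 1 0 p x * sol' k 0 1 p x - sol' k 1 0 p x * sol k 0 1 p x = w"
    using sol_wronskian[OF assms(1), of p] by blast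
  have "((\<lambda>x. sol k a b p (of_real x)) has_vector_derivative sol' k a b p (of_real 0)) (at (0::real))"
    by (rule has_vector_derivative_real_field) (rule sol_deriv)
  moreover have "((\<lambda>x. sol k a b p (of_real x)) has_vector_derivative 0) (at (0::real))"
    by (rule has_vector_derivative_transform_within_open[where S="{-1<..<1}" and f="\<lambda>_. 0"]) (auto simp: z)
  ultimately have z': "sol' k a b p (of_real 0) = 0" by (rule vector_derivative_unique_at)
  from z[of 0] have z0: "a * sol k 1 0 p 0 + b * sol k 0 1 p 0 = 0" by (subst sol_linear(1)[symmetric]) simp
  from z' have z1: "a * sol' k 1 0 p 0 + b * sol' k 0 1 p 0 = 0" by (subst sol_linear(2)[symmetric]) simp
  have "a * w = (a * sol k 1 0 p 0 + b * sol k 0 1 p 0) * sol' k 0 1 p 0 - (a * sol' k 1 0 p 0 + b * sol' k 0 1 p 0) * sol k 0 1 p 0"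
    by (subst w(2)[of 0, symmetric]) (simp add: algebra_simps)
  moreover have "b * w = (a * sol' k 1 0 p 0 + b * sol' k 0 1 p 0) * sol k 1 0 p 0 - (a * sol k 1 0 p 0 + b * sol k 0 1 p 0) * sol' k 1 0 p 0"
    by (subst w(2)[of 0, symmetric]) (simp add: algebra_simps)
  ultimately show False using w(1) assms(2) z0 z1 by simp
qed

text \<open>For the converse, a solution that satisfies the equation only inside the interval must
  be expressed by the fundamental system. Its Wronskians with both fundamental solutions are
  constant on the open interval, Cramer's rule then yields the coefficients, and continuity carries
  the identity to the end points.\<close>

lemma is_eigenvalue_iff_sol:
  assumes k: "k > 0"
  shows "is_eigenvalue (1 / k ^ 6) l \<longleftrightarrow>
    (\<exists>a b. (a \<noteq> 0 \<or> b \<noteq> 0) \<and> sol k a b (\<i> * l) (-1) = 0 \<and> sol k a b (\<i> * l) 1 = 0)"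
    (is "?L \<longleftrightarrow> ?R")
proof
  assume ?R
  then obtain a b where ab: "a \<noteq> 0 \<or> b \<noteq> 0" "sol k a b (\<i> * l) (-1) = 0" "sol k a b (\<i> * l) 1 = 0" by blast
  define y where "y = (\<lambda>x::real. sol k a b (\<i> * l) (of_real x))"
  define y' where "y' = (\<lambda>x::real. sol' k a b (\<i> * l) (of_real x))"
  define y'' where "y'' = (\<lambda>x::real. \<i> * of_real (k ^ 6) * (of_real x - l) * y x)"
  have d: "(y has_vector_derivative y' x) (at x)" for x
    unfolding y_def y'_def by (rule has_vector_derivative_real_field) (rule sol_deriv)
  have d': "(y' has_vector_derivative y'' x) (at x)" for x
    unfolding y_def y'_def y''_def by (rule has_vector_derivative_real_field) (rule sol'_deriv)
  have "continuous_on {-1..1} y"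
    by (intro continuous_at_imp_continuous_on ballI has_vector_derivative_continuous[OF d])
  moreover have "- \<i> * complex_of_real (1 / k ^ 6) * y'' x = (complex_of_real x - l) * y x" for x
    using k unfolding y''_def by simp
  moreover have "y (-1) = 0" "y 1 = 0" using ab by (auto simp: y_def)
  moreover have "\<exists>x\<in>{-1<..<1}. y x \<noteq> 0"
    unfolding y_def by (rule sol_nontrivial[OF k ab(1)])
  ultimately show ?L unfolding is_eigenvalue_def using d d' by blast
next
  assume ?L
  then obtain y y' y'' :: "real \<Rightarrow> complex" where
    cont: "continuous_on {-1..1} y" and
    d: "\<And>x. x \<in> {-1<..<1} \<Longrightarrow> (y has_vector_derivative y' x) (at x)" and
    d': "\<And>x. x \<in> {-1<..<1} \<Longrightarrow> (y' has_vector_derivative y'' x) (at x)" and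
    eq: "\<And>x. x \<in> {-1<..<1} \<Longrightarrow> - \<i> * complex_of_real (1 / k ^ 6) * y'' x = (complex_of_real x - l) * y x" and
    bc: "y (-1) = 0" "y 1 = 0" and nz: "\<exists>x\<in>{-1<..<1}. y x \<noteq> 0"
    unfolding is_eigenvalue_def by blast
  have y'': "y'' x = \<i> * of_real (k ^ 6) * (of_real x - l) * y x" if "x \<in> {-1<..<1}" for x
  proof -
    have "(\<i> * of_real (k ^ 6)) * (- \<i> * complex_of_real (1 / k ^ 6) * y'' x) = y'' x" using k by simp
    thus ?thesis unfolding eq[OF that] by (simp add: mult.assoc)
  qed
  define S where "S = (\<lambda>a b (x::real). sol k a b (\<i> * l) (of_real x))"
  define S' where "S' = (\<lambda>a b (x::real). sol' k a b (\<i> * l) (of_real x))"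
  have dS: "(S a b has_vector_derivative S' a b x) (at x)" for a b x
    unfolding S_def S'_def by (rule has_vector_derivative_real_field) (rule sol_deriv)
  have dS': "(S' a b has_vector_derivative \<i> * of_real (k ^ 6) * (of_real x - l) * S a b x) (at x)" for a b x
    unfolding S_def S'_def by (rule has_vector_derivative_real_field) (rule sol'_deriv)
  have W: "\<exists>c. \<forall>x\<in>{-1<..<1}. y x * S' a b x - y' x * S a b x = c" for a b
  proof (rule has_vector_derivative_zero_constant[of "{-1<..<1}" "\<lambda>x. y x * S' a b x - y' x * S a b x"])
    fix x :: real assume x: "x \<in> {-1<..<1}"
    have "((\<lambda>x. y x * S' a b x - y' x * S a b x) has_vector_derivative
      (y x * (\<i> * of_real (k ^ 6) * (of_real x - l) * S a b x) + y' x * S' a b x) -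
      (y' x * S' a b x + y'' x * S a b x)) (at x)"
      by (intro has_vector_derivative_diff has_vector_derivative_mult d d' dS dS' x)
    moreover have "(y x * (\<i> * of_real (k ^ 6) * (of_real x - l) * S a b x) + y' x * S' a b x) -
      (y' x * S' a b x + y'' x * S a b x) = 0"
      unfolding y''[OF x] by (simp add: algebra_simps)
    ultimately have "((\<lambda>x. y x * S' a b x - y' x * S a b x) has_vector_derivative 0) (at x)"
      by (simp only:)
    thus "((\<lambda>x. y x * S' a b x - y' x * S a b x) has_vector_derivative 0) (at x within {-1<..<1})"
      by (rule has_vector_derivative_at_within)
  qed auto
  obtain c1 where c1: "\<And>x. x \<in> {-1<..<1} \<Longrightarrow> y x * S' 0 1 x - y' x * S 0 1 x = c1" using W[of 0 1] by blast
  obtain c2 where c2: "\<And>x. x \<in> {-1<..<1} \<Longrightarrow> y x * S' 1 0 x - y' x * S 1 0 x = c2" using W[of 1 0] by blast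
  obtain w where w: "w \<noteq> 0"
    "\<And>x. sol k 1 0 (\<i> * l) x * sol' k 0 1 (\<i> * l) x - sol' k 1 0 (\<i> * l) x * sol k 0 1 (\<i> * l) x = w"
    using sol_wronskian[OF k, of "\<i> * l"] by blast
  define a where "a = c1 / w"
  define b where "b = - c2 / w"
  have yS: "y x = S a b x" if x: "x \<in> {-1<..<1}" for x
  proof -
    have "y x * w = S 1 0 x * c1 - S 0 1 x * c2"
      unfolding w(2)[of "of_real x", symmetric] c1[OF x, symmetric] c2[OF x, symmetric] S_def S'_def
      by (simp add: algebra_simps)
    hence "y x = (S 1 0 x * c1 - S 0 1 x * c2) / w" using w(1) by (simp add: field_simps)
    also have "\<dots> = S a b x"
      unfolding S_def by (subst sol_linear(1)[of k a b]) (simp add: a_def b_def diff_divide_distrib mult.commute)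
    finally show ?thesis .
  qed
  have yS': "y x = S a b x" if "x \<in> {-1..1}" for x
  proof -
    have "continuous_on {-1..1} (\<lambda>x. y x - S a b x)"
      by (intro continuous_on_diff cont continuous_at_imp_continuous_on ballI has_vector_derivative_continuous[OF dS])
    hence "continuous_on (closure {-1<..<1}) (\<lambda>x. y x - S a b x)" by simp
    from continuous_constant_on_closure[OF this, of 0 x] show ?thesis
      using that yS by auto
  qed
  have "a \<noteq> 0 \<or> b \<noteq> 0"
  proof (rule ccontr)
    assume "\<not> ?thesis"
    hence "S a b x = 0" for x by (simp add: S_def sol_def)
    thus False using nz yS by auto
  qed
  moreover have "sol k a b (\<i> * l) (-1) = 0" "sol k a b (\<i> * l) 1 = 0"
    using yS'[of "-1"] yS'[of 1] bc by (auto simp: S_def)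
  ultimately show ?R by blast
qed

lemma is_eigenvalue_iff_evans:
  assumes "k > 0"
  shows "is_eigenvalue (1 / k ^ 6) l \<longleftrightarrow> evans k (\<i> * l) = 0"
proof -
  have lin: "(\<exists>a b. (a \<noteq> 0 \<or> b \<noteq> 0) \<and> a * u1 + b * v1 = 0 \<and> a * u2 + b * v2 = 0) \<longleftrightarrow> u2 * v1 - u1 * v2 = 0"
    for u1 v1 u2 v2 :: complex
  proof
    assume "\<exists>a b. (a \<noteq> 0 \<or> b \<noteq> 0) \<and> a * u1 + b * v1 = 0 \<and> a * u2 + b * v2 = 0"
    then obtain a b where ab: "a \<noteq> 0 \<or> b \<noteq> 0" "a * u1 + b * v1 = 0" "a * u2 + b * v2 = 0" by blast
    have "a * (u2 * v1 - u1 * v2) = (a * u2 + b * v2) * v1 - (a * u1 + b * v1) * v2"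
      "b * (u2 * v1 - u1 * v2) = (a * u1 + b * v1) * u2 - (a * u2 + b * v2) * u1" by (simp_all add: algebra_simps)
    thus "u2 * v1 - u1 * v2 = 0" using ab by auto
  next
    assume eq: "u2 * v1 - u1 * v2 = 0"
    show "\<exists>a b. (a \<noteq> 0 \<or> b \<noteq> 0) \<and> a * u1 + b * v1 = 0 \<and> a * u2 + b * v2 = 0"
    proof (cases "u1 = 0 \<and> v1 = 0")
      case True
      show ?thesis
      proof (cases "u2 = 0 \<and> v2 = 0")
        case T: True
        show ?thesis by (rule exI[of _ 1], rule exI[of _ 0]) (use True T in auto)
      next
        case F: False
        show ?thesis by (rule exI[of _ v2], rule exI[of _ "- u2"]) (use True F in auto)
      qed
    next
      case False
      hence "(v1 \<noteq> 0 \<or> - u1 \<noteq> 0) \<and> v1 * u1 + - u1 * v1 = 0 \<and> v1 * u2 + - u1 * v2 = 0"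
        using eq by (auto simp: algebra_simps)
      thus ?thesis by blast
    qed
  qed
  show ?thesis unfolding is_eigenvalue_iff_sol[OF assms] sol_def lin evans_def by (simp add: algebra_simps)
qed

text \<open>Multiply the equation by the conjugate of y and integrate by parts. The real part says
  that \<open>k ^ 6 * Im l\<close> times the integral of the squared modulus of y, plus the integral
  of that of y', is 0; the imaginary part says that \<open>x - Re l\<close> has mean 0 against the
  squared modulus of y.\<close>

lemma eigenvalue_bounds:
  assumes k: "k > 0" and ev: "is_eigenvalue (1 / k ^ 6) l"
  shows "Im l < 0" "\<bar>Re l\<bar> < 1"
proof -
  obtain a b where ab: "a \<noteq> 0 \<or> b \<noteq> 0" "sol k a b (\<i> * l) (-1) = 0" "sol k a b (\<i> * l) 1 = 0"
    using ev is_eigenvalue_iff_sol[OF k] by blast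
  define y where "y = (\<lambda>x::real. sol k a b (\<i> * l) (of_real x))"
  define y' where "y' = (\<lambda>x::real. sol' k a b (\<i> * l) (of_real x))"
  have d: "(y has_vector_derivative y' x) (at x within S)" for x S
    unfolding y_def y'_def by (rule has_vector_derivative_real_field) (rule sol_deriv)
  have d': "(y' has_vector_derivative \<i> * of_real (k ^ 6) * (of_real x - l) * y x) (at x within S)" for x S
    unfolding y_def y'_def by (rule has_vector_derivative_real_field) (rule sol'_deriv)
  have bc: "y (-1) = 0" "y 1 = 0" using ab by (auto simp: y_def)
  have c: "continuous_on {-1..1} y" "continuous_on {-1..1} y'"
    by (rule continuous_on_vector_derivative[OF d]) (rule continuous_on_vector_derivative[OF d'])
  have nz: "\<exists>x\<in>{-1<..<1}. y x \<noteq> 0"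
    unfolding y_def by (rule sol_nontrivial[OF k ab(1)])
  \<comment> \<open>The derivative of \<open>y' * cnj y\<close>; its integral vanishes by the
    boundary conditions.\<close>
  define Q where "Q = (\<lambda>x. \<i> * of_real (k ^ 6) * (of_real x - l) * y x * cnj (y x) + y' x * cnj (y' x))"
  have "((\<lambda>x. y' x * cnj (y x)) has_vector_derivative Q x) (at x within S)" for x S
  proof -
    have "((\<lambda>x. cnj (y x)) has_vector_derivative cnj (y' x)) (at x within S)"
      by (rule has_vector_derivative_cnj[OF d])
    from has_vector_derivative_mult[OF d' this] show ?thesis by (simp add: Q_def add.commute)
  qed
  hence "(Q has_integral (y' 1 * cnj (y 1) - y' (-1) * cnj (y (-1)))) {-1..1}"
    by (intro fundamental_theorem_of_calculus) auto
  hence Q0: "(Q has_integral 0) {-1..1}" using bc by simp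
  have Qr: "Q x = \<i> * of_real (k ^ 6 * (norm (y x))\<^sup>2) * (of_real x - l) + of_real ((norm (y' x))\<^sup>2)" for x
    unfolding Q_def of_real_mult complex_norm_square by (simp add: mult_ac)
  have RQ: "Re (Q x) = k ^ 6 * (norm (y x))\<^sup>2 * Im l + (norm (y' x))\<^sup>2" for x
    unfolding Qr by simp
  have IQ: "Im (Q x) = k ^ 6 * (norm (y x))\<^sup>2 * (x - Re l)" for x
    unfolding Qr by simp
  have iR: "((\<lambda>x. k ^ 6 * (norm (y x))\<^sup>2 * Im l + (norm (y' x))\<^sup>2) has_integral 0) (cbox (-1) 1)"
    using has_integral_Re[OF Q0] unfolding RQ by simp
  have iI: "((\<lambda>x. k ^ 6 * (norm (y x))\<^sup>2 * (x - Re l)) has_integral 0) (cbox (-1) 1)"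
    using has_integral_Im[OF Q0] unfolding IQ by simp
  have k6: "k ^ 6 > 0" using k by simp
  show "Im l < 0"
  proof (rule ccontr)
    assume "\<not> Im l < 0"
    hence l: "Im l \<ge> 0" by simp
    have z: "k ^ 6 * (norm (y x))\<^sup>2 * Im l + (norm (y' x))\<^sup>2 = 0" if "x \<in> {-1..1}" for x
      by (rule has_integral_0_cbox_imp_0[OF _ _ iR])
         (use that l k6 c in \<open>auto intro!: continuous_intros add_nonneg_nonneg mult_nonneg_nonneg\<close>)
    have y'0: "y' x = 0" if "x \<in> {-1..1}" for x
    proof -
      have "0 \<le> k ^ 6 * (norm (y x))\<^sup>2 * Im l" using l k6 by (intro mult_nonneg_nonneg) auto
      hence "(norm (y' x))\<^sup>2 \<le> 0" using z[OF that] by linarith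
      thus ?thesis by simp
    qed
    have "\<exists>c. \<forall>x\<in>{-1..1}. y x = c"
    proof (rule has_vector_derivative_zero_constant[of "{-1..1}" y])
      fix x :: real assume "x \<in> {-1..1}"
      thus "(y has_vector_derivative 0) (at x within {-1..1})" using d[of x "{-1..1}"] y'0 by simp
    qed auto
    then obtain c where c: "\<And>x. x \<in> {-1..1} \<Longrightarrow> y x = c" by blast
    with c[of 1] bc have "y x = 0" if "x \<in> {-1..1}" for x using that by simp
    thus False using nz by auto
  qed
  show "\<bar>Re l\<bar> < 1"
  proof (rule ccontr)
    assume "\<not> \<bar>Re l\<bar> < 1"
    then consider "Re l \<ge> 1" | "Re l \<le> -1" by linarith
    hence y0: "y x = 0" if x: "x \<in> {-1<..<1}" for x
    proof cases
      case 1
      have "k ^ 6 * (norm (y x))\<^sup>2 * (Re l - x) = 0"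
      proof (rule has_integral_0_cbox_imp_0[where a="-1::real" and b=1 and f="\<lambda>x. k ^ 6 * (norm (y x))\<^sup>2 * (Re l - x)"])
        show "((\<lambda>x. k ^ 6 * (norm (y x))\<^sup>2 * (Re l - x)) has_integral 0) (cbox (-1) 1)"
          using has_integral_neg[OF iI] by (simp add: algebra_simps)
      qed (use x 1 k6 c in \<open>auto intro!: continuous_intros mult_nonneg_nonneg\<close>)
      thus ?thesis using k6 x 1 by simp
    next
      case 2
      have "k ^ 6 * (norm (y x))\<^sup>2 * (x - Re l) = 0"
        by (rule has_integral_0_cbox_imp_0[OF _ _ iI])
          (use x 2 k6 c in \<open>auto intro!: continuous_intros mult_nonneg_nonneg\<close>)
      thus ?thesis using k6 x 2 by simp
    qed
    show False using nz y0 by blast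
  qed
qed

lemma evans_zero_bounds:
  assumes "k > 0" "evans k p = 0"
  shows "Re p > 0" "\<bar>Im p\<bar> < 1"
proof -
  have "is_eigenvalue (1 / k ^ 6) (- \<i> * p)"
    using is_eigenvalue_iff_evans[OF assms(1), of "- \<i> * p"] assms(2) by simp
  from eigenvalue_bounds[OF assms(1) this] show "Re p > 0" "\<bar>Im p\<bar> < 1" by auto
qed

subsection \<open>Counting and locating zeros of holomorphic functions\<close>

lemma holomorphic_divide_zeros:
  assumes "f holomorphic_on S" "open S" "finite Z" "Z \<subseteq> S" "\<And>z. z \<in> Z \<Longrightarrow> f z = 0"
  shows "\<exists>g. g holomorphic_on S \<and> (\<forall>z\<in>S. f z = (\<Prod>w\<in>Z. z - w) * g z)"
  using assms(3-5)
proof (induction Z rule: finite_induct)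
  case empty
  thus ?case using assms(1) by auto
next
  case (insert a Z)
  then obtain g where g: "g holomorphic_on S" "\<And>z. z \<in> S \<Longrightarrow> f z = (\<Prod>w\<in>Z. z - w) * g z" by auto
  have "a \<in> S" using insert by auto
  have "(\<Prod>w\<in>Z. a - w) \<noteq> 0" using insert by auto
  hence ga: "g a = 0" using g(2)[OF \<open>a \<in> S\<close>] insert.prems by auto
  define q where "q = (\<lambda>z. if z = a then deriv g a else (g z - g a) / (z - a))"
  have "q holomorphic_on S"
    unfolding q_def using \<open>a \<in> S\<close> assms(2) by (intro pole_lemma g) (simp add: interior_open)
  moreover have "f z = (\<Prod>w\<in>insert a Z. z - w) * q z" if "z \<in> S" for z
    using g(2)[OF that] insert.hyps ga by (auto simp: q_def)
  ultimately show ?case by blast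
qed

text \<open>
  A crude form of Jensen's inequality: dividing out the zeros costs at least a factor \<open>2\<close>
  per zero by the maximum principle.
\<close>

lemma card_zeros_le:
  assumes f: "f holomorphic_on S" "open S" "cball c (3 * r) \<subseteq> S" and r: "r > 0"
    and M: "\<And>z. z \<in> cball c (3 * r) \<Longrightarrow> norm (f z) \<le> M" and c: "M < norm (f c) * 2 ^ Suc N"
  shows "finite {z \<in> cball c r. f z = 0} \<and> card {z \<in> cball c r. f z = 0} \<le> N"
proof (rule finite_if_finite_subsets_card_bdd)
  fix Z assume Z: "Z \<subseteq> {z \<in> cball c r. f z = 0}" "finite Z"
  have "cball c r \<subseteq> cball c (3 * r)" using r by (intro subset_cball) auto
  hence "Z \<subseteq> S" using Z f(3) by blast
  then obtain g where g: "g holomorphic_on S" "\<And>z. z \<in> S \<Longrightarrow> f z = (\<Prod>w\<in>Z. z - w) * g z"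
    using holomorphic_divide_zeros[OF f(1,2) Z(2)] Z(1) by blast
  let ?n = "card Z"
  have "norm (g z) \<le> M / (2 * r) ^ ?n" if z: "z \<in> frontier (cball c (3 * r))" for z
  proof -
    have z': "dist c z = 3 * r" using z r by auto
    have "z \<in> S" using z' f(3) by auto
    have "(2 * r) ^ ?n = (\<Prod>w\<in>Z. 2 * r)" by simp
    also have "\<dots> \<le> (\<Prod>w\<in>Z. norm (z - w))"
    proof (rule prod_mono)
      fix w assume "w \<in> Z"
      hence "dist c w \<le> r" using Z by auto
      moreover have "dist c z \<le> dist c w + dist w z" by (rule dist_triangle)
      ultimately show "0 \<le> 2 * r \<and> 2 * r \<le> norm (z - w)" using z' r by (simp add: dist_norm norm_minus_commute)
    qed
    finally have le: "(2 * r) ^ ?n \<le> norm (\<Prod>w\<in>Z. z - w)" by (simp add: prod_norm)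
    have "(2 * r) ^ ?n * norm (g z) \<le> norm (\<Prod>w\<in>Z. z - w) * norm (g z)"
      using le by (intro mult_right_mono) auto
    also have "\<dots> = norm (f z)" using g(2)[OF \<open>z \<in> S\<close>] by (simp add: norm_mult)
    also have "\<dots> \<le> M" using M[of z] z' by simp
    finally show ?thesis using r by (simp add: field_simps)
  qed
  hence gc: "norm (g c) \<le> M / (2 * r) ^ ?n"
  proof (rule maximum_modulus_frontier[of g "cball c (3 * r)", rotated 3])
    show "g holomorphic_on interior (cball c (3 * r))"
      by (rule holomorphic_on_subset[OF g(1)]) (use f(3) interior_subset in blast)
    show "continuous_on (closure (cball c (3 * r))) g"
      using holomorphic_on_imp_continuous_on[OF holomorphic_on_subset[OF g(1) f(3)]] by simp
  qed (use r in auto)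
  have "norm (f c) = (\<Prod>w\<in>Z. norm (c - w)) * norm (g c)"
  proof -
    have "c \<in> S" using f(3) r by auto
    thus ?thesis unfolding prod_norm g(2)[OF \<open>c \<in> S\<close>] by (simp add: norm_mult)
  qed
  also have "\<dots> \<le> r ^ ?n * (M / (2 * r) ^ ?n)"
  proof (rule mult_mono)
    have "(\<Prod>w\<in>Z. norm (c - w)) \<le> (\<Prod>w\<in>Z. r)"
      using Z by (intro prod_mono) (auto simp: dist_norm)
    thus "(\<Prod>w\<in>Z. norm (c - w)) \<le> r ^ ?n" by simp
  qed (use gc r in auto)
  also have "\<dots> = M / 2 ^ ?n" using r by (simp add: power_mult_distrib)
  finally have "norm (f c) * 2 ^ ?n \<le> M" by (simp add: field_simps)
  hence "norm (f c) * 2 ^ ?n < norm (f c) * 2 ^ Suc N" using c by linarith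
  hence "(2::real) ^ ?n < 2 ^ Suc N" by (simp add: mult_less_cancel_left)
  hence "?n < Suc N" by (rule power_less_imp_less_exp[rotated]) simp
  thus "?n \<le> N" by simp
qed

text \<open>A single N serves all x from m on, so the number of exceptional zeros can be bounded
  independently of k.\<close>

lemma ex_finite_card_bound:
  fixes M m :: real
  assumes "m > 0"
  obtains N :: nat where "\<And>x. x \<ge> m \<Longrightarrow> M < x * 2 ^ Suc N"
proof -
  obtain N where N: "M / m < 2 ^ N" using real_arch_pow[of 2 "M / m"] by auto
  have "M < x * 2 ^ Suc N" if "x \<ge> m" for x
  proof -
    have "M < m * 2 ^ N" using N assms by (simp add: field_simps)
    also have "\<dots> \<le> x * 2 ^ Suc N" using that assms by (intro mult_mono) auto
    finally show ?thesis .
  qed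
  thus ?thesis using that by blast
qed

lemma exp_eq_one_plus_small:
  fixes W :: complex
  assumes "exp (2 * \<i> * W) = 1 + e" "norm e < 1/2"
  shows "\<exists>n::int. norm (W - of_real (pi * of_int n)) \<le> norm e"
proof -
  have "1 + e \<noteq> 0"
  proof
    assume "1 + e = 0"
    hence "e = -1" by (simp add: add_eq_0_iff)
    thus False using assms(2) by simp
  qed
  hence "exp (2 * \<i> * W) = exp (Ln (1 + e))" using assms(1) by simp
  then obtain n :: int where n: "2 * \<i> * W = Ln (1 + e) + (of_int (2 * n) * pi) * \<i>"
    unfolding exp_eq by blast
  have "2 * \<i> * (W - of_real (pi * of_int n)) = Ln (1 + e)"
    using n by (simp add: algebra_simps)
  hence "2 * norm (W - of_real (pi * of_int n)) = norm (Ln (1 + e))"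
    by (metis norm_mult norm_ii mult_1_right norm_numeral)
  also have "\<dots> \<le> 2 * norm e" by (rule norm_Ln_le[OF assms(2)])
  finally show ?thesis by auto
qed

lemma unique_perturbed_zero:
  fixes Y Y' \<eta> :: "complex \<Rightarrow> complex"
  assumes d: "d \<noteq> 0"
    and Y: "\<And>z. z \<in> ball p0 (1 / norm d) \<Longrightarrow> (Y has_field_derivative Y' z) (at z)"
    and Y': "\<And>z. z \<in> ball p0 (1 / norm d) \<Longrightarrow> norm (Y' z - d) \<le> norm d / 4"
    and \<eta>: "\<eta> holomorphic_on ball p0 (1 / norm d)"
    and small: "\<And>z. z \<in> ball p0 (1 / norm d) \<Longrightarrow> norm (\<eta> z) \<le> 1 / 16"
  shows "\<exists>!z. z \<in> cball p0 (1 / (2 * norm d)) \<and> exp (2 * \<i> * (Y z - Y p0)) = 1 + \<eta> z"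
    and "\<And>z. z \<in> cball p0 (1 / (2 * norm d)) \<Longrightarrow> norm (Y z - Y p0) \<le> 5 / 8"
proof -
  define \<rho> where "\<rho> = 1 / norm d"
  have \<rho>: "\<rho> > 0" "norm d * \<rho> = 1" "1 / norm d = \<rho>" using d by (auto simp: \<rho>_def)
  have \<rho>2: "1 / (2 * norm d) = \<rho> / 2" by (simp add: \<rho>_def)
  have sub: "cball p0 (\<rho> / 2) \<subseteq> ball p0 \<rho>" using \<rho> by (auto simp: subset_iff)
  have p0: "p0 \<in> cball p0 (\<rho> / 2)" using \<rho> by simp
  note Y = Y[unfolded \<rho>(3)] and Y' = Y'[unfolded \<rho>(3)] and \<eta> = \<eta>[unfolded \<rho>(3)] and small = small[unfolded \<rho>(3)]
  define E where "E = (\<lambda>z. \<i> / 2 * Ln (1 + \<eta> z))"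
  have nz: "1 + \<eta> z \<notin> \<real>\<^sub>\<le>\<^sub>0" if "z \<in> ball p0 \<rho>" for z
  proof -
    have "\<bar>Re (\<eta> z)\<bar> \<le> 1 / 16" using small[OF that] abs_Re_le_cmod[of "\<eta> z"] by linarith
    thus ?thesis by (auto simp: complex_nonpos_Reals_iff)
  qed
  have E_holo: "E holomorphic_on ball p0 \<rho>"
    unfolding E_def using nz by (intro holomorphic_intros \<eta>) auto
  have E_le: "norm (E z) \<le> 1 / 16" if "z \<in> ball p0 \<rho>" for z
  proof -
    have "norm (Ln (1 + \<eta> z)) \<le> 2 * norm (\<eta> z)" using small[OF that] by (intro norm_Ln_le) auto
    thus ?thesis using small[OF that] by (simp add: E_def norm_mult norm_divide)
  qed
  have E_deriv: "norm (deriv E z) \<le> norm d / 4" if z: "z \<in> cball p0 (\<rho> / 2)" for z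
  proof -
    have s: "cball z (\<rho> / 4) \<subseteq> ball p0 \<rho>"
    proof
      fix x assume "x \<in> cball z (\<rho> / 4)"
      thus "x \<in> ball p0 \<rho>" using z dist_triangle[of p0 x z] \<rho> by (auto simp: dist_commute)
    qed
    \<comment> \<open>Only the size of \<eta> is assumed, so the derivative of E comes from Cauchy's
      estimate on radius \<open>\<rho> / 4\<close>. This is why the hypotheses concern a disc twice
      as large as the one in the conclusion.\<close>
    have "norm ((deriv ^^ 1) E z) \<le> fact 1 * (1 / 16) / (\<rho> / 4) ^ 1"
    proof (rule Cauchy_inequality)
      show "E holomorphic_on ball z (\<rho> / 4)"
        using E_holo s ball_subset_cball by (meson holomorphic_on_subset subset_trans)
      show "continuous_on (cball z (\<rho> / 4)) E"
        by (rule holomorphic_on_imp_continuous_on[OF holomorphic_on_subset[OF E_holo s]])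
      show "norm (E x) \<le> 1 / 16" if "norm (z - x) = \<rho> / 4" for x
        using s that by (intro E_le) (auto simp: dist_norm subset_iff)
    qed (use \<rho> in auto)
    also have "fact 1 * (1 / 16) / (\<rho> / 4) ^ 1 = norm d / 4" using d by (simp add: \<rho>_def)
    finally show ?thesis by simp
  qed
  have Y_le: "norm (Y z - Y p0) \<le> 5 / 4 * norm d * norm (z - p0)" if z: "z \<in> cball p0 (\<rho> / 2)" for z
  proof (rule field_differentiable_bound[OF convex_cball _ _ z p0])
    fix x assume "x \<in> cball p0 (\<rho> / 2)"
    hence x: "x \<in> ball p0 \<rho>" using sub by blast
    show "(Y has_field_derivative Y' x) (at x within cball p0 (\<rho> / 2))"
      by (rule has_field_derivative_at_within[OF Y[OF x]])
    show "norm (Y' x) \<le> 5 / 4 * norm d"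
      using Y'[OF x] norm_triangle_sub[of "Y' x" d] by simp
  qed
  have Y_le': "norm (Y z - Y p0) \<le> 5 / 8" if z: "z \<in> cball p0 (\<rho> / 2)" for z
  proof -
    have "5 / 4 * norm d * norm (z - p0) \<le> 5 / 4 * norm d * (\<rho> / 2)"
      using z by (intro mult_left_mono) (auto simp: dist_norm norm_minus_commute)
    also have "\<dots> = 5 / 8" using \<rho>(2) by simp
    finally show ?thesis using Y_le[OF z] by linarith
  qed
  show "norm (Y z - Y p0) \<le> 5 / 8" if "z \<in> cball p0 (1 / (2 * norm d))" for z
    using Y_le' that unfolding \<rho>2 by blast
  define \<Phi> where "\<Phi> = (\<lambda>z. z - (Y z - Y p0 + E z) / d)"
  have \<Phi>_deriv: "(\<Phi> has_field_derivative (1 - (Y' z + deriv E z) / d)) (at z)" if "z \<in> ball p0 \<rho>" for z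
    unfolding \<Phi>_def using d Y[OF that] holomorphic_derivI[OF E_holo _ that]
    by (auto intro!: derivative_eq_intros simp: field_simps)
  \<comment> \<open>The slope error of Y and the derivative of E contribute at most 1/4
    each.\<close>
  have lip: "norm (\<Phi> x - \<Phi> y) \<le> 1 / 2 * norm (x - y)" if "x \<in> cball p0 (\<rho> / 2)" "y \<in> cball p0 (\<rho> / 2)" for x y
  proof (rule field_differentiable_bound[OF convex_cball _ _ that])
    fix z assume z: "z \<in> cball p0 (\<rho> / 2)"
    hence z': "z \<in> ball p0 \<rho>" using sub by blast
    show "(\<Phi> has_field_derivative (1 - (Y' z + deriv E z) / d)) (at z within cball p0 (\<rho> / 2))"
      by (rule has_field_derivative_at_within[OF \<Phi>_deriv[OF z']])
    have "1 - (Y' z + deriv E z) / d = - ((Y' z - d) + deriv E z) / d" using d by (simp add: field_simps)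
    also have "norm \<dots> \<le> (norm d / 4 + norm d / 4) / norm d"
      unfolding norm_divide norm_minus_cancel
      by (intro divide_right_mono order.trans[OF norm_triangle_ineq] add_mono Y'[OF z'] E_deriv[OF z]) auto
    also have "\<dots> = 1 / 2" using d by simp
    finally show "norm (1 - (Y' z + deriv E z) / d) \<le> 1 / 2" .
  qed
  \<comment> \<open>The centre moves by at most \<open>\<rho> / 16\<close>, and the contraction adds
    at most \<open>\<rho> / 4\<close>.\<close>
  have img: "\<Phi> z \<in> cball p0 (\<rho> / 2)" if z: "z \<in> cball p0 (\<rho> / 2)" for z
  proof -
    have "\<Phi> p0 - p0 = - E p0 / d" by (simp add: \<Phi>_def)
    hence "norm (\<Phi> p0 - p0) = norm (E p0) / norm d" by (simp add: norm_divide)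
    also have "\<dots> \<le> (1 / 16) / norm d" using E_le[of p0] \<rho> by (intro divide_right_mono) auto
    also have "\<dots> = \<rho> / 16" by (simp add: \<rho>_def)
    finally have 1: "norm (\<Phi> p0 - p0) \<le> \<rho> / 16" .
    have 2: "norm (\<Phi> z - \<Phi> p0) \<le> 1 / 2 * norm (z - p0)" by (rule lip[OF z p0])
    have "norm (z - p0) \<le> \<rho> / 2" using z by (simp add: dist_norm norm_minus_commute)
    with 1 2 have "norm (\<Phi> z - p0) \<le> \<rho> / 2"
      using norm_triangle_ineq[of "\<Phi> z - \<Phi> p0" "\<Phi> p0 - p0"] \<rho> by simp
    thus ?thesis by (simp add: dist_norm norm_minus_commute)
  qed
  have "\<exists>!z\<in>cball p0 (\<rho> / 2). \<Phi> z = z"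
  proof (rule Banach_fix[where c="1/2"])
    show "\<Phi> ` cball p0 (\<rho> / 2) \<subseteq> cball p0 (\<rho> / 2)" using img by (rule image_subsetI)
    show "dist (\<Phi> x) (\<Phi> y) \<le> 1 / 2 * dist x y" if "x \<in> cball p0 (\<rho> / 2)" "y \<in> cball p0 (\<rho> / 2)" for x y
      using lip[OF that] by (simp only: dist_norm)
    show "cball p0 (\<rho> / 2) \<noteq> {}" using p0 by blast
  qed (simp_all add: complete_eq_closed)
  moreover have "\<Phi> z = z \<longleftrightarrow> exp (2 * \<i> * (Y z - Y p0)) = 1 + \<eta> z" if z: "z \<in> cball p0 (\<rho> / 2)" for z
  proof -
    have "\<Phi> z = z \<longleftrightarrow> Y z - Y p0 + E z = 0" using d by (auto simp: \<Phi>_def)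
    also have "\<dots> \<longleftrightarrow> 2 * \<i> * (Y z - Y p0) = Ln (1 + \<eta> z)"
    proof -
      have "2 * \<i> * (Y z - Y p0 + E z) = 2 * \<i> * (Y z - Y p0) - Ln (1 + \<eta> z)"
        by (simp add: E_def algebra_simps)
      thus ?thesis
        by (metis complex_i_not_zero eq_iff_diff_eq_0 mult_eq_0_iff zero_neq_numeral)
    qed
    also have "\<dots> \<longleftrightarrow> exp (2 * \<i> * (Y z - Y p0)) = 1 + \<eta> z"
    proof
      assume "2 * \<i> * (Y z - Y p0) = Ln (1 + \<eta> z)"
      hence "exp (2 * \<i> * (Y z - Y p0)) = exp (Ln (1 + \<eta> z))" by (simp only:)
      also have "\<dots> = 1 + \<eta> z" using nz[of z] sub z by (subst exp_Ln) auto
      finally show "exp (2 * \<i> * (Y z - Y p0)) = 1 + \<eta> z" .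
    next
      assume e: "exp (2 * \<i> * (Y z - Y p0)) = 1 + \<eta> z"
      \<comment> \<open>The bound 5/4 is below pi, so the principal logarithm inverts the
        exponential here.\<close>
      have "\<bar>Im (2 * \<i> * (Y z - Y p0))\<bar> \<le> 2 * norm (Y z - Y p0)"
        using abs_Re_le_cmod[of "Y z - Y p0"] by simp
      also have "\<dots> \<le> 5 / 4" using Y_le'[OF z] by simp
      also have "\<dots> < pi" using pi_gt3 by simp
      finally have "Ln (exp (2 * \<i> * (Y z - Y p0))) = 2 * \<i> * (Y z - Y p0)"
        by (intro Ln_exp) auto
      thus "2 * \<i> * (Y z - Y p0) = Ln (1 + \<eta> z)" unfolding e by simp
    qed
    finally show ?thesis .
  qed
  ultimately show "\<exists>!z. z \<in> cball p0 (1 / (2 * norm d)) \<and> exp (2 * \<i> * (Y z - Y p0)) = 1 + \<eta> z"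
    unfolding \<rho>2 by blast
qed

subsection \<open>Asymptotics of the Evans function\<close>

definition airy_const :: real where
  "airy_const = (SOME C. C > 0 \<and> (\<forall>s. s \<noteq> 0 \<longrightarrow> Re s \<ge> norm s / 4 \<longrightarrow>
       norm (csqrt s * (exp (2 * s ^ 3 / 3) * airy (s\<^sup>2)) - of_real C) \<le> 6 * sqrt (norm s) / (norm s)\<^sup>2))"

lemma airy_const:
  "airy_const > 0"
  "s \<noteq> 0 \<Longrightarrow> Re s \<ge> norm s / 4 \<Longrightarrow>
       norm (csqrt s * (exp (2 * s ^ 3 / 3) * airy (s\<^sup>2)) - of_real airy_const) \<le> 6 * sqrt (norm s) / (norm s)\<^sup>2"
proof -
  have "airy_const > 0 \<and> (\<forall>s. s \<noteq> 0 \<longrightarrow> Re s \<ge> norm s / 4 \<longrightarrow>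
       norm (csqrt s * (exp (2 * s ^ 3 / 3) * airy (s\<^sup>2)) - of_real airy_const) \<le> 6 * sqrt (norm s) / (norm s)\<^sup>2)"
    unfolding airy_const_def
  proof (rule someI_ex, rule airy_asymptotics)
    fix C :: real
    assume "C > 0" "\<And>s. s \<noteq> 0 \<Longrightarrow> Re s \<ge> norm s / 4 \<Longrightarrow>
       norm (csqrt s * (exp (2 * s ^ 3 / 3) * airy (s\<^sup>2)) - of_real C) \<le> 6 * sqrt (norm s) / (norm s)\<^sup>2"
    thus "\<exists>C>0. \<forall>s. s \<noteq> 0 \<longrightarrow> Re s \<ge> norm s / 4 \<longrightarrow>
       norm (csqrt s * (exp (2 * s ^ 3 / 3) * airy (s\<^sup>2)) - of_real C) \<le> 6 * sqrt (norm s) / (norm s)\<^sup>2"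
      by (intro exI[of _ C]) simp
  qed
  thus "airy_const > 0"
  "s \<noteq> 0 \<Longrightarrow> Re s \<ge> norm s / 4 \<Longrightarrow>
       norm (csqrt s * (exp (2 * s ^ 3 / 3) * airy (s\<^sup>2)) - of_real airy_const) \<le> 6 * sqrt (norm s) / (norm s)\<^sup>2"
    by simp_all
qed

text \<open>The quotient of the Airy function by its leading WKB form, in the variable s whose
  square is the argument. It is an exact quantity; the asymptotics enter only as its closeness to 1
  in the sector of \<open>airy_const\<close>.\<close>

definition airy_amp :: "complex \<Rightarrow> complex" where
  "airy_amp s = csqrt s * (exp (2 * s ^ 3 / 3) * airy (s\<^sup>2)) / of_real airy_const"

lemma airy_amp_near_1:
  assumes "\<kappa> > 0"
  obtains R where "R \<ge> 1" "\<And>s. norm s \<ge> R \<Longrightarrow> Re s \<ge> norm s / 4 \<Longrightarrow> norm (airy_amp s - 1) \<le> \<kappa>"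
proof
  define R where "R = max 1 (6 / (airy_const * \<kappa>))"
  show "R \<ge> 1" by (simp add: R_def)
  fix s :: complex assume s: "norm s \<ge> R" "Re s \<ge> norm s / 4"
  have ns: "norm s \<ge> 1" using s(1) \<open>R \<ge> 1\<close> by linarith
  hence "s \<noteq> 0" by auto
  have "airy_amp s - 1 = (csqrt s * (exp (2 * s ^ 3 / 3) * airy (s\<^sup>2)) - of_real airy_const) / of_real airy_const"
    using airy_const(1) by (simp add: airy_amp_def diff_divide_distrib)
  hence "norm (airy_amp s - 1) = norm (csqrt s * (exp (2 * s ^ 3 / 3) * airy (s\<^sup>2)) - of_real airy_const) / airy_const"
    using airy_const(1) by (simp add: norm_divide)
  also have "\<dots> \<le> (6 * sqrt (norm s) / (norm s)\<^sup>2) / airy_const"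
    using airy_const by (intro divide_right_mono airy_const(2) \<open>s \<noteq> 0\<close> s) auto
  also have "\<dots> \<le> (6 * norm s / (norm s)\<^sup>2) / airy_const"
  proof -
    have "sqrt (norm s) \<le> norm s"
      using ns mult_left_mono[of 1 "norm s" "norm s"] by (intro real_le_lsqrt) (auto simp: power2_eq_square)
    thus ?thesis using airy_const(1) by (intro divide_right_mono mult_left_mono) auto
  qed
  also have "\<dots> = 6 / (airy_const * norm s)" using ns by (simp add: power2_eq_square field_simps)
  also have "\<dots> \<le> \<kappa>"
  proof -
    have "6 / (airy_const * \<kappa>) \<le> norm s" using s(1) by (simp add: R_def)
    hence "6 \<le> norm s * (airy_const * \<kappa>)"
      using airy_const(1) assms by (subst (asm) pos_divide_le_eq) auto
    moreover have "0 < airy_const * norm s" using airy_const(1) ns by (intro mult_pos_pos) auto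
    ultimately show ?thesis by (subst pos_divide_le_eq) (auto simp: mult_ac)
  qed
  finally show "norm (airy_amp s - 1) \<le> \<kappa>" .
qed

lemma airy_eq_amp:
  assumes "s \<noteq> 0"
  shows "airy (s\<^sup>2) = of_real airy_const * airy_amp s * exp (- (2 * s ^ 3 / 3)) / csqrt s"
  using assms airy_const(1) by (simp add: airy_amp_def exp_minus field_simps)

lemma airy_amp_holomorphic: "airy_amp holomorphic_on {s. Re s > 0}"
proof -
  have "(\<lambda>s. airy (s\<^sup>2)) holomorphic_on {s. Re s > 0}"
    using holomorphic_on_compose[OF _ airy_holomorphic, of "\<lambda>s. s\<^sup>2" "{s. Re s > 0}"]
    by (simp add: o_def holomorphic_on_power)
  thus ?thesis
    unfolding airy_amp_def[abs_def] using airy_const(1)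
    by (intro holomorphic_intros) (auto simp: complex_nonpos_Reals_iff)
qed

definition twelfth_root :: complex where
  "twelfth_root = Complex (sqrt 3 / 2) (1/2)"

lemma twelfth_root_square: "twelfth_root\<^sup>2 = sixth_root"
  by (simp add: twelfth_root_def sixth_root_def complex_eq_iff power2_eq_square)

lemma twelfth_root_nonzero: "twelfth_root \<noteq> 0"
  by (simp add: twelfth_root_def complex_eq_iff)

lemma csqrt_Re_gt_Im:
  assumes "Re z > 0"
  shows "\<bar>Im (csqrt z)\<bar> < Re (csqrt z)"
proof -
  have "z = (csqrt z)\<^sup>2" by simp
  hence "Re z = (Re (csqrt z))\<^sup>2 - (Im (csqrt z))\<^sup>2" by (metis Re_power2)
  hence "(Im (csqrt z))\<^sup>2 < (Re (csqrt z))\<^sup>2" using assms by linarith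
  thus ?thesis using Re_csqrt[of z] by (metis abs_of_nonneg power2_less_imp_less power2_abs)
qed

text \<open>The principal root is multiplicative here: the argument of \<open>csqrt w\<close> is
  below pi / 4 in modulus, and a rotation by pi / 6 keeps it in the right half plane.\<close>

lemma csqrt_sixth_root:
  assumes "Re w > 0"
  shows "csqrt (sixth_root * w) = twelfth_root * csqrt w"
    "csqrt (cnj sixth_root * w) = cnj twelfth_root * csqrt w"
proof -
  define x y where "x = Re (csqrt w)" and "y = Im (csqrt w)"
  have xy: "\<bar>y\<bar> < x" using csqrt_Re_gt_Im[OF assms] by (simp add: x_def y_def)
  have "1 * x \<le> sqrt 3 * x" using xy by (intro mult_right_mono) auto
  hence "y < sqrt 3 * x" "- y < sqrt 3 * x" using xy by linarith+
  hence pos: "Re (twelfth_root * csqrt w) > 0" "Re (cnj twelfth_root * csqrt w) > 0"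
    by (simp_all add: twelfth_root_def x_def y_def)
  show "csqrt (sixth_root * w) = twelfth_root * csqrt w"
    using pos by (intro csqrt_unique) (simp_all add: power_mult_distrib twelfth_root_square)
  show "csqrt (cnj sixth_root * w) = cnj twelfth_root * csqrt w"
    using pos by (intro csqrt_unique) (simp_all add: power_mult_distrib twelfth_root_square flip: complex_cnj_power)
qed

definition phase :: "complex \<Rightarrow> complex" where
  "phase z = 2 / 3 * csqrt z ^ 3"

text \<open>Exact identities. The roots of the rotated arguments are \<open>sixth_root * s\<close>
  and \<open>cnj sixth_root * s\<close>, whose cubes are \<open>- s ^ 3\<close>; hence both rotated
  solutions carry the exponential opposite to that of the first one.\<close>

lemma mode_amp:
  assumes k: "k > 0" and S: "Re (csqrt z) > 0"
  shows "mode k 1 z = of_real airy_const * airy_amp (of_real k * csqrt z) *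
           exp (- (of_real (k ^ 3) * phase z)) / csqrt (of_real k * csqrt z)"
    "mode k cbrt_unity z = of_real airy_const * airy_amp (sixth_root * (of_real k * csqrt z)) *
           exp (of_real (k ^ 3) * phase z) / (twelfth_root * csqrt (of_real k * csqrt z))"
    "mode k (cbrt_unity\<^sup>2) z = of_real airy_const * airy_amp (cnj sixth_root * (of_real k * csqrt z)) *
           exp (of_real (k ^ 3) * phase z) / (cnj twelfth_root * csqrt (of_real k * csqrt z))"
proof -
  let ?s = "of_real k * csqrt z"
  have s: "?s \<noteq> 0" "Re ?s > 0" using k S by auto
  have sq: "?s\<^sup>2 = of_real (k\<^sup>2) * z" by (simp add: power_mult_distrib)
  have cube: "2 * ?s ^ 3 / 3 = of_real (k ^ 3) * phase z"
    by (simp add: power_mult_distrib phase_def)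
  have nz: "sixth_root \<noteq> 0" using norm_sixth_root by auto
  have cc: "(cnj sixth_root)\<^sup>2 = cbrt_unity\<^sup>2" "(cnj sixth_root) ^ 3 = - 1"
    unfolding complex_cnj_power[symmetric] sixth_root_square sixth_root_cube
    by (simp_all add: cbrt_unity_def complex_eq_iff power2_eq_square)
  show "mode k 1 z = of_real airy_const * airy_amp (of_real k * csqrt z) *
           exp (- (of_real (k ^ 3) * phase z)) / csqrt (of_real k * csqrt z)"
    using airy_eq_amp[OF s(1)] unfolding sq cube by (simp add: mode_def)
  have "(sixth_root * ?s)\<^sup>2 = cbrt_unity * (of_real (k\<^sup>2) * z)"
    unfolding power_mult_distrib[of sixth_root] sixth_root_square sq ..
  moreover have "2 * (sixth_root * ?s) ^ 3 / 3 = - (of_real (k ^ 3) * phase z)"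
    unfolding power_mult_distrib[of sixth_root] sixth_root_cube cube[symmetric] by simp
  ultimately show "mode k cbrt_unity z = of_real airy_const * airy_amp (sixth_root * (of_real k * csqrt z)) *
           exp (of_real (k ^ 3) * phase z) / (twelfth_root * csqrt (of_real k * csqrt z))"
    using airy_eq_amp[of "sixth_root * ?s"] s nz csqrt_sixth_root(1)[OF s(2)] by (simp add: mode_def)
  have "(cnj sixth_root * ?s)\<^sup>2 = cbrt_unity\<^sup>2 * (of_real (k\<^sup>2) * z)"
    unfolding power_mult_distrib[of "cnj sixth_root"] cc sq ..
  moreover have "2 * (cnj sixth_root * ?s) ^ 3 / 3 = - (of_real (k ^ 3) * phase z)"
    unfolding power_mult_distrib[of "cnj sixth_root"] cc cube[symmetric] by simp
  ultimately show "mode k (cbrt_unity\<^sup>2) z = of_real airy_const * airy_amp (cnj sixth_root * (of_real k * csqrt z)) *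
           exp (of_real (k ^ 3) * phase z) / (cnj twelfth_root * csqrt (of_real k * csqrt z))"
    using airy_eq_amp[of "cnj sixth_root * ?s"] s nz csqrt_sixth_root(2)[OF s(2)] by (simp add: mode_def)
qed

text \<open>For z in the upper half plane \<open>sixth_root * csqrt z\<close> can leave the sector
  of the asymptotics, while \<open>cnj sixth_root * csqrt z\<close> stays inside. At
  \<open>p + \<i>\<close> the second solution is therefore rewritten by two functions with
  controlled amplitudes.\<close>

lemma mode_connection:
  "mode k cbrt_unity z = - cbrt_unity\<^sup>2 * mode k 1 z - cbrt_unity * mode k (cbrt_unity\<^sup>2) z"
proof -
  let ?w = cbrt_unity
  have "?w\<^sup>2 * (mode k 1 z + ?w * mode k ?w z + ?w\<^sup>2 * mode k (?w\<^sup>2) z) = 0"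
    unfolding mode_def using airy_connection[of "of_real (k\<^sup>2) * z"] by simp
  moreover have "?w\<^sup>2 * (mode k 1 z + ?w * mode k ?w z + ?w\<^sup>2 * mode k (?w\<^sup>2) z) =
      ?w\<^sup>2 * mode k 1 z + ?w ^ 3 * mode k ?w z + ?w ^ 3 * (?w * mode k (?w\<^sup>2) z)"
    by (simp add: power3_eq_cube power2_eq_square algebra_simps)
  ultimately have z: "?w\<^sup>2 * mode k 1 z + mode k ?w z + ?w * mode k (?w\<^sup>2) z = 0"
    unfolding cbrt_unity_cube by simp
  have "mode k ?w z = (?w\<^sup>2 * mode k 1 z + mode k ?w z + ?w * mode k (?w\<^sup>2) z)
      - ?w\<^sup>2 * mode k 1 z - ?w * mode k (?w\<^sup>2) z" by simp
  thus ?thesis unfolding z by simp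
qed

section \<open>The normal form with three exponentials and its domain\<close>

definition amp1 where "amp1 k p = airy_amp (of_real k * csqrt (p - \<i>)) * airy_amp (of_real k * csqrt (p + \<i>))"
definition amp2 where "amp2 k p = airy_amp (of_real k * csqrt (p - \<i>)) * airy_amp (cnj sixth_root * (of_real k * csqrt (p + \<i>)))"
definition amp3 where "amp3 k p = airy_amp (of_real k * csqrt (p + \<i>)) * airy_amp (sixth_root * (of_real k * csqrt (p - \<i>)))"

text \<open>Let a and b denote \<open>k ^ 3\<close> times the phases at \<open>p - \<i>\<close> and
  \<open>p + \<i>\<close>. Up to amplitudes the terms are exp (b - a), - exp (a - b) and
  \<open>\<i>\<close> exp (- a - b); the last one is created by the connection formula at
  \<open>p + \<i>\<close>, which splits one of the two products of \<open>evans\<close>.\<close>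

definition evans_nf :: "real \<Rightarrow> complex \<Rightarrow> complex" where
  "evans_nf k p =
     amp2 k p * exp (of_real (k ^ 3) * (phase (p + \<i>) - phase (p - \<i>)))
   - amp3 k p * exp (of_real (k ^ 3) * (phase (p - \<i>) - phase (p + \<i>)))
   + \<i> * amp1 k p * exp (- of_real (k ^ 3) * (phase (p - \<i>) + phase (p + \<i>)))"

lemma evans_eq_nf:
  assumes k: "k > 0" and S: "Re (csqrt (p - \<i>)) > 0" "Re (csqrt (p + \<i>)) > 0"
  shows "evans k p * (twelfth_root * csqrt (of_real k * csqrt (p - \<i>)) * csqrt (of_real k * csqrt (p + \<i>)) / of_real (airy_const ^ 2))
           = evans_nf k p"
proof -
  define P M where "P = csqrt (of_real k * csqrt (p - \<i>))" and "M = csqrt (of_real k * csqrt (p + \<i>))"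
  have "csqrt (p - \<i>) \<noteq> 0" "csqrt (p + \<i>) \<noteq> 0" using S by force+
  hence PM: "P \<noteq> 0" "M \<noteq> 0" unfolding P_def M_def csqrt_eq_0 mult_eq_0_iff using k by simp_all
  define a b where "a = of_real (k ^ 3) * phase (p - \<i>)" and "b = of_real (k ^ 3) * phase (p + \<i>)"
  define ap am vp wm C where "ap = airy_amp (of_real k * csqrt (p - \<i>))" and "am = airy_amp (of_real k * csqrt (p + \<i>))"
    and "vp = airy_amp (sixth_root * (of_real k * csqrt (p - \<i>)))"
    and "wm = airy_amp (cnj sixth_root * (of_real k * csqrt (p + \<i>)))" and "C = complex_of_real airy_const"
  have C: "C \<noteq> 0" using airy_const(1) by (simp add: C_def)
  let ?t = twelfth_root and ?w = cbrt_unity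
  have t: "?t \<noteq> 0" "cnj ?t \<noteq> 0" using twelfth_root_nonzero by auto
  have tw: "?t * ?w\<^sup>2 = - \<i>" "?t / cnj ?t * ?w = - 1"
  proof -
    show "?t * ?w\<^sup>2 = - \<i>"
      by (simp add: twelfth_root_def cbrt_unity_def complex_eq_iff power2_eq_square)
    have "?t * ?w = - cnj ?t"
      by (simp add: twelfth_root_def cbrt_unity_def complex_eq_iff)
    thus "?t / cnj ?t * ?w = - 1" using t by (simp add: field_simps)
  qed
  have "evans k p = mode k 1 (p - \<i>) * (- ?w\<^sup>2 * mode k 1 (p + \<i>) - ?w * mode k (?w\<^sup>2) (p + \<i>))
      - mode k 1 (p + \<i>) * mode k ?w (p - \<i>)"
    unfolding evans_def mode_connection[of k "p + \<i>"] ..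
  also have "\<dots> = C * ap * exp (- a) / P * (- ?w\<^sup>2 * (C * am * exp (- b) / M) - ?w * (C * wm * exp b / (cnj ?t * M)))
      - (C * am * exp (- b) / M) * (C * vp * exp a / (?t * P))"
    unfolding mode_amp[OF k S(1)] mode_amp[OF k S(2)] a_def b_def ap_def am_def vp_def wm_def C_def P_def M_def ..
  finally have ev: "evans k p = \<dots>" .
  have "evans k p * (?t * P * M / C ^ 2) =
     - (?t * ?w\<^sup>2) * (ap * am * (exp (- a) * exp (- b))) - (?t / cnj ?t * ?w) * (ap * wm * (exp (- a) * exp b))
      - am * vp * (exp (- b) * exp a)"
  proof -
    let ?F = "?t * P * M / C ^ 2"
    have f: "C * ap * exp (- a) / P * (C * am * exp (- b) / M) * ?F = ?t * (ap * am * (exp (- a) * exp (- b)))"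
      "C * ap * exp (- a) / P * (C * wm * exp b / (cnj ?t * M)) * ?F = ?t / cnj ?t * (ap * wm * (exp (- a) * exp b))"
      "(C * am * exp (- b) / M) * (C * vp * exp a / (?t * P)) * ?F = am * vp * (exp (- b) * exp a)"
      using PM C t by (simp_all add: power2_eq_square)
    have "(C * ap * exp (- a) / P * (- ?w\<^sup>2 * (C * am * exp (- b) / M) - ?w * (C * wm * exp b / (cnj ?t * M)))
      - (C * am * exp (- b) / M) * (C * vp * exp a / (?t * P))) * ?F =
      - ?w\<^sup>2 * (C * ap * exp (- a) / P * (C * am * exp (- b) / M) * ?F) -
      ?w * (C * ap * exp (- a) / P * (C * wm * exp b / (cnj ?t * M)) * ?F) -
      (C * am * exp (- b) / M) * (C * vp * exp a / (?t * P)) * ?F"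
      by (simp only: left_diff_distrib right_diff_distrib mult_minus_left mult_minus_right mult_ac)
    thus ?thesis unfolding ev f by (simp add: algebra_simps)
  qed
  also have "\<dots> = evans_nf k p"
    unfolding tw mult_exp_exp evans_nf_def amp1_def amp2_def amp3_def ap_def am_def vp_def wm_def a_def b_def
    by (simp add: algebra_simps)
  finally show ?thesis by (simp add: P_def M_def C_def)
qed

lemma evans_zero_iff_nf:
  assumes k: "k > 0" and S: "Re (csqrt (p - \<i>)) > 0" "Re (csqrt (p + \<i>)) > 0"
  shows "evans k p = 0 \<longleftrightarrow> evans_nf k p = 0"
proof -
  have "csqrt (p - \<i>) \<noteq> 0" "csqrt (p + \<i>) \<noteq> 0" using S by force+
  thus ?thesis unfolding evans_eq_nf[OF assms, symmetric]
    using k airy_const(1) twelfth_root_nonzero by (simp del: csqrt.simps)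
qed

lemma csqrt_Re_ge_half_norm:
  assumes "Re z \<ge> - norm z / 2"
  shows "Re (csqrt z) \<ge> norm (csqrt z) / 2"
proof -
  have "norm (csqrt z) / 2 = sqrt (norm z / 4)" by (simp add: norm_csqrt real_sqrt_divide)
  also have "\<dots> \<le> sqrt ((norm z + Re z) / 2)" using assms by (intro real_sqrt_le_mono) simp
  finally show ?thesis by simp
qed

text \<open>Slope 1/4 bounds the argument of the root on the critical side by little more than 7
  degrees; a rotation by 60 degrees then stays inside the sector of half-angle 75 degrees. On the
  other side the rotation brings the root towards the axis.\<close>

lemma csqrt_sector:
  assumes "Re z > 0"
  shows "Im z \<le> Re z / 4 \<Longrightarrow> Re (sixth_root * csqrt z) \<ge> norm (csqrt z) / 4"
    and "Im z \<ge> - Re z / 4 \<Longrightarrow> Re (cnj sixth_root * csqrt z) \<ge> norm (csqrt z) / 4"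
proof -
  define x y where "x = Re (csqrt z)" and "y = Im (csqrt z)"
  have xy: "\<bar>y\<bar> < x" using csqrt_Re_gt_Im[OF assms] by (simp add: x_def y_def)
  have "z = (csqrt z)\<^sup>2" by simp
  hence z: "Re z = x\<^sup>2 - y\<^sup>2" "Im z = 2 * x * y" unfolding x_def y_def by (metis Re_power2, metis Im_power2)
  have n: "norm (csqrt z) \<le> x + \<bar>y\<bar>" using cmod_le[of "csqrt z"] xy by (simp add: x_def y_def)
  have s3: "sqrt 3 \<le> 2" by (simp add: real_le_lsqrt)
  have key: "x / 2 - sqrt 3 / 2 * v \<ge> norm (csqrt z) / 4" if v: "\<bar>v\<bar> = \<bar>y\<bar>" "2 * x * v \<le> (x\<^sup>2 - y\<^sup>2) / 4" for v
  proof (cases "v \<le> 0")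
    case True
    hence "sqrt 3 / 2 * v \<le> 0" by (simp add: mult_nonneg_nonpos)
    thus ?thesis using n xy by linarith
  next
    case False
    have "2 * x * v \<le> x\<^sup>2 / 4"
      by (rule order.trans[OF v(2)]) (intro divide_right_mono, auto)
    hence "x * (8 * v) \<le> x * x" by (simp add: power2_eq_square)
    hence "8 * v \<le> x" using xy by (subst (asm) mult_le_cancel_left_pos) auto
    moreover have "sqrt 3 / 2 * v \<le> 1 * v" using s3 False by (intro mult_right_mono) auto
    ultimately show ?thesis using n v(1) False xy by linarith
  qed
  show "Re (sixth_root * csqrt z) \<ge> norm (csqrt z) / 4" if "Im z \<le> Re z / 4"
    using key[of y] that by (simp add: sixth_root_def z x_def[symmetric] y_def[symmetric] del: csqrt.simps)
  show "Re (cnj sixth_root * csqrt z) \<ge> norm (csqrt z) / 4" if "Im z \<ge> - Re z / 4"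
    using key[of "- y"] that by (simp add: sixth_root_def z x_def[symmetric] y_def[symmetric] del: csqrt.simps)
qed

text \<open>The half-strip of the zeros, widened by a cone: the discs around points x of the ray
  have a radius of order \<open>sqrt x / k ^ 3\<close> and far out they leave every strip.\<close>

definition wkb_dom :: "complex set" where
  "wkb_dom = {p. Re p > 0 \<and> Im p \<le> 1 + Re p / 4 \<and> Im p \<ge> - 1 - Re p / 4}"

lemma wkb_dom_amps:
  assumes "p \<in> wkb_dom"
  shows "Re (csqrt (p - \<i>)) > 0" "Re (csqrt (p + \<i>)) > 0"
    "Re (csqrt (p - \<i>)) \<ge> norm (csqrt (p - \<i>)) / 4" "Re (csqrt (p + \<i>)) \<ge> norm (csqrt (p + \<i>)) / 4"
    "Re (sixth_root * csqrt (p - \<i>)) \<ge> norm (csqrt (p - \<i>)) / 4"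
    "Re (cnj sixth_root * csqrt (p + \<i>)) \<ge> norm (csqrt (p + \<i>)) / 4"
proof -
  have p: "Re p > 0" "Im p \<le> 1 + Re p / 4" "Im p \<ge> - 1 - Re p / 4" using assms by (auto simp: wkb_dom_def)
  show "Re (csqrt (p - \<i>)) > 0" "Re (csqrt (p + \<i>)) > 0"
    using csqrt_Re_gt_Im[of "p - \<i>"] csqrt_Re_gt_Im[of "p + \<i>"] p by (auto simp del: csqrt.simps)
  show "Re (csqrt (p - \<i>)) \<ge> norm (csqrt (p - \<i>)) / 4"
    using csqrt_Re_ge_half_norm[of "p - \<i>"] p norm_ge_zero[of "csqrt (p - \<i>)"] norm_ge_zero[of "p - \<i>"]
    unfolding minus_complex.sel imaginary_unit.sel by linarith
  show "Re (csqrt (p + \<i>)) \<ge> norm (csqrt (p + \<i>)) / 4"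
    using csqrt_Re_ge_half_norm[of "p + \<i>"] p norm_ge_zero[of "csqrt (p + \<i>)"] norm_ge_zero[of "p + \<i>"]
    unfolding plus_complex.sel imaginary_unit.sel by linarith
  show "Re (sixth_root * csqrt (p - \<i>)) \<ge> norm (csqrt (p - \<i>)) / 4"
    using p by (intro csqrt_sector(1)) auto
  show "Re (cnj sixth_root * csqrt (p + \<i>)) \<ge> norm (csqrt (p + \<i>)) / 4"
    using p by (intro csqrt_sector(2)) auto
qed

definition wkb_good :: "real \<Rightarrow> real \<Rightarrow> complex set" where
  "wkb_good R k = {p \<in> wkb_dom. k\<^sup>2 * norm (p - \<i>) \<ge> R \<and> k\<^sup>2 * norm (p + \<i>) \<ge> R}"

lemma mult_near_1:
  fixes a b :: complex
  assumes "norm (a - 1) \<le> 1 / 500" "norm (b - 1) \<le> 1 / 500"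
  shows "norm (a * b - 1) \<le> 1 / 200"
proof -
  have "a * b - 1 = (a - 1) * (b - 1) + (a - 1) + (b - 1)" by (simp add: algebra_simps)
  also have "norm \<dots> \<le> 1 / 500 * (1 / 500) + 1 / 500 + 1 / 500"

  proof (intro order.trans[OF norm_triangle_ineq] add_mono assms)
    show "norm ((a - 1) * (b - 1)) \<le> 1 / 500 * (1 / 500)"
      unfolding norm_mult by (rule mult_mono[OF assms]) auto
  qed
  finally show ?thesis by simp
qed

lemma amps_near_1:
  obtains R where "R \<ge> 1" "\<And>k p. k > 0 \<Longrightarrow> p \<in> wkb_good R k \<Longrightarrow>
    norm (amp1 k p - 1) \<le> 1 / 200 \<and> norm (amp2 k p - 1) \<le> 1 / 200 \<and> norm (amp3 k p - 1) \<le> 1 / 200"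
proof (rule airy_amp_near_1[of "1 / 500"])
  fix R assume R: "R \<ge> 1" "\<And>s. norm s \<ge> R \<Longrightarrow> Re s \<ge> norm s / 4 \<Longrightarrow> norm (airy_amp s - 1) \<le> 1 / 500"
  show thesis
  proof (rule that[of "R\<^sup>2"])
    show "R\<^sup>2 \<ge> 1" using R(1) by simp
    fix k :: real and p assume k: "k > 0" and p: "p \<in> wkb_good (R\<^sup>2) k"
    have n: "norm (of_real k * csqrt z) \<ge> R" if "k\<^sup>2 * norm z \<ge> R\<^sup>2" for z
    proof -
      have "R = sqrt (R\<^sup>2)" using R(1) by simp
      also have "\<dots> \<le> sqrt (k\<^sup>2 * norm z)" using that by (rule real_sqrt_le_mono)
      also have "\<dots> = norm (of_real k * csqrt z)" using k by (simp add: norm_mult norm_csqrt real_sqrt_mult)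
      finally show ?thesis .
    qed
    have key: "norm (airy_amp (c * (of_real k * csqrt z)) - 1) \<le> 1 / 500"
      if "k\<^sup>2 * norm z \<ge> R\<^sup>2" "norm c = 1" "Re (c * csqrt z) \<ge> norm (csqrt z) / 4" for c z
    proof (rule R(2))
      show "norm (c * (of_real k * csqrt z)) \<ge> R" using n[OF that(1)] that(2) by (simp add: norm_mult)
      have "k * (norm (csqrt z) / 4) \<le> k * Re (c * csqrt z)" using k that(3) by (intro mult_left_mono) auto
      also have "\<dots> = Re (c * (of_real k * csqrt z))" by (simp add: algebra_simps)
      finally show "Re (c * (of_real k * csqrt z)) \<ge> norm (c * (of_real k * csqrt z)) / 4"
        using k that(2) by (simp add: norm_mult)
    qed
    have pd: "p \<in> wkb_dom" "k\<^sup>2 * norm (p - \<i>) \<ge> R\<^sup>2" "k\<^sup>2 * norm (p + \<i>) \<ge> R\<^sup>2"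
      using p by (auto simp: wkb_good_def)
    note A = wkb_dom_amps[OF pd(1)]
    have 1: "norm (airy_amp (of_real k * csqrt (p - \<i>)) - 1) \<le> 1 / 500"
      using key[OF pd(2), of 1] A(3) by simp
    have 2: "norm (airy_amp (of_real k * csqrt (p + \<i>)) - 1) \<le> 1 / 500"
      using key[OF pd(3), of 1] A(4) by simp
    have 3: "norm (airy_amp (sixth_root * (of_real k * csqrt (p - \<i>))) - 1) \<le> 1 / 500"
      using key[OF pd(2) norm_sixth_root A(5)] .
    have 4: "norm (airy_amp (cnj sixth_root * (of_real k * csqrt (p + \<i>))) - 1) \<le> 1 / 500"
      using key[OF pd(3) _ A(6)] norm_sixth_root by simp
    show "norm (amp1 k p - 1) \<le> 1 / 200 \<and> norm (amp2 k p - 1) \<le> 1 / 200 \<and> norm (amp3 k p - 1) \<le> 1 / 200"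
      unfolding amp1_def amp2_def amp3_def by (intro conjI mult_near_1 1 2 3 4)
  qed
qed simp

lemma wkb_dom_off_cut:
  assumes "p \<in> wkb_dom"
  shows "p - \<i> \<notin> \<real>\<^sub>\<le>\<^sub>0" "p + \<i> \<notin> \<real>\<^sub>\<le>\<^sub>0"
  using assms by (auto simp: wkb_dom_def complex_nonpos_Reals_iff)

lemma amps_holomorphic:
  assumes "k > 0"
  shows "amp1 k holomorphic_on wkb_dom" "amp2 k holomorphic_on wkb_dom" "amp3 k holomorphic_on wkb_dom"
proof -
  have c: "(\<lambda>p. csqrt (p - \<i>)) holomorphic_on wkb_dom" "(\<lambda>p. csqrt (p + \<i>)) holomorphic_on wkb_dom"
    by (auto intro!: holomorphic_intros wkb_dom_off_cut)
  have key: "(\<lambda>p. airy_amp (c * (of_real k * f p))) holomorphic_on wkb_dom"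
    if "f holomorphic_on wkb_dom" "\<And>p. p \<in> wkb_dom \<Longrightarrow> Re (c * f p) > 0" for f c
  proof -
    have "(airy_amp \<circ> (\<lambda>p. c * (of_real k * f p))) holomorphic_on wkb_dom"
    proof (rule holomorphic_on_compose_gen[OF _ airy_amp_holomorphic])
      show "(\<lambda>p. c * (of_real k * f p)) ` wkb_dom \<subseteq> {s. Re s > 0}"
      proof safe
        fix p assume "p \<in> wkb_dom"
        hence "k * Re (c * f p) > 0" using that(2) assms by simp
        thus "Re (c * (of_real k * f p)) > 0" by (simp add: algebra_simps)
      qed
    qed (intro holomorphic_intros that)
    thus ?thesis by (simp add: o_def)
  qed
  have n0: "norm (csqrt (p - \<i>)) > 0" "norm (csqrt (p + \<i>)) > 0" if "p \<in> wkb_dom" for p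
    using wkb_dom_amps(1,2)[OF that] by (force simp del: csqrt.simps)+
  have pos: "Re (sixth_root * csqrt (p - \<i>)) > 0" "Re (cnj sixth_root * csqrt (p + \<i>)) > 0"
    if "p \<in> wkb_dom" for p
    using wkb_dom_amps(5,6)[OF that] n0[OF that] by linarith+
  note 1 = key[OF c(1), of 1] and 2 = key[OF c(2), of 1]
  show "amp1 k holomorphic_on wkb_dom" "amp2 k holomorphic_on wkb_dom" "amp3 k holomorphic_on wkb_dom"
    unfolding amp1_def[abs_def] amp2_def[abs_def] amp3_def[abs_def]
    using 1 2 key[OF c(1) pos(1)] key[OF c(2) pos(2)] wkb_dom_amps(1,2)
    by (auto intro!: holomorphic_intros simp del: csqrt.simps)
qed

subsection \<open>Phase functions\<close>

lemma phase_deriv: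
  assumes "z \<notin> \<real>\<^sub>\<le>\<^sub>0"
  shows "(phase has_field_derivative csqrt z) (at z)"
proof -
  have "csqrt z \<noteq> 0" using assms by auto
  have "(phase has_field_derivative 2 / 3 * (3 * csqrt z ^ 2 * inverse (2 * csqrt z))) (at z)"
    unfolding phase_def[abs_def]
    by (rule DERIV_cmult) (use DERIV_power[OF has_field_derivative_csqrt[OF assms], of 3] in \<open>simp add: mult_ac\<close>)
  also have "2 / 3 * (3 * csqrt z ^ 2 * inverse (2 * csqrt z)) = csqrt z"
    using \<open>csqrt z \<noteq> 0\<close> by (simp add: power2_eq_square del: power2_csqrt)
  finally show ?thesis .
qed

text \<open>At the points of the ray this is the integral of the theorem
  (\<open>ray_integral\<close>). \<open>exp (2 * \<i> * k ^ 3 * wfun p)\<close> is the quotient of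
  the first exponential of \<open>evans_nf\<close> by the second.\<close>

definition wfun :: "complex \<Rightarrow> complex" where
  "wfun p = - \<i> * (phase (p + \<i>) - phase (p - \<i>))"

definition usum :: "complex \<Rightarrow> complex" where
  "usum p = csqrt (p - \<i>) + csqrt (p + \<i>)"

lemma Re_pos_off_cut:
  assumes "Re p > 0"
  shows "p - \<i> \<notin> \<real>\<^sub>\<le>\<^sub>0" "p + \<i> \<notin> \<real>\<^sub>\<le>\<^sub>0"
  using assms by (auto simp: complex_nonpos_Reals_iff)

lemma usum_cone:
  assumes "Re p > 0"
  shows "\<bar>Im (usum p)\<bar> < Re (usum p)"
  using csqrt_Re_gt_Im[of "p - \<i>"] csqrt_Re_gt_Im[of "p + \<i>"] assms
  by (auto simp: usum_def simp del: csqrt.simps)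

lemma usum_norm_le: "norm (usum p) \<le> 2 * sqrt (norm p + 1)"
proof -
  have "norm (p - \<i>) \<le> norm p + 1" "norm (p + \<i>) \<le> norm p + 1"
    using norm_triangle_ineq4[of p \<i>] norm_triangle_ineq[of p \<i>] by auto
  hence "norm (csqrt (p - \<i>)) \<le> sqrt (norm p + 1)" "norm (csqrt (p + \<i>)) \<le> sqrt (norm p + 1)" by auto
  thus ?thesis unfolding usum_def using norm_triangle_ineq[of "csqrt (p - \<i>)" "csqrt (p + \<i>)"] by linarith
qed

text \<open>Rationalisation: the difference of the two roots times their sum is
  \<open>2 * \<i>\<close>. In this form the derivative visibly has positive real part, since both
  roots lie in the cone where the imaginary part is smaller in modulus than the real part.\<close>

lemma wfun_deriv:
  assumes "Re p > 0"
  shows "(wfun has_field_derivative 2 / usum p) (at p)"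
proof -
  have d: "((\<lambda>p. phase (p + \<i>)) has_field_derivative csqrt (p + \<i>)) (at p)"
    "((\<lambda>p. phase (p - \<i>)) has_field_derivative csqrt (p - \<i>)) (at p)"
    using DERIV_shift[THEN iffD1, OF phase_deriv[OF Re_pos_off_cut(2)[OF assms]]]
      DERIV_shift[THEN iffD1, of phase _ p "- \<i>"] phase_deriv[OF Re_pos_off_cut(1)[OF assms]] by auto
  have "usum p \<noteq> 0" using usum_cone[OF assms] by auto
  have "(csqrt (p + \<i>) - csqrt (p - \<i>)) * usum p = (csqrt (p + \<i>))\<^sup>2 - (csqrt (p - \<i>))\<^sup>2"
    unfolding usum_def by (simp only: power2_eq_square ring_distribs mult_ac) simp
  also have "\<dots> = 2 * \<i>" by simp
  finally have "- \<i> * (csqrt (p + \<i>) - csqrt (p - \<i>)) * usum p = - \<i> * (2 * \<i>)" by (simp only: mult.assoc)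
  also have "- \<i> * (2 * \<i>) = 2" by (simp add: complex_eq_iff)
  finally have "- \<i> * (csqrt (p + \<i>) - csqrt (p - \<i>)) * usum p = 2" .
  hence "- \<i> * (csqrt (p + \<i>) - csqrt (p - \<i>)) = 2 / usum p"
    using \<open>usum p \<noteq> 0\<close> by (simp only: eq_divide_eq) simp
  thus ?thesis unfolding wfun_def[abs_def]
    using DERIV_cmult[OF DERIV_diff[OF d], of "- \<i>"] by simp
qed

text \<open>In the cone the cosine of the argument is at least 1 / sqrt 2, which exceeds 7/10, and
  \<open>usum p\<close> has modulus at most \<open>2 * sqrt (T + 1)\<close>. The decay in T has the
  true order; a bound uniform in p does not exist on the unbounded ray.\<close>

lemma wfun_deriv_Re:
  assumes "Re p > 0" "norm p \<le> T"
  shows "Re (2 / usum p) \<ge> 7 / 10 / sqrt (T + 1)"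
proof -
  define u where "u = usum p"
  have u: "\<bar>Im u\<bar> < Re u" using usum_cone[OF assms(1)] by (simp add: u_def)
  have n: "norm u > 0" using u by auto
  have "(Im u)\<^sup>2 \<le> (Re u)\<^sup>2" using u by (simp add: abs_le_square_iff[symmetric])
  hence "(norm u)\<^sup>2 \<le> 2 * (Re u)\<^sup>2" by (simp add: cmod_power2)
  also have "\<dots> \<le> (10 / 7 * Re u)\<^sup>2" by (simp add: power_mult_distrib power_divide)
  finally have "norm u \<le> 10 / 7 * Re u" using u by (simp add: abs_le_square_iff[symmetric])
  hence "Re u \<ge> 7 / 10 * norm u" by simp
  hence "2 * Re u / (norm u)\<^sup>2 \<ge> 2 * (7 / 10 * norm u) / (norm u)\<^sup>2"
    by (intro divide_right_mono mult_left_mono) auto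
  moreover have "2 * (7 / 10 * norm u) / (norm u)\<^sup>2 = 14 / 10 / norm u" using n by (simp add: power2_eq_square)
  moreover have "Re (2 / u) = 2 * Re u / (norm u)\<^sup>2" by (simp add: Re_divide cmod_power2)
  moreover have "14 / 10 / norm u \<ge> 14 / 10 / (2 * sqrt (T + 1))"
  proof -
    have "norm u \<le> 2 * sqrt (norm p + 1)" using usum_norm_le by (simp add: u_def)
    also have "\<dots> \<le> 2 * sqrt (T + 1)" using assms(2) by simp
    finally have le: "norm u \<le> 2 * sqrt (T + 1)" .
    hence "0 < 2 * sqrt (T + 1) * norm u" using n by (intro mult_pos_pos) linarith+
    thus ?thesis using le by (intro divide_left_mono) auto
  qed
  ultimately show ?thesis by (simp add: u_def)
qed

text \<open>Strong monotonicity from a derivative with real part bounded below, as in the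
  Noshiro-Warschawski theorem: along the segment the derivative of
  \<open>Re (f * cnj (b - a))\<close> is the real part of f' times the squared length.\<close>

lemma monotone_derivative_bound:
  fixes f f' :: "complex \<Rightarrow> complex"
  assumes f: "\<And>z. z \<in> closed_segment a b \<Longrightarrow> (f has_field_derivative f' z) (at z)"
    and m: "\<And>z. z \<in> closed_segment a b \<Longrightarrow> Re (f' z) \<ge> m"
  shows "Re ((f b - f a) * cnj (b - a)) \<ge> m * (norm (b - a))\<^sup>2"
proof -
  define \<phi> where "\<phi> = (\<lambda>t::real. Re (f (a + of_real t * (b - a)) * cnj (b - a)) - m * (norm (b - a))\<^sup>2 * t)"
  have "\<phi> 0 \<le> \<phi> 1"
  proof (rule DERIV_nonneg_imp_nondecreasing[where f=\<phi> and a=0 and b=1])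
    fix t :: real assume t: "0 \<le> t" "t \<le> 1"
    let ?z = "a + of_real t * (b - a)"
    have z: "?z \<in> closed_segment a b"
      using t by (auto simp: in_segment scaleR_conv_of_real algebra_simps intro!: exI[of _ t])
    have "((\<lambda>w. f (a + w * (b - a)) * cnj (b - a)) has_field_derivative (f' ?z * (b - a)) * cnj (b - a)) (at (of_real t))"
      by (rule DERIV_cmult_right, rule DERIV_chain2[where f=f and g="\<lambda>w. a + w * (b - a)", OF f[OF z]])
        (auto intro!: derivative_eq_intros)
    from has_vector_derivative_real_field[OF this]
    have "((\<lambda>t. f (a + of_real t * (b - a)) * cnj (b - a)) has_vector_derivative f' ?z * (b - a) * cnj (b - a)) (at t)" .
    hence "((\<lambda>t. Re (f (a + of_real t * (b - a)) * cnj (b - a))) has_real_derivative Re (f' ?z * (b - a) * cnj (b - a))) (at t)"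
      unfolding has_real_derivative_iff_has_vector_derivative
      by (rule bounded_linear.has_vector_derivative[OF bounded_linear_Re])
    hence "(\<phi> has_real_derivative Re (f' ?z * (b - a) * cnj (b - a)) - m * (norm (b - a))\<^sup>2) (at t)"
      unfolding \<phi>_def by (rule DERIV_diff[OF _ DERIV_cmult_Id])
    moreover have "Re (f' ?z * (b - a) * cnj (b - a)) = Re (f' ?z) * (norm (b - a))\<^sup>2"
      by (simp only: mult.assoc complex_norm_square[symmetric]) simp
    moreover have "Re (f' ?z) * (norm (b - a))\<^sup>2 \<ge> m * (norm (b - a))\<^sup>2"
      by (intro mult_right_mono m[OF z]) auto
    ultimately show "\<exists>y. (\<phi> has_real_derivative y) (at t) \<and> 0 \<le> y" by auto
  qed simp
  thus ?thesis by (simp add: \<phi>_def algebra_simps)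
qed

lemma monotone_derivative_norm:
  fixes f f' :: "complex \<Rightarrow> complex"
  assumes "\<And>z. z \<in> closed_segment a b \<Longrightarrow> (f has_field_derivative f' z) (at z)"
    and "\<And>z. z \<in> closed_segment a b \<Longrightarrow> Re (f' z) \<ge> m"
  shows "norm (f b - f a) \<ge> m * norm (b - a)"
proof (cases "b = a")
  case False
  have "m * (norm (b - a))\<^sup>2 \<le> Re ((f b - f a) * cnj (b - a))" by (rule monotone_derivative_bound[OF assms])
  also have "\<dots> \<le> norm ((f b - f a) * cnj (b - a))" by (rule complex_Re_le_cmod)
  also have "\<dots> = norm (f b - f a) * norm (b - a)" by (simp only: norm_mult complex_mod_cnj)
  finally have "(m * norm (b - a)) * norm (b - a) \<le> norm (f b - f a) * norm (b - a)" by (simp add: power2_eq_square)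
  thus ?thesis using False by simp
qed simp

lemma wfun_monotone:
  assumes "Re a > 0" "Re b > 0" "norm a \<le> T" "norm b \<le> T"
  shows "Re ((wfun b - wfun a) * cnj (b - a)) \<ge> 7 / 10 / sqrt (T + 1) * (norm (b - a))\<^sup>2"
    "norm (wfun b - wfun a) \<ge> 7 / 10 / sqrt (T + 1) * norm (b - a)"
proof -
  have c: "closed_segment a b \<subseteq> {z. Re z > 0} \<inter> cball 0 T"
    by (rule closed_segment_subset) (use assms in \<open>auto intro: convex_Int convex_halfspace_Re_gt\<close>)
  have 1: "(wfun has_field_derivative 2 / usum z) (at z)" "Re (2 / usum z) \<ge> 7 / 10 / sqrt (T + 1)"
    if z: "z \<in> closed_segment a b" for z
  proof -
    have "Re z > 0" "norm z \<le> T" using z c by auto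
    thus "(wfun has_field_derivative 2 / usum z) (at z)" "Re (2 / usum z) \<ge> 7 / 10 / sqrt (T + 1)"
      using wfun_deriv wfun_deriv_Re by blast+
  qed
  show "Re ((wfun b - wfun a) * cnj (b - a)) \<ge> 7 / 10 / sqrt (T + 1) * (norm (b - a))\<^sup>2"
    by (rule monotone_derivative_bound[OF 1])
  show "norm (wfun b - wfun a) \<ge> 7 / 10 / sqrt (T + 1) * norm (b - a)"
    by (rule monotone_derivative_norm[OF 1])
qed

lemma phase_cnj: "z \<notin> \<real>\<^sub>\<le>\<^sub>0 \<Longrightarrow> phase (cnj z) = cnj (phase z)"
  by (simp add: phase_def cnj_csqrt[symmetric])

lemma wfun_real:
  assumes "x > 0"
  shows "wfun (of_real x) = of_real (Re (wfun (of_real x)))"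
proof -
  have "phase (of_real x - \<i>) = cnj (phase (of_real x + \<i>))"
    using phase_cnj[of "of_real x + \<i>"] assms by (simp add: complex_nonpos_Reals_iff)
  thus ?thesis by (simp add: wfun_def complex_eq_iff)
qed

text \<open>\<open>wfun\<close> is real on the real axis, where the two phases are conjugate, so
  strong monotonicity along the vertical segment down to the axis yields the growth. In terms of
  exponentials: above the axis the second one dominates the first.\<close>

lemma wfun_Im_ge:
  assumes "Re p > 0" "Im p \<ge> 0" "norm p \<le> T"
  shows "Im (wfun p) \<ge> 7 / 10 / sqrt (T + 1) * Im p"
proof (cases "Im p = 0")
  case True
  hence "p = of_real (Re p)" by (simp add: complex_eq_iff)
  hence "Im (wfun p) = 0" using wfun_real[OF assms(1)] by (metis Im_complex_of_real)
  thus ?thesis using True by simp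
next
  case False
  let ?a = "complex_of_real (Re p)"
  have "norm ?a \<le> T" using abs_Re_le_cmod[of p] assms(3) by simp
  from wfun_monotone(1)[OF _ assms(1) this assms(3)] assms(1)
  have "7 / 10 / sqrt (T + 1) * (norm (p - ?a))\<^sup>2 \<le> Re ((wfun p - wfun ?a) * cnj (p - ?a))" by simp
  also have pa: "p - ?a = \<i> * of_real (Im p)" by (simp add: complex_eq_iff)
  also have "Re ((wfun p - wfun ?a) * cnj (\<i> * of_real (Im p))) = (Im (wfun p) - Im (wfun ?a)) * Im p" by simp
  also have "Im (wfun ?a) = 0" using wfun_real[OF assms(1)] by (metis Im_complex_of_real)
  finally have "(7 / 10 / sqrt (T + 1) * Im p) * Im p \<le> Im (wfun p) * Im p"
    by (simp add: norm_mult power2_eq_square)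
  thus ?thesis by (rule mult_right_le_imp_le) (use False assms(2) in simp)
qed

lemma Im_wfun: "Im (wfun p) = Re (phase (p - \<i>)) - Re (phase (p + \<i>))"
  by (simp add: wfun_def)

lemma sqrt3_bounds: "sqrt 3 \<le> 1733 / 1000" "sqrt 3 \<ge> 1732 / 1000"
  by (rule real_le_lsqrt real_le_rsqrt; simp add: power2_eq_square)+

lemma norm_exp_2_of_real:
  "norm (exp (2 * of_real c * z)) = exp (2 * (c * Re z))"
  "norm (exp (- (2 * of_real c * z))) = exp (- (2 * (c * Re z)))"
  by (simp_all add: norm_exp_eq_Re mult.assoc)

text \<open>With \<open>csqrt z = x - \<i> * y\<close> the real part of the phase is
  \<open>2 / 3 * x * (x + sqrt 3 * y) * (x - sqrt 3 * y)\<close> and the linear form is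
  \<open>(sqrt 3 * x + y) * (x - sqrt 3 * y)\<close>. The common factor vanishes on the anti-Stokes
  ray of argument - pi / 3, and apart from x the quotient of the rest is at least 2 / (3 sqrt 3),
  slightly above 19/50. For \<open>z = p - \<i>\<close> this ray carries the image of the segment
  from 1 to the node.\<close>

lemma phase_Re_bounds:
  assumes "Re z > 0" "Im z \<le> 0"
  shows "sqrt 3 * Re z + Im z \<ge> 0 \<Longrightarrow> Re (phase z) \<ge> 19 / 50 * Re (csqrt z) * (sqrt 3 * Re z + Im z)"
    and "sqrt 3 * Re z + Im z \<le> 0 \<Longrightarrow> Re (phase z) \<le> 19 / 50 * Re (csqrt z) * (sqrt 3 * Re z + Im z)"
proof -
  define x y where "x = Re (csqrt z)" and "y = - Im (csqrt z)"
  have xy: "\<bar>y\<bar> < x" using csqrt_Re_gt_Im[OF assms(1)] by (simp add: x_def y_def)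
  have "z = (csqrt z)\<^sup>2" by simp
  hence z: "Re z = x\<^sup>2 - y\<^sup>2" "Im z = - (2 * x * y)"
    unfolding x_def y_def by (metis Re_power2 power2_minus, metis Im_power2 minus_minus mult_minus_right)
  have "0 \<le> x * y" using assms(2) unfolding z by simp
  hence y: "y \<ge> 0" using xy by (auto simp: zero_le_mult_iff)
  define l where "l = sqrt 3 * Re z + Im z"
  have s: "sqrt 3 * sqrt 3 = 3" by simp
  have l: "l = (sqrt 3 * x + y) * (x - sqrt 3 * y)"
    unfolding l_def z using s by (simp add: power2_eq_square algebra_simps)
  have S: "csqrt z = Complex x (- y)" by (simp add: x_def y_def complex_eq_iff del: csqrt.simps)
  have ph: "Re (phase z) = 2 / 3 * x * (x\<^sup>2 - 3 * y\<^sup>2)"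
    unfolding phase_def S by (simp add: power3_eq_cube power2_eq_square field_simps)
  have ph2: "Re (phase z) = 2 / 3 * x * (x + sqrt 3 * y) * (x - sqrt 3 * y)"
    unfolding ph using s by (simp add: power2_eq_square algebra_simps)
  note s3 = sqrt3_bounds
  have key: "19 / 50 * (sqrt 3 * x + y) \<le> 2 / 3 * (x + sqrt 3 * y)"
  proof -
    have *: "sqrt 3 * x \<le> 1733 / 1000 * x" "1 * y \<le> sqrt 3 * y" using s3 xy y by (intro mult_right_mono; simp)+
    have "19 / 50 * (sqrt 3 * x + y) \<le> 19 / 50 * (1733 / 1000 * x + y)"
      using * by (intro mult_left_mono add_mono) auto
    also have "\<dots> \<le> 2 / 3 * (x + y)" using xy y by (simp add: field_simps)
    also have "\<dots> \<le> 2 / 3 * (x + sqrt 3 * y)"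
      using * by (intro mult_left_mono add_mono) auto
    finally show ?thesis .
  qed
  have sl: "sqrt 3 * x + y > 0" using xy y by (intro add_pos_nonneg mult_pos_pos) auto
  show "Re (phase z) \<ge> 19 / 50 * Re (csqrt z) * (sqrt 3 * Re z + Im z)" if "sqrt 3 * Re z + Im z \<ge> 0"
  proof -
    have "x - sqrt 3 * y \<ge> 0" using that sl unfolding l_def[symmetric] l by (simp add: zero_le_mult_iff)
    hence "19 / 50 * (sqrt 3 * x + y) * (x * (x - sqrt 3 * y)) \<le> 2 / 3 * (x + sqrt 3 * y) * (x * (x - sqrt 3 * y))"
      using xy by (intro mult_right_mono key) auto
    thus ?thesis unfolding l_def[symmetric] l ph2 x_def[symmetric] by (simp only: mult_ac)
  qed
  show "Re (phase z) \<le> 19 / 50 * Re (csqrt z) * (sqrt 3 * Re z + Im z)" if "sqrt 3 * Re z + Im z \<le> 0"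
  proof -
    have "x - sqrt 3 * y \<le> 0" using that sl unfolding l_def[symmetric] l by (simp add: mult_le_0_iff)
    hence "2 / 3 * (x + sqrt 3 * y) * (x * (x - sqrt 3 * y)) \<le> 19 / 50 * (sqrt 3 * x + y) * (x * (x - sqrt 3 * y))"
      using xy by (intro mult_right_mono_neg key) (auto simp: mult_le_0_iff)
    thus ?thesis unfolding l_def[symmetric] l ph2 x_def[symmetric] by (simp only: mult_ac)
  qed
qed

lemma Re_csqrt_sq_ge:
  assumes "Re z \<ge> 0"
  shows "(Re (csqrt z))\<^sup>2 \<ge> norm z / 2" "(Re (csqrt z))\<^sup>2 \<ge> Re z"
  using assms complex_Re_le_cmod[of z] by (auto simp: field_simps)

text \<open>1/200 is also the accuracy of the amplitudes fixed by \<open>wkb_cutoff\<close>. The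
  threshold 3 for scaled phases in the following lemmas is half of this 6.\<close>

lemma exp_m6: "exp (-6::real) \<le> 1 / 200"
proof -
  have "(5/2::real) ^ 6 \<le> exp 1 ^ 6"
    using exp_lower_Taylor_quadratic[of 1] by (intro power_mono) (auto simp: power2_eq_square)
  also have "exp 1 ^ 6 = exp (6::real)" using exp_of_nat_mult[of 6 "1::real"] by simp
  finally have "200 \<le> exp (6::real)" by (simp add: eval_nat_numeral)
  thus ?thesis by (simp add: exp_minus field_simps)
qed

section \<open>Balance of two exponentials, dominance of the third, reflection symmetry\<close>

lemma perturbed_quotient:
  fixes a b c t :: complex
  assumes "norm (a - 1) \<le> 1 / 200" "norm (b - 1) \<le> 1 / 200" "norm (c - 1) \<le> 1 / 200" "norm t \<le> 1 / 200"
  shows "norm ((a - c * t) / b - 1) \<le> 1 / 50" "b \<noteq> 0"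
proof -
  have b: "norm b \<ge> 199 / 200" using assms(2) norm_triangle_ineq2[of 1 "1 - b"] by (simp add: norm_minus_commute)
  thus "b \<noteq> 0" by auto
  have c: "norm c \<le> 201 / 200" using assms(3) norm_triangle_ineq[of "c - 1" 1] by simp
  have "(a - c * t) / b - 1 = ((a - 1) - (b - 1) - c * t) / b" using \<open>b \<noteq> 0\<close> by (simp add: field_simps)
  also have "norm \<dots> \<le> (1 / 200 + 1 / 200 + 201 / 200 * (1 / 200)) / (199 / 200)"
    unfolding norm_divide
  proof (rule frac_le)
    have "norm (c * t) \<le> 201 / 200 * (1 / 200)" unfolding norm_mult by (intro mult_mono c assms) auto
    thus "norm (a - 1 - (b - 1) - c * t) \<le> 1 / 200 + 1 / 200 + 201 / 200 * (1 / 200)"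
      using norm_triangle_ineq4[of "a - 1 - (b - 1)" "c * t"] norm_triangle_ineq4[of "a - 1" "b - 1"] assms by linarith
  qed (use b in auto)
  finally show "norm ((a - c * t) / b - 1) \<le> 1 / 50" by simp
qed

definition eta_ray :: "real \<Rightarrow> complex \<Rightarrow> complex" where
  "eta_ray k p = (amp3 k p - amp1 k p * (\<i> * exp (- (2 * of_real (k ^ 3) * phase (p - \<i>))))) / amp2 k p - 1"

definition eta_seg :: "real \<Rightarrow> complex \<Rightarrow> complex" where
  "eta_seg k p = (amp3 k p - amp2 k p * exp (2 * of_real (k ^ 3) * (phase (p + \<i>) - phase (p - \<i>)))) / amp1 k p - 1"

definition wkb_cutoff :: real where
  "wkb_cutoff = (SOME R. R \<ge> 1 \<and> (\<forall>k p. k > 0 \<longrightarrow> p \<in> wkb_good R k \<longrightarrow>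
    norm (amp1 k p - 1) \<le> 1 / 200 \<and> norm (amp2 k p - 1) \<le> 1 / 200 \<and> norm (amp3 k p - 1) \<le> 1 / 200))"

lemma wkb_cutoff:
  "wkb_cutoff \<ge> 1"
  "k > 0 \<Longrightarrow> p \<in> wkb_good wkb_cutoff k \<Longrightarrow>
    norm (amp1 k p - 1) \<le> 1 / 200 \<and> norm (amp2 k p - 1) \<le> 1 / 200 \<and> norm (amp3 k p - 1) \<le> 1 / 200"
proof -
  have "wkb_cutoff \<ge> 1 \<and> (\<forall>k p. k > 0 \<longrightarrow> p \<in> wkb_good wkb_cutoff k \<longrightarrow>
    norm (amp1 k p - 1) \<le> 1 / 200 \<and> norm (amp2 k p - 1) \<le> 1 / 200 \<and> norm (amp3 k p - 1) \<le> 1 / 200)"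
    unfolding wkb_cutoff_def
  proof (rule someI_ex, rule amps_near_1)
    fix R :: real
    assume "R \<ge> 1" "\<And>k p. k > 0 \<Longrightarrow> p \<in> wkb_good R k \<Longrightarrow>
      norm (amp1 k p - 1) \<le> 1 / 200 \<and> norm (amp2 k p - 1) \<le> 1 / 200 \<and> norm (amp3 k p - 1) \<le> 1 / 200"
    thus "\<exists>R\<ge>1. \<forall>k p. k > 0 \<longrightarrow> p \<in> wkb_good R k \<longrightarrow>
      norm (amp1 k p - 1) \<le> 1 / 200 \<and> norm (amp2 k p - 1) \<le> 1 / 200 \<and> norm (amp3 k p - 1) \<le> 1 / 200"
      by (intro exI[of _ R]) simp
  qed
  thus "wkb_cutoff \<ge> 1"
  "k > 0 \<Longrightarrow> p \<in> wkb_good wkb_cutoff k \<Longrightarrow>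
    norm (amp1 k p - 1) \<le> 1 / 200 \<and> norm (amp2 k p - 1) \<le> 1 / 200 \<and> norm (amp3 k p - 1) \<le> 1 / 200"
    by simp_all
qed

abbreviation good :: "real \<Rightarrow> complex set" where
  "good k \<equiv> wkb_good wkb_cutoff k"

text \<open>The normal form is multiplied by exp (b - a), which turns the middle exponential into 1;
  the others become exp (2 (b - a)) and exp (- 2 a). Negligibility of the latter leads to the ray
  equation, negligibility of the former to the segment equation.\<close>

lemma evans_zero_iff_good:
  assumes "k > 0" "p \<in> good k"
  shows "evans k p = 0 \<longleftrightarrow> amp2 k p * exp (2 * of_real (k ^ 3) * (phase (p + \<i>) - phase (p - \<i>))) - amp3 k p
     + \<i> * amp1 k p * exp (- (2 * of_real (k ^ 3) * phase (p - \<i>))) = 0" (is "_ \<longleftrightarrow> ?E = 0")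
proof -
  have p: "p \<in> wkb_dom" using assms(2) by (simp add: wkb_good_def)
  let ?D = "of_real (k ^ 3) * (phase (p + \<i>) - phase (p - \<i>))"
  have "evans_nf k p * exp ?D = amp2 k p * (exp ?D * exp ?D)
      - amp3 k p * (exp (of_real (k ^ 3) * (phase (p - \<i>) - phase (p + \<i>))) * exp ?D)
      + \<i> * amp1 k p * (exp (- of_real (k ^ 3) * (phase (p - \<i>) + phase (p + \<i>))) * exp ?D)"
    by (simp add: evans_nf_def algebra_simps)
  also have "\<dots> = ?E"
    unfolding mult_exp_exp by (simp add: algebra_simps)
  finally have "evans_nf k p = 0 \<longleftrightarrow> ?E = 0" by (metis exp_not_eq_zero mult_eq_0_iff)
  thus ?thesis using evans_zero_iff_nf[OF assms(1) wkb_dom_amps(1,2)[OF p]] by simp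
qed

lemma ray_equation:
  assumes "k > 0" "p \<in> good k" "k ^ 3 * Re (phase (p - \<i>)) \<ge> 3"
  shows "evans k p = 0 \<longleftrightarrow> exp (2 * \<i> * (of_real (k ^ 3) * wfun p)) = 1 + eta_ray k p"
    and "norm (eta_ray k p) \<le> 1 / 50"
proof -
  note A = wkb_cutoff(2)[OF assms(1,2)]
  let ?t = "exp (- (2 * of_real (k ^ 3) * phase (p - \<i>)))"
  have "norm ?t \<le> exp (-6)"
    using assms(3) unfolding norm_exp_2_of_real by (simp add: mult.commute)
  hence "norm ?t \<le> 1 / 200" using exp_m6 by linarith
  hence t: "norm (\<i> * ?t) \<le> 1 / 200" by (simp only: norm_mult norm_ii mult_1)
  show "norm (eta_ray k p) \<le> 1 / 50"
    unfolding eta_ray_def using A t by (intro perturbed_quotient) auto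
  have nz: "amp2 k p \<noteq> 0" using perturbed_quotient(2)[OF _ _ _ t] A by blast
  have e: "2 * \<i> * (of_real (k ^ 3) * wfun p) = 2 * of_real (k ^ 3) * (phase (p + \<i>) - phase (p - \<i>))"
    by (simp add: wfun_def)
  show "evans k p = 0 \<longleftrightarrow> exp (2 * \<i> * (of_real (k ^ 3) * wfun p)) = 1 + eta_ray k p"
    unfolding evans_zero_iff_good[OF assms(1,2)] e eta_ray_def using nz by (auto simp: field_simps)
qed

lemma seg_equation:
  assumes "k > 0" "p \<in> good k" "k ^ 3 * Im (wfun p) \<ge> 3"
  shows "evans k p = 0 \<longleftrightarrow> exp (- (2 * of_real (k ^ 3) * phase (p - \<i>))) = - \<i> * (1 + eta_seg k p)"
    and "norm (eta_seg k p) \<le> 1 / 50"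
proof -
  note A = wkb_cutoff(2)[OF assms(1,2)]
  let ?t = "exp (2 * of_real (k ^ 3) * (phase (p + \<i>) - phase (p - \<i>)))"
  have "norm ?t \<le> exp (-6)"
    using assms(3) unfolding norm_exp_2_of_real Im_wfun by (simp add: algebra_simps)
  hence t: "norm ?t \<le> 1 / 200" using exp_m6 by linarith
  show "norm (eta_seg k p) \<le> 1 / 50"
    unfolding eta_seg_def using A t by (intro perturbed_quotient) auto
  have nz: "amp1 k p \<noteq> 0" using perturbed_quotient(2)[OF _ _ _ t] A by blast
  let ?x = "exp (- (2 * of_real (k ^ 3) * phase (p - \<i>)))"
  have "amp2 k p * ?t - amp3 k p + \<i> * amp1 k p * ?x = 0 \<longleftrightarrow> ?x = - \<i> * ((amp3 k p - amp2 k p * ?t) / amp1 k p)"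
  proof
    assume "amp2 k p * ?t - amp3 k p + \<i> * amp1 k p * ?x = 0"
    hence "\<i> * amp1 k p * ?x = amp3 k p - amp2 k p * ?t" by (simp add: algebra_simps)
    hence "- \<i> * ((amp3 k p - amp2 k p * ?t) / amp1 k p) = - \<i> * (\<i> * amp1 k p * ?x / amp1 k p)" by (simp only:)
    thus "?x = - \<i> * ((amp3 k p - amp2 k p * ?t) / amp1 k p)" using nz by simp
  next
    assume x: "?x = - \<i> * ((amp3 k p - amp2 k p * ?t) / amp1 k p)"
    have "\<i> * amp1 k p * ?x = amp3 k p - amp2 k p * ?t" unfolding x using nz by simp
    thus "amp2 k p * ?t - amp3 k p + \<i> * amp1 k p * ?x = 0" by simp
  qed
  thus "evans k p = 0 \<longleftrightarrow> ?x = - \<i> * (1 + eta_seg k p)"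
    unfolding evans_zero_iff_good[OF assms(1,2)] eta_seg_def by simp
qed

text \<open>Multiplication by exp (a + b), of modulus at most 1, leaves \<open>\<i> * amp1\<close>
  plus two terms of size exp (- 6). The bound 1/2 later serves as the lower bound at the centre of
  the Jensen disc near the node.\<close>

lemma no_zero_third_dominant:
  assumes "k > 0" "p \<in> good k" "k ^ 3 * Re (phase (p - \<i>)) \<le> - 3" "Im (wfun p) \<ge> 0"
  shows "evans k p \<noteq> 0" "norm (evans_nf k p) \<ge> 1 / 2"
proof -
  note A = wkb_cutoff(2)[OF assms(1,2)]
  let ?a = "phase (p - \<i>)" and ?b = "phase (p + \<i>)"
  have "k ^ 3 * Re ?b \<le> k ^ 3 * Re ?a" using assms(1,4) by (intro mult_left_mono) (auto simp: Im_wfun)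
  hence b: "k ^ 3 * Re ?b \<le> -3" using assms(3) by linarith
  have "norm (exp (2 * of_real (k ^ 3) * ?a)) \<le> exp (-6)" "norm (exp (2 * of_real (k ^ 3) * ?b)) \<le> exp (-6)"
    using assms(3) b unfolding norm_exp_2_of_real by (simp_all add: mult.commute)
  hence e: "norm (exp (2 * of_real (k ^ 3) * ?a)) \<le> 1 / 200" "norm (exp (2 * of_real (k ^ 3) * ?b)) \<le> 1 / 200"
    using exp_m6 by linarith+
  have amps: "norm (amp1 k p) \<ge> 199 / 200" "norm (amp2 k p) \<le> 2" "norm (amp3 k p) \<le> 2"
    using A norm_triangle_ineq2[of 1 "1 - amp1 k p"] norm_triangle_ineq[of "amp2 k p - 1" 1]
      norm_triangle_ineq[of "amp3 k p - 1" 1] by (simp_all add: norm_minus_commute)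
  let ?F = "exp (of_real (k ^ 3) * (?a + ?b))"
  have "evans_nf k p * ?F = amp2 k p * (exp (of_real (k ^ 3) * (?b - ?a)) * ?F)
      - amp3 k p * (exp (of_real (k ^ 3) * (?a - ?b)) * ?F)
      + \<i> * amp1 k p * (exp (- of_real (k ^ 3) * (?a + ?b)) * ?F)"
    by (simp add: evans_nf_def algebra_simps)
  also have "\<dots> = amp2 k p * exp (2 * of_real (k ^ 3) * ?b) - amp3 k p * exp (2 * of_real (k ^ 3) * ?a) + \<i> * amp1 k p"
    unfolding mult_exp_exp by (simp add: algebra_simps)
  finally have eq: "evans_nf k p * ?F = \<dots>" .
  have "norm (amp2 k p * exp (2 * of_real (k ^ 3) * ?b)) \<le> 2 * (1 / 200)"
    "norm (amp3 k p * exp (2 * of_real (k ^ 3) * ?a)) \<le> 2 * (1 / 200)"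
    unfolding norm_mult by (intro mult_mono amps e; simp)+
  hence "norm (evans_nf k p * ?F) \<ge> 1 / 2"
    unfolding eq using amps(1) norm_diff_ineq[of "\<i> * amp1 k p" "amp2 k p * exp (2 * of_real (k ^ 3) * ?b) - amp3 k p * exp (2 * of_real (k ^ 3) * ?a)"]
      norm_triangle_ineq4[of "amp2 k p * exp (2 * of_real (k ^ 3) * ?b)" "amp3 k p * exp (2 * of_real (k ^ 3) * ?a)"]
    by (simp add: norm_mult add.commute)
  moreover have "norm ?F \<le> 1"
    using assms(3) b by (simp add: norm_exp_eq_Re algebra_simps flip: of_real_power)
  hence "norm (evans_nf k p * ?F) \<le> norm (evans_nf k p)"
    unfolding norm_mult by (intro mult_left_le) auto
  ultimately show n: "norm (evans_nf k p) \<ge> 1 / 2" by linarith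
  have p: "p \<in> wkb_dom" using assms(2) by (simp add: wkb_good_def)
  show "evans k p \<noteq> 0" using n evans_zero_iff_nf[OF assms(1) wkb_dom_amps(1,2)[OF p]] by auto
qed

text \<open>Replacing y (x) by the conjugate of y (- x) carries the boundary problem for l to that
  for \<open>- cnj l\<close>. The symmetry is read off the problem itself, because the chosen pair
  of Airy functions is not invariant under conjugation.\<close>

lemma evans_cnj_zero:
  assumes "k > 0" "evans k p = 0"
  shows "evans k (cnj p) = 0"
proof -
  have "is_eigenvalue (1 / k ^ 6) (- \<i> * p)"
    using is_eigenvalue_iff_evans[OF assms(1), of "- \<i> * p"] assms(2) by simp
  then obtain y y' y'' :: "real \<Rightarrow> complex" where
    cont: "continuous_on {-1..1} y" and
    d: "\<And>x. x \<in> {-1<..<1} \<Longrightarrow> (y has_vector_derivative y' x) (at x)" and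
    d': "\<And>x. x \<in> {-1<..<1} \<Longrightarrow> (y' has_vector_derivative y'' x) (at x)" and
    eq: "\<And>x. x \<in> {-1<..<1} \<Longrightarrow> - \<i> * complex_of_real (1 / k ^ 6) * y'' x = (complex_of_real x - - \<i> * p) * y x" and
    bc: "y (-1) = 0" "y 1 = 0" and nz: "\<exists>x\<in>{-1<..<1}. y x \<noteq> 0"
    unfolding is_eigenvalue_def by blast
  have flip: "((\<lambda>x. cnj (f (- x))) has_vector_derivative - cnj f') (at x)"
    if "(f has_vector_derivative f') (at (- x))" for f :: "real \<Rightarrow> complex" and f' x
  proof -
    have "((\<lambda>x. f (- x)) has_vector_derivative (-1) *\<^sub>R f') (at x)"
      using vector_diff_chain_at[OF has_vector_derivative_minus[OF has_vector_derivative_id] that]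
      by (simp add: o_def)
    thus ?thesis using has_vector_derivative_cnj by fastforce
  qed
  have "is_eigenvalue (1 / k ^ 6) (- \<i> * cnj p)"
    unfolding is_eigenvalue_def
  proof (intro exI conjI ballI)
    show "continuous_on {-1..1} (\<lambda>x. cnj (y (- x)))"
      by (intro continuous_on_cnj continuous_on_compose2[OF cont]) (auto intro!: continuous_intros)
    fix x :: real assume x: "x \<in> {-1<..<1}"
    hence mx: "- x \<in> {-1<..<1}" by auto
    show "((\<lambda>x. cnj (y (- x))) has_vector_derivative - cnj (y' (- x))) (at x)"
      by (rule flip[OF d[OF mx]])
    show "((\<lambda>x. - cnj (y' (- x))) has_vector_derivative cnj (y'' (- x))) (at x)"
      using has_vector_derivative_minus[OF flip[OF d'[OF mx]]] by simp
    have "- \<i> * complex_of_real (1 / k ^ 6) * cnj (y'' (- x)) = - cnj (- \<i> * complex_of_real (1 / k ^ 6) * y'' (- x))"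
      by simp
    also have "\<dots> = (complex_of_real x - - \<i> * cnj p) * cnj (y (- x))"
      unfolding eq[OF mx] by (simp add: algebra_simps)
    finally show "- \<i> * complex_of_real (1 / k ^ 6) * cnj (y'' (- x)) = (complex_of_real x - - \<i> * cnj p) * cnj (y (- x))" .
  next
    from nz obtain x where x: "x \<in> {-1<..<1}" "y x \<noteq> 0" by blast
    thus "\<exists>x\<in>{-1<..<1}. cnj (y (- x)) \<noteq> 0" by (intro bexI[of _ "- x"]) auto
  qed (use bc in auto)
  thus ?thesis using is_eigenvalue_iff_evans[OF assms(1), of "- \<i> * cnj p"] by simp
qed

subsection \<open>Zeros along the ray\<close>

definition node_re :: real where "node_re = 1 / sqrt 3"

lemma node_re_bounds: "node_re \<ge> 577 / 1000" "node_re \<le> 578 / 1000" "sqrt 3 * node_re = 1"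
proof -
  have "577 / 1000 * sqrt 3 \<le> 1" "578 / 1000 * sqrt 3 \<ge> 1" using sqrt3_bounds by auto
  thus "node_re \<ge> 577 / 1000" "node_re \<le> 578 / 1000" "sqrt 3 * node_re = 1"
    by (auto simp: node_re_def field_simps)
qed

text \<open>The numerical margins below are tuned to \<open>k ^ 3 \<ge> 1000\<close>; the second
  condition makes every point of \<open>wkb_dom\<close> at distance at least 1/4 from the turning
  points \<open>\<i>\<close> and \<open>- \<i>\<close> good.\<close>

definition large :: "real \<Rightarrow> bool" where
  "large k \<longleftrightarrow> k \<ge> 10 \<and> k\<^sup>2 \<ge> 4 * wkb_cutoff"

lemma large_bounds:
  assumes "large k"
  shows "k > 0" "k ^ 3 \<ge> 1000" "k\<^sup>2 \<ge> 4 * wkb_cutoff"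
proof -
  show "k > 0" "k\<^sup>2 \<ge> 4 * wkb_cutoff" using assms by (auto simp: large_def)
  have "(10::real) ^ 3 \<le> k ^ 3" using assms by (intro power_mono) (auto simp: large_def)
  thus "k ^ 3 \<ge> 1000" by simp
qed

lemma large_good:
  assumes "large k" "p \<in> wkb_dom" "norm (p - \<i>) \<ge> 1 / 4" "norm (p + \<i>) \<ge> 1 / 4"
  shows "p \<in> good k"
proof -
  have "wkb_cutoff \<le> k\<^sup>2 * (1 / 4)" using large_bounds(3)[OF assms(1)] by simp
  moreover have "k\<^sup>2 * (1 / 4) \<le> k\<^sup>2 * norm (p - \<i>)" "k\<^sup>2 * (1 / 4) \<le> k\<^sup>2 * norm (p + \<i>)"
    using assms by (intro mult_left_mono; simp)+
  ultimately show ?thesis using assms(2) unfolding wkb_good_def by auto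
qed

lemma norm_ge_Re_pm_i: "norm (p - \<i>) \<ge> Re p" "norm (p + \<i>) \<ge> Re p"
  using complex_Re_le_cmod[of "p - \<i>"] complex_Re_le_cmod[of "p + \<i>"] by auto

lemma csqrt_Re_ge_34:
  assumes "Re z \<ge> 577 / 1000"
  shows "Re (csqrt z) \<ge> 3 / 4"
proof -
  have "(3 / 4)\<^sup>2 \<le> Re z" using assms by (simp add: power2_eq_square)
  also have "\<dots> \<le> (Re (csqrt z))\<^sup>2" using assms by (intro Re_csqrt_sq_ge) auto
  finally show ?thesis by (rule power2_le_imp_le) (rule Re_csqrt)
qed

lemma phase_Re_right:
  assumes "Re p \<ge> node_re" "Im p \<le> 1" "sqrt 3 * Re p + Im p - 1 \<ge> 0"
  shows "Re (phase (p - \<i>)) \<ge> (sqrt 3 * Re p + Im p - 1) / 4"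
proof -
  have R: "Re p \<ge> 577 / 1000" using assms(1) node_re_bounds by linarith
  have "Re (csqrt (p - \<i>)) \<ge> 3 / 4" using R by (intro csqrt_Re_ge_34) simp
  hence "1 / 4 \<le> 19 / 50 * Re (csqrt (p - \<i>))" by linarith
  hence "1 / 4 * (sqrt 3 * Re p + Im p - 1) \<le> 19 / 50 * Re (csqrt (p - \<i>)) * (sqrt 3 * Re p + Im p - 1)"
    using assms(3) by (intro mult_right_mono)
  also have "19 / 50 * Re (csqrt (p - \<i>)) * (sqrt 3 * Re p + Im p - 1) \<le> Re (phase (p - \<i>))"
    using phase_Re_bounds(1)[of "p - \<i>"] assms R by (simp del: csqrt.simps add: add_diff_eq)
  finally show ?thesis by simp
qed

text \<open>Covers the parts of the ray discs that rise above imaginary part 1, where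
  \<open>phase_Re_right\<close> does not apply.\<close>

lemma phase_Re_sector:
  assumes "Re z \<ge> 577 / 1000" "Im z \<ge> 0" "Im z \<le> Re z / 4"
  shows "Re (phase z) \<ge> 1 / 5"
proof -
  define x y where "x = Re (csqrt z)" and "y = Im (csqrt z)"
  have x: "x \<ge> 3 / 4" unfolding x_def by (rule csqrt_Re_ge_34[OF assms(1)])
  have "z = (csqrt z)\<^sup>2" by simp
  hence z: "Re z = x\<^sup>2 - y\<^sup>2" "Im z = 2 * x * y" unfolding x_def y_def by (metis Re_power2, metis Im_power2)
  have y: "y \<ge> 0" using assms(2) x unfolding z by (simp add: zero_le_mult_iff)
  have "2 * x * y \<le> x\<^sup>2 / 4" using assms(3) unfolding z
    by (rule order.trans) (intro divide_right_mono, auto)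
  hence "x * (8 * y) \<le> x * x" by (simp add: power2_eq_square)
  hence "8 * y \<le> x" using x by (subst (asm) mult_le_cancel_left_pos) auto
  hence "y\<^sup>2 \<le> (x / 8)\<^sup>2" using y by (intro power_mono) auto
  hence d: "x\<^sup>2 - 3 * y\<^sup>2 \<ge> 61 / 64 * x\<^sup>2" by (simp add: power_divide)
  have S: "csqrt z = Complex x y" by (simp add: x_def y_def complex_eq_iff del: csqrt.simps)
  have "Re (phase z) = 2 / 3 * x * (x\<^sup>2 - 3 * y\<^sup>2)"
    unfolding phase_def S by (simp add: power3_eq_cube power2_eq_square field_simps)
  also have "\<dots> \<ge> 2 / 3 * x * (61 / 64 * x\<^sup>2)" using d x by (intro mult_left_mono) auto
  finally have "Re (phase z) \<ge> 61 / 96 * x ^ 3" by (simp add: power3_eq_cube power2_eq_square)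
  moreover have "x ^ 3 \<ge> (3 / 4) ^ 3" using x by (intro power_mono) auto
  ultimately show ?thesis by (simp add: power3_eq_cube)
qed

lemma csqrt_diff_le:
  assumes "Re (csqrt a) \<ge> s" "s > 0"
  shows "norm (csqrt b - csqrt a) \<le> norm (b - a) / s"
proof -
  have "(csqrt b - csqrt a) * (csqrt b + csqrt a) = (csqrt b)\<^sup>2 - (csqrt a)\<^sup>2"
    by (simp only: power2_eq_square ring_distribs mult_ac) simp
  also have "\<dots> = b - a" by simp
  finally have "norm (csqrt b - csqrt a) * norm (csqrt b + csqrt a) = norm (b - a)"
    by (simp only: norm_mult[symmetric])
  moreover have "s \<le> norm (csqrt b + csqrt a)"
    using assms(1) Re_csqrt[of b] complex_Re_le_cmod[of "csqrt b + csqrt a"] by (simp del: csqrt.simps)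
  hence "norm (csqrt b - csqrt a) * s \<le> norm (csqrt b - csqrt a) * norm (csqrt b + csqrt a)"
    by (intro mult_left_mono) auto
  ultimately have "norm (csqrt b - csqrt a) * s \<le> norm (b - a)" by linarith
  thus ?thesis using assms(2) by (simp add: pos_le_divide_eq)
qed

lemma csqrt_cnj_real:
  assumes "x > 0"
  shows "csqrt (of_real x - \<i>) = cnj (csqrt (of_real x + \<i>))"
  using cnj_csqrt[of "of_real x + \<i>"] assms by (simp add: complex_nonpos_Reals_iff)

text \<open>The derivative of \<open>k ^ 3 * wfun\<close> at x is \<open>k ^ 3 / ray_s x\<close>, so
  \<open>ray_s x / k ^ 3\<close> is the radius \<open>1 / norm d\<close> of
  \<open>unique_perturbed_zero\<close>.\<close>

definition ray_s :: "real \<Rightarrow> real" where "ray_s x = Re (csqrt (of_real x + \<i>))"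

lemma usum_real: "x > 0 \<Longrightarrow> usum (of_real x) = of_real (2 * ray_s x)"
  unfolding usum_def csqrt_cnj_real ray_s_def by (simp add: complex_eq_iff del: csqrt.simps)

lemma ray_s_bounds:
  assumes "x \<ge> node_re"
  shows "ray_s x \<ge> 3 / 4" "ray_s x \<le> x / 2 + 3 / 4" "(ray_s x)\<^sup>2 \<ge> (1 + x) / 2"
proof -
  have x: "x \<ge> 577 / 1000" using assms node_re_bounds by linarith
  show s: "ray_s x \<ge> 3 / 4" unfolding ray_s_def by (rule csqrt_Re_ge_34) (use x in simp)
  have n: "norm (complex_of_real x + \<i>) \<le> x + 1" using norm_triangle_ineq[of "complex_of_real x" \<i>] x by simp
  have n2: "norm (complex_of_real x + \<i>) \<ge> 1" using abs_Im_le_cmod[of "complex_of_real x + \<i>"] by simp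
  have sq: "(ray_s x)\<^sup>2 = (norm (complex_of_real x + \<i>) + x) / 2"
    unfolding ray_s_def csqrt.simps using n2 x by (subst real_sqrt_pow2) auto
  have "2 * ray_s x \<le> 1 + (ray_s x)\<^sup>2" using zero_le_power2[of "ray_s x - 1"] by (simp add: power2_diff)
  also have "\<dots> \<le> x + 3 / 2" unfolding sq using n by argo
  finally show "ray_s x \<le> x / 2 + 3 / 4" by simp
  show "(ray_s x)\<^sup>2 \<ge> (1 + x) / 2" unfolding sq using n2 by simp
qed

text \<open>The third exponential has to be negligible on the whole disc. The radius \<rho> is
  controlled by the distance t from the node, and the linear form of \<open>phase_Re_right\<close>
  is at least \<open>17 / 10 * t - 3 * \<rho>\<close>; the offset 16 makes \<open>k ^ 3\<close>
  times it at least 12, hence \<open>k ^ 3\<close> times the real part of the phase at least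
  3.\<close>

lemma ray_disc:
  assumes k: "large k" and x: "x \<ge> node_re + 16 / k ^ 3" and p: "norm (p - of_real x) \<le> ray_s x / k ^ 3"
  shows "p \<in> good k" "k ^ 3 * Re (phase (p - \<i>)) \<ge> 3" "Re p > 0"
    "norm (usum p - usum (of_real x)) \<le> 2 / k ^ 3"
proof -
  define K where "K = k ^ 3"
  have K: "K \<ge> 1000" and k0: "k > 0" using large_bounds[OF k] by (auto simp: K_def)
  define t where "t = x - node_re"
  have "0 < 16 / K" "16 / K \<le> t" using x K by (simp_all add: t_def flip: K_def)
  hence t: "K * t \<ge> 16" "t > 0" using K by (simp add: pos_divide_le_eq mult.commute, linarith)
  have xn: "x \<ge> node_re" "x > 0" using t node_re_bounds by (auto simp: t_def)
  define \<rho> where "\<rho> = ray_s x / K"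
  note s = ray_s_bounds[OF xn(1)]
  \<comment> \<open>104/100 bounds \<open>node_re / 2 + 3 / 4\<close>.\<close>
  have "ray_s x \<le> t / 2 + 104 / 100" using s(2) node_re_bounds(1,2) unfolding t_def by argo
  hence K\<rho>: "K * \<rho> \<le> t / 2 + 104 / 100" "\<rho> > 0" using K s by (auto simp: \<rho>_def)
  have t1000: "1000 * t \<le> K * t" "1000 * \<rho> \<le> K * \<rho>" using K t K\<rho> by (auto intro: mult_right_mono)
  have p': "\<bar>Re p - x\<bar> \<le> \<rho>" "\<bar>Im p\<bar> \<le> \<rho>"
    using abs_Re_le_cmod[of "p - of_real x"] abs_Im_le_cmod[of "p - of_real x"] p by (auto simp: \<rho>_def K_def)
  have \<rho>t: "\<rho> \<le> t / 2"
  proof -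
    have "K * \<rho> \<le> K * t / 2" using K\<rho>(1) t(1) t1000(1) by argo
    hence "K * \<rho> \<le> K * (t / 2)" by simp
    thus ?thesis by (rule mult_left_le_imp_le) (use K in simp)
  qed
  have p1: "Re p \<ge> x - \<rho>" "Re p \<le> x + \<rho>" using p'(1) by linarith+
  have Rp: "Re p \<ge> node_re" using p1 \<rho>t t(2) unfolding t_def by argo
  thus "Re p > 0" using node_re_bounds by linarith
  have R577: "Re p \<ge> 577 / 1000" using Rp node_re_bounds by linarith
  have Rt: "Re p \<ge> t / 2" using p1 \<rho>t xn(1) node_re_bounds(1) unfolding t_def by argo
  have "1000 * \<rho> \<le> t / 2 + 104 / 100" using t1000 K\<rho> by linarith
  hence Imp: "\<bar>Im p\<bar> \<le> 1 + Re p / 4" using p' Rt by linarith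
  have dom: "p \<in> wkb_dom" using Imp R577 by (auto simp: wkb_dom_def abs_le_iff)
  show "p \<in> good k"
    using norm_ge_Re_pm_i[of p] R577 by (intro large_good[OF k dom]) linarith+
  show "k ^ 3 * Re (phase (p - \<i>)) \<ge> 3"
  proof (cases "Im p \<le> 1")
    case True
    define l where "l = sqrt 3 * Re p + Im p - 1"
    have s3: "sqrt 3 \<ge> 17 / 10" "sqrt 3 \<le> 2" using sqrt3_bounds by auto
    have "sqrt 3 * (x - \<rho>) \<le> sqrt 3 * Re p" using p1 by (intro mult_left_mono) auto
    moreover have "- \<rho> \<le> Im p" using p'(2) by linarith
    moreover have "sqrt 3 * (x - \<rho>) = sqrt 3 * t + 1 - sqrt 3 * \<rho>"
      using node_re_bounds(3) by (simp add: t_def algebra_simps)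
    moreover have "17 / 10 * t \<le> sqrt 3 * t" "sqrt 3 * \<rho> \<le> 2 * \<rho>"
      using s3 t K\<rho> by (intro mult_right_mono; simp)+
    ultimately have "l \<ge> 17 / 10 * t - 3 * \<rho>" unfolding l_def by argo
    hence "K * l \<ge> K * (17 / 10 * t - 3 * \<rho>)" using K by (intro mult_left_mono) auto
    also have "K * (17 / 10 * t - 3 * \<rho>) = 17 / 10 * (K * t) - 3 * (K * \<rho>)" by (simp add: algebra_simps)
    finally have Kl: "K * l \<ge> 12" using K\<rho> t t1000 by linarith
    hence "l \<ge> 0" using K by (smt (verit) mult_nonneg_nonpos)
    from phase_Re_right[OF Rp True this[unfolded l_def]]
    have "l / 4 \<le> Re (phase (p - \<i>))" by (simp add: l_def)
    hence "K * (l / 4) \<le> K * Re (phase (p - \<i>))" using K by (intro mult_left_mono) auto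
    thus ?thesis using Kl by (simp add: K_def)
  next
    case False
    have "Re (phase (p - \<i>)) \<ge> 1 / 5" using False R577 Imp by (intro phase_Re_sector) auto
    hence "K * (1 / 5) \<le> K * Re (phase (p - \<i>))" using K by (intro mult_left_mono) auto
    thus ?thesis using K by (simp add: K_def)
  qed
  have s0: "ray_s x > 0" using s(1) by simp
  have Rx: "Re (csqrt (of_real x + \<i>)) = ray_s x" "Re (csqrt (of_real x - \<i>)) = ray_s x"
    unfolding csqrt_cnj_real[OF xn(2)] ray_s_def by (simp_all del: csqrt.simps)
  have "norm (csqrt (p + \<i>) - csqrt (of_real x + \<i>)) \<le> norm (p + \<i> - (of_real x + \<i>)) / ray_s x"
    "norm (csqrt (p - \<i>) - csqrt (of_real x - \<i>)) \<le> norm (p - \<i> - (of_real x - \<i>)) / ray_s x"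
    by (rule csqrt_diff_le; simp only: Rx order.refl s0)+
  moreover have "norm (p - of_real x) / ray_s x \<le> 1 / K"
  proof -
    have "norm (p - of_real x) / ray_s x \<le> (ray_s x / K) / ray_s x"
      using p s0 by (intro divide_right_mono) (auto simp: K_def)
    thus ?thesis using s0 by simp
  qed
  ultimately have "norm (csqrt (p + \<i>) - csqrt (of_real x + \<i>)) \<le> 1 / K" "norm (csqrt (p - \<i>) - csqrt (of_real x - \<i>)) \<le> 1 / K"
    by simp_all
  moreover have "usum p - usum (of_real x) = (csqrt (p + \<i>) - csqrt (of_real x + \<i>)) + (csqrt (p - \<i>) - csqrt (of_real x - \<i>))"
    by (simp add: usum_def del: csqrt.simps)
  ultimately show "norm (usum p - usum (of_real x)) \<le> 2 / k ^ 3"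
    using norm_triangle_ineq[of "csqrt (p + \<i>) - csqrt (of_real x + \<i>)" "csqrt (p - \<i>) - csqrt (of_real x - \<i>)"]
    by (simp add: K_def del: csqrt.simps)
qed

lemma phase_shift_holomorphic:
  "(\<lambda>p. phase (p - \<i>)) holomorphic_on wkb_dom" "(\<lambda>p. phase (p + \<i>)) holomorphic_on wkb_dom"
  unfolding phase_def by (auto intro!: holomorphic_intros wkb_dom_off_cut)

lemma eta_holomorphic:
  assumes "k > 0" "S \<subseteq> good k"
  shows "eta_ray k holomorphic_on S" "eta_seg k holomorphic_on S"
proof -
  have S: "S \<subseteq> wkb_dom" using assms(2) by (auto simp: wkb_good_def)
  have nz: "amp1 k p \<noteq> 0" "amp2 k p \<noteq> 0" if "p \<in> S" for p
    using wkb_cutoff(2)[OF assms(1), of p] that assms(2) by (force simp: subset_iff)+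
  note h = amps_holomorphic[OF assms(1), THEN holomorphic_on_subset, OF S]
    phase_shift_holomorphic[THEN holomorphic_on_subset, OF S]
  show "eta_ray k holomorphic_on S" "eta_seg k holomorphic_on S"
    unfolding eta_ray_def[abs_def] eta_seg_def[abs_def] using nz by (auto intro!: holomorphic_intros h)
qed

text \<open>The second conclusion controls the phase at every point of the disc, so that the label n
  can be recovered from the zero.\<close>

lemma ray_unique:
  assumes k: "large k" and x: "x \<ge> node_re + 16 / k ^ 3" and n: "of_real (k ^ 3) * wfun (of_real x) = of_real (pi * of_int n)"
  shows "\<exists>!z. z \<in> cball (of_real x) (ray_s x / (2 * k ^ 3)) \<and> evans k z = 0"
    and "z \<in> cball (of_real x) (ray_s x / (2 * k ^ 3)) \<Longrightarrow> norm (of_real (k ^ 3) * wfun z - of_real (pi * of_int n)) \<le> 5 / 8"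
proof -
  define K where "K = k ^ 3"
  have K: "K \<ge> 1000" and k0: "k > 0" using large_bounds[OF k] by (auto simp: K_def)
  have "0 \<le> 16 / k ^ 3" using k0 by simp
  hence xn: "x \<ge> node_re" "x > 0" using x node_re_bounds(1) by linarith+
  have s: "ray_s x \<ge> 3 / 4" using ray_s_bounds[OF xn(1)] by simp
  define d where "d = complex_of_real (K / ray_s x)"
  have "norm d = K / ray_s x" unfolding d_def norm_of_real using K s by simp
  moreover have "K / ray_s x > 0" using K s by simp
  ultimately have d: "d \<noteq> 0" "norm d = K / ray_s x" by auto
  have r: "1 / norm d = ray_s x / k ^ 3" "1 / (2 * norm d) = ray_s x / (2 * k ^ 3)"
    unfolding d(2) by (simp_all add: K_def)
  have dx: "d = of_real K * (2 / usum (of_real x))" using s by (simp add: usum_real[OF xn(2)] d_def)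
  have disc: "p \<in> good k" "k ^ 3 * Re (phase (p - \<i>)) \<ge> 3" "Re p > 0" "norm (usum p - usum (of_real x)) \<le> 2 / K"
    if "p \<in> ball (of_real x) (1 / norm d)" for p
    using ray_disc[OF k x, of p] that unfolding r(1) K_def by (auto simp: dist_norm norm_minus_commute)
  have Y: "((\<lambda>p. of_real K * wfun p) has_field_derivative of_real K * (2 / usum p)) (at p)"
    if "p \<in> ball (of_real x) (1 / norm d)" for p
    by (rule DERIV_cmult[OF wfun_deriv[OF disc(3)[OF that]]])
  have Y': "norm (of_real K * (2 / usum p) - d) \<le> norm d / 4" if "p \<in> ball (of_real x) (1 / norm d)" for p
  proof -
    have ux: "norm (usum (of_real x)) = 2 * ray_s x" using s by (simp add: usum_real[OF xn(2)])
    have "2 / K \<le> 1 / 2" using K by simp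
    hence u1: "norm (usum p) \<ge> 1"
      using disc(4)[OF that] norm_triangle_ineq2[of "usum (of_real x)" "usum (of_real x) - usum p"] s ux
      by (simp add: norm_minus_commute)
    hence nz: "usum p \<noteq> 0" "usum (of_real x) \<noteq> 0" using ux s by auto
    have "of_real K * (2 / usum p) - d = d * ((usum (of_real x) - usum p) / usum p)"
      unfolding dx using nz by (simp add: field_simps)
    hence "norm (of_real K * (2 / usum p) - d) = norm d * (norm (usum p - usum (of_real x)) / norm (usum p))"
      by (simp add: norm_mult norm_divide norm_minus_commute)
    also have "\<dots> \<le> norm d * ((2 / K) / 1)"
      using disc(4)[OF that] u1 K by (intro mult_left_mono frac_le) auto
    also have "\<dots> \<le> norm d * (1 / 4)" using K by (intro mult_left_mono) auto
    finally show ?thesis by simp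
  qed
  have sub: "ball (of_real x) (1 / norm d) \<subseteq> good k" using disc(1) by blast
  have small: "norm (eta_ray k p) \<le> 1 / 16" if "p \<in> ball (of_real x) (1 / norm d)" for p
    using ray_equation(2)[OF k0 disc(1,2)[OF that]] by linarith
  note U = unique_perturbed_zero[OF d(1) Y Y' eta_holomorphic(1)[OF k0 sub] small]
  have n': "of_real K * wfun (of_real x) = of_real (pi * of_int n)" using n by (simp add: K_def)
  show "norm (of_real (k ^ 3) * wfun z - of_real (pi * of_int n)) \<le> 5 / 8"
    if "z \<in> cball (of_real x) (ray_s x / (2 * k ^ 3))" for z
    using U(2)[of z] that unfolding r n' by (simp add: K_def)
  have eq: "evans k z = 0 \<longleftrightarrow> exp (2 * \<i> * (of_real K * wfun z - of_real K * wfun (of_real x))) = 1 + eta_ray k z"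
    if z: "z \<in> cball (of_real x) (1 / (2 * norm d))" for z
  proof -
    have "1 / (2 * norm d) = 1 / norm d / 2" "1 / norm d > 0" using d(1) by auto
    hence "1 / (2 * norm d) < 1 / norm d" by linarith
    hence zb: "z \<in> ball (of_real x) (1 / norm d)" using z by (auto simp: mem_ball mem_cball)
    have "exp (2 * \<i> * (of_real K * wfun z - of_real K * wfun (of_real x)))
        = exp (2 * \<i> * (of_real K * wfun z) - 2 * \<i> * of_real (pi * of_int n))"
      unfolding n' by (simp add: algebra_simps)
    also have "\<dots> = exp (2 * \<i> * (of_real K * wfun z)) / exp (2 * of_int n * pi * \<i>)"
      by (simp add: exp_diff mult_ac)
    also have "exp (2 * of_int n * pi * \<i>) = 1"
      using exp_integer_2pi[of "of_int n"] by simp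
    finally show ?thesis
      using ray_equation(1)[OF k0 disc(1,2)[OF zb]] by (simp add: K_def)
  qed
  show "\<exists>!z. z \<in> cball (of_real x) (ray_s x / (2 * k ^ 3)) \<and> evans k z = 0"
    using U(1) eq unfolding r(2)[symmetric] by metis
qed

definition wre :: "real \<Rightarrow> real" where "wre x = Re (wfun (of_real x))"

lemma wfun_of_real: "x > 0 \<Longrightarrow> wfun (of_real x) = of_real (wre x)"
  unfolding wre_def by (rule wfun_real)

lemma wre_increase:
  assumes "0 < x" "x \<le> y"
  shows "wre y - wre x \<ge> 7 / 10 / sqrt (y + 1) * (y - x)"
proof (cases "x = y")
  case False
  have "7 / 10 / sqrt (y + 1) * (norm (complex_of_real y - of_real x))\<^sup>2
      \<le> Re ((wfun (of_real y) - wfun (of_real x)) * cnj (of_real y - of_real x))"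
    using assms by (intro wfun_monotone(1)) auto
  also have "\<dots> = (wre y - wre x) * (y - x)" using assms by (simp add: wfun_of_real)
  also have "(norm (complex_of_real y - of_real x))\<^sup>2 = (y - x) * (y - x)"
    by (simp add: power2_eq_square flip: of_real_diff)
  finally have "(7 / 10 / sqrt (y + 1) * (y - x)) * (y - x) \<le> (wre y - wre x) * (y - x)" by (simp only: mult.assoc)
  thus ?thesis by (rule mult_right_le_imp_le) (use assms False in simp)
qed simp

lemma wre_strict_mono: "0 < x \<Longrightarrow> x < y \<Longrightarrow> wre x < wre y"
  using wre_increase[of x y] by (smt (verit) divide_pos_pos mult_pos_pos real_sqrt_gt_zero)

lemma wre_mono: "0 < x \<Longrightarrow> x \<le> y \<Longrightarrow> wre x \<le> wre y"
  using wre_strict_mono[of x y] by (cases "x = y") auto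

lemma wre_surj:
  assumes "x1 > 0" "wre x1 \<le> c"
  obtains x where "x \<ge> x1" "wre x = c"
proof -
  define D where "D = c - wre x1"
  \<comment> \<open>Chosen so that \<open>sqrt (x2 + 1) = q\<close> for
    \<open>x2 = q ^ 2 - 1\<close>: the increment of \<open>wre\<close> up to x2 is then at least
    7/10 of \<open>q - (1 + x1)\<close>, which is D. The slope decays like the reciprocal square
    root, so x2 has to be quadratic in D.\<close>
  define q where "q = 1 + x1 + 10 / 7 * D"
  define x2 where "x2 = q\<^sup>2 - 1"
  have D: "D \<ge> 0" using assms by (simp add: D_def)
  hence q: "q \<ge> 1 + x1" "q > 1" using assms by (auto simp: q_def)
  have "q * 1 \<le> q * q" using q by (intro mult_left_mono) auto
  hence x2: "x2 \<ge> x1" using q unfolding x2_def power2_eq_square by linarith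
  have eq: "7 / 10 / sqrt (x2 + 1) * (x2 - x1) = 7 / 10 * ((q\<^sup>2 - (1 + x1)) / q)"
    using q by (simp add: x2_def)
  have "(q\<^sup>2 - (1 + x1)) / q \<ge> 10 / 7 * D"
  proof -
    have "10 / 7 * D = q - (1 + x1)" by (simp add: q_def)
    hence "(10 / 7 * D) * q = q\<^sup>2 - (1 + x1) * q" by (simp only: power2_eq_square left_diff_distrib)
    also have "\<dots> \<le> q\<^sup>2 - (1 + x1) * 1" using q assms by (intro diff_left_mono mult_left_mono) auto
    finally show ?thesis using q by (simp add: pos_le_divide_eq)
  qed
  hence "wre x2 - wre x1 \<ge> D" using wre_increase[OF assms(1) x2] unfolding eq by linarith
  hence "c \<le> wre x2" by (simp add: D_def)
  moreover have "continuous_on {x1..x2} wre"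
  proof (rule continuous_at_imp_continuous_on, rule ballI)
    fix x assume "x \<in> {x1..x2}"
    hence "Re (complex_of_real x) > 0" using assms by simp
    hence "isCont wfun (of_real x)" using wfun_deriv DERIV_isCont by blast
    hence "isCont (\<lambda>x. wfun (complex_of_real x)) x"
      by (intro isCont_o2[where f=complex_of_real and g=wfun and a=x]) auto
    thus "isCont wre x" unfolding wre_def[abs_def] by (rule continuous_Re)
  qed
  ultimately obtain x where "x1 \<le> x" "wre x = c"
    using IVT'[of wre x1 c x2] assms(2) x2 by blast
  thus ?thesis using that by blast
qed

text \<open>Converse of \<open>ray_unique\<close>. At a zero \<open>wfun p\<close> is within
  \<open>1 / (50 * k ^ 3)\<close> of a real number c for which \<open>k ^ 3 * c\<close> is a
  multiple of pi, and strong monotonicity turns this into closeness of p to the point x with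
  \<open>wre x = c\<close>. Starting at 20 leaves a reserve of 4 units for x to stay beyond offset
  16.\<close>

lemma ray_locate_upper:
  assumes k: "large k" and p: "evans k p = 0" "Re p \<ge> node_re + 20 / k ^ 3" "Im p \<ge> 0"
  shows "\<exists>x n. x \<ge> node_re + 16 / k ^ 3 \<and> k ^ 3 * wre x = pi * of_int n \<and> p \<in> cball (of_real x) (ray_s x / (2 * k ^ 3))"
proof -
  define K where "K = k ^ 3"
  have K: "K \<ge> 1000" and k0: "k > 0" using large_bounds[OF k] by (auto simp: K_def)
  note pb = evans_zero_bounds[OF k0 p(1)]
  have nK: "node_re \<le> Re p" using p(2) K by (simp add: K_def[symmetric]) (smt (verit) divide_nonneg_nonneg)
  have R577: "Re p \<ge> 577 / 1000" using nK node_re_bounds by linarith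
  have dom: "p \<in> wkb_dom" using pb p(3) by (auto simp: wkb_dom_def)
  have good: "p \<in> good k"
    using norm_ge_Re_pm_i[of p] R577 by (intro large_good[OF k dom]) linarith+
  define t where "t = Re p - node_re"
  have "0 < 20 / K" "20 / K \<le> t" using p(2) K by (simp_all add: t_def flip: K_def)
  hence t: "K * t \<ge> 20" "t > 0" using K by (simp add: pos_divide_le_eq mult.commute, linarith)
  have l: "sqrt 3 * Re p + Im p - 1 \<ge> t"
  proof -
    have "sqrt 3 * Re p - 1 = sqrt 3 * t" using node_re_bounds(3) by (simp add: t_def algebra_simps)
    moreover have "1 * t \<le> sqrt 3 * t" using t by (intro mult_right_mono) auto
    ultimately show ?thesis using p(3) by simp
  qed
  have "t / 4 \<le> Re (phase (p - \<i>))" using phase_Re_right[OF nK _] l t pb p(3) by force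
  hence "K * (t / 4) \<le> K * Re (phase (p - \<i>))" using K by (intro mult_left_mono) auto
  hence al: "k ^ 3 * Re (phase (p - \<i>)) \<ge> 3" using t by (simp add: K_def)
  from ray_equation[OF k0 good al] p(1)
  have eta: "exp (2 * \<i> * (of_real (k ^ 3) * wfun p)) = 1 + eta_ray k p" "norm (eta_ray k p) \<le> 1 / 50" by auto
  hence "norm (eta_ray k p) < 1 / 2" by linarith
  from exp_eq_one_plus_small[OF eta(1) this] obtain n :: int where
    "norm (of_real K * wfun p - of_real (pi * of_int n)) \<le> norm (eta_ray k p)" unfolding K_def by blast
  hence n: "norm (of_real K * wfun p - of_real (pi * of_int n)) \<le> 1 / 50" using eta(2) by linarith
  define c where "c = pi * of_int n / K"
  have wc: "norm (wfun p - of_real c) \<le> 1 / (50 * K)"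
  proof -
    have "of_real K * wfun p - of_real (pi * of_int n) = of_real K * (wfun p - of_real c)"
      using K by (simp add: c_def algebra_simps)
    hence "K * norm (wfun p - of_real c) \<le> 1 / 50" using n K by (simp add: norm_mult)
    thus ?thesis using K by (simp add: field_simps)
  qed
  define x1 where "x1 = node_re + 16 / K"
  have "0 \<le> 16 / K" "20 / K = 16 / K + 4 / K" using K by (auto simp: add_divide_distrib[symmetric])
  hence x1: "x1 > 0" "x1 \<le> Re p - 4 / K" using node_re_bounds(1) p(2) unfolding x1_def K_def by linarith+
  have x1p: "x1 < Re p" using x1 K by (smt (verit) divide_pos_pos)
  have Rn: "Re p \<le> norm p" by (rule complex_Re_le_cmod)
  have np: "norm p \<le> Re p + 1" using cmod_le[of p] pb p(3) by simp
  \<comment> \<open>Otherwise strong monotonicity puts p within \<open>r / (35 * K)\<close> of x1,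
    where \<open>r = sqrt (norm p + 1)\<close>. The distance is at least \<open>4 / K\<close>, which
    forces r to be at least 140; but then it is also at least \<open>r * r - 3\<close>, far too
    large.\<close>
  have "wre x1 \<le> c"
  proof (rule ccontr)
    assume "\<not> wre x1 \<le> c"
    hence lt: "c < wre x1" by simp
    define q where "q = p - of_real x1"
    have q: "norm q \<ge> Re p - x1" "q \<noteq> 0" using complex_Re_le_cmod[of q] x1p by (auto simp: q_def complex_eq_iff)
    define m where "m = 7 / 10 / sqrt (norm p + 1)"
    have "m * (norm q)\<^sup>2 \<le> Re ((wfun p - wfun (of_real x1)) * cnj q)"
      unfolding m_def q_def using pb x1 x1p Rn by (intro wfun_monotone(1)) auto
    also have "\<dots> = Re ((wfun p - of_real c) * cnj q) - (wre x1 - c) * (Re p - x1)"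
      using x1(1) by (simp add: wfun_of_real q_def algebra_simps)
    also have "\<dots> \<le> Re ((wfun p - of_real c) * cnj q)" using lt x1p by simp
    also have "\<dots> \<le> norm ((wfun p - of_real c) * cnj q)" by (rule complex_Re_le_cmod)
    also have "\<dots> \<le> 1 / (50 * K) * norm q" unfolding norm_mult complex_mod_cnj by (intro mult_right_mono wc) auto
    finally have "(m * norm q) * norm q \<le> 1 / (50 * K) * norm q" by (simp only: power2_eq_square mult.assoc)
    hence "m * norm q \<le> 1 / (50 * K)" by (rule mult_right_le_imp_le) (use q(2) in simp)
    define r where "r = sqrt (norm p + 1)"
    have r: "r \<ge> 1" "r * r = norm p + 1" by (auto simp: r_def)
    have mq: "7 / 10 * norm q \<le> r / (50 * K)"
      using \<open>m * norm q \<le> 1 / (50 * K)\<close> r(1) unfolding m_def r_def[symmetric] by (simp add: field_simps)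
    have "4 / K \<le> norm q" using q(1) x1(2) by linarith
    hence "7 / 10 * (4 / K) \<le> r / (50 * K)" using mq by linarith
    hence r140: "r \<ge> 140" using K by (simp add: field_simps)
    have "16 / K \<le> 16 / 1000" using K by (intro divide_left_mono) auto
    hence "x1 \<le> 1" using node_re_bounds(2) unfolding x1_def by linarith
    hence "norm q \<ge> r * r - 3" using q(1) np r(2) by linarith
    moreover have "r / (50 * K) \<le> r * 1" using r K by (simp add: field_simps)
    ultimately have "7 / 10 * (r * r - 3) \<le> r" using mq by argo
    moreover have "140 * r \<le> r * r" using r140 by (intro mult_right_mono) auto
    ultimately show False using r140 by argo
  qed
  then obtain x where x: "x \<ge> x1" "wre x = c" using wre_surj[OF x1(1)] by blast
  have "norm (p - of_real x) \<le> ray_s x / (2 * K)"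
  proof -
    have xn: "x \<ge> node_re" "x > 0" using x(1) x1 K by (auto simp: x1_def intro: order.trans[rotated])
    define T where "T = max (norm p) x"
    have T: "norm p \<le> T" "x \<le> T" by (auto simp: T_def)
    have "7 / 10 / sqrt (T + 1) * norm (p - of_real x) \<le> norm (wfun p - wfun (of_real x))"
      using pb xn T by (intro wfun_monotone(2)) auto
    also have "\<dots> \<le> 1 / (50 * K)" using wc xn x(2) by (simp add: wfun_of_real)
    finally have 1: "norm (p - of_real x) \<le> sqrt (T + 1) / (35 * K)"
      using T xn K by (simp add: field_simps)
    \<comment> \<open>If the modulus of p exceeds x, the bound just obtained is fed back into
      itself: T is at most x plus \<open>(T + 1) / 35\<close>.\<close>
    have "T + 1 \<le> 35 / 34 * (x + 1)"
    proof (cases "norm p \<le> x")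
      case False
      hence "T = norm p" by (simp add: T_def)
      have T0: "T \<ge> 0" using T(2) xn by linarith
      have "sqrt (T + 1) \<le> T + 1" using T0 mult_left_mono[of 1 "T + 1" "T + 1"] by (intro real_le_lsqrt) (auto simp: power2_eq_square)
      hence "sqrt (T + 1) / (35 * K) \<le> (T + 1) / 35" using K T0 by (intro frac_le) auto
      moreover have "T \<le> x + norm (p - of_real x)"
        using norm_triangle_sub[of p "of_real x"] xn \<open>T = norm p\<close> by simp
      ultimately show ?thesis using 1 by argo
    qed (use xn in \<open>auto simp: T_def\<close>)
    also have "\<dots> \<le> 4 * ((1 + x) / 2)" using xn by simp
    also have "\<dots> \<le> 4 * (ray_s x)\<^sup>2" using ray_s_bounds(3)[OF xn(1)] by (intro mult_left_mono) auto
    finally have "sqrt (T + 1) \<le> 2 * ray_s x"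
      using ray_s_bounds(1)[OF xn(1)] by (intro real_le_lsqrt) (auto simp: power_mult_distrib)
    hence "sqrt (T + 1) / (35 * K) \<le> 2 * ray_s x / (35 * K)" using K by (intro divide_right_mono) auto
    also have "\<dots> \<le> ray_s x / (2 * K)" using K ray_s_bounds(1)[OF xn(1)] by (simp add: field_simps)
    finally show ?thesis using 1 by linarith
  qed
  moreover have "K * wre x = pi * of_int n" unfolding x(2) c_def using K by simp
  ultimately show ?thesis using x(1) unfolding x1_def K_def
    by (intro exI[of _ x] exI[of _ n]) (auto simp: dist_norm norm_minus_commute)
qed

text \<open>A disc around a real root contains with p also \<open>cnj p\<close>, which is a zero
  too, so uniqueness forces p to be real.\<close>

lemma ray_zero_real:
  assumes k: "large k" and p: "evans k p = 0" "Re p \<ge> node_re + 20 / k ^ 3"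
  shows "Im p = 0" "\<exists>x n. x \<ge> node_re + 16 / k ^ 3 \<and> k ^ 3 * wre x = pi * of_int n \<and> p \<in> cball (of_real x) (ray_s x / (2 * k ^ 3))"
proof -
  have k0: "k > 0" using large_bounds[OF k] by simp
  have key: "Im q = 0" if q: "evans k q = 0" "Re q \<ge> node_re + 20 / k ^ 3" "Im q \<ge> 0" for q
  proof -
    obtain x and n :: int where x: "x \<ge> node_re + 16 / k ^ 3" "k ^ 3 * wre x = pi * of_int n"
      "q \<in> cball (of_real x) (ray_s x / (2 * k ^ 3))"
      using ray_locate_upper[OF k q] by blast
    have "0 \<le> 16 / k ^ 3" using k0 by simp
    hence x0: "x > 0" using x(1) node_re_bounds(1) by linarith
    have w: "of_real (k ^ 3) * wfun (of_real x) = of_real (pi * of_int n)"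
      unfolding wfun_of_real[OF x0] of_real_mult[symmetric] x(2) ..
    have "norm (cnj q - of_real x) = norm (q - of_real x)"
      by (metis complex_cnj_complex_of_real complex_cnj_diff complex_mod_cnj)
    hence "cnj q \<in> cball (of_real x) (ray_s x / (2 * k ^ 3))"
      using x(3) by (simp add: dist_norm norm_minus_commute)
    hence "cnj q = q" using ray_unique(1)[OF k x(1) w] x(3) q(1) evans_cnj_zero[OF k0 q(1)] by blast
    thus ?thesis by (simp add: complex_eq_iff)
  qed
  show "Im p = 0"
  proof (cases "Im p \<ge> 0")
    case False
    thus ?thesis using key[of "cnj p"] p evans_cnj_zero[OF k0 p(1)] by simp
  qed (use key p in auto)
  thus "\<exists>x n. x \<ge> node_re + 16 / k ^ 3 \<and> k ^ 3 * wre x = pi * of_int n \<and> p \<in> cball (of_real x) (ray_s x / (2 * k ^ 3))"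
    using ray_locate_upper[OF k p] by simp
qed

text \<open>Zeros are labelled by integers n through the value pi n of the phase. The labels lie in
  the interval widened by e and exhaust the interval shrunk by e; the error 2 e / pi + 1 is at most
  e + 1 since pi exceeds 2.\<close>

lemma card_int_count:
  fixes f :: "'a \<Rightarrow> int"
  assumes inj: "inj_on f Z" and e: "e \<ge> 0" "A \<le> B"
    and upper: "\<And>z. z \<in> Z \<Longrightarrow> A - e \<le> pi * of_int (f z) \<and> pi * of_int (f z) \<le> B + e"
    and lower: "\<And>n. A + e \<le> pi * of_int n \<Longrightarrow> pi * of_int n \<le> B - e \<Longrightarrow> n \<in> f ` Z"
  shows "finite Z" "\<bar>real (card Z) - (B - A) / pi\<bar> \<le> e + 1"
proof -
  define u where "u = {\<lceil>(A - e) / pi\<rceil>..\<lfloor>(B + e) / pi\<rfloor>}"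
  define l where "l = {\<lceil>(A + e) / pi\<rceil>..\<lfloor>(B - e) / pi\<rfloor>}"
  have sub: "f ` Z \<subseteq> u"
    using upper by (auto simp: u_def ceiling_le_iff le_floor_iff field_simps)
  have lsub: "l \<subseteq> f ` Z"
    using lower by (auto simp: l_def ceiling_le_iff le_floor_iff field_simps)
  have "finite (f ` Z)" using sub finite_subset unfolding u_def by blast
  thus fin: "finite Z" using inj finite_imageD by blast
  have card: "card Z = card (f ` Z)" using inj by (simp add: card_image)
  have pos: "(B - A + 2 * e) / pi \<ge> 0" using e by simp
  have "2 * e \<le> pi * e" using e pi_gt3 by (intro mult_right_mono) auto
  hence epi: "2 * e / pi \<le> e" by (simp add: pos_divide_le_eq mult.commute)
  have "real (card Z) \<le> real (card u)"
    unfolding card of_nat_le_iff by (rule card_mono[OF _ sub]) (simp add: u_def)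
  also have "\<dots> \<le> (B + e) / pi - (A - e) / pi + 1"
  proof -
    have "(B + e) / pi - (A - e) / pi \<ge> 0" using pos by (simp add: diff_divide_distrib add_divide_distrib)
    moreover have "of_int \<lfloor>(B + e) / pi\<rfloor> \<le> (B + e) / pi" "(A - e) / pi \<le> of_int \<lceil>(A - e) / pi\<rceil>" by auto
    ultimately show ?thesis unfolding u_def card_atLeastAtMost_int by (simp add: of_nat_nat le_max_iff_disj) linarith
  qed
  also have "\<dots> = (B - A) / pi + 2 * e / pi + 1" by (simp add: diff_divide_distrib add_divide_distrib)
  finally have 1: "real (card Z) \<le> (B - A) / pi + e + 1" using epi by linarith
  have "(B - A) / pi - 2 * e / pi - 1 = (B - e) / pi - (A + e) / pi - 1" by (simp add: diff_divide_distrib add_divide_distrib)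
  also have "\<dots> \<le> real (card l)"
  proof -
    have "(B - e) / pi < of_int \<lfloor>(B - e) / pi\<rfloor> + 1" "of_int \<lceil>(A + e) / pi\<rceil> < (A + e) / pi + 1"
      by linarith+
    thus ?thesis unfolding l_def card_atLeastAtMost_int by linarith
  qed
  also have "\<dots> \<le> real (card Z)" unfolding card using lsub \<open>finite (f ` Z)\<close> by (simp add: card_mono)
  finally show "\<bar>real (card Z) - (B - A) / pi\<bar> \<le> e + 1" using 1 epi by linarith
qed

lemma ray_count:
  assumes k: "large k" and \<rho>: "\<rho> \<ge> node_re + 20 / k ^ 3"
  defines "Z \<equiv> {p. evans k p = 0 \<and> node_re + 20 / k ^ 3 < Re p \<and> Re p \<le> \<rho>}"
  shows "finite Z" "\<bar>real (card Z) - (k ^ 3 * wre \<rho> - k ^ 3 * wre (node_re + 20 / k ^ 3)) / pi\<bar> \<le> 2"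
    "\<And>p. p \<in> Z \<Longrightarrow> Im p = 0"
proof -
  define K where "K = k ^ 3"
  have K: "K \<ge> 1000" and k0: "k > 0" using large_bounds[OF k] by (auto simp: K_def)
  define x2 where "x2 = node_re + 20 / K"
  have x2: "x2 > 0" "x2 \<ge> node_re + 16 / K" using node_re_bounds K by (auto simp: x2_def add_pos_nonneg divide_right_mono)
  define Q where "Q = (\<lambda>(p::complex) (n::int). \<exists>x \<ge> node_re + 16 / K. K * wre x = pi * of_int n \<and> p \<in> cball (of_real x) (ray_s x / (2 * K)))"
  have ex: "\<exists>n. Q p n" if "p \<in> Z" for p
    using ray_zero_real(2)[OF k, of p] that unfolding Z_def Q_def K_def by auto
  define f where "f = (\<lambda>p. SOME n. Q p n)"
  have fQ: "Q p (f p)" if "p \<in> Z" for p unfolding f_def by (rule someI_ex[OF ex[OF that]])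
  show Im0: "Im p = 0" if "p \<in> Z" for p
    using ray_zero_real(1)[OF k, of p] that unfolding Z_def by auto
  have xpos: "x > 0" if "x \<ge> node_re + 16 / K" for x
  proof -
    have "0 \<le> 16 / K" using K by simp
    thus ?thesis using that node_re_bounds(1) by linarith
  qed
  have wx: "of_real (k ^ 3) * wfun (of_real x) = of_real (pi * of_int n)" if "x \<ge> node_re + 16 / K" "K * wre x = pi * of_int n" for x n
    unfolding wfun_of_real[OF xpos[OF that(1)]] of_real_mult[symmetric] K_def[symmetric] that(2) ..
  \<comment> \<open>5/8 is below the slack 1 handed to \<open>card_int_count\<close>, and twice 5/8
    is below pi, so a zero cannot carry two labels.\<close>
  have near: "\<bar>K * wre (Re p) - pi * of_int n\<bar> \<le> 5 / 8" if im: "Im p = 0" and re: "Re p > 0" and q: "Q p n" for p n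
  proof -
    obtain x where x: "x \<ge> node_re + 16 / K" "K * wre x = pi * of_int n" "p \<in> cball (of_real x) (ray_s x / (2 * K))"
      using q unfolding Q_def by blast
    have "norm (of_real (k ^ 3) * wfun p - of_real (pi * of_int n)) \<le> 5 / 8"
      by (rule ray_unique(2)[OF k x(1)[unfolded K_def] wx[OF x(1,2)] x(3)[unfolded K_def]])
    moreover have "p = of_real (Re p)" using im by (simp add: complex_eq_iff)
    hence "wfun p = of_real (wre (Re p))" using wfun_of_real[OF re] by simp
    ultimately show ?thesis by (simp only: K_def of_real_mult[symmetric] of_real_diff[symmetric] norm_of_real)
  qed
  have Zre: "Re p > x2" "Re p \<le> \<rho>" "evans k p = 0" if "p \<in> Z" for p using that by (auto simp: Z_def x2_def K_def)
  have inj: "inj_on f Z"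
  proof (rule inj_onI)
    fix p q assume pq: "p \<in> Z" "q \<in> Z" "f p = f q"
    obtain x where x: "x \<ge> node_re + 16 / K" "K * wre x = pi * of_int (f p)" "p \<in> cball (of_real x) (ray_s x / (2 * K))"
      using fQ[OF pq(1)] unfolding Q_def by blast
    obtain y where y: "y \<ge> node_re + 16 / K" "K * wre y = pi * of_int (f p)" "q \<in> cball (of_real y) (ray_s y / (2 * K))"
      using fQ[OF pq(2)] unfolding Q_def pq(3) by blast
    have "K * wre x = K * wre y" using x(2) y(2) by linarith
    hence "wre x = wre y" using K by auto
    hence "x = y" using wre_strict_mono xpos[OF x(1)] xpos[OF y(1)] by (metis linorder_neqE_linordered_idom order_less_irrefl)
    thus "p = q" using ray_unique(1)[OF k _ wx[OF x(1,2)]] x(1,3) y(3) Zre(3)[OF pq(1)] Zre(3)[OF pq(2)]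
      unfolding K_def by blast
  qed
  have mono: "K * wre x \<le> K * wre y" if "0 < x" "x \<le> y" for x y
    using wre_mono[OF that] K by (intro mult_left_mono) auto
  have "x2 \<le> \<rho>" using \<rho> by (simp add: x2_def K_def)
  have upper: "K * wre x2 - 1 \<le> pi * of_int (f p) \<and> pi * of_int (f p) \<le> K * wre \<rho> + 1" if p: "p \<in> Z" for p
  proof -
    have Rp: "Re p > 0" using Zre(1)[OF p] x2(1) by linarith
    have "\<bar>K * wre (Re p) - pi * of_int (f p)\<bar> \<le> 5 / 8" by (rule near[OF Im0[OF p] Rp fQ[OF p]])
    moreover have "K * wre x2 \<le> K * wre (Re p)" using Zre(1)[OF p] x2(1) by (intro mono) auto
    moreover have "K * wre (Re p) \<le> K * wre \<rho>" using Zre(2)[OF p] Rp by (intro mono) auto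
    ultimately show ?thesis by linarith
  qed
  have lower: "n \<in> f ` Z" if n: "K * wre x2 + 1 \<le> pi * of_int n" "pi * of_int n \<le> K * wre \<rho> - 1" for n
  proof -
    have "wre x2 \<le> pi * of_int n / K" using n(1) K by (simp add: field_simps)
    then obtain x where x: "x \<ge> x2" "wre x = pi * of_int n / K" using wre_surj[OF x2(1)] by blast
    have x': "x \<ge> node_re + 16 / K" "K * wre x = pi * of_int n" using x x2 K by auto
    note U = ray_unique(1)[OF k x'(1)[unfolded K_def] wx[OF x']]
    obtain z where z: "z \<in> cball (of_real x) (ray_s x / (2 * K))" "evans k z = 0"
      using U unfolding K_def by blast
    have Qz: "Q z n" unfolding Q_def using x' z by blast
    have "norm (cnj z - of_real x) = norm (z - of_real x)"
      by (metis complex_cnj_complex_of_real complex_cnj_diff complex_mod_cnj)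
    hence "cnj z \<in> cball (of_real x) (ray_s x / (2 * K))"
      using z(1) by (simp add: dist_norm norm_minus_commute)
    hence "cnj z = z" using U z evans_cnj_zero[OF k0 z(2)] unfolding K_def by blast
    hence Imz: "Im z = 0" by (simp add: complex_eq_iff)
    have Rez: "Re z > 0" using evans_zero_bounds[OF k0 z(2)] by simp
    have nz: "\<bar>K * wre (Re z) - pi * of_int n\<bar> \<le> 5 / 8" by (rule near[OF Imz Rez Qz])
    have "x2 < Re z"
    proof (rule ccontr)
      assume "\<not> x2 < Re z"
      hence "K * wre (Re z) \<le> K * wre x2" by (intro mono[OF Rez]) simp
      thus False using nz n(1) by linarith
    qed
    moreover have "Re z \<le> \<rho>"
    proof (rule ccontr)
      assume "\<not> Re z \<le> \<rho>"
      hence "K * wre \<rho> \<le> K * wre (Re z)" using x2(1) \<open>x2 \<le> \<rho>\<close> by (intro mono) auto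
      thus False using nz n(2) by linarith
    qed
    ultimately have zZ: "z \<in> Z" using z(2) by (simp add: Z_def x2_def K_def)
    have "\<bar>K * wre (Re z) - pi * of_int (f z)\<bar> \<le> 5 / 8" by (rule near[OF Imz Rez fQ[OF zZ]])
    hence "\<bar>pi * of_int (f z) - pi * of_int n\<bar> \<le> 5 / 4" using nz by linarith
    moreover have "pi * of_int (f z) - pi * of_int n = pi * of_int (f z - n)" by (simp add: right_diff_distrib)
    ultimately have le: "pi * \<bar>of_int (f z - n)\<bar> \<le> 5 / 4" by (simp add: abs_mult)
    have "f z = n"
    proof (rule ccontr)
      assume "f z \<noteq> n"
      hence "(1::real) \<le> \<bar>of_int (f z - n)\<bar>" by linarith
      hence "pi * 1 \<le> pi * \<bar>of_int (f z - n)\<bar>" by (intro mult_left_mono) auto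
      thus False using le pi_gt3 by linarith
    qed
    thus "n \<in> f ` Z" using zZ by blast
  qed
  note C = card_int_count[OF inj _ mono[OF x2(1) \<open>x2 \<le> \<rho>\<close>] upper lower]
  show "finite Z" by (rule C) simp_all
  have "\<bar>real (card Z) - (K * wre \<rho> - K * wre x2) / pi\<bar> \<le> 1 + 1" by (rule C) simp_all
  thus "\<bar>real (card Z) - (k ^ 3 * wre \<rho> - k ^ 3 * wre (node_re + 20 / k ^ 3)) / pi\<bar> \<le> 2"
    by (simp add: K_def x2_def)
qed

subsection \<open>Zeros along the segments\<close>

text \<open>The inverse of the coordinate \<open>v = twelfth_root * csqrt (p - \<i>)\<close>. It is
  real on the image of the segment from 1 and turns the phase at \<open>p - \<i>\<close> into
  \<open>- \<i> * (2 / 3 * v ^ 3)\<close>. The unperturbed equation exp (- 2 a) = -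
  \<open>\<i>\<close> becomes \<open>2 / 3 * k ^ 3 * v ^ 3 = pi * n - pi / 4\<close>, the source of
  pi / 4 below.\<close>

definition seg_pt :: "complex \<Rightarrow> complex" where
  "seg_pt v = \<i> + cnj sixth_root * v\<^sup>2"

text \<open>Lower bound for \<open>k * w\<close>. Its cube, at least 125, makes the discs small
  against w; its square, at least \<open>2 * wkb_cutoff\<close>, keeps them away from the turning
  point.\<close>

definition seg_min :: real where "seg_min = max 5 (2 * wkb_cutoff)"

lemma seg_min: "seg_min \<ge> 5" "seg_min\<^sup>2 \<ge> 2 * wkb_cutoff"
proof -
  show "seg_min \<ge> 5" by (simp add: seg_min_def)
  hence "1 * seg_min \<le> seg_min * seg_min" by (intro mult_right_mono) auto
  moreover have "2 * wkb_cutoff \<le> seg_min" by (simp add: seg_min_def)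
  ultimately show "seg_min\<^sup>2 \<ge> 2 * wkb_cutoff" by (simp add: power2_eq_square)
qed

lemma cnj_twelfth_root_powers:
  "(cnj twelfth_root)\<^sup>2 = cnj sixth_root" "(cnj twelfth_root) ^ 3 = - \<i>" "norm twelfth_root = 1"
  "twelfth_root * cnj twelfth_root = 1" "sixth_root * cnj sixth_root = 1"
  by (simp_all add: twelfth_root_def sixth_root_def complex_eq_iff power2_eq_square power3_eq_cube cmod_def power_divide)

lemma csqrt_seg_pt:
  assumes "Re (cnj twelfth_root * v) > 0"
  shows "csqrt (seg_pt v - \<i>) = cnj twelfth_root * v"
  using assms by (intro csqrt_unique) (simp_all add: seg_pt_def power_mult_distrib cnj_twelfth_root_powers)

lemma phase_seg_pt:
  assumes "Re (cnj twelfth_root * v) > 0"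
  shows "phase (seg_pt v - \<i>) = - \<i> * (2 / 3 * v ^ 3)"
  unfolding phase_def csqrt_seg_pt[OF assms] by (simp add: power_mult_distrib cnj_twelfth_root_powers)

lemma seg_pt_of_csqrt: "seg_pt (twelfth_root * csqrt (p - \<i>)) = p"
  by (simp add: seg_pt_def power_mult_distrib twelfth_root_square cnj_twelfth_root_powers mult.assoc[symmetric] mult.commute[of "cnj sixth_root"])

lemma Im_seg_pt_real: "Im (cnj sixth_root * of_real r) = - (sqrt 3 / 2) * r"
  by (simp add: sixth_root_def)

lemma norm_seg_pt_real: "norm (cnj sixth_root * of_real (w\<^sup>2)) = w\<^sup>2"
  by (simp only: norm_mult complex_mod_cnj norm_sixth_root norm_of_real mult_1 abs_power2)

lemma Re_seg_pt_real: "Re (cnj sixth_root * of_real r) = r / 2"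
  by (simp add: sixth_root_def)

text \<open>The radius is the fraction c / L of w, at most 1/250, so \<open>v + w\<close> is 2 w up
  to 0.004 w. The square of v is what matters geometrically: it is the position of p relative to
  \<open>\<i>\<close> along and across the segment.\<close>

lemma square_diff_le:
  fixes v :: complex
  assumes w: "w > 0" and L: "L \<ge> 125" "K * w ^ 3 = L" "K > 0" and v: "norm (v - of_real w) \<le> c / (K * w\<^sup>2)" and c: "0 < c" "c \<le> 1 / 2"
  shows "norm (v\<^sup>2 - of_real (w\<^sup>2)) \<le> c * (2004 / 1000) / (K * w)"
    "norm (v\<^sup>2 - of_real (w\<^sup>2)) \<le> 81 / 10000 * w\<^sup>2"
    "norm (v - of_real w) \<le> w / 250"
proof -
  have eq: "c / (K * w\<^sup>2) = c * w / L"
    unfolding L(2)[symmetric] using w L by (simp add: power3_eq_cube power2_eq_square field_simps)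
  have "c * w / L \<le> (1 / 2) * w / 125" using c w L by (intro frac_le mult_right_mono) auto
  thus v2: "norm (v - of_real w) \<le> w / 250" using v unfolding eq by argo
  have "norm (v + of_real w) \<le> norm (v - of_real w) + norm (2 * of_real w :: complex)"
    using norm_triangle_ineq[of "v - of_real w" "2 * of_real w"] by (simp add: add.commute)
  hence s: "norm (v + of_real w) \<le> 2004 / 1000 * w" using v2 w by (simp add: norm_mult)
  have f: "norm (v\<^sup>2 - of_real (w\<^sup>2)) = norm (v - of_real w) * norm (v + of_real w)"
    unfolding norm_mult[symmetric] by (simp add: power2_eq_square algebra_simps)
  also have "\<dots> \<le> c / (K * w\<^sup>2) * (2004 / 1000 * w)"
    using v s L w c by (intro mult_mono) auto
  also have "\<dots> = c * (2004 / 1000) / (K * w)" using w L by (simp add: power2_eq_square field_simps)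
  finally show "norm (v\<^sup>2 - of_real (w\<^sup>2)) \<le> c * (2004 / 1000) / (K * w)" .
  have "norm (v - of_real w) * norm (v + of_real w) \<le> w / 250 * (2004 / 1000 * w)"
    using v2 s w by (intro mult_mono) auto
  also have "\<dots> \<le> 81 / 10000 * w\<^sup>2" by (simp add: power2_eq_square)
  finally show "norm (v\<^sup>2 - of_real (w\<^sup>2)) \<le> 81 / 10000 * w\<^sup>2" unfolding f .
qed

text \<open>The segment has length \<open>2 * node_re\<close>, so a missing length
  \<open>M / K\<close> means a height of about \<open>866 / 1000 * M / K\<close> above the real
  axis. For w from 1/2 on, the perturbation is at most \<open>2 * D / K\<close>; for smaller w the
  height is at least 1/2 anyway.\<close>

lemma seg_Im_ge:
  fixes v :: complex
  assumes K: "K \<ge> 1000" and w: "w > 0" "w\<^sup>2 \<le> 2 * node_re - M / K" "M \<ge> 0" "M \<le> 100"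
    and d: "norm (v\<^sup>2 - of_real (w\<^sup>2)) \<le> D / (K * w)" "0 \<le> D" "norm (v\<^sup>2 - of_real (w\<^sup>2)) \<le> 81 / 10000 * w\<^sup>2"
  shows "Im (seg_pt v) \<ge> (866 / 1000 * M - 2 * D) / K"
proof -
  have "Im (cnj sixth_root * (v\<^sup>2 - of_real (w\<^sup>2))) \<ge> - norm (cnj sixth_root * (v\<^sup>2 - of_real (w\<^sup>2)))"
    using abs_Im_le_cmod[of "cnj sixth_root * (v\<^sup>2 - of_real (w\<^sup>2))"] by linarith
  moreover have "seg_pt v = \<i> + cnj sixth_root * of_real (w\<^sup>2) + cnj sixth_root * (v\<^sup>2 - of_real (w\<^sup>2))"
    by (simp add: seg_pt_def algebra_simps)
  hence "Im (seg_pt v) = 1 - sqrt 3 / 2 * w\<^sup>2 + Im (cnj sixth_root * (v\<^sup>2 - of_real (w\<^sup>2)))"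
    using Im_seg_pt_real[of "w\<^sup>2"] by simp
  ultimately have I: "Im (seg_pt v) \<ge> 1 - sqrt 3 / 2 * w\<^sup>2 - norm (v\<^sup>2 - of_real (w\<^sup>2))"
    using norm_sixth_root by (simp add: norm_mult)
  show ?thesis
  proof (cases "w \<ge> 1 / 2")
    case True
    have "sqrt 3 / 2 * w\<^sup>2 \<le> sqrt 3 / 2 * (2 * node_re - M / K)" using w by (intro mult_left_mono) auto
    also have "\<dots> = 1 - sqrt 3 / 2 * (M / K)" using node_re_bounds(3) by (simp add: algebra_simps)
    finally have "1 - sqrt 3 / 2 * w\<^sup>2 \<ge> sqrt 3 / 2 * (M / K)" by simp
    moreover have "866 / 1000 * (M / K) \<le> sqrt 3 / 2 * (M / K)" using sqrt3_bounds w K by (intro mult_right_mono) auto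
    moreover have "D / (K * w) \<le> D / (K * (1 / 2))" using True K d(2) by (intro divide_left_mono mult_left_mono) auto
    moreover have "(866 / 1000 * M - 2 * D) / K = 866 / 1000 * (M / K) - D / (K * (1 / 2))" by (simp add: diff_divide_distrib)
    ultimately show ?thesis using I d(1) by linarith
  next
    case False
    have "w\<^sup>2 \<le> (1 / 2)\<^sup>2" using False w by (intro power_mono) auto
    hence w4: "w\<^sup>2 \<le> 1 / 4" by (simp add: power2_eq_square)
    have "sqrt 3 / 2 * w\<^sup>2 \<le> 867 / 1000 * (1 / 4)" using sqrt3_bounds w4 by (intro mult_mono) auto
    hence "Im (seg_pt v) \<ge> 1 / 2" using I d(3) w4 by linarith
    moreover have "(866 / 1000 * M - 2 * D) / K \<le> 100 / 1000" using w d K by (intro frac_le) auto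
    ultimately show ?thesis by linarith
  qed
qed

lemma twelfth_root_Re_pos:
  fixes v :: complex
  assumes "norm (v - of_real w) \<le> w / 250" "w > 0"
  shows "Re (cnj twelfth_root * v) > 0"
proof -
  have "cnj twelfth_root * v = of_real w * cnj twelfth_root + cnj twelfth_root * (v - of_real w)" by (simp add: algebra_simps)
  hence "Re (cnj twelfth_root * v) = w * (sqrt 3 / 2) + Re (cnj twelfth_root * (v - of_real w))"
    by (simp add: twelfth_root_def)
  moreover have "\<bar>Re (cnj twelfth_root * (v - of_real w))\<bar> \<le> norm (v - of_real w)"
    using abs_Re_le_cmod[of "cnj twelfth_root * (v - of_real w)"] cnj_twelfth_root_powers(3) by (simp add: norm_mult)
  moreover have "w * (866 / 1000) \<le> w * (sqrt 3 / 2)" using sqrt3_bounds assms by (intro mult_left_mono) auto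
  ultimately show ?thesis using assms by linarith
qed

lemma cube_scale: "k ^ 3 * w ^ 3 = (k * w) ^ 3" for k w :: real
  by (simp add: power_mult_distrib)

lemma cube_ge_125:
  assumes "k * w \<ge> 5" shows "k ^ 3 * w ^ 3 \<ge> (125::real)"
proof -
  have "(5::real) ^ 3 \<le> (k * w) ^ 3" using assms by (intro power_mono) auto
  thus ?thesis by (simp add: cube_scale)
qed

text \<open>The offset 14 gives imaginary part at least \<open>10 / K\<close>, because 0.866 * 14 -
  2 * 1.002 exceeds 10. The constant of \<open>wfun_Im_ge\<close> for modulus at most 3 is 0.35, so
  K times the imaginary part of \<open>wfun\<close> is at least 3.5 and the first exponential is
  negligible on the whole disc.\<close>

lemma seg_disc:
  assumes k: "large k" and w: "w > 0" "k * w \<ge> seg_min" "w\<^sup>2 \<le> 2 * node_re - 14 / k ^ 3"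
    and v: "norm (v - of_real w) \<le> 1 / (2 * k ^ 3 * w\<^sup>2)"
  shows "seg_pt v \<in> good k" "k ^ 3 * Im (wfun (seg_pt v)) \<ge> 3" "Re (cnj twelfth_root * v) > 0"
    "norm (v\<^sup>2 - of_real (w\<^sup>2)) \<le> 81 / 10000 * w\<^sup>2"
proof -
  define K where "K = k ^ 3"
  have K: "K \<ge> 1000" and k0: "k > 0" using large_bounds[OF k] by (auto simp: K_def)
  have L: "K * w ^ 3 \<ge> 125" unfolding K_def using w seg_min by (intro cube_ge_125) linarith
  have v': "norm (v - of_real w) \<le> (1 / 2) / (K * w\<^sup>2)" using v by (simp add: K_def mult.assoc)
  note S = square_diff_le[OF w(1) L refl _ v']
  have d1: "norm (v\<^sup>2 - of_real (w\<^sup>2)) \<le> (1002 / 1000) / (K * w)" and d2: "norm (v\<^sup>2 - of_real (w\<^sup>2)) \<le> 81 / 10000 * w\<^sup>2"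
    and d3: "norm (v - of_real w) \<le> w / 250"
    using S(1,2,3) K by auto
  show "norm (v\<^sup>2 - of_real (w\<^sup>2)) \<le> 81 / 10000 * w\<^sup>2" by (rule d2)
  show "Re (cnj twelfth_root * v) > 0" by (rule twelfth_root_Re_pos[OF d3 w(1)])
  define p where "p = seg_pt v"
  have "Im p \<ge> (866 / 1000 * 14 - 2 * (1002 / 1000)) / K"
    unfolding p_def using w by (intro seg_Im_ge[OF K w(1) _ _ _ d1 _ d2]) (auto simp: K_def)
  moreover have "(866 / 1000 * 14 - 2 * (1002 / 1000)) / K \<ge> 10 / K" using K by (intro divide_right_mono) auto
  ultimately have Im10: "Im p \<ge> 10 / K" by linarith
  have w2: "w\<^sup>2 \<le> 1156 / 1000" "w\<^sup>2 > 0"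
  proof -
    have "0 \<le> 14 / k ^ 3" using k0 by simp
    thus "w\<^sup>2 \<le> 1156 / 1000" using w(3) node_re_bounds(2) by linarith
  qed (use w in simp)
  define e where "e = cnj sixth_root * (v\<^sup>2 - of_real (w\<^sup>2))"
  have e: "norm e \<le> 81 / 10000 * w\<^sup>2" using d2 norm_sixth_root by (simp add: e_def norm_mult)
  have pe: "p - \<i> = cnj sixth_root * of_real (w\<^sup>2) + e" by (simp add: p_def seg_pt_def e_def algebra_simps)
  have "Re p = w\<^sup>2 / 2 + Re e" using arg_cong[OF pe, of Re] Re_seg_pt_real[of "w\<^sup>2"] by simp
  hence Rp: "Re p > 0" using abs_Re_le_cmod[of e] e w2 by linarith
  have "Im p - 1 = - (sqrt 3 / 2) * w\<^sup>2 + Im e" using arg_cong[OF pe, of Im] Im_seg_pt_real[of "w\<^sup>2"] by simp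
  moreover have "866 / 1000 * w\<^sup>2 \<le> sqrt 3 / 2 * w\<^sup>2" using sqrt3_bounds w2 by (intro mult_right_mono) auto
  ultimately have Ip: "Im p \<le> 1" using abs_Im_le_cmod[of e] e w2 by linarith
  have "0 \<le> 10 / K" using K by simp
  hence I0: "Im p \<ge> 0" using Im10 by linarith
  have dom: "p \<in> wkb_dom" using Rp Ip I0 by (auto simp: wkb_dom_def)
  have n1: "norm (p - \<i>) \<ge> 99 / 100 * w\<^sup>2"
  proof -
    note norm_seg_pt_real[of w]
    thus ?thesis unfolding pe using norm_diff_ineq[of "cnj sixth_root * of_real (w\<^sup>2)" e] e w2 by linarith
  qed
  have g1: "wkb_cutoff \<le> k\<^sup>2 * norm (p - \<i>)"
  proof -
    have "seg_min\<^sup>2 \<le> (k * w)\<^sup>2" using w seg_min by (intro power_mono) auto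
    hence "2 * wkb_cutoff \<le> k\<^sup>2 * w\<^sup>2" using seg_min(2) by (simp add: power_mult_distrib)
    moreover have "k\<^sup>2 * (99 / 100 * w\<^sup>2) \<le> k\<^sup>2 * norm (p - \<i>)" using n1 by (intro mult_left_mono) auto
    ultimately show ?thesis using wkb_cutoff(1) by (simp add: algebra_simps)
  qed
  have n2: "norm (p + \<i>) \<ge> 1" using abs_Im_le_cmod[of "p + \<i>"] I0 by simp
  have g2: "wkb_cutoff \<le> k\<^sup>2 * norm (p + \<i>)"
  proof -
    have "k\<^sup>2 * 1 \<le> k\<^sup>2 * norm (p + \<i>)" using n2 by (intro mult_left_mono) auto
    thus ?thesis using large_bounds(3)[OF k] wkb_cutoff(1) by linarith
  qed
  show "seg_pt v \<in> good k" using dom g1 g2 by (simp add: wkb_good_def p_def)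
  have "norm p \<le> 1 + norm (cnj sixth_root * of_real (w\<^sup>2)) + norm e"
    using norm_triangle_ineq[of "p - \<i>" \<i>] norm_triangle_ineq[of "cnj sixth_root * of_real (w\<^sup>2)" e] unfolding pe[symmetric] by simp
  also note norm_seg_pt_real
  finally have np: "norm p \<le> 3" using e w2 by linarith
  have "Im (wfun p) \<ge> 7 / 10 / sqrt (3 + 1) * Im p" by (rule wfun_Im_ge[OF Rp I0 np])
  hence "Im (wfun p) \<ge> 35 / 100 * Im p" by simp
  hence "Im (wfun p) \<ge> 35 / 100 * (10 / K)" using Im10 by linarith
  hence "K * (35 / 100 * (10 / K)) \<le> K * Im (wfun p)" using K by (intro mult_left_mono) auto
  moreover have "K * (35 / 100 * (10 / K)) = 35 / 10" using K by simp
  ultimately show "k ^ 3 * Im (wfun (seg_pt v)) \<ge> 3" unfolding K_def p_def by linarith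
qed

lemma seg_equation':
  assumes "k > 0" "seg_pt v \<in> good k" "k ^ 3 * Im (wfun (seg_pt v)) \<ge> 3" "Re (cnj twelfth_root * v) > 0"
  shows "evans k (seg_pt v) = 0 \<longleftrightarrow>
    exp (2 * \<i> * (of_real (2 / 3 * k ^ 3) * v ^ 3 - of_real (pi * of_int n - pi / 4))) = 1 + eta_seg k (seg_pt v)"
proof -
  let ?X = "of_real (2 / 3 * k ^ 3) * v ^ 3 :: complex"
  have e: "- (2 * of_real (k ^ 3) * phase (seg_pt v - \<i>)) = 2 * \<i> * ?X"
    unfolding phase_seg_pt[OF assms(4)] by (simp add: algebra_simps)
  have "exp (2 * \<i> * (?X - of_real (pi * of_int n - pi / 4))) =
      exp (2 * \<i> * ?X + (of_real (pi / 2) * \<i> - 2 * of_int n * of_real pi * \<i>))"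
    by (rule arg_cong[where f=exp]) (simp add: algebra_simps)
  also have "\<dots> = exp (2 * \<i> * ?X) * (exp (of_real (pi / 2) * \<i>) / exp (2 * of_int n * of_real pi * \<i>))"
    by (simp only: exp_add exp_diff)
  also have "exp (2 * of_int n * of_real pi * \<i>) = 1"
    using exp_integer_2pi[of "of_int n"] by simp
  also have "exp (of_real (pi / 2) * \<i>) = \<i>"
    by (simp only: mult.commute[of _ \<i>] cis_conv_exp[symmetric] cis_pi_half)
  finally have "exp (2 * \<i> * (?X - of_real (pi * of_int n - pi / 4))) = exp (2 * \<i> * ?X) * \<i>" by simp
  moreover have "x = - \<i> * y \<longleftrightarrow> x * \<i> = y" for x y :: complex
  proof
    assume "x = - \<i> * y" thus "x * \<i> = y" by (simp add: complex_eq_iff)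
  next
    assume "x * \<i> = y" thus "x = - \<i> * y" by (auto simp: complex_eq_iff)
  qed
  ultimately show ?thesis unfolding seg_equation(1)[OF assms(1-3)] e by simp
qed

text \<open>The slope of the phase at w is \<open>2 * k ^ 3 * w ^ 2\<close>. It degenerates at the
  turning point, so the radius depends on w and w must not be small on the scale 1 / k.\<close>

lemma seg_unique:
  fixes v :: complex
  assumes k: "large k" and w: "w > 0" "k * w \<ge> seg_min" "w\<^sup>2 \<le> 2 * node_re - 14 / k ^ 3"
    and n: "2 / 3 * k ^ 3 * w ^ 3 = pi * of_int n - pi / 4"
  shows "\<exists>!v. v \<in> cball (of_real w) (1 / (4 * k ^ 3 * w\<^sup>2)) \<and> evans k (seg_pt v) = 0"
    and "v \<in> cball (of_real w) (1 / (4 * k ^ 3 * w\<^sup>2)) \<Longrightarrow>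
      norm (of_real (2 / 3 * k ^ 3) * v ^ 3 - of_real (pi * of_int n - pi / 4)) \<le> 5 / 8"
proof -
  define K where "K = k ^ 3"
  have K: "K \<ge> 1000" and k0: "k > 0" using large_bounds[OF k] by (auto simp: K_def)
  define d where "d = complex_of_real (2 * K * w\<^sup>2)"
  have d: "norm d = 2 * K * w\<^sup>2" unfolding d_def norm_of_real using K by simp
  have d0: "d \<noteq> 0" using K w by (simp add: d_def)
  note d = d d0
  have r: "1 / norm d = 1 / (2 * k ^ 3 * w\<^sup>2)" "1 / (2 * norm d) = 1 / (4 * k ^ 3 * w\<^sup>2)"
    unfolding d(1) by (simp_all add: K_def)
  have disc: "seg_pt v \<in> good k" "k ^ 3 * Im (wfun (seg_pt v)) \<ge> 3" "Re (cnj twelfth_root * v) > 0"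
    "norm (v\<^sup>2 - of_real (w\<^sup>2)) \<le> 81 / 10000 * w\<^sup>2"
    if "v \<in> ball (of_real w) (1 / norm d)" for v
    using seg_disc[OF k w, of v] that unfolding r(1) by (auto simp: dist_norm norm_minus_commute)
  have Y: "((\<lambda>v. of_real (2 / 3 * K) * v ^ 3) has_field_derivative of_real (2 * K) * v\<^sup>2) (at v)" for v
    by (auto intro!: derivative_eq_intros simp: power2_eq_square)
  have Y': "norm (of_real (2 * K) * v\<^sup>2 - d) \<le> norm d / 4" if "v \<in> ball (of_real w) (1 / norm d)" for v
  proof -
    have "of_real (2 * K) * v\<^sup>2 - d = of_real (2 * K) * (v\<^sup>2 - of_real (w\<^sup>2))" by (simp add: d_def algebra_simps)
    hence "norm (of_real (2 * K) * v\<^sup>2 - d) = 2 * K * norm (v\<^sup>2 - of_real (w\<^sup>2))" using K by (simp add: norm_mult)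
    also have "\<dots> \<le> 2 * K * (81 / 10000 * w\<^sup>2)" using K disc(4)[OF that] by (intro mult_left_mono) auto
    also have "\<dots> \<le> norm d / 4" unfolding d(1) using K by simp
    finally show ?thesis .
  qed
  have "seg_pt ` ball (of_real w) (1 / norm d) \<subseteq> good k" using disc(1) by blast
  from holomorphic_on_compose[OF _ eta_holomorphic(2)[OF k0 this]]
  have eta: "(\<lambda>v. eta_seg k (seg_pt v)) holomorphic_on ball (of_real w) (1 / norm d)"
    by (simp add: o_def seg_pt_def[abs_def] holomorphic_intros)
  have small: "norm (eta_seg k (seg_pt v)) \<le> 1 / 16" if "v \<in> ball (of_real w) (1 / norm d)" for v
    using seg_equation(2)[OF k0 disc(1,2)[OF that]] by linarith
  note U = unique_perturbed_zero[OF d(2) Y Y' eta small]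
  have n': "of_real (2 / 3 * K) * of_real w ^ 3 = complex_of_real (pi * of_int n - pi / 4)"
    unfolding n[symmetric] by (simp add: K_def)
  show "norm (of_real (2 / 3 * k ^ 3) * v ^ 3 - of_real (pi * of_int n - pi / 4)) \<le> 5 / 8"
    if "v \<in> cball (of_real w) (1 / (4 * k ^ 3 * w\<^sup>2))"
    using U(2)[of v] that unfolding r n' by (simp add: K_def)
  have eq: "evans k (seg_pt v) = 0 \<longleftrightarrow>
      exp (2 * \<i> * (of_real (2 / 3 * K) * v ^ 3 - of_real (2 / 3 * K) * of_real w ^ 3)) = 1 + eta_seg k (seg_pt v)"
    if v: "v \<in> cball (of_real w) (1 / (2 * norm d))" for v
  proof -
    have "1 / (2 * norm d) = 1 / norm d / 2" "1 / norm d > 0" using d(2) by auto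
    hence "1 / (2 * norm d) < 1 / norm d" by linarith
    hence vb: "v \<in> ball (of_real w) (1 / norm d)" using v by (auto simp: mem_ball mem_cball)
    show ?thesis unfolding n' unfolding K_def by (rule seg_equation'[OF k0 disc(1-3)[OF vb]])
  qed
  show "\<exists>!v. v \<in> cball (of_real w) (1 / (4 * k ^ 3 * w\<^sup>2)) \<and> evans k (seg_pt v) = 0"
    using U(1) eq unfolding r(2)[symmetric] by metis
qed

definition seg_rel :: "real \<Rightarrow> complex \<Rightarrow> int \<Rightarrow> real \<Rightarrow> bool" where
  "seg_rel k v n w \<longleftrightarrow> w > 0 \<and> k * w \<ge> seg_min \<and> w\<^sup>2 \<le> 2 * node_re - 14 / k ^ 3 \<and>
     2 / 3 * k ^ 3 * w ^ 3 = pi * of_int n - pi / 4 \<and> v \<in> cball (of_real w) (1 / (4 * k ^ 3 * w\<^sup>2))"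

text \<open>The root of z has argument in (- pi / 4, 0], so v has argument in (- pi / 12, pi / 6]
  and even its cube stays in the closed right half plane.\<close>

lemma Re_cube_nonneg:
  assumes "Re z > 0" "Im z \<le> 0"
  defines "v \<equiv> twelfth_root * csqrt z"
  shows "Re v > 0" "Re (v\<^sup>2) \<ge> 0" "Re (v ^ 3) \<ge> 0"
proof -
  define x y where "x = Re (csqrt z)" and "y = - Im (csqrt z)"
  have xy: "\<bar>y\<bar> < x" using csqrt_Re_gt_Im[OF assms(1)] by (simp add: x_def y_def)
  have "z = (csqrt z)\<^sup>2" by simp
  hence z: "Im z = - (2 * x * y)" unfolding x_def y_def by (metis Im_power2 minus_minus mult_minus_right)
  have "0 \<le> x * y" using assms(2) unfolding z by simp
  hence y: "y \<ge> 0" using xy by (auto simp: zero_le_mult_iff)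
  define a b where "a = Re v" and "b = Im v"
  have a: "a = sqrt 3 / 2 * x + y / 2" and b: "b = x / 2 - sqrt 3 / 2 * y"
    by (simp_all add: a_def b_def v_def twelfth_root_def x_def y_def del: csqrt.simps)
  have s: "sqrt 3 * sqrt 3 = 3" by simp
  have "sqrt 3 * x > 0" using xy by simp
  moreover have "1 * y \<le> sqrt 3 * y" using y by (intro mult_right_mono) auto
  ultimately have a0: "a > 0" using a y by simp
  thus "Re v > 0" by (simp add: a_def)
  have m: "a - sqrt 3 * b = 2 * y" unfolding a b using s by (simp add: algebra_simps)
  have "a + sqrt 3 * b = sqrt 3 * x - y" unfolding a b using s by (simp add: algebra_simps)
  moreover have "1 * x \<le> sqrt 3 * x" using xy by (intro mult_right_mono) auto
  ultimately have p: "a + sqrt 3 * b \<ge> 0" using xy by linarith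
  have "0 \<le> (a - sqrt 3 * b) * (a + sqrt 3 * b)" using m p y by simp
  also have "\<dots> = a\<^sup>2 - 3 * b\<^sup>2" using s by (simp add: power2_eq_square algebra_simps)
  finally have q: "a\<^sup>2 - 3 * b\<^sup>2 \<ge> 0" .
  have V: "v = Complex a b" by (simp add: a_def b_def complex_eq_iff)
  have "Re (v\<^sup>2) = a\<^sup>2 - b\<^sup>2" unfolding V by (simp add: power2_eq_square)
  thus "Re (v\<^sup>2) \<ge> 0" using q zero_le_power2[of b] by linarith
  have "Re (v ^ 3) = a * (a\<^sup>2 - 3 * b\<^sup>2)" unfolding V by (simp add: power2_eq_square power3_eq_cube algebra_simps)
  thus "Re (v ^ 3) \<ge> 0" using q a0 by simp
qed

text \<open>Converse of \<open>seg_unique\<close>. The last hypothesis says that the projection of p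
  onto the line of the segment does not pass the node; it bounds the modulus of p by 3. The
  thresholds 15 and \<open>seg_min + 1\<close> leave room for the 14 and \<open>seg_min\<close> that
  \<open>seg_rel\<close> demands of the root.\<close>

lemma seg_locate:
  assumes k: "large k" and p: "evans k p = 0" "Im p \<ge> 15 / k ^ 3" "k * norm (csqrt (p - \<i>)) \<ge> seg_min + 1"
    "Re p \<le> node_re + sqrt 3 * Im p"
  shows "\<exists>n w. seg_rel k (twelfth_root * csqrt (p - \<i>)) n w"
proof -
  define K where "K = k ^ 3"
  have K: "K \<ge> 1000" and k0: "k > 0" using large_bounds[OF k] by (auto simp: K_def)
  note pb = evans_zero_bounds[OF k0 p(1)]
  define v where "v = twelfth_root * csqrt (p - \<i>)"
  have pv: "seg_pt v = p" unfolding v_def by (rule seg_pt_of_csqrt)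
  have "0 \<le> 15 / K" using K by simp
  hence I0: "Im p \<ge> 0" using p(2) unfolding K_def by linarith
  have I1: "Im p < 1" using pb(2) by simp
  note V = Re_cube_nonneg[of "p - \<i>", folded v_def]
  have V: "Re v > 0" "Re (v\<^sup>2) \<ge> 0" "Re (v ^ 3) \<ge> 0" using V pb I1 by auto
  have nv: "norm v = norm (csqrt (p - \<i>))" unfolding v_def norm_mult cnj_twelfth_root_powers(3) by simp
  have kv: "k * norm v \<ge> seg_min + 1" using p(3) unfolding nv .
  have cv: "cnj twelfth_root * v = csqrt (p - \<i>)"
    unfolding v_def mult.assoc[symmetric] mult.commute[of "cnj twelfth_root"] cnj_twelfth_root_powers(4) by simp
  have cpos: "Re (cnj twelfth_root * v) > 0" unfolding cv using csqrt_Re_gt_Im[of "p - \<i>"] pb by (simp del: csqrt.simps)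
  have dom: "p \<in> wkb_dom" using pb I0 by (auto simp: wkb_dom_def)
  have good: "p \<in> good k"
  proof -
    have "wkb_cutoff \<le> k\<^sup>2 * norm (p - \<i>)"
    proof -
      have "seg_min\<^sup>2 \<le> (k * norm (csqrt (p - \<i>)))\<^sup>2" using p(3) seg_min by (intro power_mono) auto
      also have "\<dots> = k\<^sup>2 * norm (p - \<i>)" by (simp add: power_mult_distrib)
      finally show ?thesis using seg_min(2) wkb_cutoff(1) by linarith
    qed
    moreover have "wkb_cutoff \<le> k\<^sup>2 * norm (p + \<i>)"
    proof -
      have "norm (p + \<i>) \<ge> 1" using abs_Im_le_cmod[of "p + \<i>"] I0 by simp
      hence "k\<^sup>2 * 1 \<le> k\<^sup>2 * norm (p + \<i>)" by (intro mult_left_mono) auto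
      thus ?thesis using large_bounds(3)[OF k] wkb_cutoff(1) by linarith
    qed
    ultimately show ?thesis using dom by (simp add: wkb_good_def)
  qed
  have Rp: "Re p \<le> 2312 / 1000"
  proof -
    have "sqrt 3 * Im p \<le> 1733 / 1000 * 1" using sqrt3_bounds I0 I1 by (intro mult_mono) auto
    thus ?thesis using p(4) node_re_bounds by linarith
  qed
  have np: "norm p \<le> 3"
  proof (rule power2_le_imp_le)
    have "(Re p)\<^sup>2 \<le> (2312 / 1000)\<^sup>2" "(Im p)\<^sup>2 \<le> 1\<^sup>2" using Rp pb I0 I1 by (intro power_mono; simp)+
    thus "(norm p)\<^sup>2 \<le> 3\<^sup>2" unfolding cmod_power2 by (simp add: power2_eq_square)
  qed simp
  have "Im (wfun p) \<ge> 7 / 10 / sqrt (3 + 1) * Im p" by (rule wfun_Im_ge[OF pb(1) I0 np])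
  hence "Im (wfun p) \<ge> 35 / 100 * Im p" by simp
  hence "Im (wfun p) \<ge> 35 / 100 * (15 / K)" using p(2) unfolding K_def by linarith
  hence "K * (35 / 100 * (15 / K)) \<le> K * Im (wfun p)" using K by (intro mult_left_mono) auto
  moreover have "K * (35 / 100 * (15 / K)) = 525 / 100" using K by simp
  ultimately have Iw: "k ^ 3 * Im (wfun p) \<ge> 3" unfolding K_def by linarith
  define X where "X = of_real (2 / 3 * K) * v ^ 3"
  have eqn: "exp (2 * \<i> * (X - of_real (pi * of_int 0 - pi / 4))) = 1 + eta_seg k p"
    using seg_equation'[OF k0 _ _ cpos, of 0] good Iw p(1) unfolding pv X_def K_def by blast
  have e50: "norm (eta_seg k p) \<le> 1 / 50" by (rule seg_equation(2)[OF k0 good Iw])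
  hence "norm (eta_seg k p) < 1 / 2" by linarith
  from exp_eq_one_plus_small[OF eqn this] obtain n :: int where
    n0: "norm (X - of_real (pi * of_int 0 - pi / 4) - of_real (pi * of_int n)) \<le> norm (eta_seg k p)" by blast
  have "X - of_real (pi * of_int 0 - pi / 4) - of_real (pi * of_int n) = X - of_real (pi * of_int n - pi / 4)" by simp
  hence n: "norm (X - of_real (pi * of_int n - pi / 4)) \<le> 1 / 50" using n0 e50 by (simp only:)
  define c where "c = pi * of_int n - pi / 4"
  have nX: "norm X = 2 / 3 * (k * norm v) ^ 3" using k0 by (simp add: X_def K_def norm_mult norm_power power_mult_distrib)
  have cube: "(k * norm v) ^ 3 \<ge> (seg_min + 1) ^ 3" using kv seg_min by (intro power_mono) auto
  have sm: "(seg_min + 1) ^ 3 \<ge> seg_min ^ 3 + 1"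
  proof -
    have "(seg_min + 1) ^ 3 = seg_min ^ 3 + (3 * (seg_min * seg_min) + 3 * seg_min + 1)"
      by (simp add: power3_eq_cube algebra_simps)
    moreover have "0 \<le> 3 * (seg_min * seg_min) + 3 * seg_min" using seg_min by simp
    ultimately show ?thesis by linarith
  qed
  have s125: "seg_min ^ 3 \<ge> 125"
  proof -
    have "(5::real) ^ 3 \<le> seg_min ^ 3" using seg_min by (intro power_mono) auto
    thus ?thesis by simp
  qed
  \<comment> \<open>The modulus of X alone would also allow a large negative c; the sign of the real
    part excludes it.\<close>
  have ReX: "Re X \<ge> 0" using V(3) K by (simp add: X_def)
  have "\<bar>Re (X - of_real c)\<bar> \<le> 1 / 50" using abs_Re_le_cmod[of "X - of_real c"] n by (simp add: c_def)
  hence "\<bar>Re X - c\<bar> \<le> 1 / 50" by simp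
  hence c1: "c \<ge> - 1 / 50" using ReX by linarith
  have "norm X \<le> \<bar>c\<bar> + 1 / 50" using norm_triangle_sub[of X "of_real c"] n by (simp add: c_def del: of_real_diff)
  hence c2: "c \<ge> 2 / 3 * seg_min ^ 3 + 1 / 2" using c1 nX cube sm s125 by linarith
  define w where "w = root 3 (3 * c / (2 * K))"
  have cpos': "3 * c / (2 * K) > 0" using c2 s125 K by simp
  have w0: "w > 0" using cpos' by (simp add: w_def)
  have w3: "w ^ 3 = 3 * c / (2 * K)" unfolding w_def using cpos' by (intro real_root_pow_pos2) auto
  have wc: "2 / 3 * K * w ^ 3 = c" unfolding w3 using K by simp
  have kw: "k * w \<ge> seg_min"
  proof (rule power_le_imp_le_base[of _ 2])
    have "(k * w) ^ 3 = K * w ^ 3" by (simp add: K_def power_mult_distrib)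
    also have "\<dots> = 3 / 2 * c" using wc by simp
    also have "\<dots> \<ge> seg_min ^ 3" using c2 by simp
    finally show "seg_min ^ Suc 2 \<le> (k * w) ^ Suc 2" by (simp add: eval_nat_numeral)
    show "0 \<le> k * w" using k0 w0 by simp
  qed
  have L: "K * w ^ 3 \<ge> 125" unfolding K_def using kw seg_min by (intro cube_ge_125) linarith
  have near: "norm (v - of_real w) \<le> (3 / 100) / (K * w\<^sup>2)"
  proof -
    have "v ^ 3 - of_real w ^ 3 = (v - of_real w) * (v\<^sup>2 + v * of_real w + of_real w ^ 2)"
      by (simp add: power3_eq_cube power2_eq_square algebra_simps)
    hence "norm (v - of_real w) * norm (v\<^sup>2 + v * of_real w + of_real w ^ 2) = norm (v ^ 3 - of_real w ^ 3)"
      by (simp add: norm_mult)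
    \<comment> \<open>The cofactor of \<open>v - w\<close> in the difference of cubes cannot be
      small, because v and its square have nonnegative real parts.\<close>
    moreover have "w\<^sup>2 \<le> norm (v\<^sup>2 + v * of_real w + of_real w ^ 2)"
    proof -
      have "w\<^sup>2 \<le> Re (v\<^sup>2 + v * of_real w + of_real w ^ 2)" using V w0 by (simp flip: of_real_power)
      also have "\<dots> \<le> norm (v\<^sup>2 + v * of_real w + of_real w ^ 2)" by (rule complex_Re_le_cmod)
      finally show ?thesis .
    qed
    hence "norm (v - of_real w) * w\<^sup>2 \<le> norm (v - of_real w) * norm (v\<^sup>2 + v * of_real w + of_real w ^ 2)"
      by (intro mult_left_mono) auto
    moreover have "norm (v ^ 3 - of_real w ^ 3) \<le> (3 / 100) / K"
    proof -
      have "X - of_real c = of_real (2 / 3 * K) * (v ^ 3 - of_real w ^ 3)"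
        unfolding X_def wc[symmetric] by (simp add: algebra_simps)
      hence "norm (X - of_real c) = norm (complex_of_real (2 / 3 * K)) * norm (v ^ 3 - of_real w ^ 3)" by (simp only: norm_mult)
      also have "norm (complex_of_real (2 / 3 * K)) = 2 / 3 * K" unfolding norm_of_real using K by simp
      finally have "2 / 3 * K * norm (v ^ 3 - of_real w ^ 3) \<le> 1 / 50" using n unfolding c_def[symmetric] by simp
      thus ?thesis using K by (simp add: field_simps)
    qed
    ultimately have "norm (v - of_real w) * w\<^sup>2 \<le> (3 / 100) / K" by linarith
    thus ?thesis using K w0 by (simp add: field_simps)
  qed
  have S: "norm (v\<^sup>2 - of_real (w\<^sup>2)) \<le> 3 / 100 * (2004 / 1000) / (K * w)"
    "norm (v\<^sup>2 - of_real (w\<^sup>2)) \<le> 81 / 10000 * w\<^sup>2"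
    by (rule square_diff_le[OF w0 L refl _ near]; use K in simp)+
  \<comment> \<open>The height of p is converted back into missing length: one of the 15 units
    absorbs the perturbation, and the slope sqrt 3 / 2 below 1 works in the right direction. For w
    below 1/2 the claim is numerically obvious.\<close>
  have w2: "w\<^sup>2 \<le> 2 * node_re - 14 / k ^ 3"
  proof (cases "w \<ge> 1 / 2")
    case True
    define e where "e = cnj sixth_root * (v\<^sup>2 - of_real (w\<^sup>2))"
    have "p = \<i> + cnj sixth_root * of_real (w\<^sup>2) + e" by (simp add: pv[symmetric] seg_pt_def e_def algebra_simps)
    hence "Im p = 1 - sqrt 3 / 2 * w\<^sup>2 + Im e" using Im_seg_pt_real[of "w\<^sup>2"] by simp
    moreover have "norm e = norm (v\<^sup>2 - of_real (w\<^sup>2))" using norm_sixth_root by (simp add: e_def norm_mult)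
    hence "Im e \<le> 3 / 100 * (2004 / 1000) / (K * w)" using S(1) abs_Im_le_cmod[of e] by linarith
    moreover have "3 / 100 * (2004 / 1000) / (K * w) \<le> (1 / 2) / (K * (1 / 2))" using K True by (intro frac_le mult_left_mono) auto
    ultimately have "sqrt 3 / 2 * w\<^sup>2 \<le> 1 - 15 / K + 1 / K" using p(2) unfolding K_def[symmetric] by simp
    also have "1 - 15 / K + 1 / K = sqrt 3 / 2 * (2 * node_re) - 14 / K" using node_re_bounds(3) by simp
    also have "\<dots> \<le> sqrt 3 / 2 * (2 * node_re) - sqrt 3 / 2 * (14 / K)"
    proof -
      have "sqrt 3 / 2 * (14 / K) \<le> 1 * (14 / K)" using sqrt3_bounds K by (intro mult_right_mono) auto
      thus ?thesis by linarith
    qed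
    finally have "sqrt 3 / 2 * w\<^sup>2 \<le> sqrt 3 / 2 * (2 * node_re - 14 / K)" by (simp add: algebra_simps)
    thus ?thesis unfolding K_def[symmetric] by (rule mult_left_le_imp_le) simp
  next
    case False
    have "w\<^sup>2 \<le> (1 / 2)\<^sup>2" using False w0 by (intro power_mono) auto
    moreover have "14 / K \<le> 14 / 1000" using K by (intro divide_left_mono) auto
    ultimately show ?thesis using node_re_bounds(1) unfolding K_def[symmetric] by (simp add: power2_eq_square)
  qed
  have "v \<in> cball (of_real w) (1 / (4 * k ^ 3 * w\<^sup>2))"
  proof -
    have "(3 / 100) / (K * w\<^sup>2) \<le> (1 / 4) / (K * w\<^sup>2)" using K by (intro divide_right_mono) auto
    thus ?thesis using near by (simp add: dist_norm norm_minus_commute K_def mult.assoc)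
  qed
  hence "seg_rel k v n w" unfolding seg_rel_def using w0 kw w2 wc by (simp add: c_def K_def)
  thus ?thesis unfolding v_def by blast
qed

text \<open>Rectangles measure lengths, that is squares of w, while labels are given by
  cubes.\<close>

lemma cube_square_compare:
  fixes a b :: real
  assumes "0 \<le> b" "b \<le> a"
  shows "2 / 3 * (a ^ 3 - b ^ 3) \<le> (a\<^sup>2 - b\<^sup>2) * a"
proof -
  have "0 \<le> (a - b) * (a - b) * (a + 2 * b) / 3" using assms by simp
  also have "\<dots> = (a\<^sup>2 - b\<^sup>2) * a - 2 / 3 * (a ^ 3 - b ^ 3)"
    by (simp add: power3_eq_cube power2_eq_square field_simps)
  finally show ?thesis by simp
qed

text \<open>Whether a zero lies in a rectangle depends on the real part of the square of v, its
  label on the cube of w. An error D of order \<open>1 / (K * w)\<close> in the square is an error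
  \<open>K * D * w\<close> of at most 6/10 in the phase, hence the slack 1.\<close>

lemma seg_compare:
  fixes v :: complex
  assumes w: "w > 0" and L: "K * w ^ 3 \<ge> 125" "K > 0" and v: "norm (v - of_real w) \<le> (1 / 4) / (K * w\<^sup>2)" and t: "t \<ge> 0"
  shows "Re (v\<^sup>2) \<le> t\<^sup>2 \<Longrightarrow> 2 / 3 * K * w ^ 3 \<le> 2 / 3 * K * t ^ 3 + 1"
    "Re (v\<^sup>2) > t\<^sup>2 \<Longrightarrow> 2 / 3 * K * w ^ 3 \<ge> 2 / 3 * K * t ^ 3 - 1"
    "norm (v\<^sup>2 - of_real (w\<^sup>2)) \<le> (1 / 4) * (2004 / 1000) / (K * w)" "Re (v\<^sup>2) > 0"
proof -
  define D where "D = (1 / 4) * (2004 / 1000) / (K * w)"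
  note S = square_diff_le[OF w L(1) refl L(2) v]
  show D: "norm (v\<^sup>2 - of_real (w\<^sup>2)) \<le> (1 / 4) * (2004 / 1000) / (K * w)" by (rule S) simp_all
  have S2: "norm (v\<^sup>2 - of_real (w\<^sup>2)) \<le> 81 / 10000 * w\<^sup>2" by (rule S) simp_all
  have r: "\<bar>Re (v\<^sup>2) - w\<^sup>2\<bar> \<le> norm (v\<^sup>2 - of_real (w\<^sup>2))"
    using abs_Re_le_cmod[of "v\<^sup>2 - of_real (w\<^sup>2)"] by (simp del: of_real_power)
  have KD: "K * D * w \<le> 6 / 10" using w L by (simp add: D_def)
  have w2: "w\<^sup>2 > 0" using w by simp
  show "Re (v\<^sup>2) > 0" using r S2 w2 by linarith
  show "2 / 3 * K * w ^ 3 \<le> 2 / 3 * K * t ^ 3 + 1" if "Re (v\<^sup>2) \<le> t\<^sup>2"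
  proof (cases "w \<le> t")
    case True
    hence "w ^ 3 \<le> t ^ 3" using w by (intro power_mono) auto
    hence "2 / 3 * K * w ^ 3 \<le> 2 / 3 * K * t ^ 3" using L by (intro mult_left_mono) auto
    thus ?thesis by linarith
  next
    case False
    have "w\<^sup>2 - t\<^sup>2 \<le> D" using that r D unfolding D_def by linarith
    hence "(w\<^sup>2 - t\<^sup>2) * w \<le> D * w" using w by (intro mult_right_mono) auto
    hence "2 / 3 * (w ^ 3 - t ^ 3) \<le> D * w" using cube_square_compare[of t w] False t by linarith
    hence "K * (2 / 3 * (w ^ 3 - t ^ 3)) \<le> K * (D * w)" using L by (intro mult_left_mono) auto
    also have "\<dots> \<le> 6 / 10" using KD by (simp add: mult.assoc)
    finally show ?thesis by (simp add: algebra_simps)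
  qed
  show "2 / 3 * K * w ^ 3 \<ge> 2 / 3 * K * t ^ 3 - 1" if "Re (v\<^sup>2) > t\<^sup>2"
  proof (cases "t \<le> w")
    case True
    hence "t ^ 3 \<le> w ^ 3" using t by (intro power_mono) auto
    hence "2 / 3 * K * t ^ 3 \<le> 2 / 3 * K * w ^ 3" using L by (intro mult_left_mono) auto
    thus ?thesis by linarith
  next
    case False
    have tw: "t\<^sup>2 - w\<^sup>2 \<le> D" using that r D unfolding D_def by linarith
    have "t\<^sup>2 \<le> (101 / 100 * w)\<^sup>2" using that r S2 w2 by (simp add: power_mult_distrib power_divide)
    hence t2: "t \<le> 101 / 100 * w" using w by (intro power2_le_imp_le[of t "101 / 100 * w"]) auto
    have D0: "D \<ge> 0" using w L by (simp add: D_def)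
    have "(t\<^sup>2 - w\<^sup>2) * t \<le> D * t" using t tw by (intro mult_right_mono) auto
    also have "\<dots> \<le> D * (101 / 100 * w)" using t2 D0 by (intro mult_left_mono) auto
    finally have "2 / 3 * (t ^ 3 - w ^ 3) \<le> D * (101 / 100 * w)" using cube_square_compare[of w t] False w by linarith
    hence "K * (2 / 3 * (t ^ 3 - w ^ 3)) \<le> K * (D * (101 / 100 * w))" using L by (intro mult_left_mono) auto
    also have "\<dots> = 101 / 100 * (K * D * w)" by simp
    also have "\<dots> \<le> 1" using KD by simp
    finally show ?thesis by (simp add: algebra_simps)
  qed
qed

text \<open>\<open>(p - \<i>) * sixth_root\<close> has the coordinate along the segment, measured
  from \<open>\<i>\<close>, as real part and the coordinate across it as imaginary part. The
  conditions with 15 and \<open>seg_min + 1\<close> cut out neighbourhoods of the node and of the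
  turning point, where zeros are only bounded in number.\<close>

definition seg_zeros :: "real \<Rightarrow> real \<Rightarrow> real \<Rightarrow> complex set" where
  "seg_zeros k \<delta> t = {p. evans k p = 0 \<and> Im p \<ge> 15 / k ^ 3 \<and> k * norm (csqrt (p - \<i>)) \<ge> seg_min + 1 \<and>
     0 < Re ((p - \<i>) * sixth_root) \<and> Re ((p - \<i>) * sixth_root) \<le> t\<^sup>2 \<and> \<bar>Im ((p - \<i>) * sixth_root)\<bar> \<le> \<delta>}"

text \<open>Roots whose phase is this close to an end of the range need not produce a member of
  \<open>seg_zeros\<close>: the cube guards the turning point, the 30 guards the other end.\<close>

definition seg_err :: real where "seg_err = (seg_min + 2) ^ 3 + 30"

lemma seg_strip:
  assumes "Re ((p - \<i>) * sixth_root) \<le> 2 * node_re"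
  shows "Re p \<le> node_re + sqrt 3 * Im p"
proof -
  have "Re ((p - \<i>) * sixth_root) = Re p / 2 - (sqrt 3 * Im p) / 2 + sqrt 3 / 2" by (simp add: sixth_root_def field_simps)
  moreover have "sqrt 3 = 3 * node_re" by (simp add: node_re_def real_div_sqrt)
  ultimately show ?thesis using assms by argo
qed

lemma seg_count:
  assumes k: "large k" "1 / \<delta> \<le> k\<^sup>2" and \<delta>: "\<delta> > 0" and t: "t \<ge> 0" "t\<^sup>2 \<le> 2 * node_re"
  shows "finite (seg_zeros k \<delta> t)"
    "\<bar>real (card (seg_zeros k \<delta> t)) - 2 / 3 * k ^ 3 * t ^ 3 / pi\<bar> \<le> seg_err + 1"
proof -
  define K where "K = k ^ 3"
  have K: "K \<ge> 1000" and k0: "k > 0" using large_bounds[OF k(1)] by (auto simp: K_def)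
  let ?Z = "seg_zeros k \<delta> t"
  define V where "V = (\<lambda>p. twelfth_root * csqrt (p - \<i>))"
  have V2: "(V p)\<^sup>2 = (p - \<i>) * sixth_root" for p
    by (simp add: V_def power_mult_distrib twelfth_root_square mult.commute)
  have VP: "seg_pt (V p) = p" for p unfolding V_def by (rule seg_pt_of_csqrt)
  have ex: "\<exists>n w. seg_rel k (V p) n w" if p: "p \<in> ?Z" for p
    unfolding V_def using p t by (intro seg_locate[OF k(1)] seg_strip) (auto simp: seg_zeros_def)
  define f where "f = (\<lambda>p. SOME n. \<exists>w. seg_rel k (V p) n w)"
  have fw: "\<exists>w. seg_rel k (V p) (f p) w" if "p \<in> ?Z" for p unfolding f_def by (rule someI_ex[OF ex[OF that]])
  have rel125: "K * w ^ 3 \<ge> 125" if "k * w \<ge> seg_min" for w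
    unfolding K_def using that seg_min by (intro cube_ge_125) linarith
  have inj: "inj_on f ?Z"
  proof (rule inj_onI)
    fix p q assume pq: "p \<in> ?Z" "q \<in> ?Z" "f p = f q"
    obtain w where w: "seg_rel k (V p) (f p) w" using fw[OF pq(1)] by blast
    obtain u where u: "seg_rel k (V q) (f p) u" using fw[OF pq(2)] unfolding pq(3) by blast
    have "2 / 3 * k ^ 3 * w ^ 3 = 2 / 3 * k ^ 3 * u ^ 3" using w u by (simp add: seg_rel_def)
    hence "w ^ 3 = u ^ 3" using k0 by simp
    hence "w = u" by (rule power_eq_imp_eq_base) (use w u in \<open>auto simp: seg_rel_def\<close>)
    moreover have "evans k (seg_pt (V p)) = 0" "evans k (seg_pt (V q)) = 0" unfolding VP using pq by (auto simp: seg_zeros_def)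
    ultimately have "V p = V q" using seg_unique(1)[OF k(1), of w "f p"] w u unfolding seg_rel_def by blast
    thus "p = q" using VP by metis
  qed
  define A where "A = pi / 4"
  define B where "B = 2 / 3 * K * t ^ 3 + pi / 4"
  have t3: "2 / 3 * K * t ^ 3 \<ge> 0" using K t by simp
  have e0: "seg_err \<ge> 30" using seg_min by (simp add: seg_err_def)
  have upper: "A - seg_err \<le> pi * of_int (f p) \<and> pi * of_int (f p) \<le> B + seg_err" if p: "p \<in> ?Z" for p
  proof -
    obtain w where w: "seg_rel k (V p) (f p) w" using fw[OF p] by blast
    have w': "w > 0" "k * w \<ge> seg_min" "2 / 3 * K * w ^ 3 = pi * of_int (f p) - pi / 4"
      "norm (V p - of_real w) \<le> (1 / 4) / (K * w\<^sup>2)"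
      using w by (auto simp: seg_rel_def K_def dist_norm norm_minus_commute mult.assoc)
    have "Re ((V p)\<^sup>2) \<le> t\<^sup>2" using p unfolding V2 by (simp add: seg_zeros_def)
    hence "2 / 3 * K * w ^ 3 \<le> 2 / 3 * K * t ^ 3 + 1"
      using K by (intro seg_compare(1)[OF w'(1) rel125[OF w'(2)] _ w'(4) t(1)]) auto
    moreover have "2 / 3 * K * w ^ 3 \<ge> 0" using K w'(1) by (intro mult_nonneg_nonneg) auto
    ultimately show ?thesis using w'(3) e0 unfolding A_def B_def by linarith
  qed
  have lower: "n \<in> f ` ?Z" if n: "A + seg_err \<le> pi * of_int n" "pi * of_int n \<le> B - seg_err" for n
  proof -
    define c where "c = pi * of_int n - pi / 4"
    have c: "seg_err \<le> c" "c \<le> 2 / 3 * K * t ^ 3 - seg_err" using n by (auto simp: A_def B_def c_def)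
    define w where "w = root 3 (3 * c / (2 * K))"
    have cpos: "3 * c / (2 * K) > 0" using c e0 K by simp
    have w0: "w > 0" using cpos by (simp add: w_def)
    have w3: "w ^ 3 = 3 * c / (2 * K)" unfolding w_def using cpos by (intro real_root_pow_pos2) auto
    have wc: "2 / 3 * K * w ^ 3 = c" unfolding w3 using K by simp
    have kw: "k * w \<ge> seg_min + 2"
    proof (rule power_le_imp_le_base[of _ 2])
      have "(k * w) ^ 3 = K * w ^ 3" by (simp add: K_def power_mult_distrib)
      also have "\<dots> = 3 / 2 * c" using wc by simp
      finally have "(k * w) ^ 3 = 3 / 2 * c" .
      moreover have "(seg_min + 2) ^ 3 \<le> 3 / 2 * c" using c(1) e0 unfolding seg_err_def by linarith
      ultimately show "(seg_min + 2) ^ Suc 2 \<le> (k * w) ^ Suc 2" by (simp add: eval_nat_numeral)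
      show "0 \<le> k * w" using k0 w0 by simp
    qed
    have L: "K * w ^ 3 \<ge> 125" using kw by (intro rel125) simp
    have lt: "2 / 3 * (t ^ 3 - w ^ 3) * K \<ge> 30" using c wc e0 by (simp add: algebra_simps)
    have "w \<le> t"
    proof (rule ccontr)
      assume "\<not> w \<le> t"
      hence "t ^ 3 \<le> w ^ 3" using t by (intro power_mono) auto
      hence "2 / 3 * (t ^ 3 - w ^ 3) \<le> 0" by simp
      hence "2 / 3 * (t ^ 3 - w ^ 3) * K \<le> 0" by (rule mult_nonpos_nonneg) (use K in simp)
      thus False using lt by linarith
    qed
    have t1: "t \<le> 11 / 10" using t node_re_bounds by (intro power2_le_imp_le[of t "11 / 10"]) (auto simp: power2_eq_square)
    \<comment> \<open>30 missing units of phase amount to a missing length of at least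
      \<open>20 / K\<close>, because t is at most 11/10; by \<open>seg_Im_ge\<close> this yields
      imaginary part at least \<open>15 / K\<close> for the zero.\<close>
    have "2 / 3 * (t ^ 3 - w ^ 3) \<le> (t\<^sup>2 - w\<^sup>2) * t" by (rule cube_square_compare) (use w0 \<open>w \<le> t\<close> in auto)
    also have "\<dots> \<le> (t\<^sup>2 - w\<^sup>2) * (11 / 10)"
    proof -
      have "w\<^sup>2 \<le> t\<^sup>2" using \<open>w \<le> t\<close> w0 by (intro power_mono) auto
      thus ?thesis using t1 by (intro mult_left_mono) auto
    qed
    finally have "2 / 3 * (t ^ 3 - w ^ 3) * K \<le> (t\<^sup>2 - w\<^sup>2) * (11 / 10) * K" using K by (intro mult_right_mono) auto
    hence "30 \<le> (t\<^sup>2 - w\<^sup>2) * (11 / 10) * K" using lt by linarith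
    hence "20 / K \<le> t\<^sup>2 - w\<^sup>2" using K by (simp add: field_simps)
    hence w20: "w\<^sup>2 \<le> 2 * node_re - 20 / K" using t by linarith
    have "14 / K \<le> 20 / K" using K by (intro divide_right_mono) auto
    hence w14: "w\<^sup>2 \<le> 2 * node_re - 14 / k ^ 3" using w20 by (simp add: K_def)
    have kws: "k * w \<ge> seg_min" using kw by simp
    have wn: "2 / 3 * k ^ 3 * w ^ 3 = pi * of_int n - pi / 4" using wc by (simp add: c_def K_def)
    note U = seg_unique[OF k(1) w0 kws w14 wn]
    obtain v where v: "v \<in> cball (of_real w) (1 / (4 * k ^ 3 * w\<^sup>2))" "evans k (seg_pt v) = 0" using U(1) by blast
    have v4: "norm (v - of_real w) \<le> (1 / 4) / (K * w\<^sup>2)" using v(1) by (simp add: dist_norm norm_minus_commute K_def mult.assoc)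
    have S2: "norm (v\<^sup>2 - of_real (w\<^sup>2)) \<le> 81 / 10000 * w\<^sup>2" "norm (v - of_real w) \<le> w / 250"
      using K by (intro square_diff_le[OF w0 L refl _ v4]; simp)+
    note C = seg_compare[OF w0 L _ v4 t(1)]
    have C1: "norm (v\<^sup>2 - of_real (w\<^sup>2)) \<le> (1 / 4) * (2004 / 1000) / (K * w)" using K by (intro C) auto
    define p where "p = seg_pt v"
    have cs: "csqrt (p - \<i>) = cnj twelfth_root * v"
      unfolding p_def by (rule csqrt_seg_pt[OF twelfth_root_Re_pos[OF S2(2) w0]])
    have Vp: "V p = v" unfolding V_def cs mult.assoc[symmetric] cnj_twelfth_root_powers(4) by simp
    have v2: "(p - \<i>) * sixth_root = v\<^sup>2" using V2[of p] Vp by simp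
    have "Im p \<ge> (866 / 1000 * 20 - 2 * ((1 / 4) * (2004 / 1000))) / K"
      unfolding p_def using w20 by (intro seg_Im_ge[OF K w0 _ _ _ C1 _ S2(1)]) auto
    moreover have "(866 / 1000 * 20 - 2 * ((1 / 4) * (2004 / 1000))) / K \<ge> 15 / K" using K by (intro divide_right_mono) auto
    ultimately have "Im p \<ge> 15 / k ^ 3" by (simp add: K_def)
    moreover have "k * norm (csqrt (p - \<i>)) \<ge> seg_min + 1"
    proof -
      have ncs: "norm (csqrt (p - \<i>)) = norm v" unfolding cs norm_mult using cnj_twelfth_root_powers(3) by simp
      have "norm v \<ge> w - (1 / 4) / (K * w\<^sup>2)"
        using norm_triangle_sub[of "of_real w" v] v4 w0 by (simp add: norm_minus_commute)
      hence "k * (w - (1 / 4) / (K * w\<^sup>2)) \<le> k * norm v" using k0 by (intro mult_left_mono) auto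
      moreover have "k * (w - (1 / 4) / (K * w\<^sup>2)) = k * w - (1 / 4) / (k * w)\<^sup>2"
        using k0 w0 by (simp add: K_def power2_eq_square power3_eq_cube field_simps)
      moreover have "(1 / 4) / (k * w)\<^sup>2 \<le> (1 / 4) / 1"
      proof (intro divide_left_mono)
        have "(1::real)\<^sup>2 \<le> (k * w)\<^sup>2" using kws seg_min by (intro power_mono) auto
        thus "1 \<le> (k * w)\<^sup>2" by simp
      qed (use k0 w0 in auto)
      ultimately show ?thesis using kw unfolding ncs by linarith
    qed
    moreover have "0 < Re (v\<^sup>2)" using K by (intro C) auto
    moreover have "Re (v\<^sup>2) \<le> t\<^sup>2"
    proof (rule ccontr)
      assume "\<not> Re (v\<^sup>2) \<le> t\<^sup>2"
      hence "2 / 3 * K * w ^ 3 \<ge> 2 / 3 * K * t ^ 3 - 1" using K by (intro C) auto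
      thus False using wc c e0 by linarith
    qed
    moreover have "\<bar>Im (v\<^sup>2)\<bar> \<le> \<delta>"
    proof -
      have "\<bar>Im (v\<^sup>2)\<bar> = \<bar>Im (v\<^sup>2 - of_real (w\<^sup>2))\<bar>" by (simp del: of_real_power)
      also have "\<dots> \<le> (1 / 4) * (2004 / 1000) / (K * w)" using abs_Im_le_cmod C1 order.trans by blast
      \<comment> \<open>Here k has to exceed a threshold depending on \<delta>: the distance of the
        zero from the segment is at most 0.501 / (K w), which is below
        \<open>1 / k ^ 2\<close>.\<close>
      also have "K * w = k\<^sup>2 * (k * w)" by (simp add: K_def power3_eq_cube power2_eq_square)
      also have "(1 / 4) * (2004 / 1000) / (k\<^sup>2 * (k * w)) \<le> 1 / (k\<^sup>2 * 1)"
        using k0 kws seg_min by (intro frac_le mult_left_mono) auto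
      also have "\<dots> \<le> \<delta>" using k(2) \<delta> k0 by (simp add: field_simps)
      finally show ?thesis .
    qed
    ultimately have pZ: "p \<in> ?Z" using v(2)[folded p_def] unfolding seg_zeros_def mem_Collect_eq v2 by blast
    have "f p = n"
    proof -
      obtain u where u: "seg_rel k v (f p) u" using fw[OF pZ] unfolding Vp by blast
      have "norm (of_real (2 / 3 * k ^ 3) * v ^ 3 - of_real (pi * of_int (f p) - pi / 4)) \<le> 5 / 8"
        using u unfolding seg_rel_def by (intro seg_unique(2)[OF k(1), of u]) auto
      moreover have "norm (of_real (2 / 3 * k ^ 3) * v ^ 3 - of_real (pi * of_int n - pi / 4)) \<le> 5 / 8"
        by (rule U(2)[OF v(1)])
      ultimately have "norm (of_real (pi * of_int (f p) - pi / 4) - of_real (pi * of_int n - pi / 4) :: complex) \<le> 5 / 4"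
        using norm_triangle_ineq4[of "of_real (2 / 3 * k ^ 3) * v ^ 3 - of_real (pi * of_int n - pi / 4)"
          "of_real (2 / 3 * k ^ 3) * v ^ 3 - of_real (pi * of_int (f p) - pi / 4)"] by simp
      also have "of_real (pi * of_int (f p) - pi / 4) - of_real (pi * of_int n - pi / 4) = complex_of_real (pi * of_int (f p - n))"
        by (simp add: algebra_simps)
      finally have le: "pi * \<bar>of_int (f p - n)\<bar> \<le> 5 / 4" unfolding norm_of_real by (simp add: abs_mult)
      show ?thesis
      proof (rule ccontr)
        assume "f p \<noteq> n"
        hence "(1::real) \<le> \<bar>of_int (f p - n)\<bar>" by linarith
        hence "pi * 1 \<le> pi * \<bar>of_int (f p - n)\<bar>" by (intro mult_left_mono) auto
        thus False using le pi_gt3 by linarith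
      qed
    qed
    thus ?thesis using pZ by blast
  qed
  have "A \<le> B" "seg_err \<ge> 0" using t3 e0 by (auto simp: A_def B_def)
  note C = card_int_count[OF inj this(2,1) upper lower]
  show "finite ?Z" by (rule C)
  have "\<bar>real (card ?Z) - (B - A) / pi\<bar> \<le> seg_err + 1" by (rule C)
  thus "\<bar>real (card ?Z) - 2 / 3 * k ^ 3 * t ^ 3 / pi\<bar> \<le> seg_err + 1" by (simp add: A_def B_def K_def)
qed

subsection \<open>Exceptional zeros near the node and the end points\<close>

lemma evans_nf_holomorphic:
  assumes "k > 0" shows "evans_nf k holomorphic_on wkb_dom"
  unfolding evans_nf_def[abs_def]
  by (intro holomorphic_intros amps_holomorphic[OF assms] phase_shift_holomorphic)

text \<open>The node lies on anti-Stokes lines of both turning points, so all three exponentials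
  have modulus 1 there and no two-term balance is available.\<close>

lemma Re_phase_node: "Re (phase (of_real node_re - \<i>)) = 0" "Re (phase (of_real node_re + \<i>)) = 0"
proof -
  have "Re (of_real node_re - \<i>) > 0" "sqrt 3 * Re (of_real node_re - \<i>) + Im (of_real node_re - \<i>) = 0"
    using node_re_bounds by auto
  thus 1: "Re (phase (of_real node_re - \<i>)) = 0"
    using phase_Re_bounds[of "of_real node_re - \<i>"] by (simp del: csqrt.simps)
  have "phase (cnj (of_real node_re - \<i>)) = cnj (phase (of_real node_re - \<i>))"
    using node_re_bounds by (intro phase_cnj) (auto simp: complex_nonpos_Reals_iff)
  thus "Re (phase (of_real node_re + \<i>)) = 0" using 1 by simp
qed

lemma node_ball:
  assumes k: "large k" and p: "norm (p - of_real node_re) \<le> 1 / 10"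
  shows "p \<in> wkb_dom" "p \<in> good k" "norm p \<le> 1" "Re p \<ge> 4 / 10" "\<bar>Im p\<bar> \<le> 1 / 10"
proof -
  have R: "\<bar>Re p - node_re\<bar> \<le> 1 / 10" using abs_Re_le_cmod[of "p - of_real node_re"] p by simp
  thus Rp: "Re p \<ge> 4 / 10" using node_re_bounds by linarith
  show Ip: "\<bar>Im p\<bar> \<le> 1 / 10" using abs_Im_le_cmod[of "p - of_real node_re"] p by simp
  show d: "p \<in> wkb_dom" using Rp Ip by (auto simp: wkb_dom_def)
  show "norm p \<le> 1" using norm_triangle_sub[of p "of_real node_re"] p node_re_bounds by simp
  show "p \<in> good k"
    using norm_ge_Re_pm_i[of p] Rp by (intro large_good[OF k d]) linarith+
qed

lemma node_phase_small:
  assumes k: "large k" and p: "norm (p - of_real node_re) \<le> Q / k ^ 3" "Q / k ^ 3 \<le> 1 / 10"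
  shows "k ^ 3 * \<bar>Re (phase (p - \<i>))\<bar> \<le> 2 * Q" "k ^ 3 * \<bar>Re (phase (p + \<i>))\<bar> \<le> 2 * Q"
proof -
  have k0: "k > 0" using large_bounds[OF k] by simp
  have key: "k ^ 3 * \<bar>Re (phase (p + c))\<bar> \<le> 2 * Q"
    if c: "c = \<i> \<or> c = - \<i>" and z: "Re (phase (of_real node_re + c)) = 0" for c
  proof -
    have "norm (phase (p + c) - phase (of_real node_re + c)) \<le> 2 * norm (p - of_real node_re)"
    proof (rule field_differentiable_bound[where f="\<lambda>p. phase (p + c)" and f'="\<lambda>p. csqrt (p + c)" and S="cball (of_real node_re) (1 / 10)"])
      show "convex (cball (complex_of_real node_re) (1 / 10))" by (rule convex_cball)
      show "complex_of_real node_re \<in> cball (of_real node_re) (1 / 10)" by simp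
      show "p \<in> cball (of_real node_re) (1 / 10)" using order.trans[OF p] by (simp add: dist_norm norm_minus_commute)
    next
      fix q :: complex assume "q \<in> cball (of_real node_re) (1 / 10)"
      hence q: "norm (q - of_real node_re) \<le> 1 / 10" by (simp add: dist_norm norm_minus_commute)
      note nb = node_ball[OF k q]
      have "(phase has_field_derivative csqrt (q + c)) (at (q + c))"
        using nb(4) c by (intro phase_deriv) (auto simp: complex_nonpos_Reals_iff)
      hence "((\<lambda>p. phase (p + c)) has_field_derivative csqrt (q + c)) (at q)"
        by (simp only: DERIV_shift)
      thus "((\<lambda>p. phase (p + c)) has_field_derivative csqrt (q + c)) (at q within cball (of_real node_re) (1 / 10))"
        by (rule has_field_derivative_at_within)
      have "norm (q + c) \<le> 2" using norm_triangle_ineq[of q c] nb(3) c by auto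
      hence "norm (csqrt (q + c)) \<le> sqrt 4" unfolding norm_csqrt by (intro real_sqrt_le_mono) linarith
      thus "norm (csqrt (q + c)) \<le> 2" by simp
    qed
    moreover have "\<bar>Re (phase (p + c) - phase (of_real node_re + c))\<bar> \<le> norm (phase (p + c) - phase (of_real node_re + c))"
      by (rule abs_Re_le_cmod)
    moreover have "2 * norm (p - of_real node_re) \<le> 2 * (Q / k ^ 3)" by (rule mult_left_mono[OF p(1)]) simp
    ultimately have "\<bar>Re (phase (p + c))\<bar> \<le> 2 * (Q / k ^ 3)" unfolding minus_complex.simps z diff_zero by linarith
    hence "k ^ 3 * \<bar>Re (phase (p + c))\<bar> \<le> k ^ 3 * (2 * (Q / k ^ 3))" using k0 by (intro mult_left_mono) auto
    thus ?thesis using k0 by simp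
  qed
  show "k ^ 3 * \<bar>Re (phase (p - \<i>))\<bar> \<le> 2 * Q" using key[of "- \<i>"] Re_phase_node by simp
  show "k ^ 3 * \<bar>Re (phase (p + \<i>))\<bar> \<le> 2 * Q" using key[of "\<i>"] Re_phase_node by simp
qed

text \<open>Imaginary part at most 1/2 keeps the real part of \<open>csqrt (q - \<i>)\<close> above
  1/2, and 19/50 * 1/2 * 16 just exceeds the required 3.\<close>

lemma left_third_dominant:
  assumes k: "large k" and q: "Re q > 0" "0 \<le> Im q" "Im q \<le> 1 / 2" "sqrt 3 * (Re q - node_re) + Im q \<le> - 16 / k ^ 3"
  shows "evans k q \<noteq> 0" "norm (evans_nf k q) \<ge> 1 / 2"
proof -
  define K where "K = k ^ 3"
  have K: "K \<ge> 1000" and k0: "k > 0" using large_bounds[OF k] by (auto simp: K_def)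
  have n1: "norm (q - \<i>) \<ge> 1 / 2" using abs_Im_le_cmod[of "q - \<i>"] q by simp
  have n2: "norm (q + \<i>) \<ge> 1 / 2" using abs_Im_le_cmod[of "q + \<i>"] q by simp
  have dom: "q \<in> wkb_dom" using q by (auto simp: wkb_dom_def)
  have good: "q \<in> good k" using n1 n2 by (intro large_good[OF k dom]) auto
  define l where "l = sqrt 3 * Re q + Im q - 1"
  have l: "l \<le> - 16 / K" using q(4) node_re_bounds(3) by (simp add: l_def K_def algebra_simps)
  have l0: "l \<le> 0" by (rule order.trans[OF l]) (use K in simp)
  have "(1 / 2)\<^sup>2 \<le> norm (q - \<i>) / 2" using n1 by (simp add: power2_eq_square)
  also have "\<dots> \<le> (Re (csqrt (q - \<i>)))\<^sup>2" using q by (intro Re_csqrt_sq_ge) auto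
  finally have x: "1 / 2 \<le> Re (csqrt (q - \<i>))" by (rule power2_le_imp_le) (rule Re_csqrt)
  have "Re (phase (q - \<i>)) \<le> 19 / 50 * Re (csqrt (q - \<i>)) * l"
    using phase_Re_bounds(2)[of "q - \<i>"] q l0 by (simp add: l_def add_diff_eq del: csqrt.simps)
  also have "\<dots> \<le> 19 / 50 * (1 / 2) * l" using x l0 by (intro mult_right_mono_neg mult_left_mono) auto
  also have "\<dots> \<le> 19 / 50 * (1 / 2) * (- 16 / K)" using l by (intro mult_left_mono) auto
  finally have "K * Re (phase (q - \<i>)) \<le> K * (19 / 50 * (1 / 2) * (- 16 / K))" using K by (intro mult_left_mono) auto
  also have "\<dots> \<le> - 3" using K by simp
  finally have a: "k ^ 3 * Re (phase (q - \<i>)) \<le> - 3" by (simp add: K_def)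
  have "0 \<le> 7 / 10 / sqrt (norm q + 1) * Im q" using q by simp
  also have "\<dots> \<le> Im (wfun q)" by (rule wfun_Im_ge[OF q(1,2)]) simp
  finally have w: "Im (wfun q) \<ge> 0" .
  show "evans k q \<noteq> 0" "norm (evans_nf k q) \<ge> 1 / 2" by (rule no_zero_third_dominant[OF k0 good a w])+
qed

text \<open>In a ball of radius \<open>Q / k ^ 3\<close> all exponentials are bounded by
  \<open>exp (4 * Q)\<close>. The Jensen disc is centred \<open>(M + 10) / k ^ 3\<close> to the left
  of the node, where the third exponential dominates and \<open>evans_nf\<close> is at least 1/2;
  radius \<open>(2 * M + 10) / k ^ 3\<close> covers the given ball, and the tripled disc stays
  within Q = 7 M + 40 units of the node.\<close>

lemma node_zeros_bounded:
  assumes M: "M \<ge> 0"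
  obtains N :: nat and K0 where "\<And>k. large k \<Longrightarrow> k ^ 3 \<ge> K0 \<Longrightarrow>
    finite {p. evans k p = 0 \<and> norm (p - of_real node_re) \<le> M / k ^ 3} \<and>
    card {p. evans k p = 0 \<and> norm (p - of_real node_re) \<le> M / k ^ 3} \<le> N"
proof -
  define Q where "Q = 7 * M + 40"
  obtain N where N: "\<And>x. x \<ge> 1 / 2 \<Longrightarrow> 6 * exp (4 * Q) < x * 2 ^ Suc N"
    using ex_finite_card_bound[of "1 / 2" "6 * exp (4 * Q)"] by auto
  have "finite {p. evans k p = 0 \<and> norm (p - of_real node_re) \<le> M / k ^ 3} \<and>
    card {p. evans k p = 0 \<and> norm (p - of_real node_re) \<le> M / k ^ 3} \<le> N"
    if k: "large k" "k ^ 3 \<ge> 20 * Q" for k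
  proof -
    define K where "K = k ^ 3"
    have K: "K \<ge> 1000" and k0: "k > 0" using large_bounds[OF k(1)] by (auto simp: K_def)
    have QK: "Q / K \<le> 1 / 20" using k(2) K by (simp add: K_def[symmetric] field_simps)
    define c where "c = node_re - (M + 10) / K"
    define r where "r = (2 * M + 10) / K"
    have r0: "r > 0" using M K by (simp add: r_def)
    have cn: "norm (of_real c - of_real node_re :: complex) = (M + 10) / K"
      unfolding of_real_diff[symmetric] norm_of_real c_def using M K by simp
    have big: "norm (p - of_real node_re) \<le> Q / K" if "p \<in> cball (of_real c) (3 * r)" for p :: complex
    proof -
      have "norm (p - of_real node_re) \<le> norm (p - of_real c) + norm (of_real c - of_real node_re :: complex)"
        using norm_triangle_ineq[of "p - of_real c" "of_real c - of_real node_re"] by simp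
      also have "\<dots> \<le> 3 * r + (M + 10) / K" using that cn by (simp add: dist_norm norm_minus_commute)
      also have "\<dots> = Q / K" by (simp add: r_def Q_def add_divide_distrib[symmetric])
      finally show ?thesis .
    qed
    have nb: "norm (p - of_real node_re) \<le> 1 / 10" if "p \<in> cball (of_real c) (3 * r)" for p :: complex
      using big[OF that] QK by linarith
    have "(M + 10) / K \<le> Q / K" using M K by (intro divide_right_mono) (auto simp: Q_def)
    hence c0: "c > 0" using QK node_re_bounds unfolding c_def by linarith
    have fc: "norm (evans_nf k (of_real c)) \<ge> 1 / 2"
    proof (rule left_third_dominant(2)[OF k(1)])
      have "sqrt 3 * ((M + 10) / K) \<ge> 17 / 10 * (10 / K)"
        using sqrt3_bounds M K by (intro mult_mono divide_right_mono) auto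
      hence "sqrt 3 * (c - node_re) \<le> - (17 / K)" by (simp add: c_def)
      moreover have "- (17 / K) \<le> - 16 / K" using K by (simp add: field_simps)
      ultimately show "sqrt 3 * (Re (of_real c) - node_re) + Im (of_real c) \<le> - 16 / k ^ 3" by (simp add: K_def)
    qed (use c0 in auto)
    have bound: "norm (evans_nf k p) \<le> 6 * exp (4 * Q)" if p: "p \<in> cball (of_real c) (3 * r)" for p :: complex
    proof -
      note ph = node_phase_small[OF k(1), of p Q, folded K_def, OF big[OF p]]
      have ph: "K * \<bar>Re (phase (p - \<i>))\<bar> \<le> 2 * Q" "K * \<bar>Re (phase (p + \<i>))\<bar> \<le> 2 * Q" using ph QK by auto
      note A = wkb_cutoff(2)[OF k0 node_ball(2)[OF k(1) nb[OF p]]]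
      have a: "norm (amp1 k p) \<le> 2" "norm (amp2 k p) \<le> 2" "norm (amp3 k p) \<le> 2"
        using A norm_triangle_ineq[of "amp1 k p - 1" 1] norm_triangle_ineq[of "amp2 k p - 1" 1]
          norm_triangle_ineq[of "amp3 k p - 1" 1] by simp_all
      have Kr: "\<bar>K * Re (phase (p - \<i>))\<bar> \<le> 2 * Q" "\<bar>K * Re (phase (p + \<i>))\<bar> \<le> 2 * Q"
        using ph K by (simp_all add: abs_mult)
      have e: "norm (exp (of_real (k ^ 3) * (phase (p + \<i>) - phase (p - \<i>)))) \<le> exp (4 * Q)"
        "norm (exp (of_real (k ^ 3) * (phase (p - \<i>) - phase (p + \<i>)))) \<le> exp (4 * Q)"
        "norm (exp (- of_real (k ^ 3) * (phase (p - \<i>) + phase (p + \<i>)))) \<le> exp (4 * Q)"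
      proof -
        have R: "Re (of_real (k ^ 3) * w) = K * Re w" "Re (- of_real (k ^ 3) * w) = - (K * Re w)" for w
          unfolding K_def by simp_all
        show "norm (exp (of_real (k ^ 3) * (phase (p + \<i>) - phase (p - \<i>)))) \<le> exp (4 * Q)"
          "norm (exp (of_real (k ^ 3) * (phase (p - \<i>) - phase (p + \<i>)))) \<le> exp (4 * Q)"
          "norm (exp (- of_real (k ^ 3) * (phase (p - \<i>) + phase (p + \<i>)))) \<le> exp (4 * Q)"
          unfolding norm_exp_eq_Re R minus_complex.sel plus_complex.sel exp_le_cancel_iff ring_distribs
          using Kr[THEN abs_le_D1] Kr[THEN abs_le_D2] by linarith+
      qed
      have tri: "norm (a - b + c) \<le> norm a + norm b + norm c" for a b c :: complex
        using norm_triangle_ineq[of "a - b" c] norm_triangle_ineq4[of a b] by linarith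
      have "norm (evans_nf k p) \<le> norm (amp2 k p) * norm (exp (of_real (k ^ 3) * (phase (p + \<i>) - phase (p - \<i>))))
        + norm (amp3 k p) * norm (exp (of_real (k ^ 3) * (phase (p - \<i>) - phase (p + \<i>))))
        + norm (amp1 k p) * norm (exp (- of_real (k ^ 3) * (phase (p - \<i>) + phase (p + \<i>))))"
        unfolding evans_nf_def by (rule order.trans[OF tri]) (simp only: norm_mult norm_ii mult_1 order.refl)
      also have "\<dots> \<le> 2 * exp (4 * Q) + 2 * exp (4 * Q) + 2 * exp (4 * Q)"
        by (intro add_mono mult_mono a e) auto
      finally show ?thesis by simp
    qed
    have Z: "finite {z \<in> cball (of_real c) r. evans_nf k z = 0} \<and> card {z \<in> cball (of_real c) r. evans_nf k z = 0} \<le> N"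
    proof (rule card_zeros_le[where f="evans_nf k" and S="ball (of_real node_re) (1 / 10)" and c="of_real c" and r=r and M="6 * exp (4 * Q)" and N=N])
      show "open (ball (complex_of_real node_re) (1 / 10))" by (rule open_ball)
      show "r > 0" by (rule r0)
      show "6 * exp (4 * Q) < norm (evans_nf k (of_real c)) * 2 ^ Suc N" by (rule N[OF fc])
      show "norm (evans_nf k z) \<le> 6 * exp (4 * Q)" if "z \<in> cball (of_real c) (3 * r)" for z by (rule bound[OF that])
      show "evans_nf k holomorphic_on ball (of_real node_re) (1 / 10)"
      proof (rule holomorphic_on_subset[OF evans_nf_holomorphic[OF k0]], rule subsetI)
        fix p :: complex assume "p \<in> ball (of_real node_re) (1 / 10)"
        thus "p \<in> wkb_dom" by (intro node_ball(1)[OF k(1)]) (simp add: dist_norm norm_minus_commute)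
      qed
      show "cball (complex_of_real c) (3 * r) \<subseteq> ball (complex_of_real node_re) (1 / 10)"
      proof
        fix p :: complex assume "p \<in> cball (of_real c) (3 * r)"
        from big[OF this] have "norm (p - of_real node_re) < 1 / 10" using QK by linarith
        thus "p \<in> ball (of_real node_re) (1 / 10)" by (simp add: dist_norm norm_minus_commute)
      qed
    qed
    have mem: "p \<in> {z \<in> cball (of_real c) r. evans_nf k z = 0}" if p: "evans k p = 0" "norm (p - of_real node_re) \<le> M / k ^ 3" for p
    proof -
      have "norm (p - of_real c) \<le> norm (p - of_real node_re) + norm (of_real c - of_real node_re :: complex)"
        using norm_triangle_ineq4[of "p - of_real node_re" "of_real c - of_real node_re"] by simp
      moreover have "r = M / K + (M + 10) / K" by (simp add: r_def add_divide_distrib[symmetric])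
      ultimately have pr: "norm (p - of_real c) \<le> r" using p(2) cn unfolding K_def by linarith
      have c1: "p \<in> cball (of_real c) r" using pr by (simp add: dist_norm norm_minus_commute)
      have "p \<in> cball (of_real c) (3 * r)" using pr r0 by (simp add: dist_norm norm_minus_commute)
      hence "p \<in> wkb_dom" by (rule node_ball(1)[OF k(1) nb])
      from evans_zero_iff_nf[OF k0 wkb_dom_amps(1,2)[OF this]] p(1) have "evans_nf k p = 0" by (rule iffD1)
      thus ?thesis using c1 by (intro CollectI conjI)
    qed
    have sub: "{p. evans k p = 0 \<and> norm (p - of_real node_re) \<le> M / k ^ 3} \<subseteq> {z \<in> cball (of_real c) r. evans_nf k z = 0}"
      by (intro subsetI mem; elim CollectE conjE)
    have fin: "finite {p. evans k p = 0 \<and> norm (p - of_real node_re) \<le> M / k ^ 3}"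
      by (rule finite_subset[OF sub conjunct1[OF Z]])
    show ?thesis by (rule conjI[OF fin order.trans[OF card_mono[OF conjunct1[OF Z] sub] conjunct2[OF Z]]])
  qed
  thus thesis by (rule that[of "20 * Q" N])
qed

text \<open>Supplies the centre of the Jensen disc at the turning point; the factor 3 has to beat
  the bound of \<open>far_end_ratio\<close>.\<close>

lemma airy_ratio_large: "\<exists>z. norm (airy (cbrt_unity * z)) > 3 * norm (airy z)"
proof (rule airy_amp_near_1[of "1 / 5"])
  fix R :: real assume R: "R \<ge> 1" "\<And>s. norm s \<ge> R \<Longrightarrow> Re s \<ge> norm s / 4 \<Longrightarrow> norm (airy_amp s - 1) \<le> 1 / 5"
  define x where "x = max R 2"
  have x: "x \<ge> R" "x \<ge> 2" by (auto simp: x_def)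
  define z where "z = complex_of_real (x\<^sup>2)"
  have cz: "csqrt z = of_real x" unfolding z_def using x by (subst csqrt_of_real) auto
  have S: "Re (csqrt z) > 0" unfolding cz using x by simp
  have a1: "norm (airy_amp (of_real x) - 1) \<le> 1 / 5" using x by (intro R(2)) auto
  have a2: "norm (airy_amp (sixth_root * of_real x) - 1) \<le> 1 / 5"
    using x norm_sixth_root by (intro R(2)) (auto simp: norm_mult sixth_root_def)
  have n1: "norm (airy_amp (of_real x)) \<le> 6 / 5" using a1 norm_triangle_ineq[of "airy_amp (of_real x) - 1" 1] by simp
  have n2: "norm (airy_amp (sixth_root * of_real x)) \<ge> 4 / 5"
    using a2 norm_triangle_ineq2[of 1 "1 - airy_amp (sixth_root * of_real x)"] by (simp add: norm_minus_commute)
  have ph: "Re (phase z) = 2 / 3 * x ^ 3" unfolding phase_def cz by (simp flip: of_real_power)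
  define P where "P = norm (csqrt (complex_of_real x))"
  have P: "P > 0" using x by (simp add: P_def)
  define E where "E = exp (2 / 3 * x ^ 3)"
  have m1: "norm (airy z) = airy_const * norm (airy_amp (of_real x)) * (1 / E) / P"
    using mode_amp(1)[of 1 z, OF _ S] airy_const(1) ph
    by (simp add: mode_def cz norm_mult norm_divide norm_exp_eq_Re P_def E_def exp_minus inverse_eq_divide)
  have m2: "norm (airy (cbrt_unity * z)) = airy_const * norm (airy_amp (sixth_root * of_real x)) * E / P"
    using mode_amp(2)[of 1 z, OF _ S] airy_const(1) ph
    by (simp add: mode_def cz norm_mult norm_divide norm_exp_eq_Re P_def E_def cnj_twelfth_root_powers(3))
  have "(2::real) ^ 3 \<le> x ^ 3" using x by (intro power_mono) auto
  moreover have "2 / 3 * x ^ 3 + 1 \<le> E" unfolding E_def using exp_ge_add_one_self[of "2 / 3 * x ^ 3"] by linarith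
  ultimately have E: "E \<ge> 6" by simp
  have "3 * (norm (airy_amp (of_real x)) * (1 / E)) \<le> 3 * (6 / 5 * (1 / 6))"
    using n1 E by (intro mult_left_mono mult_mono divide_left_mono) auto
  also have "\<dots> < 4 / 5 * 6" by simp
  also have "\<dots> \<le> norm (airy_amp (sixth_root * of_real x)) * E" using n2 E by (intro mult_mono) auto
  finally have "airy_const / P * (3 * (norm (airy_amp (of_real x)) * (1 / E))) < airy_const / P * (norm (airy_amp (sixth_root * of_real x)) * E)"
    using airy_const(1) P by (intro mult_strict_left_mono) auto
  hence "3 * norm (airy z) < norm (airy (cbrt_unity * z))" unfolding m1 m2 by (simp add: mult_ac)
  thus ?thesis by blast
qed simp

text \<open>When p is near \<open>\<i>\<close>, the other argument \<open>p + \<i>\<close> is near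
  \<open>2 * \<i>\<close>, where the real part of the phase is not positive. The solution rotated by
  the square of \<open>cbrt_unity\<close> then exceeds the first one at most by the ratio of the
  amplitudes, and the connection formula adds a term of modulus 1.\<close>

lemma far_end_ratio:
  obtains k1 where "k1 > 0" "\<And>k z. k \<ge> k1 \<Longrightarrow> norm (z - 2 * \<i>) \<le> 1 / 4 \<Longrightarrow>
     mode k 1 z \<noteq> 0 \<and> norm (mode k cbrt_unity z / mode k 1 z) \<le> 3"
proof (rule airy_amp_near_1[of "1 / 5"])
  fix R :: real assume R: "R \<ge> 1" "\<And>s. norm s \<ge> R \<Longrightarrow> Re s \<ge> norm s / 4 \<Longrightarrow> norm (airy_amp s - 1) \<le> 1 / 5"
  show thesis
  proof (rule that[of R])
    show "R > 0" using R by simp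
    fix k :: real and z assume k: "k \<ge> R" and z: "norm (z - 2 * \<i>) \<le> 1 / 4"
    have k0: "k > 0" using k R by simp
    have zr: "\<bar>Re z\<bar> \<le> 1 / 4" "Im z \<ge> 7 / 4"
      using abs_Re_le_cmod[of "z - 2 * \<i>"] abs_Im_le_cmod[of "z - 2 * \<i>"] z by auto
    have nz: "norm z \<ge> 7 / 4" using abs_Im_le_cmod[of z] zr by linarith
    define S where "S = csqrt z"
    define x y where "x = Re S" and "y = Im S"
    have S1: "norm S \<ge> 1"
    proof -
      have "sqrt 1 \<le> sqrt (norm z)" using nz by (intro real_sqrt_le_mono) linarith
      thus ?thesis unfolding S_def norm_csqrt by simp
    qed
    have xh: "x \<ge> norm S / 2" unfolding x_def S_def by (rule csqrt_Re_ge_half_norm) (use zr nz in linarith)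
    have x0: "x > 0" using xh S1 by linarith
    have "z = S\<^sup>2" by (simp add: S_def)
    hence zz: "Re z = x\<^sup>2 - y\<^sup>2" "Im z = 2 * x * y" unfolding x_def y_def by (metis Re_power2, metis Im_power2)
    have "0 < x * y" using zr zz by simp
    hence y0: "y > 0" using x0 by (simp add: zero_less_mult_iff)
    have nS: "norm S \<le> x + y" using cmod_le[of S] x0 y0 by (simp add: x_def y_def)
    have nS2: "x\<^sup>2 + y\<^sup>2 = norm z"
    proof -
      have "(norm S)\<^sup>2 = norm z" by (simp add: S_def)
      thus ?thesis unfolding cmod_power2 x_def y_def .
    qed
    have c1: "Re (cnj sixth_root * S) \<ge> norm S / 4"
    proof -
      have "1 * y \<le> sqrt 3 * y" using y0 by (intro mult_right_mono) auto
      hence "(x + y) / 2 \<le> x / 2 + sqrt 3 / 2 * y" by argo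
      moreover have "Re (cnj sixth_root * S) = x / 2 + sqrt 3 / 2 * y" by (simp add: sixth_root_def x_def y_def)
      ultimately show ?thesis using nS S1 by argo
    qed
    have kS: "norm (of_real k * S) \<ge> R"
    proof -
      have "R * 1 \<le> k * norm S" using k S1 R by (intro mult_mono) auto
      thus ?thesis using k0 by (simp add: norm_mult)
    qed
    have a1: "norm (airy_amp (of_real k * S) - 1) \<le> 1 / 5"
    proof (rule R(2)[OF kS])
      have "k * (norm S / 4) \<le> k * x" using xh S1 k0 by (intro mult_left_mono) linarith+
      thus "norm (of_real k * S) / 4 \<le> Re (of_real k * S)" using k0 by (simp add: norm_mult x_def)
    qed
    have a2: "norm (airy_amp (cnj sixth_root * (of_real k * S)) - 1) \<le> 1 / 5"
    proof (rule R(2))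
      show "R \<le> norm (cnj sixth_root * (of_real k * S))" using kS norm_sixth_root by (simp only: norm_mult complex_mod_cnj)
      have "k * (norm S / 4) \<le> k * Re (cnj sixth_root * S)" using c1 k0 by (intro mult_left_mono) auto
      also have "\<dots> = Re (cnj sixth_root * (of_real k * S))" by (simp add: algebra_simps)
      finally show "norm (cnj sixth_root * (of_real k * S)) / 4 \<le> Re (cnj sixth_root * (of_real k * S))"
        using k0 norm_sixth_root by (simp add: norm_mult)
    qed
    have n1: "norm (airy_amp (of_real k * S)) \<ge> 4 / 5"
      using a1 norm_triangle_ineq2[of 1 "1 - airy_amp (of_real k * S)"] by (simp add: norm_minus_commute)
    have n2: "norm (airy_amp (cnj sixth_root * (of_real k * S))) \<le> 6 / 5"
      using a2 norm_triangle_ineq[of "airy_amp (cnj sixth_root * (of_real k * S)) - 1" 1] by simp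
    have ReS: "Re (csqrt z) > 0" using x0 by (simp add: x_def S_def)
    have SC: "S = Complex x y" by (simp add: x_def y_def)
    have "Re (phase z) = 2 / 3 * x * (x\<^sup>2 - 3 * y\<^sup>2)"
      unfolding phase_def S_def[symmetric] SC by (simp add: power3_eq_cube power2_eq_square field_simps)
    \<comment> \<open>The left side equals twice the real part of z minus its modulus, with
      \<open>Re z \<le> 1 / 4\<close> and \<open>norm z \<ge> 7 / 4\<close>.\<close>
    moreover have "x\<^sup>2 - 3 * y\<^sup>2 \<le> 0" using nS2 zz(1) zr nz by linarith
    moreover from this have "2 / 3 * x * (x\<^sup>2 - 3 * y\<^sup>2) \<le> 0" using x0 by (intro mult_nonneg_nonpos) auto
    ultimately have ph: "Re (phase z) \<le> 0" by linarith
    define P where "P = csqrt (of_real k * S)"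
    have P: "P \<noteq> 0" unfolding P_def csqrt_eq_0 using k0 S1 by auto
    have C: "complex_of_real airy_const \<noteq> 0" using airy_const(1) by simp
    have amp0: "airy_amp (of_real k * S) \<noteq> 0" using n1 by auto
    note m1 = mode_amp(1)[OF k0 ReS, folded S_def, folded P_def] and m3 = mode_amp(3)[OF k0 ReS, folded S_def, folded P_def]
    have u0: "mode k 1 z \<noteq> 0" unfolding m1 using P C amp0 by simp
    have t0: "cnj twelfth_root \<noteq> 0" using twelfth_root_nonzero by simp
    have "mode k (cbrt_unity\<^sup>2) z / mode k 1 z = airy_amp (cnj sixth_root * (of_real k * S)) / airy_amp (of_real k * S)
        / cnj twelfth_root * (exp (of_real (k ^ 3) * phase z) / exp (- (of_real (k ^ 3) * phase z)))"
      unfolding m1 m3 using P C amp0 t0 by (simp add: field_simps)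
    also have "exp (of_real (k ^ 3) * phase z) / exp (- (of_real (k ^ 3) * phase z)) = exp (2 * of_real (k ^ 3) * phase z)"
      unfolding exp_diff[symmetric] by (rule arg_cong[where f=exp]) simp
    finally have eq: "mode k (cbrt_unity\<^sup>2) z / mode k 1 z = airy_amp (cnj sixth_root * (of_real k * S)) / airy_amp (of_real k * S)
        / cnj twelfth_root * exp (2 * of_real (k ^ 3) * phase z)" .
    have "norm (mode k (cbrt_unity\<^sup>2) z / mode k 1 z) =
      norm (airy_amp (cnj sixth_root * (of_real k * S))) / norm (airy_amp (of_real k * S)) * exp (2 * (k ^ 3 * Re (phase z)))"
      unfolding eq norm_mult[of _ "exp _"] norm_divide norm_exp_2_of_real complex_mod_cnj cnj_twelfth_root_powers(3) by (simp add: mult_ac)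
    also have "\<dots> \<le> (6 / 5) / (4 / 5) * 1"
    proof (intro mult_mono frac_le n1 n2)
      have "k ^ 3 * Re (phase z) \<le> 0" using k0 ph by (intro mult_nonneg_nonpos) auto
      thus "exp (2 * (k ^ 3 * Re (phase z))) \<le> 1" by (simp add: mult.commute)
    qed auto
    finally have r: "norm (mode k (cbrt_unity\<^sup>2) z / mode k 1 z) \<le> 2" by simp
    have "mode k cbrt_unity z / mode k 1 z = - cbrt_unity\<^sup>2 - cbrt_unity * (mode k (cbrt_unity\<^sup>2) z / mode k 1 z)"
      unfolding mode_connection[of k z] using u0 by (simp add: field_simps)
    also have "norm \<dots> \<le> norm (cbrt_unity\<^sup>2) + norm (cbrt_unity * (mode k (cbrt_unity\<^sup>2) z / mode k 1 z))"
      using norm_triangle_ineq4[of "- cbrt_unity\<^sup>2"] by simp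
    also have "\<dots> \<le> 1 + 2" using r by (simp only: norm_mult norm_power norm_cbrt_unity power_one mult_1)
    finally show "mode k 1 z \<noteq> 0 \<and> norm (mode k cbrt_unity z / mode k 1 z) \<le> 3" using u0 by simp
  qed
qed simp

lemma airy_scale_holomorphic: "(\<lambda>z. airy (c * z)) holomorphic_on S"
proof -
  have "(\<lambda>z. airy (c * z)) field_differentiable at z within S" for z
    unfolding field_differentiable_def by (rule exI, rule airy_scale_deriv(1))
  thus ?thesis by (simp add: holomorphic_on_def)
qed

text \<open>In the Airy variable \<open>k ^ 2 * (p - \<i>)\<close> and divided by
  \<open>mode k 1 (p + \<i>)\<close>, the Evans function is \<open>airy z\<close> times a ratio of
  modulus at most 3, minus \<open>airy (cbrt_unity * z)\<close>. This is bounded on compact sets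
  uniformly in k, and at zc it is bounded below by the gap from \<open>airy_ratio_large\<close>, so
  the Jensen bound does not depend on k.\<close>

lemma end_zeros_bounded:
  obtains N :: nat and k0 where "k0 > 0" "\<And>k. k \<ge> k0 \<Longrightarrow>
    finite {p. evans k p = 0 \<and> k\<^sup>2 * norm (p - \<i>) \<le> q} \<and>
    card {p. evans k p = 0 \<and> k\<^sup>2 * norm (p - \<i>) \<le> q} \<le> N"
proof -
  obtain zc where zc: "norm (airy (cbrt_unity * zc)) > 3 * norm (airy zc)" using airy_ratio_large by blast
  obtain k1 where k1: "k1 > 0" "\<And>k z. k \<ge> k1 \<Longrightarrow> norm (z - 2 * \<i>) \<le> 1 / 4 \<Longrightarrow>
     mode k 1 z \<noteq> 0 \<and> norm (mode k cbrt_unity z / mode k 1 z) \<le> 3"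
    using far_end_ratio by blast
  define r where "r = \<bar>q\<bar> + norm zc + 1"
  have r0: "r > 0" by (auto simp: r_def intro: add_nonneg_pos)
  have cont: "continuous_on (cball zc (3 * r)) airy" "continuous_on (cball zc (3 * r)) (\<lambda>z. airy (cbrt_unity * z))"
    using airy_holomorphic holomorphic_on_imp_continuous_on[OF airy_scale_holomorphic] holomorphic_on_imp_continuous_on by blast+
  obtain A1 where A1: "\<And>z. z \<in> cball zc (3 * r) \<Longrightarrow> norm (airy z) \<le> A1"
    using compact_imp_bounded[OF compact_continuous_image[OF cont(1)]] by (force simp: bounded_iff)
  obtain A2 where A2: "\<And>z. z \<in> cball zc (3 * r) \<Longrightarrow> norm (airy (cbrt_unity * z)) \<le> A2"
    using compact_imp_bounded[OF compact_continuous_image[OF cont(2)]] by (force simp: bounded_iff)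
  define m where "m = norm (airy (cbrt_unity * zc)) - 3 * norm (airy zc)"
  have m: "m > 0" using zc by (simp add: m_def)
  obtain N where N: "\<And>x. x \<ge> m \<Longrightarrow> A1 * 3 + A2 < x * 2 ^ Suc N"
    using ex_finite_card_bound[OF m, of "A1 * 3 + A2"] by auto
  define B where "B = norm zc + 3 * r + 1"
  have B: "B \<ge> 1" using r0 by (simp add: B_def)
  define k0 where "k0 = max k1 (4 * B)"
  have "finite {p. evans k p = 0 \<and> k\<^sup>2 * norm (p - \<i>) \<le> q} \<and>
    card {p. evans k p = 0 \<and> k\<^sup>2 * norm (p - \<i>) \<le> q} \<le> N" if k: "k \<ge> k0" for k
  proof -
    have kk: "k \<ge> k1" "k \<ge> 4 * B" "k > 0" using k k1(1) by (auto simp: k0_def)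
    have k2: "k\<^sup>2 \<ge> 4 * B" "k\<^sup>2 > 0"
    proof -
      have "4 * B * 1 \<le> k * k" using kk B by (intro mult_mono) auto
      thus "k\<^sup>2 \<ge> 4 * B" "k\<^sup>2 > 0" using kk by (auto simp: power2_eq_square)
    qed
    define zm where "zm = (\<lambda>z. 2 * \<i> + z / of_real (k\<^sup>2))"
    have zmb: "norm (zm z - 2 * \<i>) \<le> 1 / 4" if "z \<in> ball zc (3 * r + 1)" for z
    proof -
      have "norm z \<le> B" using that norm_triangle_sub[of z zc] by (simp add: B_def dist_norm norm_minus_commute)
      hence "norm z / k\<^sup>2 \<le> B / (4 * B)" using k2 B by (intro frac_le) auto
      thus ?thesis using B by (simp add: zm_def norm_divide flip: of_real_power)
    qed
    note fe = k1(2)[OF kk(1) zmb]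
    define f where "f = (\<lambda>z. airy z * (mode k cbrt_unity (zm z) / mode k 1 (zm z)) - airy (cbrt_unity * z))"
    have zmh: "zm holomorphic_on S" for S unfolding zm_def using k2 by (intro holomorphic_intros) auto
    have modeh: "(\<lambda>z. mode k c (zm z)) holomorphic_on S" for c S
      using holomorphic_on_compose[OF zmh mode_holomorphic] by (simp add: o_def)
    note scale = airy_scale_holomorphic[of cbrt_unity]
    have fh: "f holomorphic_on ball zc (3 * r + 1)"
      unfolding f_def using fe by (intro holomorphic_intros airy_holomorphic modeh scale) auto
    have sub: "cball zc (3 * r) \<subseteq> ball zc (3 * r + 1)" by auto
    have ub: "norm (f z) \<le> A1 * 3 + A2" if z: "z \<in> cball zc (3 * r)" for z
    proof -
      have "norm (airy z * (mode k cbrt_unity (zm z) / mode k 1 (zm z))) \<le> A1 * 3"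
        unfolding norm_mult using A1[OF z] fe[of z] z sub order.trans[OF norm_ge_zero A1[OF z]] by (intro mult_mono) auto
      thus ?thesis unfolding f_def by (rule order.trans[OF norm_triangle_ineq4 add_mono[OF _ A2[OF z]]])
    qed
    have fc: "norm (f zc) \<ge> m"
    proof -
      have "norm (airy zc * (mode k cbrt_unity (zm zc) / mode k 1 (zm zc))) \<le> norm (airy zc) * 3"
        unfolding norm_mult[of "airy zc"] using fe[of zc] r0 by (intro mult_left_mono) auto
      moreover have "norm (airy (cbrt_unity * zc)) - norm (airy zc * (mode k cbrt_unity (zm zc) / mode k 1 (zm zc))) \<le> norm (f zc)"
        unfolding f_def by (metis norm_minus_commute norm_triangle_ineq2)
      ultimately show ?thesis by (simp add: m_def)
    qed
    have Z: "finite {z \<in> cball zc r. f z = 0} \<and> card {z \<in> cball zc r. f z = 0} \<le> N"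
      by (rule card_zeros_le[OF fh open_ball sub r0 ub N[OF fc]])
    define g where "g = (\<lambda>p. of_real (k\<^sup>2) * (p - \<i>) :: complex)"
    have inj: "inj_on g S" for S using k2 by (auto simp: g_def inj_on_def)
    have img: "g ` {p. evans k p = 0 \<and> k\<^sup>2 * norm (p - \<i>) \<le> q} \<subseteq> {z \<in> cball zc r. f z = 0}"
    proof safe
      fix p assume p: "evans k p = 0" "k\<^sup>2 * norm (p - \<i>) \<le> q"
      have ng: "norm (g p) \<le> q" using p(2) unfolding g_def norm_mult norm_of_real by simp
      show gb: "g p \<in> cball zc r" using ng norm_triangle_ineq4[of zc "g p"] by (simp add: r_def dist_norm)
      have zp: "zm (g p) = p + \<i>" using kk by (simp add: zm_def g_def)
      have "g p \<in> ball zc (3 * r + 1)" using gb r0 by auto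
      from fe[OF this] have u: "mode k 1 (p + \<i>) \<noteq> 0" unfolding zp by blast
      have "f (g p) * mode k 1 (p + \<i>) = mode k 1 (p - \<i>) * mode k cbrt_unity (p + \<i>) - mode k cbrt_unity (p - \<i>) * mode k 1 (p + \<i>)"
        unfolding f_def zp using u by (simp add: mode_def g_def field_simps)
      also have "\<dots> = evans k p" by (simp add: evans_def mult.commute)
      finally show "f (g p) = 0" using p(1) u by simp
    qed
    have "finite (g ` {p. evans k p = 0 \<and> k\<^sup>2 * norm (p - \<i>) \<le> q})" using Z img finite_subset by blast
    hence "finite {p. evans k p = 0 \<and> k\<^sup>2 * norm (p - \<i>) \<le> q}" using inj finite_imageD by blast
    moreover have "card {p. evans k p = 0 \<and> k\<^sup>2 * norm (p - \<i>) \<le> q} = card (g ` {p. evans k p = 0 \<and> k\<^sup>2 * norm (p - \<i>) \<le> q})"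
      using inj by (simp add: card_image)
    ultimately show ?thesis using Z img by (metis (lifting) card_mono order.trans)
  qed
  thus ?thesis using that[of k0 N] k1(1) by (simp add: k0_def less_max_iff_disj)
qed

text \<open>No zero escapes between the counted ones and the node ball. With imaginary part in [0,
  15 / K), a point is either within the ball or so far to the left that the third exponential
  dominates. Below the axis the strip condition itself pushes p to the left of the node, and
  \<open>cnj p\<close> falls into the zero-free region.\<close>

lemma strip_zero_cases:
  assumes k: "large k" and p: "evans k p = 0" and strip: "Re ((p - \<i>) * sixth_root) \<le> 2 * node_re"
  shows "norm (p - of_real node_re) \<le> 45 / k ^ 3 \<or> Im p \<ge> 15 / k ^ 3"
proof (rule ccontr)
  assume neg: "\<not> (norm (p - of_real node_re) \<le> 45 / k ^ 3 \<or> Im p \<ge> 15 / k ^ 3)"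
  define K where "K = k ^ 3"
  have K: "K \<ge> 1000" and k0: "k > 0" using large_bounds[OF k] by (auto simp: K_def)
  have no: "norm (p - of_real node_re) > 45 / K" "Im p < 15 / K" using neg by (auto simp: K_def)
  note pb = evans_zero_bounds[OF k0 p]
  have st: "Re p \<le> node_re + sqrt 3 * Im p" by (rule seg_strip[OF strip])
  have "15 / K \<le> 15 / 1000" using K by (intro divide_left_mono) auto
  moreover have "0 < 1 / K" using K by simp
  ultimately have K15: "15 / K \<le> 15 / 1000" "0 < 1 / K" by auto
  have far: "Re p < node_re - 20 / K" if "Re p \<le> node_re + 25 / K" "\<bar>Im p\<bar> \<le> 20 / K"
  proof (rule ccontr)
    assume "\<not> Re p < node_re - 20 / K"
    moreover have "20 / K \<le> 25 / K" using K by (intro divide_right_mono) auto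
    ultimately have "\<bar>Re p - node_re\<bar> \<le> 25 / K" using that(1) by linarith
    moreover have "norm (p - of_real node_re) \<le> \<bar>Re p - node_re\<bar> + \<bar>Im p\<bar>" using cmod_le[of "p - of_real node_re"] by simp
    ultimately have "norm (p - of_real node_re) \<le> 25 / K + 20 / K" using that(2) by linarith
    thus False using no(1) by (simp add: add_divide_distrib[symmetric])
  qed
  have K20: "15 / K \<le> 20 / K" "15 / K = 15 * (1 / K)" "20 / K = 20 * (1 / K)" "25 / K = 25 * (1 / K)" "16 / K = 16 * (1 / K)"
    using K by (auto intro: divide_right_mono)
  show False
  proof (cases "Im p \<ge> 0")
    case True
    have "sqrt 3 * Im p \<le> sqrt 3 * (15 / K)" using no by (intro mult_left_mono) auto
    also have "\<dots> \<le> 5 / 3 * (15 / K) + 1 * (1 / K)"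
    proof -
      have "sqrt 3 * (15 / K) \<le> 1733 / 1000 * (15 / K)" using sqrt3_bounds K by (intro mult_right_mono) auto
      thus ?thesis unfolding K20 using K15(2) by linarith
    qed
    finally have s26: "sqrt 3 * Im p \<le> 26 * (1 / K)" unfolding K20 by linarith
    show False
    proof (cases "Re p < node_re - 20 / K")
      case far': True
      have "sqrt 3 * (node_re - Re p) \<ge> 17 / 10 * (20 / K)"
        using far' sqrt3_bounds K by (intro mult_mono) auto
      hence "sqrt 3 * (Re p - node_re) + Im p \<le> - (34 * (1 / K)) + 15 * (1 / K)"
        using no(2) unfolding K20 by (simp add: algebra_simps)
      hence "sqrt 3 * (Re p - node_re) + Im p \<le> - (16 / K)" using K15(2) unfolding K20 by linarith
      hence "sqrt 3 * (Re p - node_re) + Im p \<le> - 16 / K" by simp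
      moreover have "Im p \<le> 1 / 2" using no(2) K15 by linarith
      ultimately show False using left_third_dominant(1)[OF k pb(1) True] p unfolding K_def by blast
    next
      case False
      have "\<bar>Re p - node_re\<bar> \<le> 26 * (1 / K)" using False st s26 K15(2) unfolding K20 by linarith
      moreover have "norm (p - of_real node_re) \<le> \<bar>Re p - node_re\<bar> + \<bar>Im p\<bar>" using cmod_le[of "p - of_real node_re"] by simp
      ultimately have "norm (p - of_real node_re) \<le> 41 * (1 / K)" using True no(2) unfolding K20 by linarith
      thus False using no(1) K15(2) by simp
    qed
  next
    case False
    define y where "y = - Im p"
    have y: "y > 0" using False by (simp add: y_def)
    have R: "sqrt 3 * y \<le> node_re - Re p" using st by (simp add: y_def)
    have "17 / 10 * y \<le> sqrt 3 * y" using sqrt3_bounds y by (intro mult_right_mono) auto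
    hence y1: "17 / 10 * y \<le> node_re - Re p" using R by linarith
    have far': "Re p < node_re - 20 / K"
    proof (rule ccontr)
      assume n: "\<not> Re p < node_re - 20 / K"
      have "Re p \<le> node_re + 25 / K" using y1 y K15(2) unfolding K20 by linarith
      moreover have "\<bar>Im p\<bar> \<le> 20 / K" using y1 y n by (simp add: y_def)
      ultimately show False using far n by blast
    qed
    have "evans k (cnj p) = 0" by (rule evans_cnj_zero[OF k0 p])
    moreover have "evans k (cnj p) \<noteq> 0"
    proof (rule left_third_dominant(1)[OF k])
      show "Re (cnj p) > 0" "0 \<le> Im (cnj p)" using pb y by (auto simp: y_def)
      show "Im (cnj p) \<le> 1 / 2" using y1 pb node_re_bounds by (simp add: y_def)
      have "node_re - Re p \<ge> 0" using y1 y by linarith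
      hence "17 / 10 * (node_re - Re p) \<le> sqrt 3 * (node_re - Re p)" using sqrt3_bounds
        by (intro mult_right_mono) auto
      hence "sqrt 3 * (Re p - node_re) + y \<le> - (17 / 10 * (node_re - Re p)) + y" by (simp add: algebra_simps)
      also have "\<dots> \<le> - (node_re - Re p)" using y1 y by argo
      also have "\<dots> \<le> - (16 / K)" using far' K15(2) unfolding K20 by linarith
      finally show "sqrt 3 * (Re (cnj p) - node_re) + Im (cnj p) \<le> - 16 / k ^ 3" by (simp add: y_def K_def)
    qed
    ultimately show False by blast
  qed
qed

text \<open>Above height \<open>12 / K\<close> the third exponential is already negligible, and the
  ray equation would give \<open>K * Im (wfun q) \<le> 1 / 50\<close>, whereas the growth of
  \<open>wfun\<close> off the axis gives at least 0.35 * 12.\<close>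

lemma slab_zero:
  assumes k: "large k" and p: "evans k p = 0" and slab: "node_re < Re p" "Re p \<le> node_re + 20 / k ^ 3"
  shows "norm (p - of_real node_re) \<le> 45 / k ^ 3"
proof -
  define K where "K = k ^ 3"
  have K: "K \<ge> 1000" and k0: "k > 0" using large_bounds[OF k] by (auto simp: K_def)
  have key: "Im q \<le> 12 / K" if q: "evans k q = 0" "node_re < Re q" "Re q \<le> node_re + 20 / K" "Im q \<ge> 0" for q
  proof (rule ccontr)
    assume "\<not> Im q \<le> 12 / K"
    hence I: "Im q > 12 / K" by simp
    note pb = evans_zero_bounds[OF k0 q(1)]
    have R577: "Re q \<ge> 577 / 1000" using q node_re_bounds by linarith
    have dom: "q \<in> wkb_dom" using pb q(4) by (auto simp: wkb_dom_def)
    have good: "q \<in> good k"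
      using norm_ge_Re_pm_i[of q] R577 by (intro large_good[OF k dom]) linarith+
    have "sqrt 3 * node_re \<le> sqrt 3 * Re q" using q by (intro mult_left_mono) auto
    hence l: "sqrt 3 * Re q + Im q - 1 \<ge> Im q" using node_re_bounds by linarith
    have "sqrt 3 * Re q + Im q - 1 \<ge> 0" using l q(4) by linarith
    from phase_Re_right[OF _ _ this] have "(sqrt 3 * Re q + Im q - 1) / 4 \<le> Re (phase (q - \<i>))" using q(2) pb(2) by simp
    hence "Im q / 4 \<le> Re (phase (q - \<i>))" using l by argo
    hence "K * (Im q / 4) \<le> K * Re (phase (q - \<i>))" using K by (intro mult_left_mono) auto
    moreover have KI: "K * Im q \<ge> 12" using I K by (simp add: field_simps)
    ultimately have al: "k ^ 3 * Re (phase (q - \<i>)) \<ge> 3" by (simp add: K_def)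
    from ray_equation[OF k0 good al] q(1)
    have eta: "exp (2 * \<i> * (of_real (k ^ 3) * wfun q)) = 1 + eta_ray k q" "norm (eta_ray k q) \<le> 1 / 50" by auto
    hence "norm (eta_ray k q) < 1 / 2" by linarith
    from exp_eq_one_plus_small[OF eta(1) this] obtain n :: int where
      "norm (of_real K * wfun q - of_real (pi * of_int n)) \<le> norm (eta_ray k q)" unfolding K_def by blast
    hence "\<bar>Im (of_real K * wfun q - of_real (pi * of_int n))\<bar> \<le> 1 / 50"
      using eta(2) abs_Im_le_cmod[of "of_real K * wfun q - of_real (pi * of_int n)"] by linarith
    hence up: "K * Im (wfun q) \<le> 1 / 50" by simp
    have "20 / K \<le> 20 / 1000" using K by (intro divide_left_mono) auto
    hence "norm q \<le> 3" using cmod_le[of q] pb q node_re_bounds by simp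
    from wfun_Im_ge[OF pb(1) q(4) this] have "35 / 100 * Im q \<le> Im (wfun q)" by simp
    hence "K * (35 / 100 * Im q) \<le> K * Im (wfun q)" using K by (intro mult_left_mono) auto
    thus False using up KI by simp
  qed
  have "\<bar>Im p\<bar> \<le> 12 / K"
    using key[of p] key[of "cnj p"] p slab evans_cnj_zero[OF k0 p] by (cases "Im p \<ge> 0") (auto simp: K_def)
  moreover have "\<bar>Re p - node_re\<bar> \<le> 20 / K" using slab by (simp add: K_def)
  moreover have "norm (p - of_real node_re) \<le> \<bar>Re p - node_re\<bar> + \<bar>Im p\<bar>" using cmod_le[of "p - of_real node_re"] by simp
  ultimately have "norm (p - of_real node_re) \<le> 20 / K + 12 / K" by linarith
  also have "\<dots> \<le> 45 / K" using K by (simp add: add_divide_distrib[symmetric] divide_right_mono)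
  finally show ?thesis by (simp add: K_def)
qed

subsection \<open>The counting function\<close>

lemma card_sandwich:
  assumes sub: "A \<subseteq> B" "B \<subseteq> A \<union> E" and fin: "finite A" "finite E" and E: "card E \<le> N"
  shows "finite B" "card A \<le> card B" "card B \<le> card A + N"
proof -
  have AE: "finite (A \<union> E)" using fin by simp
  show B: "finite B" by (rule finite_subset[OF sub(2) AE])
  show "card A \<le> card B" by (rule card_mono[OF B sub(1)])
  have "card B \<le> card (A \<union> E)" by (rule card_mono[OF AE sub(2)])
  also have "\<dots> \<le> card A + card E" by (rule card_Un_le)
  finally show "card B \<le> card A + N" using E by linarith
qed

lemma wre_deriv:
  assumes "x > 0" shows "(wre has_real_derivative Re (2 / usum (of_real x))) (at x)"
proof -
  have "((\<lambda>x. wfun (of_real x)) has_vector_derivative 2 / usum (of_real x)) (at x)"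
    by (rule has_vector_derivative_real_field, rule wfun_deriv) (use assms in simp)
  from has_field_derivative_Re[OF this] show ?thesis unfolding wre_def[abs_def] .
qed

text \<open>The derivative is \<open>1 / ray_s u\<close>. The slab of width
  \<open>20 / k ^ 3\<close> beyond the node therefore carries a phase of at most 80/3 and
  contributes O(1) to the count.\<close>

lemma wre_diff_le:
  assumes "node_re \<le> x" "x \<le> y"
  shows "wre y - wre x \<le> 4 / 3 * (y - x)"
proof -
  have "norm (wre y - wre x) \<le> 4 / 3 * norm (y - x)"
  proof (rule field_differentiable_bound[where f=wre and f'="\<lambda>u. Re (2 / usum (of_real u))" and S="{node_re..}"])
    show "convex {node_re..}" "y \<in> {node_re..}" "x \<in> {node_re..}" using assms by auto
  next
    fix u assume "u \<in> {node_re..}"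
    hence u: "u \<ge> node_re" "u > 0" using node_re_bounds by auto
    show "(wre has_real_derivative Re (2 / usum (of_real u))) (at u within {node_re..})"
      by (rule has_field_derivative_at_within[OF wre_deriv[OF u(2)]])
    have "2 / usum (of_real u) = of_real (1 / ray_s u)" unfolding usum_real[OF u(2)] by simp
    hence "Re (2 / usum (of_real u)) = 1 / ray_s u" by (simp only: Re_complex_of_real)
    moreover have "1 / ray_s u \<le> 4 / 3" using ray_s_bounds(1)[OF u(1)] by (simp add: divide_le_eq)
    moreover have "0 \<le> 1 / ray_s u" using ray_s_bounds(1)[OF u(1)] by simp
    ultimately show "norm (Re (2 / usum (of_real u))) \<le> 4 / 3" unfolding real_norm_def by linarith
  qed
  moreover have "norm (y - x) = y - x" using assms by simp
  ultimately show ?thesis unfolding real_norm_def by linarith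
qed

definition ray_zeros :: "real \<Rightarrow> real \<Rightarrow> real \<Rightarrow> complex set" where
  "ray_zeros k \<delta> \<rho> = {p. evans k p = 0 \<and> node_re < Re p \<and> Re p \<le> \<rho> \<and> \<bar>Im p\<bar> \<le> \<delta>}"

text \<open>\<open>ray_count\<close> starts only at the offset 20. The zeros in the slab before it
  belong to the node ball by \<open>slab_zero\<close>, and so do all zeros when \<rho> itself lies
  in the slab.\<close>

lemma ray_zeros_count:
  obtains N :: real and K0 where "\<And>k \<delta> \<rho>. large k \<Longrightarrow> k ^ 3 \<ge> K0 \<Longrightarrow> \<delta> > 0 \<Longrightarrow> \<rho> \<ge> node_re \<Longrightarrow>
    finite (ray_zeros k \<delta> \<rho>) \<and>
    \<bar>real (card (ray_zeros k \<delta> \<rho>)) - (k ^ 3 * wre \<rho> - k ^ 3 * wre node_re) / pi\<bar> \<le> N"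
proof -
  have "(45::real) \<ge> 0" by simp
  then obtain M :: nat and K0 where M: "\<And>k. large k \<Longrightarrow> k ^ 3 \<ge> K0 \<Longrightarrow>
      finite {p. evans k p = 0 \<and> norm (p - of_real node_re) \<le> 45 / k ^ 3} \<and>
      card {p. evans k p = 0 \<and> norm (p - of_real node_re) \<le> 45 / k ^ 3} \<le> M"
    by (rule node_zeros_bounded) blast
  have "finite (ray_zeros k \<delta> \<rho>) \<and>
    \<bar>real (card (ray_zeros k \<delta> \<rho>)) - (k ^ 3 * wre \<rho> - k ^ 3 * wre node_re) / pi\<bar> \<le> real M + 30"
    if k: "large k" "k ^ 3 \<ge> K0" and \<delta>: "\<delta> > 0" and \<rho>: "\<rho> \<ge> node_re" for k \<delta> \<rho>
  proof -
    define K where "K = k ^ 3"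
    have K: "K \<ge> 1000" using large_bounds[OF k(1)] by (simp add: K_def)
    define x where "x = node_re + 20 / K"
    have xn: "x \<ge> node_re" using K by (simp add: x_def)
    define E where "E = {p. evans k p = 0 \<and> norm (p - of_real node_re) \<le> 45 / k ^ 3}"
    have E: "finite E" "card E \<le> M" using M[OF k] by (simp_all add: E_def)
    have incr: "0 \<le> (K * wre y - K * wre node_re) / pi \<and> (K * wre y - K * wre node_re) / pi \<le> 27"
      if y: "node_re \<le> y" "y \<le> x" for y
    proof -
      have "wre node_re \<le> wre y" using y node_re_bounds by (intro wre_mono) auto
      hence "K * wre node_re \<le> K * wre y" using K by (intro mult_left_mono) auto
      moreover have "wre y - wre node_re \<le> 4 / 3 * (20 / K)"
        using wre_diff_le[OF order.refl y(1)] y(2) by (simp add: x_def)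
      hence "K * (wre y - wre node_re) \<le> K * (4 / 3 * (20 / K))" using K by (intro mult_left_mono) auto
      hence "K * wre y - K * wre node_re \<le> 80 / 3" using K by (simp add: right_diff_distrib)
      moreover have "27 * 1 \<le> 27 * pi" using pi_ge_two by simp
      ultimately show ?thesis by (auto simp: pos_divide_le_eq)
    qed
    show ?thesis
    proof (cases "\<rho> \<ge> x")
      case True
      define Z where "Z = {p. evans k p = 0 \<and> x < Re p \<and> Re p \<le> \<rho>}"
      have "node_re + 20 / k ^ 3 \<le> \<rho>" using True by (simp add: x_def K_def)
      note rc = ray_count[OF k(1) this, folded K_def, folded x_def, folded Z_def]
      have "Z \<subseteq> ray_zeros k \<delta> \<rho>"
        using rc(3) xn \<delta> by (auto simp: Z_def ray_zeros_def)
      moreover have "ray_zeros k \<delta> \<rho> \<subseteq> Z \<union> E"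
      proof
        fix p assume p: "p \<in> ray_zeros k \<delta> \<rho>"
        show "p \<in> Z \<union> E"
        proof (cases "Re p > x")
          case False
          thus ?thesis using slab_zero[OF k(1), of p] p by (simp add: ray_zeros_def E_def x_def K_def)
        qed (use p in \<open>simp add: ray_zeros_def Z_def\<close>)
      qed
      ultimately have cs: "finite (ray_zeros k \<delta> \<rho>)" "card Z \<le> card (ray_zeros k \<delta> \<rho>)" "card (ray_zeros k \<delta> \<rho>) \<le> card Z + M"
        using card_sandwich[OF _ _ rc(1) E] by auto
      have "(K * wre \<rho> - K * wre node_re) / pi = (K * wre \<rho> - K * wre x) / pi + (K * wre x - K * wre node_re) / pi"
        by (simp add: add_divide_distrib[symmetric])
      moreover have "real (card Z) \<le> real (card (ray_zeros k \<delta> \<rho>))" "real (card (ray_zeros k \<delta> \<rho>)) \<le> real (card Z) + real M"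
        using cs by linarith+
      ultimately have "\<bar>real (card (ray_zeros k \<delta> \<rho>)) - (K * wre \<rho> - K * wre node_re) / pi\<bar> \<le> real M + 30"
        using rc(2) incr[OF xn order.refl] by linarith
      thus ?thesis using cs(1) by (simp add: K_def)
    next
      case False
      have sub: "ray_zeros k \<delta> \<rho> \<subseteq> E"
        using slab_zero[OF k(1)] False by (force simp: ray_zeros_def E_def x_def K_def)
      have "card (ray_zeros k \<delta> \<rho>) \<le> M" using card_mono[OF E(1) sub] E(2) by linarith
      moreover note incr[OF \<rho>]
      ultimately have "\<bar>real (card (ray_zeros k \<delta> \<rho>)) - (K * wre \<rho> - K * wre node_re) / pi\<bar> \<le> real M + 30"
        using False by linarith
      thus ?thesis using finite_subset[OF sub E(1)] by (simp add: K_def)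
    qed
  qed
  thus thesis by (rule that[of K0 "real M + 30"])
qed

definition strip_zeros :: "real \<Rightarrow> real \<Rightarrow> real \<Rightarrow> complex set" where
  "strip_zeros k \<delta> r = {p. evans k p = 0 \<and> 0 < Re ((p - \<i>) * sixth_root) \<and>
     Re ((p - \<i>) * sixth_root) \<le> r \<and> \<bar>Im ((p - \<i>) * sixth_root)\<bar> \<le> \<delta>}"

text \<open>The strip differs from \<open>seg_zeros\<close> with \<open>t = sqrt r\<close> by at
  most the exceptional zeros at the node and at \<open>\<i>\<close>, two sets bounded independently
  of k, \<delta> and r.\<close>

lemma strip_zeros_count:
  obtains N :: real and K0 where "\<And>k \<delta> r. large k \<Longrightarrow> k \<ge> K0 \<Longrightarrow> k ^ 3 \<ge> K0 \<Longrightarrow> \<delta> > 0 \<Longrightarrow> 1 / \<delta> \<le> k\<^sup>2 \<Longrightarrow>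
    0 \<le> r \<Longrightarrow> r \<le> 2 * node_re \<Longrightarrow>
    finite (strip_zeros k \<delta> r) \<and>
    \<bar>real (card (strip_zeros k \<delta> r)) - k ^ 3 * (2 / 3 * (r * sqrt r)) / pi\<bar> \<le> N"
proof -
  have "(45::real) \<ge> 0" by simp
  then obtain M :: nat and K0 where M: "\<And>k. large k \<Longrightarrow> k ^ 3 \<ge> K0 \<Longrightarrow>
      finite {p. evans k p = 0 \<and> norm (p - of_real node_re) \<le> 45 / k ^ 3} \<and>
      card {p. evans k p = 0 \<and> norm (p - of_real node_re) \<le> 45 / k ^ 3} \<le> M"
    by (rule node_zeros_bounded) blast
  obtain L :: nat and k0 where L: "\<And>k. k \<ge> k0 \<Longrightarrow>
      finite {p. evans k p = 0 \<and> k\<^sup>2 * norm (p - \<i>) \<le> (seg_min + 1)\<^sup>2} \<and>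
      card {p. evans k p = 0 \<and> k\<^sup>2 * norm (p - \<i>) \<le> (seg_min + 1)\<^sup>2} \<le> L"
    by (rule end_zeros_bounded[of "(seg_min + 1)\<^sup>2"]) blast
  define N where "N = seg_err + 1 + (real M + real L)"
  have "finite (strip_zeros k \<delta> r) \<and>
    \<bar>real (card (strip_zeros k \<delta> r)) - k ^ 3 * (2 / 3 * (r * sqrt r)) / pi\<bar> \<le> N"
    if k: "large k" "k \<ge> max K0 k0" "k ^ 3 \<ge> max K0 k0" and \<delta>: "\<delta> > 0" "1 / \<delta> \<le> k\<^sup>2" and r: "0 \<le> r" "r \<le> 2 * node_re" for k \<delta> r
  proof -
    have k0: "k > 0" using large_bounds[OF k(1)] by simp
    define E1 where "E1 = {p. evans k p = 0 \<and> norm (p - of_real node_re) \<le> 45 / k ^ 3}"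
    define E2 where "E2 = {p. evans k p = 0 \<and> k\<^sup>2 * norm (p - \<i>) \<le> (seg_min + 1)\<^sup>2}"
    have E1: "finite E1" "card E1 \<le> M" using M[OF k(1)] k(3) by (simp_all add: E1_def)
    have E2: "finite E2" "card E2 \<le> L" using L[of k] k(2) by (simp_all add: E2_def)
    have E: "finite (E1 \<union> E2)" "card (E1 \<union> E2) \<le> M + L" using E1 E2 card_Un_le[of E1 E2] by auto
    have sq: "(sqrt r)\<^sup>2 = r" "(sqrt r) ^ 3 = r * sqrt r" using r by (simp_all add: power3_eq_cube)
    have t: "sqrt r \<ge> 0" "(sqrt r)\<^sup>2 \<le> 2 * node_re" using r by simp_all
    note sc = seg_count[OF k(1) \<delta>(2,1) t]
    have "seg_zeros k \<delta> (sqrt r) \<subseteq> strip_zeros k \<delta> r"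
      unfolding seg_zeros_def strip_zeros_def sq by blast
    moreover have "strip_zeros k \<delta> r \<subseteq> seg_zeros k \<delta> (sqrt r) \<union> (E1 \<union> E2)"
    proof
      fix p assume p: "p \<in> strip_zeros k \<delta> r"
      hence z: "evans k p = 0" and R: "Re ((p - \<i>) * sixth_root) \<le> 2 * node_re"
        using r unfolding strip_zeros_def by auto
      show "p \<in> seg_zeros k \<delta> (sqrt r) \<union> (E1 \<union> E2)"
      proof (cases "k * norm (csqrt (p - \<i>)) \<ge> seg_min + 1")
        case True
        from strip_zero_cases[OF k(1) z R] show ?thesis
        proof
          assume "norm (p - of_real node_re) \<le> 45 / k ^ 3"
          thus ?thesis using z by (simp add: E1_def)
        next
          assume "Im p \<ge> 15 / k ^ 3"
          hence "p \<in> seg_zeros k \<delta> (sqrt r)" using True p unfolding seg_zeros_def strip_zeros_def sq by blast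
          thus ?thesis by blast
        qed
      next
        case False
        hence "(k * norm (csqrt (p - \<i>)))\<^sup>2 \<le> (seg_min + 1)\<^sup>2" using k0 by (intro power_mono) auto
        moreover have "(k * norm (csqrt (p - \<i>)))\<^sup>2 = k\<^sup>2 * norm (p - \<i>)" by (simp add: power_mult_distrib del: csqrt.simps)
        ultimately show ?thesis using z by (simp add: E2_def)
      qed
    qed
    ultimately have cs: "finite (strip_zeros k \<delta> r)" "card (seg_zeros k \<delta> (sqrt r)) \<le> card (strip_zeros k \<delta> r)"
      "card (strip_zeros k \<delta> r) \<le> card (seg_zeros k \<delta> (sqrt r)) + (M + L)"
      using card_sandwich[OF _ _ sc(1) E] by auto
    have eq: "2 / 3 * k ^ 3 * (sqrt r) ^ 3 / pi = k ^ 3 * (2 / 3 * (r * sqrt r)) / pi" unfolding sq by simp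
    have "real (card (seg_zeros k \<delta> (sqrt r))) \<le> real (card (strip_zeros k \<delta> r))"
      "real (card (strip_zeros k \<delta> r)) \<le> real (card (seg_zeros k \<delta> (sqrt r))) + (real M + real L)"
      using cs by linarith+
    hence "\<bar>real (card (strip_zeros k \<delta> r)) - k ^ 3 * (2 / 3 * (r * sqrt r)) / pi\<bar> \<le> N"
      using sc(2) unfolding eq N_def by linarith
    thus ?thesis using cs(1) by blast
  qed
  thus thesis by (rule that[of "max K0 k0" N])
qed

text \<open>For \<open>p = \<i> * l\<close> one has \<open>x - l = \<i> * (p - \<i> * x)\<close>, so
  the factor exp (- i pi / 4) of the theorem converts its integrand into
  \<open>csqrt (p - \<i> * x)\<close>. The branch is respected because the argument of
  \<open>csqrt w\<close> is below pi / 4 in modulus.\<close>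

lemma csqrt_ii_times:
  assumes "Re w > 0"
  shows "exp (- \<i> * of_real pi / 4) * csqrt (\<i> * w) = csqrt w"
proof -
  define d where "d = Complex (sqrt 2 / 2) (sqrt 2 / 2)"
  have "exp (- \<i> * of_real pi / 4) = cis (- (pi / 4))" by (simp add: cis_conv_exp)
  also have "\<dots> = Complex (sqrt 2 / 2) (- (sqrt 2 / 2))" by (simp add: complex_eq_iff cos_45 sin_45)
  finally have c: "exp (- \<i> * of_real pi / 4) * d = 1"
    by (simp only: d_def) (simp add: complex_eq_iff)
  have "csqrt (\<i> * w) = d * csqrt w"
  proof (rule csqrt_unique)
    have "d\<^sup>2 = \<i>" by (simp add: d_def complex_eq_iff power2_eq_square)
    thus "(d * csqrt w)\<^sup>2 = \<i> * w" by (simp add: power_mult_distrib del: csqrt.simps)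
    have "\<bar>Im (csqrt w)\<bar> < Re (csqrt w)" by (rule csqrt_Re_gt_Im[OF assms])
    hence "sqrt 2 / 2 * (Re (csqrt w) - Im (csqrt w)) > 0" by (intro mult_pos_pos) auto
    thus "0 < Re (d * csqrt w) \<or> Re (d * csqrt w) = 0 \<and> 0 \<le> Im (d * csqrt w)"
      by (simp add: d_def right_diff_distrib del: csqrt.simps)
  qed
  thus ?thesis using c by (simp only: mult.assoc[symmetric] mult_1)
qed

lemma has_integral_sqrt: "(sqrt has_integral 2 / 3) {0..1}"
proof -
  have "(sqrt has_integral (2 / 3 * sqrt 1 ^ 3 - 2 / 3 * sqrt 0 ^ 3)) {0..1}"
  proof (rule fundamental_theorem_of_calculus_interior)
    show "continuous_on {0..1} (\<lambda>x. 2 / 3 * sqrt x ^ 3)" by (intro continuous_intros)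
    fix x :: real assume "x \<in> {0<..<1}"
    hence "((\<lambda>x. 2 / 3 * sqrt x ^ 3) has_real_derivative sqrt x) (at x)"
      by (auto intro!: derivative_eq_intros simp: field_simps power2_eq_square)
    thus "((\<lambda>x. 2 / 3 * sqrt x ^ 3) has_vector_derivative sqrt x) (at x)"
      by (simp add: has_real_derivative_iff_has_vector_derivative)
  qed simp
  thus ?thesis by simp
qed

text \<open>Along the segment the integrand is \<open>sqrt (t * r) * q\<close>. In the applications
  q is \<open>cnj twelfth_root\<close> or \<open>twelfth_root\<close>, for which
  \<open>\<i> * q ^ 3\<close> is 1 or -1; this is the origin of the two signs in the
  theorem.\<close>

lemma seg_contour_integral:
  assumes q: "Re q > 0" "Re (q\<^sup>2) > 0" and r: "r \<ge> 0" and z: "s - z = \<i> * of_real r * q\<^sup>2"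
  shows "contour_integral (linepath z s) (\<lambda>x. exp (- \<i> * of_real pi / 4) * csqrt (x - z)) =
    of_real (2 / 3 * (r * sqrt r)) * (\<i> * q ^ 3)"
proof (rule contour_integral_unique)
  have "((\<lambda>t. of_real (sqrt t) * (of_real (r * sqrt r) * (\<i> * q ^ 3))) has_integral
      of_real (2 / 3) * (of_real (r * sqrt r) * (\<i> * q ^ 3))) {0..1}"
    by (intro has_integral_mult_left has_integral_of_real has_integral_sqrt)
  hence I: "((\<lambda>t. of_real (sqrt t) * (of_real (r * sqrt r) * (\<i> * q ^ 3))) has_integral
      of_real (2 / 3 * (r * sqrt r)) * (\<i> * q ^ 3)) {0..1}" by (simp only: of_real_mult mult.assoc)
  have eq: "exp (- \<i> * of_real pi / 4) * csqrt (linepath z s t - z) * (s - z)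
      = of_real (sqrt t) * (of_real (r * sqrt r) * (\<i> * q ^ 3))" if t: "t \<in> {0..1}" for t
  proof -
    have l: "linepath z s t - z = \<i> * (of_real (t * r) * q\<^sup>2)"
    proof -
      have "linepath z s t - z = of_real t * (s - z)" by (simp add: linepath_def scaleR_conv_of_real algebra_simps)
      thus ?thesis unfolding z by simp
    qed
    have "exp (- \<i> * of_real pi / 4) * csqrt (linepath z s t - z) = of_real (sqrt (t * r)) * q"
    proof (cases "t * r = 0")
      case False
      hence tr: "t * r > 0" using t r by (simp add: less_le)
      have "csqrt (of_real (t * r) * q\<^sup>2) = of_real (sqrt (t * r)) * q"
      proof (rule csqrt_unique)
        have "(of_real (sqrt (t * r)))\<^sup>2 = complex_of_real (t * r)" using tr by (simp flip: of_real_power)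
        thus "(of_real (sqrt (t * r)) * q)\<^sup>2 = of_real (t * r) * q\<^sup>2" by (simp only: power_mult_distrib)
        have "0 < sqrt (t * r) * Re q" using real_sqrt_gt_zero[OF tr] q(1) by (rule mult_pos_pos)
        thus "0 < Re (of_real (sqrt (t * r)) * q) \<or> Re (of_real (sqrt (t * r)) * q) = 0 \<and> 0 \<le> Im (of_real (sqrt (t * r)) * q)"
          by (simp only: Re_complex_of_real times_complex.sel Im_complex_of_real mult_zero_left diff_zero simp_thms)
      qed
      moreover have "0 < t * r * Re (q\<^sup>2)" using tr q(2) by (rule mult_pos_pos)
      hence "Re (of_real (t * r) * q\<^sup>2) > 0" by (simp only: times_complex.sel(1) Re_complex_of_real Im_complex_of_real mult_zero_left diff_zero)
      ultimately show ?thesis unfolding l using csqrt_ii_times[of "of_real (t * r) * q\<^sup>2"] by simp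
    next
      \<comment> \<open>At the branch point \<open>csqrt_ii_times\<close> does not apply, but both
        sides are 0.\<close>
      case True
      thus ?thesis unfolding l True by simp
    qed
    thus ?thesis unfolding z real_sqrt_mult by (simp only: of_real_mult power2_eq_square power3_eq_cube mult_ac)
  qed
  show "((\<lambda>x. exp (- \<i> * of_real pi / 4) * csqrt (x - z)) has_contour_integral
      of_real (2 / 3 * (r * sqrt r)) * (\<i> * q ^ 3)) (linepath z s)"
    unfolding has_contour_integral_linepath by (rule iffD2[OF has_integral_cong[OF eq] I])
qed

lemma ray_integral:
  assumes "\<tau> > 0" and z: "z = - \<i> * of_real \<tau>"
  shows "integral {-1..1} (\<lambda>x::real. exp (- \<i> * of_real pi / 4) * csqrt (of_real x - z)) = of_real (wre \<tau>)"
proof (rule integral_unique)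
  have "((\<lambda>x. csqrt (of_real \<tau> - \<i> * of_real x)) has_integral
     \<i> * phase (of_real \<tau> - \<i> * of_real 1) - \<i> * phase (of_real \<tau> - \<i> * of_real (-1))) {-1..1}"
  proof (rule fundamental_theorem_of_calculus)
    fix x :: real assume "x \<in> {-1..1}"
    have "(phase has_field_derivative csqrt (of_real \<tau> - \<i> * of_real x)) (at (of_real \<tau> - \<i> * of_real x))"
      using assms(1) by (intro phase_deriv) (auto simp: complex_nonpos_Reals_iff)
    moreover have "((\<lambda>x. of_real \<tau> - \<i> * x) has_field_derivative - \<i>) (at (of_real x))"
      by (auto intro!: derivative_eq_intros)
    ultimately have "((\<lambda>x. phase (of_real \<tau> - \<i> * x)) has_field_derivative csqrt (of_real \<tau> - \<i> * of_real x) * - \<i>) (at (of_real x))"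
      by (rule DERIV_chain2)
    hence "((\<lambda>x. \<i> * phase (of_real \<tau> - \<i> * x)) has_field_derivative \<i> * (csqrt (of_real \<tau> - \<i> * of_real x) * - \<i>)) (at (of_real x))"
      by (rule DERIV_cmult)
    moreover have "\<i> * (csqrt (of_real \<tau> - \<i> * of_real x) * - \<i>) = csqrt (of_real \<tau> - \<i> * of_real x)"
      by (simp add: algebra_simps del: csqrt.simps)
    ultimately have "((\<lambda>x. \<i> * phase (of_real \<tau> - \<i> * x)) has_field_derivative csqrt (of_real \<tau> - \<i> * of_real x)) (at (of_real x))"
      by simp
    from has_vector_derivative_real_field[OF this]
    show "((\<lambda>x. \<i> * phase (of_real \<tau> - \<i> * of_real x)) has_vector_derivative csqrt (of_real \<tau> - \<i> * of_real x)) (at x within {-1..1})"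
      by (rule has_vector_derivative_at_within)
  qed simp
  also have "\<i> * phase (of_real \<tau> - \<i> * of_real 1) - \<i> * phase (of_real \<tau> - \<i> * of_real (-1)) = wfun (of_real \<tau>)"
    by (simp add: wfun_def algebra_simps)
  also have "\<dots> = of_real (wre \<tau>)" by (rule wfun_of_real[OF assms(1)])
  finally have I: "((\<lambda>x. csqrt (of_real \<tau> - \<i> * of_real x)) has_integral of_real (wre \<tau>)) {-1..1}" .
  have "exp (- \<i> * of_real pi / 4) * csqrt (of_real x - z) = csqrt (of_real \<tau> - \<i> * of_real x)" for x
  proof -
    have "of_real x - z = \<i> * (of_real \<tau> - \<i> * of_real x)" unfolding z by (simp add: algebra_simps)
    thus ?thesis using csqrt_ii_times[of "of_real \<tau> - \<i> * of_real x"] assms(1) by simp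
  qed
  thus "((\<lambda>x::real. exp (- \<i> * of_real pi / 4) * csqrt (of_real x - z)) has_integral of_real (wre \<tau>)) {-1..1}"
    using I by simp
qed

lemma thin_rectangle_eq:
  assumes e: "norm e = 1" and r: "r1 < r2"
  shows "thin_rectangle \<delta> (c + of_real r1 * e) (c + of_real r2 * e) =
    {l. r1 < Re ((l - c) * cnj e) \<and> Re ((l - c) * cnj e) \<le> r2 \<and> \<bar>Im ((l - c) * cnj e)\<bar> \<le> \<delta>}"
proof -
  have ee: "e * cnj e = 1" using e complex_norm_square[of e] by simp
  have d: "c + of_real r2 * e - (c + of_real r1 * e) = of_real (r2 - r1) * e" by (simp add: algebra_simps)
  have sgn: "sgn (of_real (r2 - r1) * e) = e"
    unfolding sgn_eq norm_mult e norm_of_real using r by simp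
  have pt: "(c + of_real r1 * e + of_real t * (of_real (r2 - r1) * e) + of_real s * \<i> * e - c) * cnj e
      = Complex (r1 + t * (r2 - r1)) s" for t s
  proof -
    have "(c + of_real r1 * e + of_real t * (of_real (r2 - r1) * e) + of_real s * \<i> * e - c) * cnj e
        = (of_real r1 + of_real t * of_real (r2 - r1) + of_real s * \<i>) * (e * cnj e)" by (simp add: algebra_simps)
    thus ?thesis unfolding ee by (simp add: complex_eq_iff)
  qed
  show ?thesis
  proof (rule set_eqI, rule iffI)
    fix l assume "l \<in> thin_rectangle \<delta> (c + of_real r1 * e) (c + of_real r2 * e)"
    then obtain t s where l: "l = c + of_real r1 * e + of_real t * (of_real (r2 - r1) * e) + of_real s * \<i> * e"
        "0 < t" "t \<le> 1" "\<bar>s\<bar> \<le> \<delta>"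
      unfolding thin_rectangle_def d sgn by blast
    have "t * (r2 - r1) \<le> 1 * (r2 - r1)" using l(3) r by (intro mult_right_mono) auto
    moreover have "0 < t * (r2 - r1)" using l(2) r by simp
    ultimately show "l \<in> {l. r1 < Re ((l - c) * cnj e) \<and> Re ((l - c) * cnj e) \<le> r2 \<and> \<bar>Im ((l - c) * cnj e)\<bar> \<le> \<delta>}"
      unfolding l(1) mem_Collect_eq pt using l(4) by simp
  next
    fix l assume l: "l \<in> {l. r1 < Re ((l - c) * cnj e) \<and> Re ((l - c) * cnj e) \<le> r2 \<and> \<bar>Im ((l - c) * cnj e)\<bar> \<le> \<delta>}"
    define w where "w = (l - c) * cnj e"
    define t where "t = (Re w - r1) / (r2 - r1)"
    have w: "r1 < Re w" "Re w \<le> r2" "\<bar>Im w\<bar> \<le> \<delta>" using l by (auto simp: w_def)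
    have t: "0 < t" "t \<le> 1" using w r by (auto simp: t_def)
    have "t * (r2 - r1) = Re w - r1" using r by (simp add: t_def)
    hence tr: "of_real t * of_real (r2 - r1) = complex_of_real (Re w - r1)" by (metis of_real_mult)
    have "l - c = w * e" using ee by (simp add: w_def mult.assoc mult.commute[of "cnj e"])
    moreover have "w = of_real r1 + of_real (Re w - r1) + of_real (Im w) * \<i>" by (simp add: complex_eq_iff)
    ultimately have "l - c = (of_real r1 + of_real t * of_real (r2 - r1) + of_real (Im w) * \<i>) * e" unfolding tr by simp
    hence "l = c + of_real r1 * e + of_real t * (of_real (r2 - r1) * e) + of_real (Im w) * \<i> * e"
      by (simp add: algebra_simps)
    thus "l \<in> thin_rectangle \<delta> (c + of_real r1 * e) (c + of_real r2 * e)"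
      unfolding thin_rectangle_def d sgn using t w(3) by blast
  qed
qed

text \<open>The half-open rectangle corresponds exactly to the difference of the nested sets
  \<open>S r2\<close> and \<open>S r1\<close>, so its count is an increment of the cardinality of S.
  The map \<Phi> passes to the variable p, with an additional conjugation for the left segment, and
  G gives the coordinates along and across.\<close>

lemma rectangle_count:
  assumes e: "norm e = 1" and r: "a \<le> r1" "r1 < r2"
    and \<Phi>: "bij \<Phi>" "\<And>z. is_eigenvalue \<epsilon> z \<longleftrightarrow> evans k (\<Phi> z) = 0"
    and G: "\<And>z. Re (G (\<Phi> z)) = Re ((z - c) * cnj e)" "\<And>z. \<bar>Im (G (\<Phi> z))\<bar> = \<bar>Im ((z - c) * cnj e)\<bar>"
    and S: "\<And>r. S r = {p. evans k p = 0 \<and> a < Re (G p) \<and> Re (G p) \<le> r \<and> \<bar>Im (G p)\<bar> \<le> \<delta>}" and fin: "finite (S r2)"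
  defines "Z \<equiv> {z \<in> thin_rectangle \<delta> (c + of_real r1 * e) (c + of_real r2 * e). is_eigenvalue \<epsilon> z}"
  shows "finite Z \<and> real (card Z) = \<bar>real (card (S r2)) - real (card (S r1))\<bar>"
proof -
  have Z: "z \<in> Z \<longleftrightarrow> \<Phi> z \<in> S r2 - S r1" for z
    unfolding Z_def thin_rectangle_eq[OF e r(2)] S using \<Phi>(2) G r by auto
  have img: "\<Phi> ` Z = S r2 - S r1"
  proof
    show "S r2 - S r1 \<subseteq> \<Phi> ` Z"
    proof
      fix p assume p: "p \<in> S r2 - S r1"
      obtain z where "p = \<Phi> z" using bij_is_surj[OF \<Phi>(1)] by blast
      thus "p \<in> \<Phi> ` Z" using p Z by blast
    qed
  qed (use Z in blast)
  have inj: "inj_on \<Phi> Z" using bij_is_inj[OF \<Phi>(1)] inj_on_subset by blast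
  have sub: "S r1 \<subseteq> S r2" unfolding S using r by auto
  have fin1: "finite (S r1)" by (rule finite_subset[OF sub fin])
  have "finite (\<Phi> ` Z)" unfolding img using fin by simp
  hence "finite Z" using inj by (rule finite_imageD)
  moreover have "card Z = card (S r2) - card (S r1)"
    using card_image[OF inj] card_Diff_subset[OF fin1 sub] unfolding img by simp
  moreover have "card (S r1) \<le> card (S r2)" by (rule card_mono[OF fin sub])
  ultimately show ?thesis by (simp add: of_nat_diff)
qed

section \<open>The components of T and the explicit counting function\<close>

lemma node_eq: "node = - \<i> * of_real node_re"
  by (simp add: node_def node_re_def)

text \<open>The unit vector from \<sigma> towards the node; the factor \<open>- \<i>\<close> leads
  from the variable p back to the spectral parameter.\<close>

definition seg_dir :: "complex \<Rightarrow> complex" where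
  "seg_dir \<sigma> = - \<i> * (if \<sigma> = 1 then cnj sixth_root else sixth_root)"

lemma seg_dir_props:
  assumes "\<sigma> \<in> {1, -1}"
  shows "norm (seg_dir \<sigma>) = 1" "Im (seg_dir \<sigma>) = - (1 / 2)" "Re (seg_dir \<sigma>) = - (Re \<sigma> * (sqrt 3 / 2))"
    "node = \<sigma> + of_real (2 * node_re) * seg_dir \<sigma>"
proof -
  show "norm (seg_dir \<sigma>) = 1" by (simp add: seg_dir_def norm_mult norm_sixth_root)
  show I: "Im (seg_dir \<sigma>) = - (1 / 2)" and R: "Re (seg_dir \<sigma>) = - (Re \<sigma> * (sqrt 3 / 2))"
    using assms by (auto simp: seg_dir_def sixth_root_def)
  have "Re \<sigma> * (2 * node_re * (sqrt 3 / 2)) = Re \<sigma> * 1" using node_re_bounds(3) by (simp add: mult.commute)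
  thus "node = \<sigma> + of_real (2 * node_re) * seg_dir \<sigma>"
    using assms by (auto simp: complex_eq_iff node_eq I R)
qed

lemma half_open_segmentE:
  assumes \<sigma>: "\<sigma> \<in> {1, -1}" and z: "z \<in> half_open_segment \<sigma> node"
  obtains r where "0 \<le> r" "r < 2 * node_re" "z = \<sigma> + of_real r * seg_dir \<sigma>"
proof -
  obtain u where u: "0 \<le> u" "u \<le> 1" "z = (1 - u) *\<^sub>R \<sigma> + u *\<^sub>R node"
    using z by (auto simp: half_open_segment_def in_segment)
  have zu: "z = \<sigma> + of_real (u * (2 * node_re)) * seg_dir \<sigma>"
    unfolding u(3) seg_dir_props(4)[OF \<sigma>] by (simp add: scaleR_conv_of_real algebra_simps)
  have "u \<noteq> 1" using z u(3) by (auto simp: half_open_segment_def)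
  hence "u * (2 * node_re) < 1 * (2 * node_re)" using u node_re_bounds by (intro mult_strict_right_mono) auto
  moreover have "0 \<le> u * (2 * node_re)" using u node_re_bounds by simp
  ultimately show thesis by (intro that[OF _ _ zu]) simp_all
qed

lemma half_open_segment_props:
  assumes \<sigma>: "\<sigma> \<in> {1, -1}" and r: "0 \<le> r" "r < 2 * node_re" and z: "z = \<sigma> + of_real r * seg_dir \<sigma>"
  shows "Im z = - r / 2" "Im z > - node_re" "Re \<sigma> * Re z > 0" "norm (z - \<sigma>) = r" "of_real (sgn (Re z)) = \<sigma>" "Re z \<noteq> 0"
proof -
  show I: "Im z = - r / 2" using \<sigma> seg_dir_props(2)[OF \<sigma>] by (auto simp: z)
  show "Im z > - node_re" unfolding I using r by simp
  show "norm (z - \<sigma>) = r" using seg_dir_props(1)[OF \<sigma>] r by (simp add: z norm_mult)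
  have "sqrt 3 * r < sqrt 3 * (2 * node_re)" using r by (intro mult_strict_left_mono) auto
  hence s: "sqrt 3 * r < 2" using node_re_bounds(3) by linarith
  have "Re z = Re \<sigma> * (1 - sqrt 3 * r / 2)" using seg_dir_props(3)[OF \<sigma>] by (simp add: z algebra_simps)
  hence P: "Re \<sigma> * Re z = Re \<sigma> * Re \<sigma> * (1 - sqrt 3 * r / 2)" by simp
  show P': "Re \<sigma> * Re z > 0" unfolding P using \<sigma> s by auto
  show "of_real (sgn (Re z)) = \<sigma>" "Re z \<noteq> 0" using P' \<sigma> by auto
qed

lemma node_ray_props:
  assumes "z \<in> node_ray"
  shows "Re z = 0" "Im z < - node_re"
  using assms by (auto simp: node_ray_def node_eq)

text \<open>The height of the node is omitted by \<open>T_set\<close> and separates the ray from the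
  segments; above it real part 0 is omitted, which separates the two segments. A connected subset
  has intervals as images under \<open>Im\<close> and \<open>Re\<close>.\<close>

lemma T_set_component:
  assumes "connected_component T_set z1 z2"
  shows "z1 \<in> node_ray \<and> z2 \<in> node_ray \<or>
    (\<exists>\<sigma>\<in>{1, -1}. z1 \<in> half_open_segment \<sigma> node \<and> z2 \<in> half_open_segment \<sigma> node)"
proof -
  obtain t where t: "connected t" "t \<subseteq> T_set" "z1 \<in> t" "z2 \<in> t"
    using assms unfolding connected_component_def by blast
  have seg: "Im z > - node_re \<and> Re \<sigma> * Re z > 0" if "\<sigma> \<in> {1, -1}" "z \<in> half_open_segment \<sigma> node" for \<sigma> z
    using half_open_segmentE[OF that] half_open_segment_props(2,3)[OF that(1)] by metis
  have cases: "z \<in> node_ray \<or> z \<in> half_open_segment 1 node \<or> z \<in> half_open_segment (-1) node" if "z \<in> t" for z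
    using t(2) that unfolding T_set_def by blast
  have Imne: "Im z \<noteq> - node_re" if "z \<in> t" for z
    using cases[OF that] seg[of 1 z] seg[of "-1" z] node_ray_props(2)[of z] by auto
  have low: "z \<in> node_ray" if "z \<in> t" "Re z = 0" for z
    using cases[OF that(1)] seg[of 1 z] seg[of "-1" z] that(2) by auto
  have A: False if xy: "x \<in> t" "y \<in> t" "Im x > - node_re" "Im y < - node_re" for x y
  proof -
    have "connected (Im ` t)" by (intro connected_continuous_image continuous_intros t(1))
    hence "{Im y..Im x} \<subseteq> Im ` t" using xy by (intro connected_contains_Icc) auto
    moreover have "- node_re \<in> {Im y..Im x}" using xy by simp
    ultimately obtain w where "w \<in> t" "Im w = - node_re" by (metis imageE subsetD)
    thus False using Imne by blast
  qed
  have B: False if xy: "x \<in> t" "y \<in> t" "Re x > 0" "Re y < 0" for x y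
  proof -
    have "connected (Re ` t)" by (intro connected_continuous_image continuous_intros t(1))
    hence "{Re y..Re x} \<subseteq> Re ` t" using xy by (intro connected_contains_Icc) auto
    moreover have "0 \<in> {Re y..Re x}" using xy by simp
    ultimately obtain w where w: "w \<in> t" "Re w = 0" by (metis imageE subsetD)
    have "Im w < - node_re" using low[OF w] node_ray_props(2) by blast
    moreover have "x \<notin> node_ray" using xy(3) node_ray_props(1)[of x] by auto
    hence "Im x > - node_re" using cases[OF xy(1)] seg[of 1 x] seg[of "-1" x] by auto
    ultimately show False using A[OF xy(1) w(1)] by blast
  qed
  have AB: False if "x \<in> t" "y \<in> t" "x \<in> half_open_segment 1 node" "y \<in> half_open_segment (-1) node" for x y
    using B[OF that(1,2)] seg[of 1 x] seg[of "-1" y] that(3,4) by auto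
  have AR: False if "x \<in> t" "y \<in> t" "\<sigma> \<in> {1, -1}" "x \<in> half_open_segment \<sigma> node" "y \<in> node_ray" for x y \<sigma>
    using A[OF that(1,2)] seg[OF that(3,4)] node_ray_props(2)[OF that(5)] by blast
  show ?thesis
    using cases[OF t(3)] cases[OF t(4)] AB[OF t(3,4)] AB[OF t(4,3)] AR[OF t(3,4)] AR[OF t(4,3)] by auto
qed

text \<open>On the ray zeros are counted from the node, and the added constant makes the value
  comparable with the full integral instead of its increment. On a segment counting starts at the
  end \<sigma>, recovered as the sign of the real part, where the integral vanishes. Both segments
  share one set because of the conjugation symmetry.\<close>

definition counting :: "real \<Rightarrow> real \<Rightarrow> complex \<Rightarrow> real" where
  "counting k \<delta> z =
     (if Re z = 0 then real (card (ray_zeros k \<delta> (- Im z))) + k ^ 3 * wre node_re / pi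
      else real (card (strip_zeros k \<delta> (norm (z - of_real (sgn (Re z)))))))"

lemma counting_seg:
  assumes "\<sigma> \<in> {1, -1}" "0 \<le> r" "r < 2 * node_re" "z = \<sigma> + of_real r * seg_dir \<sigma>"
  shows "counting k \<delta> z = real (card (strip_zeros k \<delta> r))"
  using half_open_segment_props(4-6)[OF assms] by (simp add: counting_def)

lemma evans_cnj_iff: "k > 0 \<Longrightarrow> evans k (cnj p) = 0 \<longleftrightarrow> evans k p = 0"
  using evans_cnj_zero[of k p] evans_cnj_zero[of k "cnj p"] by auto

lemma counting_is_counting_function:
  assumes k: "k > 0"
    and fin: "\<And>\<rho>. \<rho> \<ge> node_re \<Longrightarrow> finite (ray_zeros k \<delta> \<rho>)"
      "\<And>r. 0 \<le> r \<Longrightarrow> r \<le> 2 * node_re \<Longrightarrow> finite (strip_zeros k \<delta> r)"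
  shows "is_counting_function (1 / k ^ 6) \<delta> (counting k \<delta>)"
  unfolding is_counting_function_def
proof (intro allI impI, elim conjE)
  fix z1 z2 assume conn: "connected_component T_set z1 z2" and im: "Im z2 < Im z1"
  let ?goal = "finite {z \<in> thin_rectangle \<delta> z1 z2. is_eigenvalue (1 / k ^ 6) z} \<and>
        real (card {z \<in> thin_rectangle \<delta> z1 z2. is_eigenvalue (1 / k ^ 6) z}) = \<bar>counting k \<delta> z2 - counting k \<delta> z1\<bar>"
  have bij1: "bij (\<lambda>z. \<i> * z)" by (rule bij_betw_byWitness[where f'="\<lambda>z. - \<i> * z"]) (auto simp: mult.assoc[symmetric])
  have bij2: "bij (\<lambda>z. cnj (\<i> * z))"
    by (rule bij_betw_byWitness[where f'="\<lambda>z. - \<i> * cnj z"]) (auto simp: mult.assoc[symmetric])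
  note ev = is_eigenvalue_iff_evans[OF k]
  from T_set_component[OF conn] consider "z1 \<in> node_ray" "z2 \<in> node_ray"
    | \<sigma> where "\<sigma> \<in> {1, -1}" "z1 \<in> half_open_segment \<sigma> node" "z2 \<in> half_open_segment \<sigma> node" by blast
  thus ?goal
  proof cases
    case 1
    note p1 = node_ray_props[OF 1(1)] and p2 = node_ray_props[OF 1(2)]
    have z: "z1 = 0 + of_real (- Im z1) * (- \<i>)" "z2 = 0 + of_real (- Im z2) * (- \<i>)"
      using p1 p2 by (simp_all add: complex_eq_iff)
    have "finite {z \<in> thin_rectangle \<delta> (0 + of_real (- Im z1) * (- \<i>)) (0 + of_real (- Im z2) * (- \<i>)). is_eigenvalue (1 / k ^ 6) z} \<and>
        real (card {z \<in> thin_rectangle \<delta> (0 + of_real (- Im z1) * (- \<i>)) (0 + of_real (- Im z2) * (- \<i>)). is_eigenvalue (1 / k ^ 6) z})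
        = \<bar>real (card (ray_zeros k \<delta> (- Im z2))) - real (card (ray_zeros k \<delta> (- Im z1)))\<bar>"
    proof (rule rectangle_count[where a=node_re and S="ray_zeros k \<delta>" and \<Phi>="\<lambda>z. \<i> * z" and G="\<lambda>p. p"])
      show "bij (\<lambda>z. \<i> * z)" by (rule bij1)
      show "is_eigenvalue (1 / k ^ 6) z = (evans k (\<i> * z) = 0)" for z by (rule ev)
      show "ray_zeros k \<delta> r = {p. evans k p = 0 \<and> node_re < Re p \<and> Re p \<le> r \<and> \<bar>Im p\<bar> \<le> \<delta>}" for r
        by (rule ray_zeros_def)
      show "finite (ray_zeros k \<delta> (- Im z2))" using p2 by (intro fin(1)) simp
    qed (use p1 p2 im in auto)
    moreover have "counting k \<delta> z2 - counting k \<delta> z1 = real (card (ray_zeros k \<delta> (- Im z2))) - real (card (ray_zeros k \<delta> (- Im z1)))"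
      using p1 p2 by (simp add: counting_def)
    ultimately show ?goal unfolding z[symmetric] by simp
  next
    case (2 \<sigma>)
    obtain r1 where r1: "0 \<le> r1" "r1 < 2 * node_re" "z1 = \<sigma> + of_real r1 * seg_dir \<sigma>" by (rule half_open_segmentE[OF 2(1,2)])
    obtain r2 where r2: "0 \<le> r2" "r2 < 2 * node_re" "z2 = \<sigma> + of_real r2 * seg_dir \<sigma>" by (rule half_open_segmentE[OF 2(1,3)])
    have r12: "r1 < r2" using im half_open_segment_props(1)[OF 2(1) r1] half_open_segment_props(1)[OF 2(1) r2] by simp
    have S: "strip_zeros k \<delta> r = {p. evans k p = 0 \<and> 0 < Re ((p - \<i>) * sixth_root) \<and> Re ((p - \<i>) * sixth_root) \<le> r \<and>
        \<bar>Im ((p - \<i>) * sixth_root)\<bar> \<le> \<delta>}" for r by (rule strip_zeros_def)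
    have fin2: "finite (strip_zeros k \<delta> r2)" using r2 by (intro fin(2)) auto
    have "finite {z \<in> thin_rectangle \<delta> (\<sigma> + of_real r1 * seg_dir \<sigma>) (\<sigma> + of_real r2 * seg_dir \<sigma>). is_eigenvalue (1 / k ^ 6) z} \<and>
        real (card {z \<in> thin_rectangle \<delta> (\<sigma> + of_real r1 * seg_dir \<sigma>) (\<sigma> + of_real r2 * seg_dir \<sigma>). is_eigenvalue (1 / k ^ 6) z})
        = \<bar>real (card (strip_zeros k \<delta> r2)) - real (card (strip_zeros k \<delta> r1))\<bar>"
    proof (cases "\<sigma> = 1")
      case True
      have G: "(\<i> * z - \<i>) * sixth_root = (z - \<sigma>) * cnj (seg_dir \<sigma>)" for z
        using True by (simp add: seg_dir_def algebra_simps)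
      show ?thesis
        by (rule rectangle_count[OF seg_dir_props(1)[OF 2(1)] r1(1) r12 bij1 ev _ _ S fin2]) (simp_all only: G)
    next
      case False
      \<comment> \<open>Conjugation in p maps the image of the left segment to that of the right one
        and preserves the zeros, so the same sets serve as counters.\<close>
      hence s: "\<sigma> = -1" using 2(1) by simp
      have G: "(cnj (\<i> * z) - \<i>) * sixth_root = cnj ((z - \<sigma>) * cnj (seg_dir \<sigma>))" for z
        unfolding s by (simp add: seg_dir_def algebra_simps)
      have ev': "is_eigenvalue (1 / k ^ 6) z = (evans k (cnj (\<i> * z)) = 0)" for z
        unfolding evans_cnj_iff[OF k] by (rule ev)
      show ?thesis
        by (rule rectangle_count[OF seg_dir_props(1)[OF 2(1)] r1(1) r12 bij2 ev' _ _ S fin2])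
          (simp_all only: G cnj.sel abs_minus_cancel)
    qed
    thus ?goal unfolding counting_seg[OF 2(1) r1] counting_seg[OF 2(1) r2] unfolding r1(3) r2(3) .
  qed
qed

lemma seg_integral_value:
  assumes \<sigma>: "\<sigma> \<in> {1, -1}" and r: "0 \<le> r" and z: "z = \<sigma> + of_real r * seg_dir \<sigma>"
  shows "\<sigma> * contour_integral (linepath z \<sigma>) (\<lambda>x. exp (- \<i> * of_real pi / 4) * csqrt (x - z)) = of_real (2 / 3 * (r * sqrt r))"
proof (cases "\<sigma> = 1")
  case True
  have "\<sigma> - z = \<i> * of_real r * (cnj twelfth_root)\<^sup>2" using True by (simp add: z seg_dir_def cnj_twelfth_root_powers)
  hence "contour_integral (linepath z \<sigma>) (\<lambda>x. exp (- \<i> * of_real pi / 4) * csqrt (x - z)) =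
      of_real (2 / 3 * (r * sqrt r)) * (\<i> * cnj twelfth_root ^ 3)"
    by (intro seg_contour_integral r) (simp_all add: cnj_twelfth_root_powers, simp_all add: twelfth_root_def sixth_root_def)
  thus ?thesis using True by (simp add: cnj_twelfth_root_powers)
next
  case False
  hence s: "\<sigma> = -1" using \<sigma> by simp
  have t3: "twelfth_root ^ 3 = \<i>" by (simp add: twelfth_root_def complex_eq_iff power3_eq_cube)
  have "\<sigma> - z = \<i> * of_real r * twelfth_root\<^sup>2" using False by (simp add: z seg_dir_def twelfth_root_square)
  hence "contour_integral (linepath z \<sigma>) (\<lambda>x. exp (- \<i> * of_real pi / 4) * csqrt (x - z)) =
      of_real (2 / 3 * (r * sqrt r)) * (\<i> * twelfth_root ^ 3)"
    by (intro seg_contour_integral r) (simp_all add: twelfth_root_square, simp_all add: twelfth_root_def sixth_root_def)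
  thus ?thesis by (simp add: s t3)
qed

theorem mainTheorem5:
  shows "\<exists>C::real. \<forall>\<delta>>0. \<exists>N :: complex \<Rightarrow> real \<Rightarrow> real. \<forall>\<^sub>F \<epsilon> in at_right 0.
    is_counting_function \<epsilon> \<delta> (\<lambda>z. N z \<epsilon>) \<and>
    (\<forall>\<sigma>\<in>{1, -1}. \<forall>z\<in>half_open_segment \<sigma> node.
       cmod (complex_of_real (N z \<epsilon>)
             - \<sigma> * (complex_of_real (\<epsilon> powr (-1/2) / pi)
                    * contour_integral (linepath z \<sigma>)
                        (\<lambda>x. exp (- \<i> * complex_of_real pi / 4) * csqrt (x - z)))) \<le> C) \<and>
    (\<forall>z\<in>node_ray.
       cmod (complex_of_real (N z \<epsilon>)
             - complex_of_real (\<epsilon> powr (-1/2) / pi)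
               * integral {-1..1}
                   (\<lambda>x::real. exp (- \<i> * complex_of_real pi / 4)
                              * csqrt (complex_of_real x - z))) \<le> C)"
proof -
  obtain N1 K1 where ray: "\<And>k \<delta> \<rho>. large k \<Longrightarrow> k ^ 3 \<ge> K1 \<Longrightarrow> \<delta> > 0 \<Longrightarrow> \<rho> \<ge> node_re \<Longrightarrow>
      finite (ray_zeros k \<delta> \<rho>) \<and>
      \<bar>real (card (ray_zeros k \<delta> \<rho>)) - (k ^ 3 * wre \<rho> - k ^ 3 * wre node_re) / pi\<bar> \<le> N1"
    by (rule ray_zeros_count) blast
  obtain N2 K2 where strip: "\<And>k \<delta> r. large k \<Longrightarrow> k \<ge> K2 \<Longrightarrow> k ^ 3 \<ge> K2 \<Longrightarrow> \<delta> > 0 \<Longrightarrow> 1 / \<delta> \<le> k\<^sup>2 \<Longrightarrow>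
      0 \<le> r \<Longrightarrow> r \<le> 2 * node_re \<Longrightarrow> finite (strip_zeros k \<delta> r) \<and>
      \<bar>real (card (strip_zeros k \<delta> r)) - k ^ 3 * (2 / 3 * (r * sqrt r)) / pi\<bar> \<le> N2"
    by (rule strip_zeros_count) blast
  show ?thesis
  \<comment> \<open>The constant is fixed before \<delta>; only the threshold B for k depends on
    \<delta>. Here k is the power -1/6 of the small parameter, and conditions on
    \<open>k ^ 2\<close> and \<open>k ^ 3\<close> follow from those on k because k is at least
    1.\<close>
  proof (rule exI[of _ "max N1 N2"], intro allI impI, rule exI[of _ "\<lambda>z \<epsilon>. counting (\<epsilon> powr (-1/6)) \<delta> z" for \<delta>])
    fix \<delta> :: real assume \<delta>: "\<delta> > 0"
    define B where "B = Max {10, 4 * wkb_cutoff, K1, K2, 1 / \<delta>}"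
    have B: "10 \<le> B" "4 * wkb_cutoff \<le> B" "K1 \<le> B" "K2 \<le> B" "1 / \<delta> \<le> B" unfolding B_def by (intro Max_ge; simp)+
    have "filterlim (\<lambda>\<epsilon>::real. \<epsilon> powr (-1/6)) at_top (at_right 0)" by real_asymp
    hence "\<forall>\<^sub>F \<epsilon> in at_right 0. B \<le> \<epsilon> powr (-1/6)" unfolding filterlim_at_top by blast
    moreover have "\<forall>\<^sub>F \<epsilon> in at_right 0. (0::real) < \<epsilon>" by (rule eventually_at_right_less)
    ultimately show "\<forall>\<^sub>F \<epsilon> in at_right 0.
      is_counting_function \<epsilon> \<delta> (counting (\<epsilon> powr (-1/6)) \<delta>) \<and>
      (\<forall>\<sigma>\<in>{1, -1}. \<forall>z\<in>half_open_segment \<sigma> node.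
         cmod (complex_of_real (counting (\<epsilon> powr (-1/6)) \<delta> z)
               - \<sigma> * (complex_of_real (\<epsilon> powr (-1/2) / pi)
                      * contour_integral (linepath z \<sigma>)
                          (\<lambda>x. exp (- \<i> * complex_of_real pi / 4) * csqrt (x - z)))) \<le> max N1 N2) \<and>
      (\<forall>z\<in>node_ray.
         cmod (complex_of_real (counting (\<epsilon> powr (-1/6)) \<delta> z)
               - complex_of_real (\<epsilon> powr (-1/2) / pi)
                 * integral {-1..1}
                     (\<lambda>x::real. exp (- \<i> * complex_of_real pi / 4)
                                * csqrt (complex_of_real x - z))) \<le> max N1 N2)"
    proof eventually_elim
      case (elim \<epsilon>)
      define k where "k = \<epsilon> powr (-1/6)"
      have kB: "k \<ge> B" and e0: "\<epsilon> > 0" using elim by (simp_all add: k_def)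
      have k3: "\<epsilon> powr (-1/2) = k ^ 3" using e0 by (simp add: k_def powr_power)
      have "k ^ 6 = \<epsilon> powr (-1)" using e0 by (simp add: k_def powr_power)
      hence k6: "\<epsilon> = 1 / k ^ 6" using e0 by (simp add: powr_minus_divide)
      have "k * 1 \<le> k * k" using kB B by (intro mult_left_mono) auto
      hence k2: "k \<le> k\<^sup>2" by (simp add: power2_eq_square)
      have "k\<^sup>2 * 1 \<le> k\<^sup>2 * k" using kB B by (intro mult_left_mono) auto
      hence kk: "k \<le> k ^ 3" using k2 by (simp add: power2_eq_square power3_eq_cube)
      have lk: "large k" unfolding large_def using kB B k2 by linarith
      have k0: "k > 0" using kB B by linarith
      have ray': "finite (ray_zeros k \<delta> \<rho>)"
          "\<bar>real (card (ray_zeros k \<delta> \<rho>)) - (k ^ 3 * wre \<rho> - k ^ 3 * wre node_re) / pi\<bar> \<le> N1" if "\<rho> \<ge> node_re" for \<rho>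
        using ray[OF lk _ \<delta> that] kB B kk by auto
      have strip': "finite (strip_zeros k \<delta> r)"
          "\<bar>real (card (strip_zeros k \<delta> r)) - k ^ 3 * (2 / 3 * (r * sqrt r)) / pi\<bar> \<le> N2" if "0 \<le> r" "r \<le> 2 * node_re" for r
        using strip[OF lk _ _ \<delta> _ that] kB B kk k2 by auto
      have "is_counting_function \<epsilon> \<delta> (counting k \<delta>)"
        unfolding k6 by (rule counting_is_counting_function[OF k0 ray'(1) strip'(1)])
      moreover have "cmod (complex_of_real (counting k \<delta> z) - \<sigma> * (complex_of_real (k ^ 3 / pi)
            * contour_integral (linepath z \<sigma>) (\<lambda>x. exp (- \<i> * complex_of_real pi / 4) * csqrt (x - z)))) \<le> max N1 N2"
        if \<sigma>: "\<sigma> \<in> {1, -1}" and z: "z \<in> half_open_segment \<sigma> node" for \<sigma> z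
      proof -
        obtain r where r: "0 \<le> r" "r < 2 * node_re" "z = \<sigma> + of_real r * seg_dir \<sigma>" by (rule half_open_segmentE[OF \<sigma> z])
        have "\<sigma> * (complex_of_real (k ^ 3 / pi)
            * contour_integral (linepath z \<sigma>) (\<lambda>x. exp (- \<i> * complex_of_real pi / 4) * csqrt (x - z)))
          = complex_of_real (k ^ 3 / pi) * of_real (2 / 3 * (r * sqrt r))"
          unfolding seg_integral_value[OF \<sigma> r(1,3), symmetric] by (simp only: mult.left_commute)
        also have "\<dots> = of_real (k ^ 3 * (2 / 3 * (r * sqrt r)) / pi)" by simp
        finally show ?thesis unfolding counting_seg[OF \<sigma> r]
          using strip'(2)[of r] r by (simp only: of_real_diff[symmetric] norm_of_real le_max_iff_disj) simp
      qed
      moreover have "cmod (complex_of_real (counting k \<delta> z) - complex_of_real (k ^ 3 / pi)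
            * integral {-1..1} (\<lambda>x::real. exp (- \<i> * complex_of_real pi / 4) * csqrt (complex_of_real x - z))) \<le> max N1 N2"
        if z: "z \<in> node_ray" for z
      proof -
        note p = node_ray_props[OF z]
        have t: "- Im z > 0" using p node_re_bounds by linarith
        have "z = - \<i> * of_real (- Im z)" using p by (simp add: complex_eq_iff)
        from ray_integral[OF t this] have "complex_of_real (k ^ 3 / pi)
            * integral {-1..1} (\<lambda>x::real. exp (- \<i> * complex_of_real pi / 4) * csqrt (complex_of_real x - z))
          = of_real (k ^ 3 / pi * wre (- Im z))" by (simp only: of_real_mult)
        moreover have "\<bar>counting k \<delta> z - k ^ 3 / pi * wre (- Im z)\<bar> \<le> N1"
          using ray'(2)[of "- Im z"] p by (simp add: counting_def diff_divide_distrib)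
        ultimately show ?thesis by (simp only: of_real_diff[symmetric] norm_of_real le_max_iff_disj simp_thms)
      qed
      ultimately show ?case unfolding k3 k_def[symmetric] by blast
    qed
  qed
qed

end
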